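(* Fix $n\in\mathbb{N}$, $n\ge 1$. (a) Let $\mathcal P$ be an unshaded subfactor planar algebra with principal graph $\tilde A_{2n-1}$ which is in the arrow case, and let $P_1$, $U$, $U^*$ be elements of $\mathcal P$, with $U$ having $n$ bottom and $n$ top strands, satisfying the arrow relations (listed in the context, with $a=n$) with parameter some $2n$th root of unity. Then $P_1$, $U$, $U^*$ generate $\mathcal P$. (b) Let $\mathcal P'$ be an unshaded subfactor planar algebra with principal graph $\tilde A_{2n}$, and let $P_1$, $U$, $U^*$ be elements of $\mathcal P'$, with $U$ having $n+1$ strands on the bottom and $n$ on top and $U^*$ having $n$ on the bottom and $n+1$ on top, satisfying the arrow relations (listed in the context, with $a=n+1$) with parameter some $(2n+1)$th root of unity. Then $P_1$, $U$, $U^*$ generate $\mathcal P'$.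
   Context: Unshaded planar algebras. An unshaded planar algebra is the notion obtained from Jones' planar algebras by dropping the shading: a family of complex vector spaces with a compatible action of unshaded planar tangles (outer box, inner boxes, non-crossing strands, a star at each box; isotopy invariant, compatible with composition of tangles). Boxes may have any number of boundary points, divided into bottom and top points; $\mathcal P_k$ is the space of elements with $k$ strands on top and $k$ on the bottom, star on the left. Elements generate the planar algebra if every element is a linear combination of planar diagrams whose boxes are labelled by these elements. $fg$ is $f$ stacked on top of $g$; $\otimes$ is horizontal juxtaposition; $\overline{T}$ is rotation by $\pi$; $\mathrm{tr}=\mathrm{tr}^R$ (resp. $\mathrm{tr}^L$) closes all strands up to the right (resp. left); $\emptyset\in\mathcal P_0$ is the empty diagram; $X\in\mathcal P_1$ is the vertical strand. Number the boundary points of a box clockwise from the star (top from left to right, then bottom from right to left). The click $\mathcal F$ is the one-step rotation, keeping the numbers of top and bottom points, for which the $i$-th boundary point of $T$ becomes the $(i+1)$-st (cyclically) boundary point of $\mathcal F(T)$. Unshaded subfactor planar algebra: (1) $\dim\mathcal P_0=1$ (closed diagrams are scalars, $\emptyset=1$); (2) $\mathrm{tr}^L=\mathrm{tr}^R$ on $\mathcal P_1$; (3) there is an antilinear adjoint $*$, compatible with reflection of tangles over a horizontal line, such that $\langle f,g\rangle=\mathrm{tr}(f^*g)$ is positive definite. Principal graph. A projection is $p$ with $p=p^2=p^*$. $\mathrm{Hom}(p,q)$ is the space of diagrams $f$ with bottom boundary that of $p$, top boundary that of $q$ and $qfp=f$ (numbers of bottom and top points may differ). $p$ is minimal if $\dim\mathrm{Hom}(p,p)=1$;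 $p\cong q$ if there is $f\in\mathrm{Hom}(p,q)$ with $f^*f=p$, $ff^*=q$. The principal graph has as vertices the isomorphism classes of minimal projections in the $\mathcal P_k$, $k\ge0$, with $\dim\mathrm{Hom}(p\otimes X,q)$ edges between $p$ and $q$. $\tilde A_{m-1}$ is the cycle with $m$ vertices (for $m=2$: two vertices joined by two edges). Arrow case: $X=P_1+Q_1$ with $P_1,Q_1\in\mathcal P_1$ minimal projections, $P_1Q_1=Q_1P_1=0$ and $\overline P_1=Q_1$. Arrow relations with $a\in\{n,n+1\}$ and parameter $\omega$. Put $Q_1=\overline{P}_1$. A strand oriented upward denotes $P_1$ and oriented downward denotes $Q_1$ (oriented strands up to isotopy). $U$ has $a$ bottom strands coloured $P_1$ and $n$ top strands coloured $Q_1$ (all strands are oriented into $U$; $U=Q_1^{\otimes n}UP_1^{\otimes a}$), and $U^*$ is its adjoint (all strands oriented out of $U^*$). Relations: (i) (bubble) closed loops of either orientation equal $1$; (ii) $X=P_1+Q_1$; (iii) $P_1Q_1=0$ and $Q_1P_1=0$; (iv) (saddle) the element of $\mathcal P_2$ consisting of an oriented arc joining the two top points and an oriented arc joining the two bottom points, with orientations at the four boundary points equal to those of $P_1\otimes Q_1$ (resp. $Q_1\otimes P_1$), equals $P_1\otimes Q_1$ (resp. $Q_1\otimes P_1$); (v) (unitary) $UU^*=Q_1^{\otimes n}$ and $U^*U=P_1^{\otimes a}$; (vi) (click) $\mathcal F(U)=\omega U$ and $\mathcal F(U^* )=\omega U^*$. *)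

theory Defs
  imports "HOL-Analysis.Analysis"
begin

section \<open>Planar tangles\<close>

text \<open>
  The standard box is the square with corners \<open>\<plusminus>1 \<plusminus> \<i>\<close>. A box of type \<open>(b, t)\<close> has \<open>b\<close> equally
  spaced boundary points on its bottom side, \<open>t\<close> on its top side, and its star at the midpoint of its
  left side. Both families of boundary points are indexed from left to right, starting at \<open>0\<close>.
\<close>

definition sq :: "complex set" where
  "sq = cbox (Complex (- 1) (- 1)) (Complex 1 1)"

definition xpos :: "nat \<Rightarrow> nat \<Rightarrow> real" where
  "xpos k j = (2 * real j + 1) / real k - 1"

definition bot_mark :: "nat \<Rightarrow> nat \<Rightarrow> complex" where
  "bot_mark b j = Complex (xpos b j) (- 1)"

definition top_mark :: "nat \<Rightarrow> nat \<Rightarrow> complex" where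
  "top_mark t j = Complex (xpos t j) 1"

definition marks :: "nat \<Rightarrow> nat \<Rightarrow> complex set" where
  "marks b t = bot_mark b ` {..<b} \<union> top_mark t ` {..<t}"

text \<open>
  An inner box is a type \<open>(b, t)\<close> with an orientation preserving real-affine map of the plane; the box
  is the image of the standard box, together with the images of the boundary points and of the star.
  This class of maps contains the translations, rotations and positive scalings, is connected, and is
  closed under composition, so that tangles can be glued without any matching condition beyond the type.
\<close>

type_synonym inbox = "nat \<times> nat \<times> (complex \<Rightarrow> complex)"

definition orient_affine :: "(complex \<Rightarrow> complex) \<Rightarrow> bool" where
  "orient_affine \<phi> \<longleftrightarrow> (\<exists>c a d. cmod d < cmod a \<and> \<phi> = (\<lambda>z. c + a * z + d * cnj z))"

definition in_bot :: "inbox \<Rightarrow> nat" where "in_bot B = fst B"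
definition in_top :: "inbox \<Rightarrow> nat" where "in_top B = fst (snd B)"
definition in_map :: "inbox \<Rightarrow> complex \<Rightarrow> complex" where "in_map B = snd (snd B)"
definition in_region :: "inbox \<Rightarrow> complex set" where "in_region B = in_map B ` sq"
definition in_marks :: "inbox \<Rightarrow> complex set" where
  "in_marks B = in_map B ` marks (in_bot B) (in_top B)"

record tangle =
  bots :: nat
  tops :: nat
  boxes :: "inbox list"
  strands :: "complex set"

definition all_marks :: "tangle \<Rightarrow> complex set" where
  "all_marks T = marks (bots T) (tops T) \<union> (\<Union>B\<in>set (boxes T). in_marks B)"

definition is_strand :: "complex set \<Rightarrow> complex set \<Rightarrow> bool" where
  "is_strand M C \<longleftrightarrow>
     (\<exists>\<gamma>. arc \<gamma> \<and> path_image \<gamma> = C \<and> C \<inter> M = {pathstart \<gamma>, pathfinish \<gamma>}) \<or>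
     (\<exists>\<gamma>. simple_path \<gamma> \<and> pathfinish \<gamma> = pathstart \<gamma> \<and> path_image \<gamma> = C \<and> C \<inter> M = {})"

text \<open>
  Strands are topological arcs and closed curves. Since arcs in the plane are tame, this gives the same
  isotopy classes as smooth strands.
\<close>

definition planar_tangle :: "tangle \<Rightarrow> bool" where
  "planar_tangle T \<longleftrightarrow>
     (\<forall>B\<in>set (boxes T). orient_affine (in_map B) \<and> in_region B \<subseteq> interior sq) \<and>
     (\<forall>i<length (boxes T). \<forall>j<length (boxes T). i \<noteq> j \<longrightarrow>
        in_region (boxes T ! i) \<inter> in_region (boxes T ! j) = {}) \<and>
     strands T \<subseteq> sq \<and>
     strands T \<inter> frontier sq = marks (bots T) (tops T) \<and>
     (\<forall>B\<in>set (boxes T). strands T \<inter> in_region B = in_marks B) \<and>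
     (\<exists>S. finite S \<and> disjoint S \<and> strands T = \<Union>S \<and> (\<forall>C\<in>S. is_strand (all_marks T) C))"

text \<open>
  An isotopy is a continuous motion of inner boxes and strands through planar tangles, fixing the outer
  box. In dimension two it extends to an ambient isotopy.
\<close>

definition isotopic :: "tangle \<Rightarrow> tangle \<Rightarrow> bool" where
  "isotopic T T' \<longleftrightarrow>
     (\<exists>(F :: real \<Rightarrow> tangle) (H :: real \<Rightarrow> complex \<Rightarrow> complex).
        F 0 = T \<and> F 1 = T' \<and>
        (\<forall>s\<in>{0..1}.
           planar_tangle (F s) \<and> bots (F s) = bots T \<and> tops (F s) = tops T \<and>
           map in_bot (boxes (F s)) = map in_bot (boxes T) \<and>
           map in_top (boxes (F s)) = map in_top (boxes T) \<and>
           inj_on (H s) (strands T) \<and> strands (F s) = H s ` strands T) \<and>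
        (\<forall>z\<in>strands T. H 0 z = z) \<and>
        continuous_on ({0..1} \<times> strands T) (\<lambda>(s, z). H s z) \<and>
        (\<forall>i<length (boxes T).
           continuous_on ({0..1} \<times> sq) (\<lambda>(s, z). in_map (boxes (F s) ! i) z)))"

definition glue :: "tangle \<Rightarrow> nat \<Rightarrow> tangle \<Rightarrow> tangle" where
  "glue T i S =
     (let \<phi> = in_map (boxes T ! i) in
      \<lparr> bots = bots T, tops = tops T,
        boxes = take i (boxes T)
                @ map (\<lambda>B. (in_bot B, in_top B, \<phi> \<circ> in_map B)) (boxes S)
                @ drop (Suc i) (boxes T),
        strands = strands T \<union> \<phi> ` strands S \<rparr>)"

definition permute_boxes :: "(nat \<Rightarrow> nat) \<Rightarrow> tangle \<Rightarrow> tangle" where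
  "permute_boxes \<pi> T = T\<lparr>boxes := map (\<lambda>k. boxes T ! \<pi> k) [0..<length (boxes T)]\<rparr>"

text \<open>Reflection over a horizontal line; stars stay on the left.\<close>

definition reflect :: "tangle \<Rightarrow> tangle" where
  "reflect T =
     \<lparr> bots = tops T, tops = bots T,
       boxes = map (\<lambda>B. (in_top B, in_bot B, cnj \<circ> in_map B \<circ> cnj)) (boxes T),
       strands = cnj ` strands T \<rparr>"


subsection \<open>The tangles of the diagrammatic operations\<close>

definition place :: "complex \<Rightarrow> real \<Rightarrow> real \<Rightarrow> complex \<Rightarrow> complex" where
  "place c w h z = c + Complex (w * Re z) (h * Im z)"

definition unit_tangle :: "nat \<Rightarrow> nat \<Rightarrow> tangle" where
  "unit_tangle b t =
     \<lparr> bots = b, tops = t, boxes = [(b, t, place 0 (1/2) (1/2))],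
       strands = (\<Union>m\<in>marks b t. closed_segment (place 0 (1/2) (1/2) m) m) \<rparr>"

definition empty_tangle :: tangle where
  "empty_tangle = \<lparr> bots = 0, tops = 0, boxes = [], strands = {} \<rparr>"

definition strand_tangle :: tangle where
  "strand_tangle = \<lparr> bots = 1, tops = 1, boxes = [],
     strands = closed_segment (bot_mark 1 0) (top_mark 1 0) \<rparr>"

definition cup_tangle :: tangle where
  "cup_tangle = \<lparr> bots = 0, tops = 2, boxes = [],
     strands = {z. dist z \<i> = 1/2 \<and> Im z \<le> 1} \<rparr>"

definition cap_tangle :: tangle where
  "cap_tangle = \<lparr> bots = 2, tops = 0, boxes = [],
     strands = {z. dist z (- \<i>) = 1/2 \<and> Im z \<ge> - 1} \<rparr>"

text \<open>The first input, of type \<open>(c, t)\<close>, is stacked on top of the second, of type \<open>(b, c)\<close>.\<close>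

definition mult_tangle :: "nat \<Rightarrow> nat \<Rightarrow> nat \<Rightarrow> tangle" where
  "mult_tangle b c t =
     (let up = place (Complex 0 (1/2)) (1/2) (1/4); dn = place (Complex 0 (- 1/2)) (1/2) (1/4) in
      \<lparr> bots = b, tops = t, boxes = [(c, t, up), (b, c, dn)],
        strands = (\<Union>j<t. closed_segment (up (top_mark t j)) (top_mark t j))
                \<union> (\<Union>j<c. closed_segment (dn (top_mark c j)) (up (bot_mark c j)))
                \<union> (\<Union>j<b. closed_segment (bot_mark b j) (dn (bot_mark b j))) \<rparr>)"

definition tensor_tangle :: "nat \<Rightarrow> nat \<Rightarrow> nat \<Rightarrow> nat \<Rightarrow> tangle" where
  "tensor_tangle b t b' t' =
     (let lf = place (Complex (- 1/2) 0) (1/4) (1/2); rt = place (Complex (1/2) 0) (1/4) (1/2) in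
      \<lparr> bots = b + b', tops = t + t', boxes = [(b, t, lf), (b', t', rt)],
        strands = (\<Union>j<t. closed_segment (lf (top_mark t j)) (top_mark (t + t') j))
                \<union> (\<Union>j<t'. closed_segment (rt (top_mark t' j)) (top_mark (t + t') (t + j)))
                \<union> (\<Union>j<b. closed_segment (lf (bot_mark b j)) (bot_mark (b + b') j))
                \<union> (\<Union>j<b'. closed_segment (rt (bot_mark b' j)) (bot_mark (b + b') (b + j))) \<rparr>)"

text \<open>
  The stadium-shaped curve running from the \<open>x\<close>-coordinate \<open>\<rho>\<close> to \<open>- \<rho>\<close> above and below a box of
  half-height \<open>1/4\<close>, which it passes on the side of \<open>\<rho>\<close>.
\<close>

definition closing_strand :: "real \<Rightarrow> complex set" where
  "closing_strand \<rho> =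
     {z. dist z (Complex 0 (1/4)) = \<bar>\<rho>\<bar> \<and> Im z \<ge> 1/4}
     \<union> closed_segment (Complex \<rho> (1/4)) (Complex \<rho> (- 1/4))
     \<union> {z. dist z (Complex 0 (- 1/4)) = \<bar>\<rho>\<bar> \<and> Im z \<le> - 1/4}"

text \<open>The \<open>j\<close>-th strand meets the box at \<open>x\<close>-coordinate \<open>\<mp>1/2 + xpos k j / 4\<close>.\<close>

definition trR_tangle :: "nat \<Rightarrow> tangle" where
  "trR_tangle k =
     \<lparr> bots = 0, tops = 0, boxes = [(k, k, place (Complex (- 1/2) 0) (1/4) (1/4))],
       strands = (\<Union>j<k. closing_strand (1/2 - xpos k j / 4)) \<rparr>"

definition trL_tangle :: "nat \<Rightarrow> tangle" where
  "trL_tangle k =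
     \<lparr> bots = 0, tops = 0, boxes = [(k, k, place (Complex (1/2) 0) (1/4) (1/4))],
       strands = (\<Union>j<k. closing_strand (- 1/2 - xpos k j / 4)) \<rparr>"

definition half_turn_tangle :: "nat \<Rightarrow> nat \<Rightarrow> tangle" where
  "half_turn_tangle b t =
     \<lparr> bots = t, tops = b, boxes = [(b, t, \<lambda>z. - z / 2)],
       strands = (\<Union>m\<in>marks b t. closed_segment (- m / 2) (- m)) \<rparr>"

fun polyline :: "complex list \<Rightarrow> complex set" where
  "polyline (x # y # zs) = closed_segment x y \<union> polyline (y # zs)"
| "polyline _ = {}"

text \<open>
  The click: each top strand moves one place to the right and each bottom strand one place to the left.
  The last top strand turns around the right side of the box to the bottom, and the first bottom strand
  around the left side to the top. If one of the two sides has no boundary points, the strand continues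
  around the box.
\<close>

definition click_tangle :: "nat \<Rightarrow> nat \<Rightarrow> tangle" where
  "click_tangle b t =
     (let \<phi> = place 0 (1/4) (1/4);
          ne = Complex (1/2) (1/2); se = Complex (1/2) (- 1/2);
          sw = Complex (- 1/2) (- 1/2); nw = Complex (- 1/2) (1/2) in
      \<lparr> bots = b, tops = t, boxes = [(b, t, \<phi>)],
        strands =
          (\<Union>j\<in>{j. Suc j < t}. closed_segment (\<phi> (top_mark t j)) (top_mark t (Suc j)))
          \<union> (\<Union>j\<in>{j. Suc j < b}. closed_segment (\<phi> (bot_mark b (Suc j))) (bot_mark b j))
          \<union> (if 0 < t \<and> 0 < b then
                polyline [\<phi> (top_mark t (t - 1)), ne, se, bot_mark b (b - 1)]
                \<union> polyline [\<phi> (bot_mark b 0), sw, nw, top_mark t 0]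
              else if 0 < t then
                polyline [\<phi> (top_mark t (t - 1)), ne, se, sw, nw, top_mark t 0]
              else if 0 < b then
                polyline [\<phi> (bot_mark b 0), sw, nw, ne, se, bot_mark b (b - 1)]
              else {}) \<rparr>)"


section \<open>Unshaded planar algebras\<close>

text \<open>
  The complex vector spaces are subspaces of one ambient complex vector space. They may
  overlap there, so operations are indexed by the types of their arguments.
\<close>

record 'a planar_alg =
  scl :: "complex \<Rightarrow> 'a \<Rightarrow> 'a"
  spc :: "nat \<Rightarrow> nat \<Rightarrow> 'a set"
  act :: "tangle \<Rightarrow> 'a list \<Rightarrow> 'a"

definition labelling :: "('a, 'b) planar_alg_scheme \<Rightarrow> tangle \<Rightarrow> 'a list \<Rightarrow> bool" where
  "labelling A T xs \<longleftrightarrow>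
     length xs = length (boxes T) \<and>
     (\<forall>i<length xs. xs ! i \<in> spc A (in_bot (boxes T ! i)) (in_top (boxes T ! i)))"

definition unshaded_planar_algebra :: "('a :: ab_group_add, 'b) planar_alg_scheme \<Rightarrow> bool" where
  "unshaded_planar_algebra A \<longleftrightarrow>
     vector_space (scl A) \<and>
     (\<forall>b t. module.subspace (scl A) (spc A b t)) \<and>
     (\<forall>T xs. planar_tangle T \<and> labelling A T xs \<longrightarrow> act A T xs \<in> spc A (bots T) (tops T)) \<and>
     (\<forall>T xs i x y c. planar_tangle T \<and> i < length xs \<and>
        labelling A T (xs[i := x]) \<and> labelling A T (xs[i := y]) \<longrightarrow>
          act A T (xs[i := x + y]) = act A T (xs[i := x]) + act A T (xs[i := y]) \<and>
          act A T (xs[i := scl A c x]) = scl A c (act A T (xs[i := x]))) \<and>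
     (\<forall>T T' xs. planar_tangle T \<and> planar_tangle T' \<and> isotopic T T' \<and> labelling A T xs \<longrightarrow>
        act A T xs = act A T' xs) \<and>
     (\<forall>T xs \<pi>. planar_tangle T \<and> labelling A T xs \<and>
        bij_betw \<pi> {..<length xs} {..<length xs} \<longrightarrow>
          act A (permute_boxes \<pi> T) (map (\<lambda>k. xs ! \<pi> k) [0..<length xs]) = act A T xs) \<and>
     (\<forall>T S xs ys i. planar_tangle T \<and> planar_tangle S \<and> labelling A T xs \<and> labelling A S ys \<and>
        i < length xs \<and>
        bots S = in_bot (boxes T ! i) \<and> tops S = in_top (boxes T ! i) \<and> xs ! i = act A S ys \<longrightarrow>
          act A (glue T i S) (take i xs @ ys @ drop (Suc i) xs) = act A T xs) \<and>
     (\<forall>b t. \<forall>x\<in>spc A b t. act A (unit_tangle b t) [x] = x)"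

definition empty_diag :: "('a, 'b) planar_alg_scheme \<Rightarrow> 'a" where
  "empty_diag A = act A empty_tangle []"

definition strand :: "('a, 'b) planar_alg_scheme \<Rightarrow> 'a" where
  "strand A = act A strand_tangle []"

definition cup :: "('a, 'b) planar_alg_scheme \<Rightarrow> 'a" where
  "cup A = act A cup_tangle []"

definition cap :: "('a, 'b) planar_alg_scheme \<Rightarrow> 'a" where
  "cap A = act A cap_tangle []"

definition mult :: "('a, 'b) planar_alg_scheme \<Rightarrow> nat \<Rightarrow> nat \<Rightarrow> nat \<Rightarrow> 'a \<Rightarrow> 'a \<Rightarrow> 'a" where
  "mult A b c t f g = act A (mult_tangle b c t) [f, g]"

definition tensor ::
    "('a, 'b) planar_alg_scheme \<Rightarrow> nat \<Rightarrow> nat \<Rightarrow> nat \<Rightarrow> nat \<Rightarrow> 'a \<Rightarrow> 'a \<Rightarrow> 'a" where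
  "tensor A b t b' t' f g = act A (tensor_tangle b t b' t') [f, g]"

primrec tensor_power :: "('a, 'b) planar_alg_scheme \<Rightarrow> nat \<Rightarrow> 'a \<Rightarrow> 'a" where
  "tensor_power A 0 p = empty_diag A"
| "tensor_power A (Suc k) p = tensor A k k 1 1 (tensor_power A k p) p"

definition half_turn :: "('a, 'b) planar_alg_scheme \<Rightarrow> nat \<Rightarrow> nat \<Rightarrow> 'a \<Rightarrow> 'a" where
  "half_turn A b t f = act A (half_turn_tangle b t) [f]"

definition click :: "('a, 'b) planar_alg_scheme \<Rightarrow> nat \<Rightarrow> nat \<Rightarrow> 'a \<Rightarrow> 'a" where
  "click A b t f = act A (click_tangle b t) [f]"

definition trR :: "('a, 'b) planar_alg_scheme \<Rightarrow> nat \<Rightarrow> 'a \<Rightarrow> 'a" where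
  "trR A k f = act A (trR_tangle k) [f]"

definition trL :: "('a, 'b) planar_alg_scheme \<Rightarrow> nat \<Rightarrow> 'a \<Rightarrow> 'a" where
  "trL A k f = act A (trL_tangle k) [f]"

text \<open>A set of generators consists of triples \<open>(b, t, x)\<close> with \<open>x\<close> in the space of type \<open>(b, t)\<close>.\<close>

definition generates :: "('a :: ab_group_add, 'b) planar_alg_scheme \<Rightarrow> (nat \<times> nat \<times> 'a) set \<Rightarrow> bool" where
  "generates A G \<longleftrightarrow>
     (\<forall>b t. spc A b t = module.span (scl A)
        {act A T xs | T xs. planar_tangle T \<and> bots T = b \<and> tops T = t \<and>
           length xs = length (boxes T) \<and>
           (\<forall>i<length xs. (in_bot (boxes T ! i), in_top (boxes T ! i), xs ! i) \<in> G)})"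


section \<open>Subfactor planar algebras\<close>

record 'a star_planar_alg = "'a planar_alg" +
  star :: "nat \<Rightarrow> nat \<Rightarrow> 'a \<Rightarrow> 'a"

definition planar_adjoint :: "('a :: ab_group_add, 'b) star_planar_alg_scheme \<Rightarrow> bool" where
  "planar_adjoint A \<longleftrightarrow>
     (\<forall>b t. \<forall>x\<in>spc A b t.
        star A b t x \<in> spc A t b \<and> star A t b (star A b t x) = x \<and>
        (\<forall>y\<in>spc A b t. star A b t (x + y) = star A b t x + star A b t y) \<and>
        (\<forall>c. star A b t (scl A c x) = scl A (cnj c) (star A b t x))) \<and>
     (\<forall>T xs. planar_tangle T \<and> labelling A T xs \<longrightarrow>
        star A (bots T) (tops T) (act A T xs) =
        act A (reflect T) (map2 (\<lambda>B x. star A (in_bot B) (in_top B) x) (boxes T) xs))"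

text \<open>
  Since closed diagrams are multiples of the empty diagram, \<open>\<langle>f, f\<rangle>\<close> is the complex coefficient below.
\<close>

definition subfactor_planar_algebra :: "('a :: ab_group_add, 'b) star_planar_alg_scheme \<Rightarrow> bool" where
  "subfactor_planar_algebra A \<longleftrightarrow>
     unshaded_planar_algebra A \<and>
     vector_space.dim (scl A) (spc A 0 0) = 1 \<and>
     (\<forall>f\<in>spc A 1 1. trL A 1 f = trR A 1 f) \<and>
     planar_adjoint A \<and>
     (\<forall>b t. \<forall>f\<in>spc A b t. f \<noteq> 0 \<longrightarrow>
        (\<exists>r>0. trR A b (mult A b t b (star A b t f) f) = scl A (complex_of_real r) (empty_diag A)))"


subsection \<open>Principal graph\<close>

definition projection :: "('a, 'b) star_planar_alg_scheme \<Rightarrow> nat \<Rightarrow> 'a \<Rightarrow> bool" where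
  "projection A k p \<longleftrightarrow> p \<in> spc A k k \<and> mult A k k k p p = p \<and> star A k k p = p"

definition Hom :: "('a, 'b) planar_alg_scheme \<Rightarrow> nat \<Rightarrow> 'a \<Rightarrow> nat \<Rightarrow> 'a \<Rightarrow> 'a set" where
  "Hom A k p l q = {f \<in> spc A k l. mult A k l l q (mult A k k l f p) = f}"

definition minimal_projection ::
    "('a :: ab_group_add, 'b) star_planar_alg_scheme \<Rightarrow> nat \<Rightarrow> 'a \<Rightarrow> bool" where
  "minimal_projection A k p \<longleftrightarrow>
     projection A k p \<and> vector_space.dim (scl A) (Hom A k p k p) = 1"

definition proj_iso :: "('a, 'b) star_planar_alg_scheme \<Rightarrow> nat \<Rightarrow> 'a \<Rightarrow> nat \<Rightarrow> 'a \<Rightarrow> bool" where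
  "proj_iso A k p l q \<longleftrightarrow>
     (\<exists>f\<in>Hom A k p l q. mult A k l k (star A k l f) f = p \<and> mult A l k l f (star A k l f) = q)"

text \<open>An undirected multigraph is given by its vertices and its edge multiplicities.\<close>

type_synonym 'v multigraph = "'v set \<times> ('v \<Rightarrow> 'v \<Rightarrow> nat)"

definition multigraph_iso :: "'v multigraph \<Rightarrow> 'w multigraph \<Rightarrow> bool" where
  "multigraph_iso G H \<longleftrightarrow>
     (\<exists>\<phi>. bij_betw \<phi> (fst G) (fst H) \<and>
          (\<forall>u\<in>fst G. \<forall>v\<in>fst G. snd H (\<phi> u) (\<phi> v) = snd G u v))"

definition minimal_projections :: "('a :: ab_group_add, 'b) star_planar_alg_scheme \<Rightarrow> (nat \<times> 'a) set" where
  "minimal_projections A = {(k, p). minimal_projection A k p}"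

definition principal_graph ::
    "('a :: ab_group_add, 'b) star_planar_alg_scheme \<Rightarrow> (nat \<times> 'a) set multigraph" where
  "principal_graph A =
     (minimal_projections A //
        {((k, p), (l, q)). minimal_projection A k p \<and> minimal_projection A l q \<and> proj_iso A k p l q},
      \<lambda>C D. let (k, p) = (SOME u. u \<in> C); (l, q) = (SOME v. v \<in> D) in
        vector_space.dim (scl A) (Hom A (k + 1) (tensor A k k 1 1 p (strand A)) l q))"

text \<open>The cycle with \<open>l + 1\<close> vertices, for \<open>l \<ge> 1\<close>; the two summands make a double edge if \<open>l = 1\<close>.\<close>

definition affine_A :: "nat \<Rightarrow> nat multigraph" where
  "affine_A l =
     ({..l}, \<lambda>i j. of_bool ((i + 1) mod (l + 1) = j) + of_bool ((j + 1) mod (l + 1) = i))"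


subsection \<open>The arrow case\<close>

definition arrow_case :: "('a :: ab_group_add, 'b) star_planar_alg_scheme \<Rightarrow> bool" where
  "arrow_case A \<longleftrightarrow>
     (\<exists>P Q. minimal_projection A 1 P \<and> minimal_projection A 1 Q \<and> strand A = P + Q \<and>
        mult A 1 1 1 P Q = 0 \<and> mult A 1 1 1 Q P = 0 \<and> half_turn A 1 1 P = Q)"

text \<open>
  Arcs carrying the label \<open>p\<close> on their left leg. Moved to the right leg, the label becomes the
  rotation of \<open>p\<close> by \<open>\<pi>\<close>.
\<close>

definition labelled_cup :: "('a, 'b) planar_alg_scheme \<Rightarrow> 'a \<Rightarrow> 'a" where
  "labelled_cup A p = mult A 0 2 2 (tensor A 1 1 1 1 p (strand A)) (cup A)"

definition labelled_cap :: "('a, 'b) planar_alg_scheme \<Rightarrow> 'a \<Rightarrow> 'a" where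
  "labelled_cap A p = mult A 2 2 0 (cap A) (tensor A 1 1 1 1 p (strand A))"

definition arrow_relations ::
    "('a :: ab_group_add, 'b) star_planar_alg_scheme \<Rightarrow> nat \<Rightarrow> nat \<Rightarrow> complex \<Rightarrow> 'a \<Rightarrow> 'a \<Rightarrow> bool" where
  "arrow_relations A a n \<omega> P U \<longleftrightarrow>
     (let Q = half_turn A 1 1 P; U' = star A a n U in
       P \<in> spc A 1 1 \<and> U \<in> spc A a n \<and>
       \<comment> \<open>colours of the strands at \<open>U\<close> and its adjoint\<close>
       mult A a n n (tensor_power A n Q) (mult A a a n U (tensor_power A a P)) = U \<and>
       mult A n a a (tensor_power A a P) (mult A n n a U' (tensor_power A n Q)) = U' \<and>
       \<comment> \<open>bubble\<close>
       trR A 1 P = empty_diag A \<and> trR A 1 Q = empty_diag A \<and>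
       strand A = P + Q \<and>
       mult A 1 1 1 P Q = 0 \<and> mult A 1 1 1 Q P = 0 \<and>
       \<comment> \<open>saddle\<close>
       mult A 2 0 2 (labelled_cup A P) (labelled_cap A P) = tensor A 1 1 1 1 P Q \<and>
       mult A 2 0 2 (labelled_cup A Q) (labelled_cap A Q) = tensor A 1 1 1 1 Q P \<and>
       \<comment> \<open>unitary\<close>
       mult A n a n U U' = tensor_power A n Q \<and> mult A a n a U' U = tensor_power A a P \<and>
       \<comment> \<open>click\<close>
       click A a n U = scl A \<omega> U \<and> click A n a U' = scl A \<omega> U')"

end

theory Submission
  imports Defs
begin

text \<open>
  Write \<open>P\<close> and \<open>Q\<close> for the two colours of a strand and \<open>m = a + n\<close>. Since the strand is \<open>P + Q\<close>, every
  identity element is a sum of tensor products of \<open>P\<close> and \<open>Q\<close>, called words. The saddle and the bubble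
  relation make \<open>Q \<otimes> P\<close> isomorphic to the empty word, and the unitary relation makes \<open>P\<^sup>a\<close> isomorphic to
  \<open>Q\<^sup>n\<close>; hence \<open>P\<^sup>m\<close> is isomorphic to the empty word, \<open>Q\<close> is inverse to \<open>P\<close>, and every word is isomorphic
  to \<open>P\<^sup>j\<close> for some \<open>j < m\<close>. All these isomorphisms are built from \<open>P\<close>, \<open>U\<close>, \<open>U\<^sup>*\<close> and unlabelled diagrams. An
  arbitrary element is a sum of elements between words, so it is generated as soon as the elements
  between \<open>P\<^sup>i\<close> and \<open>P\<^sup>j\<close> are, for \<open>i, j < m\<close>. For \<open>i = j\<close> they are scalar multiples of \<open>P\<^sup>j\<close>, because \<open>P\<^sup>j\<close> is
  invertible for the tensor product and closed diagrams are scalars.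

  For \<open>i \<noteq> j\<close> there are no nonzero elements, and this is where the principal graph enters. Every minimal
  projection admits a nonzero morphism to some \<open>P\<^sup>j\<close> with \<open>j < m\<close>, and positivity of the trace form shows
  that two minimal projections with nonzero morphisms to the same \<open>P\<^sup>j\<close> are isomorphic. So there are at
  most \<open>m\<close> isomorphism classes. A nonzero morphism from \<open>P\<^sup>i\<close> to \<open>P\<^sup>j\<close> would make the index \<open>i\<close> redundant
  and leave at most \<open>m - 1\<close> classes, but the principal graph is a cycle with \<open>m\<close> vertices
  (lemmas \<open>generation\<close>, \<open>linked_isomorphic\<close>, \<open>linked_exists\<close>, \<open>arrow_relations_generate\<close>).

  This argument takes place in a strict monoidal category, and the other half of the work is to
  derive the laws of that category from the action of tangles up to isotopy. All diagrams in these
  laws are layered: horizontal lines cut them into rows of segments and boxes. Two layered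
  tangles whose rows have the same combinatorial shape are isotopic by moving every point along a
  straight segment (\<open>layered_isotopy\<close>), so a layered diagram can be evaluated from its shape
  alone, and each law compares two shapes that differ by rows of strands. The one isotopy that is
  not of this kind straightens the trace into a cap, a box beside a strand, and a cup
  (\<open>trace_isotopy\<close>).
\<close>

section \<open>Gluing planar tangles\<close>

lemma orient_affine_inj: "orient_affine f \<Longrightarrow> inj f"
proof -
  assume "orient_affine f"
  then obtain c a d where ad: "cmod d < cmod a" and f: "f = (\<lambda>z. c + a * z + d * cnj z)"
    unfolding orient_affine_def by blast
  show "inj f"
  proof (rule injI)
    fix x y assume "f x = f y"
    then have "a * (x - y) = - d * cnj (x - y)"
      unfolding f by (simp add: algebra_simps)
    then have "cmod a * cmod (x - y) = cmod d * cmod (x - y)"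
      by (metis complex_mod_cnj norm_minus_cancel norm_mult)
    then show "x = y" using ad by auto
  qed
qed

lemma orient_affine_continuous: "orient_affine f \<Longrightarrow> continuous_on S f"
  unfolding orient_affine_def by (auto intro!: continuous_intros)

text \<open>The determinants \<open>\<bar>a\<bar>\<^sup>2 - \<bar>d\<bar>\<^sup>2\<close> multiply.\<close>

lemma orient_affine_comp:
  assumes "orient_affine f" "orient_affine g" shows "orient_affine (f \<circ> g)"
proof -
  obtain c a d where ad: "cmod d < cmod a" and f: "f = (\<lambda>z. c + a * z + d * cnj z)"
    using assms(1) unfolding orient_affine_def by blast
  obtain c' a' d' where ad': "cmod d' < cmod a'" and g: "g = (\<lambda>z. c' + a' * z + d' * cnj z)"
    using assms(2) unfolding orient_affine_def by blast
  have fg: "f \<circ> g = (\<lambda>z. (c + a * c' + d * cnj c') + (a * a' + d * cnj d') * z + (a * d' + d * cnj a') * cnj z)"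
    unfolding f g by (auto simp: fun_eq_iff algebra_simps)
  have "(cmod (a * a' + d * cnj d'))\<^sup>2 - (cmod (a * d' + d * cnj a'))\<^sup>2
      = ((cmod a)\<^sup>2 - (cmod d)\<^sup>2) * ((cmod a')\<^sup>2 - (cmod d')\<^sup>2)"
    unfolding cmod_power2 by (simp add: algebra_simps power2_eq_square)
  also have "\<dots> > 0"
    using ad ad' by (simp add: power_strict_mono)
  finally have "cmod (a * d' + d * cnj a') < cmod (a * a' + d * cnj d')"
    by (simp add: power2_less_imp_less)
  then show ?thesis unfolding orient_affine_def fg by blast
qed

lemma is_strand_image:
  assumes "is_strand M C" "continuous_on C h" "inj_on h (C \<union> M)"
  shows "is_strand (h ` M) (h ` C)"
proof -
  have inC: "inj_on h C" using assms(3) by (rule inj_on_subset) simp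
  have int: "h ` C \<inter> h ` M = h ` (C \<inter> M)"
    using assms(3) by (simp add: inj_on_image_Int)
  from assms(1) show ?thesis unfolding is_strand_def
  proof (elim disjE exE conjE)
    fix g assume g: "arc g" "path_image g = C" "C \<inter> M = {pathstart g, pathfinish g}"
    have "arc (h \<circ> g)"
      using g inC assms(2) unfolding arc_def path_image_def
      by (auto intro!: path_continuous_image comp_inj_on simp: path_image_def)
    moreover have "path_image (h \<circ> g) = h ` C" using g by (simp add: path_image_compose)
    moreover have "h ` C \<inter> h ` M = {pathstart (h \<circ> g), pathfinish (h \<circ> g)}"
      unfolding int g by (simp add: pathstart_compose pathfinish_compose)
    ultimately show "(\<exists>\<gamma>. arc \<gamma> \<and> path_image \<gamma> = h ` C \<and> h ` C \<inter> h ` M = {pathstart \<gamma>, pathfinish \<gamma>}) \<or>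
      (\<exists>\<gamma>. simple_path \<gamma> \<and> pathfinish \<gamma> = pathstart \<gamma> \<and> path_image \<gamma> = h ` C \<and> h ` C \<inter> h ` M = {})"
      by blast
  next
    fix g assume g: "simple_path g" "pathfinish g = pathstart g" "path_image g = C" "C \<inter> M = {}"
    have "simple_path (h \<circ> g)"
      by (rule simple_path_continuous_image) (use g inC assms(2) in auto)
    moreover have "path_image (h \<circ> g) = h ` C" using g by (simp add: path_image_compose)
    moreover have "h ` C \<inter> h ` M = {}" unfolding int g by simp
    moreover have "pathfinish (h \<circ> g) = pathstart (h \<circ> g)"
      using g by (simp add: pathstart_compose pathfinish_compose)
    ultimately show "(\<exists>\<gamma>. arc \<gamma> \<and> path_image \<gamma> = h ` C \<and> h ` C \<inter> h ` M = {pathstart \<gamma>, pathfinish \<gamma>}) \<or>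
      (\<exists>\<gamma>. simple_path \<gamma> \<and> pathfinish \<gamma> = pathstart \<gamma> \<and> path_image \<gamma> = h ` C \<and> h ` C \<inter> h ` M = {})"
      by blast
  qed
qed

lemma is_strand_cong: "is_strand M C \<Longrightarrow> C \<inter> M = C \<inter> M' \<Longrightarrow> is_strand M' C"
  unfolding is_strand_def by metis

lemma is_strand_infinite: "is_strand M C \<Longrightarrow> infinite C"
  unfolding is_strand_def
  using arc_image_uncountable simple_path_image_uncountable countable_finite by metis

lemma is_strand_arc_from:
  assumes "is_strand M C" "p \<in> C" "p \<in> M"
  obtains g where "arc g" "path_image g = C" "pathstart g = p" "C \<inter> M = {p, pathfinish g}"
proof -
  from assms obtain g where g: "arc g" "path_image g = C" "C \<inter> M = {pathstart g, pathfinish g}"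
    unfolding is_strand_def by blast
  with assms have "p = pathstart g \<or> p = pathfinish g" by blast
  then show ?thesis
  proof
    assume "p = pathstart g" then show ?thesis using that[of g] g by simp
  next
    assume "p = pathfinish g" then show ?thesis
      using that[of "reversepath g"] g by (auto simp: arc_reversepath)
  qed
qed

text \<open>
  Gluing joins strands end to end at the boundary points of a box, here the points of \<open>N\<close>. They are
  removed by induction: two arcs with one common end become a longer arc, and two arcs with both
  ends in common become a closed curve, in which case two points of \<open>N\<close> disappear at once.
\<close>

lemma merge_strands:
  assumes "finite N" "finite K" "N \<subseteq> M" "\<And>C. C \<in> K \<Longrightarrow> is_strand M C"
    and "\<And>C D. C \<in> K \<Longrightarrow> D \<in> K \<Longrightarrow> C \<noteq> D \<Longrightarrow> C \<inter> D \<subseteq> N"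
    and "\<And>p. p \<in> N \<Longrightarrow> \<exists>C\<in>K. \<exists>D\<in>K. C \<noteq> D \<and> p \<in> C \<and> p \<in> D \<and> (\<forall>E\<in>K. p \<in> E \<longrightarrow> E = C \<or> E = D)"
  shows "\<exists>S. finite S \<and> disjoint S \<and> \<Union>S = \<Union>K \<and> (\<forall>C\<in>S. is_strand (M - N) C)"
  using assms
proof (induction "card N" arbitrary: N M K rule: less_induct)
  case less
  show ?case
  proof (cases "N = {}")
    case True
    show ?thesis
      by (rule exI[of _ K]) (use less.prems True in \<open>auto simp: pairwise_def disjnt_def\<close>)
  next
    case False
    then obtain p where pN: "p \<in> N" by blast
    from less.prems(6)[OF pN] obtain C D where
      CD: "C \<in> K" "D \<in> K" "C \<noteq> D" "p \<in> C" "p \<in> D" and only: "\<And>E. E \<in> K \<Longrightarrow> p \<in> E \<Longrightarrow> E = C \<or> E = D"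
      by blast
    have pM: "p \<in> M" using pN less.prems(3) by blast
    obtain g where g: "arc g" "path_image g = C" "pathstart g = p" "C \<inter> M = {p, pathfinish g}"
      using is_strand_arc_from[OF less.prems(4)[OF CD(1)] CD(4) pM] .
    obtain h where h: "arc h" "path_image h = D" "pathstart h = p" "D \<inter> M = {p, pathfinish h}"
      using is_strand_arc_from[OF less.prems(4)[OF CD(2)] CD(5) pM] .
    have inter: "C \<inter> D \<subseteq> {p, pathfinish g} \<inter> {p, pathfinish h}"
      using less.prems(5)[OF CD(1-3)] less.prems(3) g(4) h(4) by blast
    have gne: "pathfinish g \<noteq> p" "pathfinish h \<noteq> p"
      using arc_distinct_ends[OF g(1)] arc_distinct_ends[OF h(1)] g(3) h(3) by auto
    let ?K = "insert (C \<union> D) (K - {C, D})"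
    have UK: "\<Union>?K = \<Union>K" using CD by blast
    have finK: "finite ?K" using less.prems(2) by simp
    have CDnot: "E \<in> K - {C, D} \<Longrightarrow> p \<notin> E" for E using only by blast
    show ?thesis
    \<comment> \<open>\<open>C\<close> and \<open>D\<close> either close up to a loop or form an arc through \<open>p\<close>\<close>
    proof (cases "pathfinish g = pathfinish h")
      case True
      let ?q = "pathfinish g"
      have loop: "simple_path (g +++ reversepath h)"
        by (rule simple_path_join_loop) (use g h True inter in \<open>auto simp: arc_reversepath\<close>)
      have qC: "?q \<in> C" "?q \<in> D" using g h True by (metis pathfinish_in_path_image)+
      have qN: "?q \<in> N" using less.prems(5)[OF CD(1-3)] qC by blast
      have qonly: "E = C \<or> E = D" if "E \<in> K" "?q \<in> E" for E
      proof -
        from less.prems(6)[OF qN] obtain C' D' where "\<forall>E\<in>K. ?q \<in> E \<longrightarrow> E = C' \<or> E = D'" by blast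
        then show ?thesis using that CD qC by metis
      qed
      have "is_strand (M - {p, ?q}) (C \<union> D)"
        unfolding is_strand_def
      proof (rule disjI2, rule exI[of _ "g +++ reversepath h"], intro conjI loop)
        show "pathfinish (g +++ reversepath h) = pathstart (g +++ reversepath h)"
          using g h by simp
        show "path_image (g +++ reversepath h) = C \<union> D"
          using g h True by (subst path_image_join) auto
        show "(C \<union> D) \<inter> (M - {p, pathfinish g}) = {}" using g(4) h(4)[folded True] by blast
      qed
      moreover have "is_strand (M - {p, ?q}) E" if "E \<in> K - {C, D}" for E
        by (rule is_strand_cong[OF less.prems(4)]) (use that only qonly in blast)+
      ultimately have str: "\<And>E. E \<in> ?K \<Longrightarrow> is_strand (M - {p, ?q}) E" by blast
      have "card (N - {p, ?q}) < card N"
        using less.prems(1) pN by (intro psubset_card_mono) auto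
      then have "\<exists>S. finite S \<and> disjoint S \<and> \<Union>S = \<Union>?K \<and> (\<forall>C\<in>S. is_strand (M - {p, ?q} - (N - {p, ?q})) C)"
      proof (rule less.hyps)
        show "finite (N - {p, ?q})" "finite ?K" using less.prems by auto
        show "N - {p, pathfinish g} \<subseteq> M - {p, pathfinish g}" using less.prems(3) by blast
        show "\<And>E. E \<in> ?K \<Longrightarrow> is_strand (M - {p, ?q}) E" by (rule str)
        fix E F assume EF: "E \<in> ?K" "F \<in> ?K" "E \<noteq> F"
        have *: "E \<inter> F \<subseteq> N - {p, ?q}" if "E \<in> K - {C, D}" "F \<in> ?K" "E \<noteq> F" for E F
        proof -
          have "p \<notin> E" "?q \<notin> E" using that only qonly by blast+
          moreover have "E \<inter> F \<subseteq> N"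
          proof (cases "F = C \<union> D")
            case True
            have "E \<inter> C \<subseteq> N" "E \<inter> D \<subseteq> N"
              using less.prems(5)[of E C] less.prems(5)[of E D] that(1) CD(1,2) by simp_all
            then show ?thesis using True by (simp add: Int_Un_distrib)
          next
            case False
            then show ?thesis using that by (intro less.prems(5)) auto
          qed
          ultimately show ?thesis by blast
        qed
        show "E \<inter> F \<subseteq> N - {p, pathfinish g}"
        proof (cases "E \<in> K - {C, D}")
          case True show ?thesis by (rule *[OF True EF(2,3)])
        next
          case False
          then have "F \<in> K - {C, D}" using EF by blast
          from *[OF this EF(1)] EF(3) show ?thesis by blast
        qed
      next
        fix x assume x: "x \<in> N - {p, pathfinish g}"
        then obtain C' D' where C': "C' \<in> K" "D' \<in> K" "C' \<noteq> D'" "x \<in> C'" "x \<in> D'" "\<forall>E\<in>K. x \<in> E \<longrightarrow> E = C' \<or> E = D'"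
          using less.prems(6)[of x] by blast
        have xM: "x \<in> M" using x less.prems(3) by blast
        have "x \<notin> C" using x g(4) xM by blast
        moreover have "x \<notin> D" using x h(4)[folded True] xM by blast
        ultimately have "C' \<in> K - {C, D}" "D' \<in> K - {C, D}" "x \<notin> C \<union> D" using C'(1,2,4,5) by blast+
        with C' show "\<exists>C\<in>?K. \<exists>D\<in>?K. C \<noteq> D \<and> x \<in> C \<and> x \<in> D \<and> (\<forall>E\<in>?K. x \<in> E \<longrightarrow> E = C \<or> E = D)"
          by blast
      qed
      moreover have "M - {p, ?q} - (N - {p, ?q}) = M - N" using pN qN by blast
      ultimately show ?thesis unfolding UK by simp
    next
      case False
      have int2: "C \<inter> D \<subseteq> {p}" using inter False by blast
      have ar: "arc (reversepath g +++ h)"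
        by (rule arc_join) (use g h int2 in \<open>auto simp: arc_reversepath\<close>)
      have "is_strand (M - {p}) (C \<union> D)"
        unfolding is_strand_def
      proof (rule disjI1, rule exI[of _ "reversepath g +++ h"], intro conjI ar)
        show "path_image (reversepath g +++ h) = C \<union> D"
          using g h by (subst path_image_join) auto
        show "(C \<union> D) \<inter> (M - {p}) = {pathstart (reversepath g +++ h), pathfinish (reversepath g +++ h)}"
          using g h gne by auto
      qed
      moreover have "is_strand (M - {p}) E" if "E \<in> K - {C, D}" for E
        by (rule is_strand_cong[OF less.prems(4)]) (use that only in blast)+
      ultimately have str: "\<And>E. E \<in> ?K \<Longrightarrow> is_strand (M - {p}) E" by blast
      have "card (N - {p}) < card N"
        using less.prems(1) pN by (intro psubset_card_mono) auto
      then have "\<exists>S. finite S \<and> disjoint S \<and> \<Union>S = \<Union>?K \<and> (\<forall>C\<in>S. is_strand (M - {p} - (N - {p})) C)"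
      proof (rule less.hyps)
        show "finite (N - {p})" "finite ?K" using less.prems by auto
        show "N - {p} \<subseteq> M - {p}" using less.prems(3) by blast
        show "\<And>E. E \<in> ?K \<Longrightarrow> is_strand (M - {p}) E" by (rule str)
        fix E F assume EF: "E \<in> ?K" "F \<in> ?K" "E \<noteq> F"
        have *: "E \<inter> F \<subseteq> N - {p}" if "E \<in> K - {C, D}" "F \<in> ?K" "E \<noteq> F" for E F
        proof -
          have "p \<notin> E" using that only by blast+
          moreover have "E \<inter> F \<subseteq> N"
          proof (cases "F = C \<union> D")
            case True
            have "E \<inter> C \<subseteq> N" "E \<inter> D \<subseteq> N"
              using less.prems(5)[of E C] less.prems(5)[of E D] that(1) CD(1,2) by simp_all
            then show ?thesis using True by (simp add: Int_Un_distrib)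
          next
            case False
            then show ?thesis using that by (intro less.prems(5)) auto
          qed
          ultimately show ?thesis by blast
        qed
        show "E \<inter> F \<subseteq> N - {p}"
        proof (cases "E \<in> K - {C, D}")
          case True show ?thesis by (rule *[OF True EF(2,3)])
        next
          case False
          then have "F \<in> K - {C, D}" using EF by blast
          from *[OF this EF(1)] EF(3) show ?thesis by blast
        qed
      next
        fix x assume x: "x \<in> N - {p}"
        then obtain C' D' where C': "C' \<in> K" "D' \<in> K" "C' \<noteq> D'" "x \<in> C'" "x \<in> D'" "\<forall>E\<in>K. x \<in> E \<longrightarrow> E = C' \<or> E = D'"
          using less.prems(6)[of x] by blast
        have nb: "\<not> (x \<in> C \<and> x \<in> D)" using x int2 by blast
        \<comment> \<open>the piece that contains \<open>E\<close> after the join\<close>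
        define f where "f = (\<lambda>E. if E = C \<or> E = D then C \<union> D else E)"
        have fC: "f C' \<in> ?K" "f D' \<in> ?K" "x \<in> f C'" "x \<in> f D'" unfolding f_def using C' by auto
        have pf: "p \<in> f E \<longleftrightarrow> E = C \<or> E = D" if "E \<in> K" for E using that only CD unfolding f_def by auto
        have ne: "f C' \<noteq> f D'"
        proof
          assume eq: "f C' = f D'"
          show False
          proof (cases "C' = C \<or> C' = D")
            case True
            then have "D' = C \<or> D' = D" using eq pf C' by metis
            then show False using True C' nb by metis
          next
            case False
            then have "\<not> (D' = C \<or> D' = D)" using eq pf C' by metis
            then show False using False eq C' unfolding f_def by simp
          qed
        qed
        have "E = f C' \<or> E = f D'" if "E \<in> ?K" "x \<in> E" for E
        proof (cases "E = C \<union> D")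
          case True
          then have "x \<in> C \<or> x \<in> D" using that by blast
          then have "C \<in> {C', D'} \<or> D \<in> {C', D'}" using C' CD by blast
          then show ?thesis unfolding f_def using True by auto
        next
          case False
          then have "E \<in> K" "E \<noteq> C" "E \<noteq> D" using that by blast+
          moreover have "E = C' \<or> E = D'" using C'(6) \<open>E \<in> K\<close> that(2) by blast
          ultimately show ?thesis unfolding f_def by auto
        qed
        with fC ne show "\<exists>C\<in>?K. \<exists>D\<in>?K. C \<noteq> D \<and> x \<in> C \<and> x \<in> D \<and> (\<forall>E\<in>?K. x \<in> E \<longrightarrow> E = C \<or> E = D)"
          by (metis (no_types))
      qed
      moreover have "M - {p} - (N - {p}) = M - N" using pN by blast
      ultimately show ?thesis unfolding UK by simp
    qed
  qed
qed

lemma xpos_bounds: "j < k \<Longrightarrow> -1 < xpos k j" "j < k \<Longrightarrow> xpos k j < 1"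
  unfolding xpos_def by (auto simp: field_simps)

lemma xpos_less_iff: "j < k \<Longrightarrow> xpos k i < xpos k j \<longleftrightarrow> i < j"
  unfolding xpos_def by (auto simp: field_simps)

lemma xpos_inj: "k > 0 \<Longrightarrow> xpos k i = xpos k j \<longleftrightarrow> i = j"
  unfolding xpos_def by (auto simp: field_simps)

lemma mem_sq: "z \<in> sq \<longleftrightarrow> \<bar>Re z\<bar> \<le> 1 \<and> \<bar>Im z\<bar> \<le> 1"
  unfolding sq_def by (auto simp: in_cbox_complex_iff)

lemma interior_sq: "z \<in> interior sq \<longleftrightarrow> \<bar>Re z\<bar> < 1 \<and> \<bar>Im z\<bar> < 1"
  unfolding sq_def interior_cbox by (auto simp: in_box_complex_iff)

lemma closed_sq: "closed sq" unfolding sq_def by (rule closed_cbox)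

lemma frontier_sq: "z \<in> frontier sq \<longleftrightarrow> z \<in> sq \<and> z \<notin> interior sq"
  unfolding frontier_def using closed_sq by (simp add: closure_closed)

lemma frontier_sq': "frontier sq = sq - interior sq"
  using frontier_sq by blast

lemma marks_frontier: "marks b t \<subseteq> frontier sq"
  unfolding marks_def bot_mark_def top_mark_def
  using xpos_bounds by (fastforce simp: frontier_sq mem_sq interior_sq abs_le_iff)

lemma marks_sq: "marks b t \<subseteq> sq" using marks_frontier frontier_sq by blast

lemma finite_marks: "finite (marks b t)" unfolding marks_def by simp

lemma sorted_wrt_disj_iff:
  "(\<forall>i<length xs. \<forall>j<length xs. i \<noteq> j \<longrightarrow> f (xs ! i) \<inter> f (xs ! j) = {}) \<longleftrightarrow>
    sorted_wrt (\<lambda>x y. f x \<inter> f y = {}) xs"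
  (is "?L \<longleftrightarrow> ?R")
proof
  assume ?L then show ?R unfolding sorted_wrt_iff_nth_less by (metis nat_neq_iff order.strict_trans)
next
  assume R: ?R
  have "f (xs ! i) \<inter> f (xs ! j) = {}" if "i < j" "j < length xs" for i j
    using R that unfolding sorted_wrt_iff_nth_less by blast
  then show ?L by (metis Int_commute nat_neq_iff)
qed

lemma planar_tangle_sorted:
  "planar_tangle T \<longleftrightarrow>
     (\<forall>B\<in>set (boxes T). orient_affine (in_map B) \<and> in_region B \<subseteq> interior sq) \<and>
     sorted_wrt (\<lambda>B B'. in_region B \<inter> in_region B' = {}) (boxes T) \<and>
     strands T \<subseteq> sq \<and>
     strands T \<inter> frontier sq = marks (bots T) (tops T) \<and>
     (\<forall>B\<in>set (boxes T). strands T \<inter> in_region B = in_marks B) \<and>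
     (\<exists>S. finite S \<and> disjoint S \<and> strands T = \<Union>S \<and> (\<forall>C\<in>S. is_strand (all_marks T) C))"
  unfolding planar_tangle_def sorted_wrt_disj_iff ..

lemma in_marks_region: "in_marks B \<subseteq> in_region B"
  unfolding in_marks_def in_region_def using marks_sq by blast

lemma all_marks_strands: "planar_tangle T \<Longrightarrow> all_marks T \<subseteq> strands T"
  unfolding planar_tangle_def all_marks_def by blast

lemma planar_tangle_strandsE:
  assumes "planar_tangle T"
  obtains S where "finite S" "disjoint S" "strands T = \<Union>S" "\<And>C. C \<in> S \<Longrightarrow> is_strand (all_marks T) C"
proof -
  have "\<exists>S. finite S \<and> disjoint S \<and> strands T = \<Union>S \<and> (\<forall>C\<in>S. is_strand (all_marks T) C)"
    using assms unfolding planar_tangle_def by (elim conjE)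
  then show ?thesis using that by (elim exE conjE) simp
qed

lemma Un_disjoint_subset: "A \<inter> V = {} \<Longrightarrow> W \<inter> V = {} \<Longrightarrow> N \<subseteq> V \<Longrightarrow> (A \<union> W) \<inter> N = {}"
  by blast

lemma remove_common: "A \<inter> N = {} \<Longrightarrow> W \<inter> N = {} \<Longrightarrow> A \<union> N \<union> (N \<union> W) - N = A \<union> W"
  by blast

text \<open>
  Each boundary point of the filled box lies on exactly one strand of the outer and one of the inner
  tangle, so \<open>merge_strands\<close> applies.
\<close>

lemma planar_glue:
  assumes T: "planar_tangle T" and S: "planar_tangle S" and i: "i < length (boxes T)"
    and b: "bots S = in_bot (boxes T ! i)" and t: "tops S = in_top (boxes T ! i)"
  shows "planar_tangle (glue T i S)"
proof -
  define B where "B = boxes T ! i"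
  define p where "p = in_map B"
  define X where "X = take i (boxes T)"
  define Y where "Y = drop (Suc i) (boxes T)"
  define Z where "Z = map (\<lambda>B. (in_bot B, in_top B, p \<circ> in_map B)) (boxes S)"
  have bT: "boxes T = X @ B # Y" unfolding X_def Y_def B_def using i by (simp add: id_take_nth_drop)
  have G: "glue T i S = \<lparr> bots = bots T, tops = tops T, boxes = X @ Z @ Y, strands = strands T \<union> p ` strands S \<rparr>"
    unfolding glue_def Let_def X_def Y_def Z_def p_def B_def by simp
  note T' = T[unfolded planar_tangle_sorted bT]
  note S' = S[unfolded planar_tangle_sorted]
  have pa: "orient_affine p" using T' unfolding p_def by auto
  have pinj: "inj p" using orient_affine_inj[OF pa] .
  have pcont: "continuous_on A p" for A using orient_affine_continuous[OF pa] .
  have rB: "in_region B = p ` sq" unfolding in_region_def p_def ..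
  have mB: "in_marks B = p ` marks (bots S) (tops S)" unfolding in_marks_def p_def b t B_def ..
  have rBi: "in_region B \<subseteq> interior sq" using T' by auto
  have TB: "strands T \<inter> p ` sq = in_marks B" using T' rB by auto
  have Ssq: "strands S \<subseteq> sq" using S' by auto
  have disjX: "B' \<in> set X \<union> set Y \<Longrightarrow> in_region B' \<inter> p ` sq = {}" for B'
    using T' rB unfolding sorted_wrt_append by (fastforce simp: Int_commute)
  have regZ: "in_region (in_bot B', in_top B', p \<circ> in_map B') = p ` in_region B'" for B'
    unfolding in_region_def in_map_def by (simp add: image_comp)
  have marZ: "in_marks (in_bot B', in_top B', p \<circ> in_map B') = p ` in_marks B'" for B'
    unfolding in_marks_def in_map_def in_bot_def in_top_def by (simp add: image_comp)
  have regS: "B' \<in> set (boxes S) \<Longrightarrow> in_region B' \<subseteq> interior sq" for B' using S' by auto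
  have mkB: "B' \<in> set X \<union> set Y \<Longrightarrow> in_marks B' \<inter> p ` sq = {}" for B'
    using disjX in_marks_region by blast
  have intsq: "interior sq \<subseteq> sq" by (rule interior_subset)
  have mf: "marks (bots T) (tops T) \<inter> p ` sq = {}"
    using marks_frontier rBi rB frontier_sq by blast
  let ?M = "all_marks T \<union> p ` all_marks S" and ?N = "in_marks B"
  have amT: "all_marks T = marks (bots T) (tops T) \<union> (\<Union>B\<in>set X \<union> set Y. in_marks B) \<union> ?N"
    unfolding all_marks_def bT by auto
  have amS: "all_marks S = marks (bots S) (tops S) \<union> (\<Union>B\<in>set (boxes S). in_marks B)"
    unfolding all_marks_def by auto
  have amTp: "all_marks T \<inter> p ` sq = ?N"
    unfolding amT using mf mkB in_marks_region[of B] rB by blast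
  have mkS: "(\<Union>B\<in>set (boxes S). in_marks B) \<inter> frontier sq = {}"
    using regS in_marks_region frontier_sq by blast
  have amG: "all_marks (glue T i S) = ?M - ?N"
  proof -
    have e1: "all_marks (glue T i S) = marks (bots T) (tops T) \<union> (\<Union>B\<in>set X \<union> set Y. in_marks B) \<union> p ` (\<Union>B\<in>set (boxes S). in_marks B)"
      unfolding all_marks_def G by (auto simp: Z_def marZ)
    have e2: "(marks (bots T) (tops T) \<union> (\<Union>B\<in>set X \<union> set Y. in_marks B)) \<inter> ?N = {}"
    proof -
      have N: "?N \<subseteq> p ` sq" using in_marks_region[of B] unfolding rB .
      have UX: "(\<Union>B\<in>set X \<union> set Y. in_marks B) \<inter> p ` sq = {}"
        using mkB by (intro equalityI subsetI) (elim IntE UN_E, blast, simp)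
      show ?thesis by (rule Un_disjoint_subset[OF mf UX N])
    qed
    have e3: "p ` (\<Union>B\<in>set (boxes S). in_marks B) \<inter> ?N = {}"
    proof -
      have "(\<Union>B\<in>set (boxes S). in_marks B) \<inter> marks (bots S) (tops S) = {}"
        using mkS marks_frontier by blast
      then show ?thesis unfolding mB using pinj by (simp add: image_Int[symmetric])
    qed
    show ?thesis
      unfolding e1 remove_common[OF e2 e3, symmetric] unfolding amT amS image_Un mB[symmetric] by (rule refl)
  qed
  obtain S1 where S1: "finite S1" "disjoint S1" "strands T = \<Union>S1" "\<And>C. C \<in> S1 \<Longrightarrow> is_strand (all_marks T) C"
    using planar_tangle_strandsE[OF T] by blast
  obtain S2 where S2: "finite S2" "disjoint S2" "strands S = \<Union>S2" "\<And>C. C \<in> S2 \<Longrightarrow> is_strand (all_marks S) C"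
    using planar_tangle_strandsE[OF S] by blast
  have fN: "finite ?N" unfolding mB using finite_marks by simp
  have amSs: "all_marks S \<subseteq> sq" using all_marks_strands[OF S] Ssq by blast
  have pS2: "p ` C \<subseteq> p ` sq" if "C \<in> S2" for C using that S2(3) Ssq by blast
  have dS1: "C \<in> S1 \<Longrightarrow> D \<in> S1 \<Longrightarrow> x \<in> C \<Longrightarrow> x \<in> D \<Longrightarrow> C = D" for C D x
    using S1(2) unfolding disjoint_def by blast
  have dS2: "C \<in> S2 \<Longrightarrow> D \<in> S2 \<Longrightarrow> x \<in> C \<Longrightarrow> x \<in> D \<Longrightarrow> C = D" for C D x
    using S2(2) unfolding disjoint_def by blast
  have cross: "C \<in> S1 \<Longrightarrow> D \<in> S2 \<Longrightarrow> C \<inter> p ` D \<subseteq> ?N" for C D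
    using S1(3) pS2 TB by blast
  have "\<exists>S. finite S \<and> disjoint S \<and> \<Union>S = \<Union>(S1 \<union> (\<lambda>C. p ` C) ` S2) \<and> (\<forall>C\<in>S. is_strand (?M - ?N) C)"
  proof (rule merge_strands)
    show "finite ?N" by (rule fN)
    show "finite (S1 \<union> (\<lambda>C. p ` C) ` S2)" using S1 S2 by simp
    show "?N \<subseteq> ?M" unfolding amT by blast
    show "is_strand ?M C" if CK: "C \<in> S1 \<union> (\<lambda>C. p ` C) ` S2" for C
    proof (cases "C \<in> S1")
      case True
      have "C \<inter> p ` all_marks S \<subseteq> ?N" using True S1(3) amSs TB by blast
      then have "C \<inter> all_marks T = C \<inter> ?M" unfolding amT by blast
      then show ?thesis using is_strand_cong[OF S1(4)[OF True]] by blast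
    next
      case False
      then obtain D where D: "D \<in> S2" "C = p ` D" using CK by blast
      have "is_strand (p ` all_marks S) C"
        unfolding D(2) by (rule is_strand_image[OF S2(4)[OF D(1)] pcont inj_on_subset[OF pinj]]) simp
      moreover have "C \<inter> p ` all_marks S = C \<inter> ?M"
      proof -
        have "C \<inter> all_marks T \<subseteq> ?N" using amTp pS2[OF D(1)] D(2) by blast
        moreover have "?N \<subseteq> p ` all_marks S" unfolding mB amS by blast
        ultimately show ?thesis by blast
      qed
      ultimately show ?thesis by (rule is_strand_cong)
    qed
    show "C \<inter> D \<subseteq> ?N" if "C \<in> S1 \<union> (\<lambda>C. p ` C) ` S2" "D \<in> S1 \<union> (\<lambda>C. p ` C) ` S2" "C \<noteq> D" for C D
      using that
    proof (elim UnE imageE, goal_cases)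
      case 1 then show ?case using dS1 by blast
    next
      case (2 x) then show ?case using cross by blast
    next
      case (3 x) then show ?case using cross by blast
    next
      case (4 x y)
      then have "x \<inter> y = {}" using dS2 by blast
      then show ?case using 4 pinj by (simp add: image_Int[symmetric])
    qed
    show "\<exists>C\<in>S1 \<union> (\<lambda>C. p ` C) ` S2. \<exists>D\<in>S1 \<union> (\<lambda>C. p ` C) ` S2. C \<noteq> D \<and> x \<in> C \<and> x \<in> D \<and>
        (\<forall>E\<in>S1 \<union> (\<lambda>C. p ` C) ` S2. x \<in> E \<longrightarrow> E = C \<or> E = D)" if x: "x \<in> ?N" for x
    proof -
      have "x \<in> strands T" using x TB by blast
      then obtain C where C: "C \<in> S1" "x \<in> C" using S1(3) by blast
      obtain y where y: "y \<in> marks (bots S) (tops S)" "x = p y" using x mB by blast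
      then have "y \<in> strands S" using all_marks_strands[OF S] amS by blast
      then obtain D where D: "D \<in> S2" "y \<in> D" using S2(3) by blast
      have "C \<noteq> p ` D"
      proof
        assume "C = p ` D"
        then have "C \<subseteq> ?N" using cross[OF C(1) D(1)] by blast
        then show False using is_strand_infinite[OF S1(4)[OF C(1)]] fN finite_subset by blast
      qed
      moreover have "\<forall>E\<in>S1 \<union> (\<lambda>C. p ` C) ` S2. x \<in> E \<longrightarrow> E = C \<or> E = p ` D"
      proof (intro ballI impI)
        fix E assume EK: "E \<in> S1 \<union> (\<lambda>C. p ` C) ` S2" "x \<in> E"
        show "E = C \<or> E = p ` D"
        proof (cases "E \<in> S1")
          case True
          then have "E = C" using dS1[OF _ C(1) EK(2) C(2)] by blast
          then show ?thesis ..
        next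
          case False
          then obtain D' where D': "D' \<in> S2" "E = p ` D'" using EK by blast
          then have "y \<in> D'" using EK(2) y pinj by (auto dest: injD)
          then have "D' = D" using dS2[OF D'(1) D(1) _ D(2)] by blast
          then show ?thesis using D'(2) by simp
        qed
      qed
      moreover have "x \<in> p ` D" "C \<in> S1 \<union> (\<lambda>C. p ` C) ` S2" "p ` D \<in> S1 \<union> (\<lambda>C. p ` C) ` S2"
        using C(1) D y(2) by simp_all
      ultimately show ?thesis using C(2) by (intro bexI[of _ C] bexI[of _ "p ` D"] conjI)
    qed
  qed
  moreover have "strands (glue T i S) = \<Union>(S1 \<union> (\<lambda>C. p ` C) ` S2)"
    unfolding G using S1(3) S2(3) by (simp add: image_Union)
  ultimately have arcs: "\<exists>S'. finite S' \<and> disjoint S' \<and> strands (glue T i S) = \<Union>S' \<and> (\<forall>C\<in>S'. is_strand (all_marks (glue T i S)) C)"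
    unfolding amG by (elim exE conjE) (intro exI conjI, assumption+, simp, assumption)
  have boxes: "\<forall>B'\<in>set (X @ Z @ Y). orient_affine (in_map B') \<and> in_region B' \<subseteq> interior sq"
  proof -
    have "orient_affine (in_map B') \<and> in_region B' \<subseteq> interior sq" if BZ: "B' \<in> set Z" for B'
    proof -
      obtain B2 where B2: "B2 \<in> set (boxes S)" "B' = (in_bot B2, in_top B2, p \<circ> in_map B2)"
        using BZ unfolding Z_def by auto
      have "orient_affine (in_map B2)" using S' B2 by auto
      moreover have "in_region B' \<subseteq> interior sq"
        unfolding B2(2) regZ using regS[OF B2(1)] intsq rBi rB by blast
      ultimately show ?thesis unfolding B2(2) in_map_def using orient_affine_comp[OF pa] by (simp add: in_map_def)
    qed
    then show ?thesis using T' by auto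
  qed
  have disj: "sorted_wrt (\<lambda>B B'. in_region B \<inter> in_region B' = {}) (X @ Z @ Y)"
  proof -
    have Zreg: "B' \<in> set Z \<Longrightarrow> in_region B' \<subseteq> p ` sq" for B'
      unfolding Z_def using regS intsq by (fastforce simp: regZ)
    have "sorted_wrt (\<lambda>B B'. in_region B \<inter> in_region B' = {}) Z"
      unfolding Z_def sorted_wrt_map regZ using S' pinj
      by (auto simp: image_Int[symmetric] intro: sorted_wrt_mono_rel[rotated])
    moreover have "in_region B' \<inter> in_region B2 = {}" "in_region B2 \<inter> in_region B' = {}"
      if "B' \<in> set Z" "B2 \<in> set X \<or> B2 \<in> set Y" for B' B2
      using Zreg[OF that(1)] disjX[of B2] that(2) by blast+
    moreover have "sorted_wrt (\<lambda>B B'. in_region B \<inter> in_region B' = {}) (X @ B # Y)"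
      using T' by (elim conjE)
    ultimately show ?thesis unfolding sorted_wrt_append by (simp add: ball_Un)
  qed
  have fr: "(strands T \<union> p ` strands S) \<inter> frontier sq = marks (bots T) (tops T)"
  proof -
    have "p ` strands S \<inter> frontier sq = {}" using Ssq rBi rB frontier_sq by blast
    then show ?thesis using T' by auto
  qed
  have ss: "strands T \<union> p ` strands S \<subseteq> sq" using T' Ssq rBi rB intsq by blast
  have reg: "(strands T \<union> p ` strands S) \<inter> in_region B' = in_marks B'" if "B' \<in> set (X @ Z @ Y)" for B'
  proof (cases "B' \<in> set X \<union> set Y")
    case True
    have "p ` strands S \<inter> in_region B' = {}" using disjX[OF True] Ssq by blast
    moreover have "strands T \<inter> in_region B' = in_marks B'" using T' True by auto
    ultimately show ?thesis by blast
  next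
    case False
    then have "B' \<in> set Z" using that by auto
    then obtain B2 where B2: "B2 \<in> set (boxes S)" "B' = (in_bot B2, in_top B2, p \<circ> in_map B2)"
      unfolding Z_def by auto
    have "strands T \<inter> p ` in_region B2 = {}"
    proof -
      have "strands T \<inter> p ` in_region B2 \<subseteq> p ` marks (bots S) (tops S) \<inter> p ` in_region B2"
        using TB mB regS[OF B2(1)] intsq by blast
      also have "\<dots> = p ` (marks (bots S) (tops S) \<inter> in_region B2)" using pinj by (simp add: image_Int)
      also have "\<dots> = {}" using marks_frontier[of "bots S" "tops S"] regS[OF B2(1)] frontier_sq by blast
      finally show ?thesis by blast
    qed
    moreover have "p ` strands S \<inter> p ` in_region B2 = p ` in_marks B2"
      using S' B2 pinj by (simp add: image_Int[symmetric])
    ultimately show ?thesis unfolding B2(2) regZ marZ by blast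
  qed
  show ?thesis
    unfolding planar_tangle_sorted
    using boxes disj ss fr reg arcs unfolding G by simp
qed

section \<open>Straight-line isotopies\<close>

definition is_place :: "(complex \<Rightarrow> complex) \<Rightarrow> bool" where
  "is_place f \<longleftrightarrow> (\<exists>c w h. 0 < w \<and> 0 < h \<and> f = place c w h)"

lemma orient_affine_place: "is_place f \<Longrightarrow> orient_affine f"
proof -
  assume "is_place f"
  then obtain c w h where wh: "0 < w" "0 < h" and f: "f = place c w h"
    unfolding is_place_def by blast
  have "cmod (of_real ((w - h) / 2)) < cmod (of_real ((w + h) / 2))"
    unfolding norm_of_real using wh by (auto simp: abs_if field_simps)
  moreover have "f = (\<lambda>z. c + of_real ((w + h) / 2) * z + of_real ((w - h) / 2) * cnj z)"
    unfolding f place_def by (auto simp: complex_eq_iff fun_eq_iff field_simps)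
  ultimately show ?thesis unfolding orient_affine_def by blast
qed

lemma is_place_interpolate:
  assumes "is_place f" "is_place g" "0 \<le> s" "s \<le> 1"
  shows "is_place (\<lambda>z. (1 - of_real s) * f z + of_real s * g z)"
proof -
  obtain c w h where wh: "0 < w" "0 < h" and f: "f = place c w h"
    using assms(1) unfolding is_place_def by blast
  obtain c' w' h' where wh': "0 < w'" "0 < h'" and g: "g = place c' w' h'"
    using assms(2) unfolding is_place_def by blast
  have pos: "0 < (1 - s) * x + s * y" if "0 < x" "0 < y" for x y
    using that assms(3,4) by (cases "s = 0") (auto intro!: add_nonneg_pos)
  have "(\<lambda>z. (1 - of_real s) * f z + of_real s * g z) =
      place ((1 - of_real s) * c + of_real s * c') ((1 - s) * w + s * w') ((1 - s) * h + s * h')"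
    unfolding f g place_def by (auto simp: fun_eq_iff complex_eq_iff algebra_simps)
  then show ?thesis using pos[OF wh(1) wh'(1)] pos[OF wh(2) wh'(2)] unfolding is_place_def by blast
qed

lemma is_place_continuous: "is_place f \<Longrightarrow> continuous_on S f"
  by (rule orient_affine_continuous[OF orient_affine_place])

lemma convex_interior_sq: "convex (interior sq)"
  unfolding sq_def by (simp add: convex_interior)

text \<open>
  The relation \<open>R\<close> says where each point of the strands and of the filled boxes goes. If no two points
  moving along straight segments collide, every stage of the motion is an injective image of \<open>T\<close>; taking
  the filled boxes into \<open>R\<close> keeps strands out of the boxes. Compactness of the graph \<open>RS\<close> of the motion of the strands
  replaces a continuity hypothesis.
\<close>

lemma straight_isotopy:
  fixes R :: "(complex \<times> complex) set"
  assumes T: "planar_tangle T"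
    and types: "bots T' = bots T" "tops T' = tops T" "length (boxes T') = length (boxes T)"
      "\<And>i. i < length (boxes T) \<Longrightarrow> in_bot (boxes T' ! i) = in_bot (boxes T ! i) \<and> in_top (boxes T' ! i) = in_top (boxes T ! i)"
    and places: "\<And>i. i < length (boxes T) \<Longrightarrow> is_place (in_map (boxes T ! i)) \<and> is_place (in_map (boxes T' ! i))"
    and R: "compact RS" "RS \<subseteq> R" "strands T = fst ` RS" "strands T' = snd ` RS"
    and boxR: "\<And>i z. i < length (boxes T) \<Longrightarrow> z \<in> sq \<Longrightarrow> (in_map (boxes T ! i) z, in_map (boxes T' ! i) z) \<in> R"
    and nocol: "\<And>z z' w w' s. (z, z') \<in> R \<Longrightarrow> (w, w') \<in> R \<Longrightarrow> 0 \<le> s \<Longrightarrow> s \<le> 1 \<Longrightarrow>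
        (1 - of_real s) * z + of_real s * z' = (1 - of_real s) * w + of_real s * w' \<Longrightarrow> z = w \<and> z' = w'"
    and bd: "\<And>z z'. (z, z') \<in> R \<Longrightarrow> z = z' \<or> (z \<in> interior sq \<and> z' \<in> interior sq)"
  shows "planar_tangle T'" and "isotopic T T'"
proof -
  define h where "h z = (THE z'. (z, z') \<in> R)" for z
  have hR: "h z = z'" if "(z, z') \<in> R" for z z'
    unfolding h_def
  proof (rule the_equality)
    show "(z, z') \<in> R" by fact
    fix w assume "(z, w) \<in> R"
    then show "w = z'" using nocol[OF that, of z w 0] by simp
  qed
  define K where "K = fst ` R"
  have Rh: "(z, h z) \<in> R" if "z \<in> K" for z using that hR unfolding K_def by force
  define H where "H s z = (1 - of_real s) * z + of_real s * h z" for s :: real and z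
  have SK: "strands T \<subseteq> K" unfolding K_def R(3) using R(2) by blast
  have Hinj: "inj_on (H s) K" if "s \<in> {0..1}" for s
    using that nocol Rh unfolding H_def inj_on_def by (metis atLeastAtMost_iff)
  define F where "F s = \<lparr> bots = bots T, tops = tops T,
      boxes = map (\<lambda>i. (in_bot (boxes T ! i), in_top (boxes T ! i),
         \<lambda>z. (1 - of_real s) * in_map (boxes T ! i) z + of_real s * in_map (boxes T' ! i) z)) [0..<length (boxes T)],
      strands = H s ` strands T \<rparr>" for s :: real
  have lenF: "length (boxes (F s)) = length (boxes T)" for s unfolding F_def by simp
  have nthF: "boxes (F s) ! i = (in_bot (boxes T ! i), in_top (boxes T ! i),
         \<lambda>z. (1 - of_real s) * in_map (boxes T ! i) z + of_real s * in_map (boxes T' ! i) z)"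
    if "i < length (boxes T)" for s i
    using that unfolding F_def by simp
  have mapF: "in_map (boxes (F s) ! i) z = (1 - of_real s) * in_map (boxes T ! i) z + of_real s * in_map (boxes T' ! i) z"
    if "i < length (boxes T)" for s i z
    unfolding nthF[OF that] by (simp add: in_map_def)
  have hbox: "h (in_map (boxes T ! i) z) = in_map (boxes T' ! i) z" "in_map (boxes T ! i) z \<in> K"
    if "i < length (boxes T)" "z \<in> sq" for i z
    using boxR[OF that] hR unfolding K_def by force+
  have Hbox: "in_map (boxes (F s) ! i) z = H s (in_map (boxes T ! i) z)" if "i < length (boxes T)" "z \<in> sq" for s i z
    using mapF hbox that unfolding H_def by simp
  have regK: "in_region (boxes T ! i) \<subseteq> K" if "i < length (boxes T)" for i
    using hbox(2)[OF that] unfolding in_region_def by blast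
  have regF: "in_region (boxes (F s) ! i) = H s ` in_region (boxes T ! i)" if "i < length (boxes T)" for s i
    unfolding in_region_def using Hbox[OF that] by (auto simp: image_image intro!: image_cong)
  have marF: "in_marks (boxes (F s) ! i) = H s ` in_marks (boxes T ! i)" if "i < length (boxes T)" for s i
  proof -
    have "in_marks (boxes (F s) ! i) = (\<lambda>z. in_map (boxes (F s) ! i) z) ` marks (in_bot (boxes T ! i)) (in_top (boxes T ! i))"
      unfolding in_marks_def nthF[OF that] by (simp add: in_bot_def in_top_def)
    also have "\<dots> = H s ` in_marks (boxes T ! i)"
      unfolding in_marks_def image_image using Hbox[OF that] marks_sq by (intro image_cong) blast+
    finally show ?thesis .
  qed
  have Hfix: "H s z = z" if "z \<in> K" "z \<notin> interior sq" for s z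
    using bd[OF Rh[OF that(1)]] that unfolding H_def by (auto simp: algebra_simps)
  have Hint: "H s z \<in> interior sq" if z: "z \<in> K" "z \<in> interior sq" and s: "s \<in> {0..1}" for s z
  proof -
    have "h z \<in> interior sq" using bd[OF Rh[OF z(1)]] z(2) by metis
    then have "(1 - s) *\<^sub>R z + s *\<^sub>R h z \<in> interior sq"
      using convex_interior_sq z(2) s by (intro convexD) auto
    then show ?thesis unfolding H_def scaleR_conv_of_real by simp
  qed
  have Ksq: "z \<in> sq" if "z \<in> strands T" for z using that T unfolding planar_tangle_def by blast
  have H01: "H 0 z = z" "H 1 z = h z" for z unfolding H_def by simp_all
  have amK: "all_marks T \<subseteq> K" using all_marks_strands[OF T] SK by blast
  have amF: "all_marks (F s) = H s ` all_marks T" for s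
  proof -
    have "H s ` marks (bots T) (tops T) = marks (bots T) (tops T)"
    proof -
      have "H s z = z" if "z \<in> marks (bots T) (tops T)" for z
        using that amK marks_frontier[of "bots T" "tops T"] frontier_sq'
        by (intro Hfix) (auto simp: all_marks_def)
      then show ?thesis by simp
    qed
    moreover have "(\<Union>B\<in>set (boxes (F s)). in_marks B) = H s ` (\<Union>B\<in>set (boxes T). in_marks B)"
    proof -
      have U: "(\<Union>B\<in>set Bs. in_marks B) = (\<Union>i<length Bs. in_marks (Bs ! i))" for Bs
        by (auto simp: set_conv_nth) 
      show ?thesis unfolding U lenF image_UN using marF by simp
    qed
    ultimately show ?thesis unfolding all_marks_def image_Un by (simp add: F_def)
  qed
  have hcont: "continuous_on (strands T) h"
  proof (rule continuous_from_closed_graph)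
    show "compact (snd ` RS)" using R(1) by (intro compact_continuous_image continuous_intros)
    have im: "h z \<in> snd ` RS \<and> (z, h z) \<in> RS" if "z \<in> strands T" for z
    proof -
      from that obtain z' where "(z, z') \<in> RS" unfolding R(3) by force
      moreover from this have "h z = z'" using hR R(2) by blast
      ultimately show ?thesis by force
    qed
    then show "h \<in> strands T \<rightarrow> snd ` RS" by blast
    have "(\<lambda>x. (x, h x)) ` strands T = RS"
    proof
      show "(\<lambda>x. (x, h x)) ` strands T \<subseteq> RS" using im by blast
      show "RS \<subseteq> (\<lambda>x. (x, h x)) ` strands T"
      proof
        fix x assume x: "x \<in> RS"
        then have "h (fst x) = snd x" using hR[of "fst x" "snd x"] R(2) by auto
        then show "x \<in> (\<lambda>x. (x, h x)) ` strands T" using x unfolding R(3) by force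
      qed
    qed
    then show "closed ((\<lambda>x. (x, h x)) ` strands T)" using compact_imp_closed[OF R(1)] by simp
  qed
  have Hcont: "continuous_on (strands T) (H s)" for s
    unfolding H_def by (intro continuous_intros hcont)
  have planarF: "planar_tangle (F s)" if s: "s \<in> {0..1}" for s
    unfolding planar_tangle_def lenF
  proof (intro conjI ballI allI impI)
    fix B assume "B \<in> set (boxes (F s))"
    then obtain i where i: "i < length (boxes T)" "B = boxes (F s) ! i" unfolding in_set_conv_nth lenF by blast
    have "is_place (in_map (boxes T ! i))" "is_place (in_map (boxes T' ! i))" using places i by auto
    from is_place_interpolate[OF this] s have "is_place (in_map B)"
      unfolding i(2) nthF[OF i(1)] in_map_def by simp
    then show "orient_affine (in_map B)" by (rule orient_affine_place)
    have "in_region (boxes T ! i) \<subseteq> interior sq" using T i unfolding planar_tangle_def by simp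
    then show "in_region B \<subseteq> interior sq"
      unfolding i(2) regF[OF i(1)] using Hint s regK[OF i(1)] by blast
    have "strands T \<inter> in_region (boxes T ! i) = in_marks (boxes T ! i)"
      using T i unfolding planar_tangle_def by simp
    then show "strands (F s) \<inter> in_region B = in_marks B"
      unfolding i(2) regF[OF i(1)] marF[OF i(1)]
      using inj_on_image_Int[OF Hinj[OF s] SK regK[OF i(1)]] by (simp add: F_def)
  next
    fix i j assume ij: "i < length (boxes T)" "j < length (boxes T)" "i \<noteq> j"
    then have "in_region (boxes T ! i) \<inter> in_region (boxes T ! j) = {}"
      using T unfolding planar_tangle_def by simp
    then show "in_region (boxes (F s) ! i) \<inter> in_region (boxes (F s) ! j) = {}"
      unfolding regF[OF ij(1)] regF[OF ij(2)]
      using inj_on_image_Int[OF Hinj[OF s] regK[OF ij(1)] regK[OF ij(2)]] by simp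
  next
    have "H s z \<in> sq" if "z \<in> strands T" for z
    proof (cases "z \<in> interior sq")
      case True then show ?thesis using Hint SK that s interior_subset by blast
    next
      case False then show ?thesis using Hfix Ksq SK that by (metis subsetD)
    qed
    then show "strands (F s) \<subseteq> sq" unfolding F_def by auto
    have Hfr: "H s z \<in> frontier sq \<longleftrightarrow> z \<in> frontier sq" "z \<in> frontier sq \<Longrightarrow> H s z = z" if "z \<in> strands T" for z
    proof -
      have zK: "z \<in> K" "z \<in> sq" using that SK Ksq by auto
      show fx: "H s z = z" if "z \<in> frontier sq"
        using Hfix[OF zK(1)] that unfolding frontier_sq by simp
      have "z \<notin> interior sq" if "H s z \<in> frontier sq"
        using Hint[OF zK(1) _ s] that unfolding frontier_sq by blast
      then show "H s z \<in> frontier sq \<longleftrightarrow> z \<in> frontier sq"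
        using fx zK(2) unfolding frontier_sq by metis
    qed
    have "strands T \<inter> frontier sq = marks (bots T) (tops T)" using T unfolding planar_tangle_def by simp
    moreover have "H s ` strands T \<inter> frontier sq = strands T \<inter> frontier sq"
      using Hfr by (intro equalityI subsetI) (auto simp: image_iff, metis)
    ultimately show "strands (F s) \<inter> frontier sq = marks (bots (F s)) (tops (F s))"
      by (simp add: F_def)
    obtain S where S: "finite S" "disjoint S" "strands T = \<Union>S" "\<And>C. C \<in> S \<Longrightarrow> is_strand (all_marks T) C"
      using planar_tangle_strandsE[OF T] by blast
    show "\<exists>S. finite S \<and> disjoint S \<and> strands (F s) = \<Union> S \<and> (\<forall>C\<in>S. is_strand (all_marks (F s)) C)"
    proof (intro exI conjI ballI)
      show "finite ((\<lambda>C. H s ` C) ` S)" using S(1) by simp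
      show "strands (F s) = \<Union> ((\<lambda>C. H s ` C) ` S)" unfolding F_def using S(3) by auto
      show "disjoint ((\<lambda>C. H s ` C) ` S)"
      proof (rule pairwiseI)
        fix X Y assume "X \<in> (\<lambda>C. H s ` C) ` S" "Y \<in> (\<lambda>C. H s ` C) ` S" "X \<noteq> Y"
        then obtain C D where CD: "C \<in> S" "D \<in> S" "C \<noteq> D" "X = H s ` C" "Y = H s ` D" by blast
        have "C \<inter> D = {}" using CD S(2) unfolding disjoint_def by blast
        moreover have "C \<subseteq> K" "D \<subseteq> K" using CD(1,2) S(3) SK by blast+
        ultimately show "disjnt X Y" unfolding CD(4,5) disjnt_def
          using inj_on_image_Int[OF Hinj[OF s], of C D] by simp
      qed
      fix C assume "C \<in> (\<lambda>C. H s ` C) ` S"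
      then obtain D where D: "D \<in> S" "C = H s ` D" by blast
      have DS: "D \<subseteq> strands T" using D S(3) by blast
      show "is_strand (all_marks (F s)) C"
        unfolding amF D(2)
        by (rule is_strand_image[OF S(4)[OF D(1)] continuous_on_subset[OF Hcont DS]
              inj_on_subset[OF Hinj[OF s]]]) (use DS SK amK in blast)
    qed
  qed
  have box_eq: "(in_bot B, in_top B, in_map B) = B" for B
    by (simp add: in_bot_def in_top_def in_map_def)
  have F0: "F 0 = T"
  proof -
    have "boxes (F 0) = boxes T"
      by (rule nth_equalityI) (simp_all add: lenF nthF box_eq)
    moreover have "strands (F 0) = strands T" unfolding F_def using H01 by simp
    ultimately show ?thesis by (simp add: tangle.equality F_def)
  qed
  have F1: "F 1 = T'"
  proof -
    have "boxes (F 1) = boxes T'"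
    proof (rule nth_equalityI)
      show "length (boxes (F 1)) = length (boxes T')" using lenF types by simp
      fix i assume "i < length (boxes (F 1))"
      then have i: "i < length (boxes T)" using lenF by simp
      show "boxes (F 1) ! i = boxes T' ! i"
        unfolding nthF[OF i] using types(4)[OF i] box_eq[of "boxes T' ! i"] by simp
    qed
    moreover have "strands (F 1) = strands T'"
    proof -
      have "strands (F 1) = h ` fst ` RS" unfolding F_def using H01 R(3) by simp
      also have "\<dots> = snd ` RS" unfolding image_image
        using hR R(2) by (intro image_cong refl) (metis prod.collapse subsetD)
      finally show ?thesis using R(4) by simp
    qed
    ultimately show ?thesis using types by (simp add: tangle.equality F_def)
  qed
  show "planar_tangle T'" using planarF[of 1] F1 by simp
  show "isotopic T T'"
    unfolding isotopic_def
  proof (rule exI[of _ F], rule exI[of _ H], intro conjI ballI allI impI)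
    show "F 0 = T" "F 1 = T'" by (fact F0 F1)+
    show "H 0 z = z" for z by (rule H01)
    fix s :: real assume s: "s \<in> {0..1}"
    show "planar_tangle (F s)" using planarF s .
    show "bots (F s) = bots T" "tops (F s) = tops T" "strands (F s) = H s ` strands T"
      unfolding F_def by simp_all
    show "map in_bot (boxes (F s)) = map in_bot (boxes T)" "map in_top (boxes (F s)) = map in_top (boxes T)"
      by (rule nth_equalityI; simp add: lenF nthF in_bot_def in_top_def)+
    show "inj_on (H s) (strands T)" using inj_on_subset[OF Hinj[OF s] SK] .
  next
    show "continuous_on ({0..1} \<times> strands T) (\<lambda>(s, z). H s z)"
      unfolding H_def case_prod_beta
      by (intro continuous_intros continuous_on_compose2[OF hcont continuous_on_snd[OF continuous_on_id]]) auto
    fix i assume i: "i < length (boxes T)"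
    have "continuous_on sq (in_map (boxes T ! i))" "continuous_on sq (in_map (boxes T' ! i))"
      using places[OF i] is_place_continuous by blast+
    then have "continuous_on ({0..1::real} \<times> sq) (\<lambda>p. in_map (boxes T ! i) (snd p))"
      "continuous_on ({0..1::real} \<times> sq) (\<lambda>p. in_map (boxes T' ! i) (snd p))"
      by (auto intro!: continuous_on_compose2[OF _ continuous_on_snd[OF continuous_on_id]])
    then show "continuous_on ({0..1} \<times> sq) (\<lambda>(s, z). in_map (boxes (F s) ! i) z)"
      unfolding mapF[OF i] case_prod_beta by (intro continuous_intros)
  qed
qed

section \<open>Layered tangles\<close>

text \<open>
  An item is a segment of a strand (\<open>None\<close>) or a labelled box of a given type. It has an
  \<open>x\<close>-coordinate at its top, one at its bottom, and a half-width, which is \<open>0\<close> for segments. A layer has an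
  upper and a lower height and a row of items.
\<close>

type_synonym 'a item = "(nat \<times> nat \<times> 'a) option \<times> real \<times> real \<times> real"
type_synonym 'a layer = "real \<times> real \<times> 'a item list"

fun item_tops :: "'a item \<Rightarrow> real list" where
  "item_tops (None, a, b, w) = [a]"
| "item_tops (Some (k, l, x), a, b, w) = map (\<lambda>j. a + w * xpos l j) [0..<l]"

fun item_bots :: "'a item \<Rightarrow> real list" where
  "item_bots (None, a, b, w) = [b]"
| "item_bots (Some (k, l, x), a, b, w) = map (\<lambda>j. b + w * xpos k j) [0..<k]"

fun good_item :: "'a item \<Rightarrow> bool" where
  "good_item (lab, a, b, w) \<longleftrightarrow> (case lab of None \<Rightarrow> w = 0 | Some _ \<Rightarrow> 0 < w \<and> a = b) \<and>
     - 1 < a - w \<and> a + w < 1 \<and> - 1 < b - w \<and> b + w < 1"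

fun left_of :: "'a item \<Rightarrow> 'a item \<Rightarrow> bool" where
  "left_of (lab, a, b, w) (lab', a', b', w') \<longleftrightarrow> a + w < a' - w' \<and> b + w < b' - w'"

definition only_strands :: "'a item list \<Rightarrow> bool" where
  "only_strands I \<longleftrightarrow> (\<forall>it\<in>set I. fst it = None)"

fun good_layer :: "'a layer \<Rightarrow> bool" where
  "good_layer (u, d, I) \<longleftrightarrow> d < u \<and> (\<forall>it\<in>set I. good_item it) \<and> sorted_wrt left_of I"

text \<open>Boxes of adjacent layers could touch, so one of the two layers consists of segments.\<close>

fun joins :: "'a layer \<Rightarrow> 'a layer \<Rightarrow> bool" where
  "joins (u, d, I) (u', d', I') \<longleftrightarrow> d = u' \<and> concat (map item_bots I) = concat (map item_tops I') \<and>
     (only_strands I \<or> only_strands I')"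

abbreviation mark_xs :: "nat \<Rightarrow> real list" where "mark_xs k \<equiv> map (xpos k) [0..<k]"

fun starts_at :: "nat \<Rightarrow> 'a layer \<Rightarrow> bool" where
  "starts_at t (u, d, I) \<longleftrightarrow> u = 1 \<and> only_strands I \<and> concat (map item_tops I) = mark_xs t"

fun ends_at :: "nat \<Rightarrow> 'a layer \<Rightarrow> bool" where
  "ends_at b (u, d, I) \<longleftrightarrow> d = - 1 \<and> only_strands I \<and> concat (map item_bots I) = mark_xs b"

definition good :: "nat \<Rightarrow> nat \<Rightarrow> 'a layer list \<Rightarrow> bool" where
  "good b t D \<longleftrightarrow> D \<noteq> [] \<and> (\<forall>L\<in>set D. good_layer L) \<and> successively joins D \<and>
     starts_at t (hd D) \<and> ends_at b (last D)"

fun item_box :: "real \<Rightarrow> real \<Rightarrow> 'a item \<Rightarrow> inbox list" where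
  "item_box u d (None, a, b, w) = []"
| "item_box u d (Some (k, l, x), a, b, w) = [(k, l, place (Complex a ((u + d) / 2)) w ((u - d) / 2))]"

fun item_strand :: "real \<Rightarrow> real \<Rightarrow> 'a item \<Rightarrow> complex set" where
  "item_strand u d (None, a, b, w) = closed_segment (Complex a u) (Complex b d)"
| "item_strand u d (Some y, a, b, w) = {}"

fun layer_boxes :: "'a layer \<Rightarrow> inbox list" where
  "layer_boxes (u, d, I) = concat (map (item_box u d) I)"

fun layer_strands :: "'a layer \<Rightarrow> complex set" where
  "layer_strands (u, d, I) = (\<Union>it\<in>set I. item_strand u d it)"

definition layered :: "nat \<Rightarrow> nat \<Rightarrow> 'a layer list \<Rightarrow> tangle" where
  "layered b t D = \<lparr> bots = b, tops = t, boxes = concat (map layer_boxes D), strands = (\<Union>L\<in>set D. layer_strands L) \<rparr>"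

text \<open>Everything about a layered diagram except the coordinates.\<close>

definition shape :: "'a layer list \<Rightarrow> (nat \<times> nat \<times> 'a) option list list" where
  "shape D = map (\<lambda>(u, d, I). map fst I) D"

text \<open>
  The point of an item at relative depth \<open>\<theta>\<close>, from \<open>0\<close> at the top of the layer to \<open>1\<close> at the bottom, and at
  relative horizontal position \<open>\<sigma>\<close> between \<open>-1\<close> and \<open>1\<close>.
\<close>

fun item_x :: "real \<Rightarrow> 'a item \<Rightarrow> real \<Rightarrow> real" where
  "item_x \<theta> (lab, a, b, w) \<sigma> = (1 - \<theta>) * a + \<theta> * b + \<sigma> * w"

definition level :: "real \<Rightarrow> 'a layer \<Rightarrow> real" where
  "level \<theta> L = (1 - \<theta>) * fst L + \<theta> * fst (snd L)"

abbreviation items :: "'a layer \<Rightarrow> 'a item list" where "items L \<equiv> snd (snd L)"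

definition slice_pairs :: "real \<Rightarrow> 'a item list \<Rightarrow> 'a item list \<Rightarrow> (real \<times> real) set" where
  "slice_pairs \<theta> I I' = {(item_x \<theta> it \<sigma>, item_x \<theta> it' \<sigma>) | it it' \<sigma>. (it, it') \<in> set (zip I I') \<and> - 1 \<le> \<sigma> \<and> \<sigma> \<le> 1}"

definition order_preserving :: "(real \<times> real) set \<Rightarrow> bool" where
  "order_preserving X \<longleftrightarrow> (\<forall>x x' z z'. (x, x') \<in> X \<longrightarrow> (z, z') \<in> X \<longrightarrow> (x < z \<longrightarrow> x' < z') \<and> (x = z \<longrightarrow> x' = z'))"

lemma item_x_le:
  assumes "good_item it" "0 \<le> \<theta>" "\<theta> \<le> 1" "-1 \<le> \<sigma>" "\<sigma> \<le> 1"
  shows "item_x \<theta> it (-1) \<le> item_x \<theta> it \<sigma>" "item_x \<theta> it \<sigma> \<le> item_x \<theta> it 1"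
proof -
  obtain lab a b w where it: "it = (lab, a, b, w)" by (cases it) auto
  have "0 \<le> w" using assms(1) unfolding it by (cases lab) auto
  then have "\<sigma> * w \<le> 1 * w" "(-1) * w \<le> \<sigma> * w"
    using assms(4,5) mult_right_mono[of \<sigma> 1 w] mult_right_mono[of "-1" \<sigma> w] by simp_all
  then show "item_x \<theta> it (-1) \<le> item_x \<theta> it \<sigma>" "item_x \<theta> it \<sigma> \<le> item_x \<theta> it 1"
    unfolding it by simp_all
qed

lemma convex_less: "(x::real) < x' \<Longrightarrow> y < y' \<Longrightarrow> 0 \<le> \<theta> \<Longrightarrow> \<theta> \<le> 1 \<Longrightarrow> (1 - \<theta>) * x + \<theta> * y < (1 - \<theta>) * x' + \<theta> * y'"
  by (cases "\<theta> = 0") (auto intro!: add_le_less_mono mult_left_mono)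

lemma item_x_less:
  assumes "left_of it jt" "good_item it" "good_item jt" "0 \<le> \<theta>" "\<theta> \<le> 1" "-1 \<le> \<sigma>" "\<sigma> \<le> 1" "-1 \<le> \<sigma>'" "\<sigma>' \<le> 1"
  shows "item_x \<theta> it \<sigma> < item_x \<theta> jt \<sigma>'"
proof -
  obtain lab a b w where it: "it = (lab, a, b, w)" by (cases it) auto
  obtain lab' a' b' w' where jt: "jt = (lab', a', b', w')" by (cases jt) auto
  have "(1 - \<theta>) * (a + w) + \<theta> * (b + w) < (1 - \<theta>) * (a' - w') + \<theta> * (b' - w')"
    using assms unfolding it jt by (intro convex_less) auto
  then have "item_x \<theta> it 1 < item_x \<theta> jt (-1)" unfolding it jt by (simp add: algebra_simps)
  then show ?thesis using item_x_le[OF assms(2,4-7)] item_x_le[OF assms(3,4,5,8,9)] by linarith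
qed

lemma item_x_bounds:
  assumes "good_item it" "0 \<le> \<theta>" "\<theta> \<le> 1" "-1 \<le> \<sigma>" "\<sigma> \<le> 1"
  shows "\<bar>item_x \<theta> it \<sigma>\<bar> < 1"
proof -
  obtain lab a b w where it: "it = (lab, a, b, w)" by (cases it) auto
  have "(1 - \<theta>) * (a + w) + \<theta> * (b + w) < (1 - \<theta>) * 1 + \<theta> * 1"
    "(1 - \<theta>) * (-1) + \<theta> * (-1) < (1 - \<theta>) * (a - w) + \<theta> * (b - w)"
    using assms unfolding it by (intro convex_less; auto)+
  then have "item_x \<theta> it 1 < 1" "-1 < item_x \<theta> it (-1)" unfolding it by (simp_all add: algebra_simps)
  then show ?thesis using item_x_le[OF assms] by linarith
qed

lemma slE:
  assumes "(x, x') \<in> slice_pairs \<theta> I I'" "length I' = length I"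
  obtains p \<sigma> where "p < length I" "x = item_x \<theta> (I ! p) \<sigma>" "x' = item_x \<theta> (I' ! p) \<sigma>" "-1 \<le> \<sigma>" "\<sigma> \<le> 1"
proof -
  obtain it it' \<sigma> where s: "(it, it') \<in> set (zip I I')" "x = item_x \<theta> it \<sigma>" "x' = item_x \<theta> it' \<sigma>" "-1 \<le> \<sigma>" "\<sigma> \<le> 1"
    using assms(1) unfolding slice_pairs_def by blast
  obtain n where "n < length I" "it = I ! n" "it' = I' ! n"
    using s(1) assms(2) unfolding in_set_zip by auto
  then show ?thesis using that s by blast
qed

lemma slI: "(it, it') \<in> set (zip I I') \<Longrightarrow> \<bar>\<sigma>\<bar> \<le> 1 \<Longrightarrow> (item_x \<theta> it \<sigma>, item_x \<theta> it' \<sigma>) \<in> slice_pairs \<theta> I I'"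
  unfolding slice_pairs_def by (rule CollectI, rule exI[of _ it], rule exI[of _ it'], rule exI[of _ \<sigma>]) auto

lemma slice_pairs_mono:
  assumes "\<forall>it\<in>set I. good_item it" "sorted_wrt left_of I" "\<forall>it\<in>set I'. good_item it" "sorted_wrt left_of I'"
    and "map fst I = map fst I'" "0 \<le> \<theta>" "\<theta> \<le> 1"
  shows "order_preserving (slice_pairs \<theta> I I')"
  unfolding order_preserving_def
proof (intro allI impI)
  fix x x' z z' assume "(x, x') \<in> slice_pairs \<theta> I I'" "(z, z') \<in> slice_pairs \<theta> I I'"
  have len: "length I' = length I" using assms(5) by (metis length_map)
  obtain p \<sigma> where p: "p < length I" "x = item_x \<theta> (I ! p) \<sigma>" "x' = item_x \<theta> (I' ! p) \<sigma>" "-1 \<le> \<sigma>" "\<sigma> \<le> 1"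
    using slE[OF \<open>(x, x') \<in> slice_pairs \<theta> I I'\<close> len] .
  obtain q \<tau> where q: "q < length I" "z = item_x \<theta> (I ! q) \<tau>" "z' = item_x \<theta> (I' ! q) \<tau>" "-1 \<le> \<tau>" "\<tau> \<le> 1"
    using slE[OF \<open>(z, z') \<in> slice_pairs \<theta> I I'\<close> len] .
  have gi: "good_item (I ! p)" "good_item (I' ! p)" "good_item (I ! q)" "good_item (I' ! q)"
    using assms(1,3) p q len by auto
  consider "p < q" | "q < p" | "p = q" by linarith
  then show "(x < z \<longrightarrow> x' < z') \<and> (x = z \<longrightarrow> x' = z')"
  proof cases
    case 1
    then have "left_of (I ! p) (I ! q)" "left_of (I' ! p) (I' ! q)"
      using assms(2,4) q len unfolding sorted_wrt_iff_nth_less by auto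
    then show ?thesis using item_x_less gi assms(6,7) p q by (metis less_irrefl)
  next
    case 2
    then have "left_of (I ! q) (I ! p)" "left_of (I' ! q) (I' ! p)"
      using assms(2,4) p len unfolding sorted_wrt_iff_nth_less by auto
    then have "z < x" using item_x_less gi assms(6,7) p q by metis
    then show ?thesis by simp
  next
    case 3
    obtain lab a b w where it: "I ! p = (lab, a, b, w)" by (cases "I ! p") auto
    obtain lab' a' b' w' where it': "I' ! p = (lab', a', b', w')" by (cases "I' ! p") auto
    have "fst (I ! p) = fst (I' ! p)" using assms(5) p(1) len by (metis nth_map)
    then have lab: "lab' = lab" using it it' by simp
    show ?thesis
    proof (cases lab)
      case None
      then show ?thesis using p q gi(1,2) 3 it it' lab by simp
    next
      case (Some y)
      then have "0 < w" "0 < w'" using gi(1,2) it it' lab by auto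
      then show ?thesis using p q 3 it it' by simp
    qed
  qed
qed

lemma zip_concat_eq:
  assumes "map fst I = map fst I'"
  shows "set (zip (concat (map item_tops I)) (concat (map item_tops I'))) =
      (\<Union>(it, it')\<in>set (zip I I'). set (zip (item_tops it) (item_tops it')))"
    and "set (zip (concat (map item_bots I)) (concat (map item_bots I'))) =
      (\<Union>(it, it')\<in>set (zip I I'). set (zip (item_bots it) (item_bots it')))"
proof -
  have len: "length I = length I'" using assms by (metis length_map)
  have "map fst I = map fst I' \<Longrightarrow>
    set (zip (concat (map item_tops I)) (concat (map item_tops I'))) =
      (\<Union>(it, it')\<in>set (zip I I'). set (zip (item_tops it) (item_tops it'))) \<and>
    set (zip (concat (map item_bots I)) (concat (map item_bots I'))) =
      (\<Union>(it, it')\<in>set (zip I I'). set (zip (item_bots it) (item_bots it')))"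
    using len
  proof (induction I I' rule: list_induct2)
    case Nil then show ?case by simp
  next
    case (Cons it I it' I')
    obtain lab a b w where it: "it = (lab, a, b, w)" by (cases it) auto
    obtain a' b' w' where it': "it' = (lab, a', b', w')" using Cons.prems it by (cases it') auto
    have "length (item_tops it) = length (item_tops it')" "length (item_bots it) = length (item_bots it')"
      unfolding it it' by (cases lab; auto)+
    then show ?case using Cons.IH Cons.prems by (simp add: zip_append)
  qed
  then show "set (zip (concat (map item_tops I)) (concat (map item_tops I'))) =
      (\<Union>(it, it')\<in>set (zip I I'). set (zip (item_tops it) (item_tops it')))"
    "set (zip (concat (map item_bots I)) (concat (map item_bots I'))) =
      (\<Union>(it, it')\<in>set (zip I I'). set (zip (item_bots it) (item_bots it')))"
    using assms by blast+
qed

lemma zip_map_upt: "set (zip (map f [0..<n]) (map g [0..<n])) = {(f j, g j) | j. j < n}"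
  by (auto simp: zip_map_map zip_same_conv_map)

lemma zip_fst_eq:
  assumes "(it, it') \<in> set (zip I I')" "map fst I = map fst I'" shows "fst it = fst it'"
proof -
  obtain n where n: "n < length I" "n < length I'" "it = I ! n" "it' = I' ! n"
    using assms(1) unfolding set_zip by auto
  have "map fst I ! n = map fst I' ! n" using assms(2) by simp
  then show ?thesis using n by simp
qed

lemma item_marks_slice_pairs:
  assumes "(it, it') \<in> set (zip I I')" "map fst I = map fst I'" "good_item it" "good_item it'"
  shows "set (zip (item_tops it) (item_tops it')) \<subseteq> slice_pairs 0 I I'" "set (zip (item_bots it) (item_bots it')) \<subseteq> slice_pairs 1 I I'"
proof -
  obtain lab a b w where it: "it = (lab, a, b, w)" by (cases it) auto
  have "fst it = fst it'" by (rule zip_fst_eq[OF assms(1,2)])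
  then obtain a' b' w' where it': "it' = (lab, a', b', w')" using it by (cases it') auto
  have xb: "\<bar>xpos l j\<bar> \<le> 1" if "j < l" for l j using xpos_bounds[OF that] by linarith
  have mem: "(item_x \<theta> it \<sigma>, item_x \<theta> it' \<sigma>) \<in> slice_pairs \<theta> I I'" if "\<bar>\<sigma>\<bar> \<le> 1" for \<theta> \<sigma>
    by (rule slI[OF assms(1) that])
  have mem0: "(a + w * \<sigma>, a' + w' * \<sigma>) \<in> slice_pairs 0 I I'" "(b + w * \<sigma>, b' + w' * \<sigma>) \<in> slice_pairs 1 I I'" if "\<bar>\<sigma>\<bar> \<le> 1" for \<sigma>
    using mem[OF that, of 0] mem[OF that, of 1] unfolding it it' by (simp_all add: mult.commute)
  show "set (zip (item_tops it) (item_tops it')) \<subseteq> slice_pairs 0 I I'"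
  proof (cases lab)
    case None
    then show ?thesis using mem0(1)[of 0] unfolding it it' by simp
  next
    case (Some y)
    obtain k l v where y: "y = (k, l, v)" by (cases y) auto
    show ?thesis unfolding it it' Some y item_tops.simps zip_map_upt
      using mem0(1) xb by auto
  qed
  show "set (zip (item_bots it) (item_bots it')) \<subseteq> slice_pairs 1 I I'"
  proof (cases lab)
    case None
    then show ?thesis using mem0(2)[of 0] unfolding it it' by simp
  next
    case (Some y)
    obtain k l v where y: "y = (k, l, v)" by (cases y) auto
    show ?thesis unfolding it it' Some y item_bots.simps zip_map_upt
      using mem0(2) xb by auto
  qed
qed

lemma marks_slice_pairs:
  assumes "map fst I = map fst I'" "\<forall>it\<in>set I. good_item it" "\<forall>it\<in>set I'. good_item it"
  shows "set (zip (concat (map item_tops I)) (concat (map item_tops I'))) \<subseteq> slice_pairs 0 I I'"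
    and "set (zip (concat (map item_bots I)) (concat (map item_bots I'))) \<subseteq> slice_pairs 1 I I'"
proof -
  have "good_item it" "good_item it'" if "(it, it') \<in> set (zip I I')" for it it'
    using set_zip_leftD[OF that] set_zip_rightD[OF that] assms(2,3) by blast+
  then have *: "set (zip (item_tops it) (item_tops it')) \<subseteq> slice_pairs 0 I I'" "set (zip (item_bots it) (item_bots it')) \<subseteq> slice_pairs 1 I I'"
    if "(it, it') \<in> set (zip I I')" for it it'
    using item_marks_slice_pairs[OF that assms(1)] that by blast+
  show "set (zip (concat (map item_tops I)) (concat (map item_tops I'))) \<subseteq> slice_pairs 0 I I'"
    unfolding zip_concat_eq[OF assms(1)] using *(1) by (intro UN_least) (simp add: case_prod_beta)
  show "set (zip (concat (map item_bots I)) (concat (map item_bots I'))) \<subseteq> slice_pairs 1 I I'"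
    unfolding zip_concat_eq[OF assms(1)] using *(2) by (intro UN_least) (simp add: case_prod_beta)
qed

lemma slice_pairs_only_strands:
  assumes "map fst I = map fst I'" "\<forall>it\<in>set I. good_item it" "\<forall>it\<in>set I'. good_item it" "only_strands I"
  shows "slice_pairs 0 I I' = set (zip (concat (map item_tops I)) (concat (map item_tops I')))"
    and "slice_pairs 1 I I' = set (zip (concat (map item_bots I)) (concat (map item_bots I')))"
proof -
  have *: "(item_x 0 it \<sigma>, item_x 0 it' \<sigma>) \<in> set (zip (item_tops it) (item_tops it'))"
    "(item_x 1 it \<sigma>, item_x 1 it' \<sigma>) \<in> set (zip (item_bots it) (item_bots it'))" if m: "(it, it') \<in> set (zip I I')" for it it' \<sigma>
  proof -
    have "fst it = fst it'" by (rule zip_fst_eq[OF m assms(1)])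
    moreover have "fst it = None" using assms(4) m unfolding only_strands_def by (metis set_zip_leftD)
    moreover have "good_item it" "good_item it'" using m assms(2,3) by (metis set_zip_leftD set_zip_rightD)+
    ultimately show "(item_x 0 it \<sigma>, item_x 0 it' \<sigma>) \<in> set (zip (item_tops it) (item_tops it'))"
      "(item_x 1 it \<sigma>, item_x 1 it' \<sigma>) \<in> set (zip (item_bots it) (item_bots it'))"
      by (cases it; cases it'; simp)+
  qed
  show "slice_pairs 0 I I' = set (zip (concat (map item_tops I)) (concat (map item_tops I')))"
    by (rule equalityI[OF _ marks_slice_pairs(1)[OF assms(1-3)]]) (use *(1) in \<open>auto simp: slice_pairs_def zip_concat_eq[OF assms(1)]\<close>)
  show "slice_pairs 1 I I' = set (zip (concat (map item_bots I)) (concat (map item_bots I')))"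
    by (rule equalityI[OF _ marks_slice_pairs(2)[OF assms(1-3)]]) (use *(2) in \<open>auto simp: slice_pairs_def zip_concat_eq[OF assms(1)]\<close>)
qed

lemma good_nth:
  assumes "good b t D" "i < length D"
  shows "good_layer (D ! i)" "\<forall>it\<in>set (items (D ! i)). good_item it" "sorted_wrt left_of (items (D ! i))"
    "fst (snd (D ! i)) < fst (D ! i)"
proof -
  show g: "good_layer (D ! i)" using assms unfolding good_def by auto
  obtain u d I where L: "D ! i = (u, d, I)" by (cases "D ! i") auto
  show "\<forall>it\<in>set (items (D ! i)). good_item it" "sorted_wrt left_of (items (D ! i))" "fst (snd (D ! i)) < fst (D ! i)"
    using g unfolding L by simp_all
qed

lemma good_joins: "good b t D \<Longrightarrow> Suc i < length D \<Longrightarrow> joins (D ! i) (D ! Suc i)"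
  unfolding good_def by (metis successively_conv_nth)

lemma joins_iff: "joins L L' \<longleftrightarrow> fst (snd L) = fst L' \<and> concat (map item_bots (items L)) = concat (map item_tops (items L')) \<and>
     (only_strands (items L) \<or> only_strands (items L'))"
  by (cases L; cases L') auto

lemma good_heights:
  assumes "good b t D" "i < j" "j < length D"
  shows "fst (D ! j) \<le> fst (snd (D ! i))" "j \<noteq> Suc i \<Longrightarrow> fst (D ! j) < fst (snd (D ! i))"
proof -
  have "fst (D ! j) \<le> fst (snd (D ! i)) \<and> (j \<noteq> Suc i \<longrightarrow> fst (D ! j) < fst (snd (D ! i)))"
    using assms(2,3)
  proof (induction j)
    case 0 then show ?case by simp
  next
    case (Suc j)
    have e: "fst (snd (D ! j)) = fst (D ! Suc j)" using good_joins[OF assms(1)] Suc.prems joins_iff by blast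
    show ?case
    proof (cases "i = j")
      case True then show ?thesis using e by simp
    next
      case False
      then have "fst (D ! j) \<le> fst (snd (D ! i))" using Suc by simp
      moreover have "fst (snd (D ! j)) < fst (D ! j)" using good_nth(4)[OF assms(1)] Suc.prems by simp
      ultimately show ?thesis using e by simp
    qed
  qed
  then show "fst (D ! j) \<le> fst (snd (D ! i))" "j \<noteq> Suc i \<Longrightarrow> fst (D ! j) < fst (snd (D ! i))" by auto
qed

lemma level_bounds:
  assumes "good_layer L" "0 \<le> \<theta>" "\<theta> \<le> 1"
  shows "fst (snd L) \<le> level \<theta> L" "level \<theta> L \<le> fst L" "\<theta> \<noteq> 1 \<Longrightarrow> fst (snd L) < level \<theta> L" "\<theta> \<noteq> 0 \<Longrightarrow> level \<theta> L < fst L"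
proof -
  obtain u d I where L: "L = (u, d, I)" by (cases L) auto
  have ud: "d < u" using assms(1) unfolding L by simp
  have e: "level \<theta> L = d + (1 - \<theta>) * (u - d)" "level \<theta> L = u - \<theta> * (u - d)"
    unfolding L level_def by (simp_all add: algebra_simps)
  have "0 \<le> (1 - \<theta>) * (u - d)" "0 \<le> \<theta> * (u - d)" using ud assms by simp_all
  then show "fst (snd L) \<le> level \<theta> L" "level \<theta> L \<le> fst L" using e unfolding L by simp_all
  show "fst (snd L) < level \<theta> L" if "\<theta> \<noteq> 1" using e(1) ud assms that unfolding L by simp
  show "level \<theta> L < fst L" if "\<theta> \<noteq> 0" using e(2) ud assms that unfolding L by simp
qed

lemma level_less: "good_layer L \<Longrightarrow> \<theta> < \<eta> \<Longrightarrow> level \<eta> L < level \<theta> L"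
proof -
  assume g: "good_layer L" and t: "\<theta> < \<eta>"
  obtain u d I where L: "L = (u, d, I)" by (cases L) auto
  have "level \<theta> L - level \<eta> L = (\<eta> - \<theta>) * (u - d)" unfolding L level_def by (simp add: algebra_simps)
  also have "\<dots> > 0" using g t unfolding L by simp
  finally show ?thesis by simp
qed

lemma shape_nth: "shape D = shape D' \<Longrightarrow> i < length D \<Longrightarrow> length D' = length D \<and> map fst (items (D ! i)) = map fst (items (D' ! i))"
proof -
  assume t: "shape D = shape D'" and i: "i < length D"
  have l: "length D' = length D" using arg_cong[OF t, of length] unfolding shape_def by simp
  have "shape D ! i = shape D' ! i" using t by simp
  then show ?thesis using i l unfolding shape_def by (simp add: case_prod_beta)
qed

text \<open>
  Two diagrams of the same shape have corresponding items. Points are matched if they have the same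
  relative position in corresponding items; boxes take part with all their points.
\<close>

definition matched :: "'a layer list \<Rightarrow> 'a layer list \<Rightarrow> (complex \<times> complex) set" where
  "matched D D' = {(Complex x (level \<theta> (D ! i)), Complex x' (level \<theta> (D' ! i))) | x x' \<theta> i.
     i < length D \<and> 0 \<le> \<theta> \<and> \<theta> \<le> 1 \<and> (x, x') \<in> slice_pairs \<theta> (items (D ! i)) (items (D' ! i))}"

text \<open>
  The only heights that belong to two layers are those between adjacent layers, one of which has
  only strands there. Its points are marks, and these agree with the marks of the other layer.
\<close>

lemma matched_ordered:
  assumes D: "good b t D" and D': "good b t D'" and shape: "shape D = shape D'"
    and i: "i < length D" "0 \<le> \<theta>" "\<theta> \<le> 1" "(x, x') \<in> slice_pairs \<theta> (items (D ! i)) (items (D' ! i))"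
    and j: "j < length D" "0 \<le> \<eta>" "\<eta> \<le> 1" "(z, z') \<in> slice_pairs \<eta> (items (D ! j)) (items (D' ! j))"
    and ij: "i < j \<or> i = j \<and> \<theta> \<le> \<eta>"
  shows "level \<eta> (D ! j) < level \<theta> (D ! i) \<and> level \<eta> (D' ! j) < level \<theta> (D' ! i) \<or>
     level \<eta> (D ! j) = level \<theta> (D ! i) \<and> level \<eta> (D' ! j) = level \<theta> (D' ! i) \<and>
     (x < z \<longrightarrow> x' < z') \<and> (x = z \<longrightarrow> x' = z') \<and> (z < x \<longrightarrow> z' < x')"
proof -
  have len: "length D' = length D" using shape_nth[OF shape i(1)] by simp
  note tyi = shape_nth[OF shape i(1), THEN conjunct2] and tyj = shape_nth[OF shape j(1), THEN conjunct2]
  have i': "i < length D'" and j': "j < length D'" using i j len by simp_all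
  note gi = good_nth[OF D i(1)] and gi' = good_nth[OF D' i']
  note gj = good_nth[OF D j(1)] and gj' = good_nth[OF D' j']
  have moni: "order_preserving (slice_pairs \<theta> (items (D ! i)) (items (D' ! i)))" if "0 \<le> \<theta>" "\<theta> \<le> 1" for \<theta>
    by (rule slice_pairs_mono[OF gi(2,3) gi'(2,3) tyi that])
  have monj: "order_preserving (slice_pairs \<theta> (items (D ! j)) (items (D' ! j)))" if "0 \<le> \<theta>" "\<theta> \<le> 1" for \<theta>
    by (rule slice_pairs_mono[OF gj(2,3) gj'(2,3) tyj that])
  show ?thesis
  proof (cases "i = j")
    case True
    then have "\<theta> < \<eta> \<or> \<theta> = \<eta>" using ij by auto
    then show ?thesis
    proof
      assume "\<theta> < \<eta>" then show ?thesis using level_less gi(1) gi'(1) True by blast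
    next
      assume "\<theta> = \<eta>"
      then show ?thesis using True i j moni[OF i(2,3)] unfolding order_preserving_def by blast
    qed
  next
    case False
    then have lt: "i < j" using ij by simp
    note h = good_heights[OF D lt j(1)] and h' = good_heights[OF D' lt j']
    note b = level_bounds[OF gi(1) i(2,3)] and b' = level_bounds[OF gi'(1) i(2,3)]
    note c = level_bounds[OF gj(1) j(2,3)] and c' = level_bounds[OF gj'(1) j(2,3)]
    show ?thesis
    proof (cases "j = Suc i \<and> \<theta> = 1 \<and> \<eta> = 0")
      case False
      then have "level \<eta> (D ! j) < level \<theta> (D ! i)" using h b c by fastforce
      moreover have "level \<eta> (D' ! j) < level \<theta> (D' ! i)" using False h' b' c' by fastforce
      ultimately show ?thesis by blast
    next
      case True
      have jo: "joins (D ! i) (D ! j)" "joins (D' ! i) (D' ! j)"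
        using good_joins[OF D] good_joins[OF D'] True j(1) j' by auto
      have e: "level \<eta> (D ! j) = level \<theta> (D ! i)" "level \<eta> (D' ! j) = level \<theta> (D' ! i)"
        using jo True unfolding joins_iff level_def by simp_all
      let ?X = "slice_pairs 1 (items (D ! i)) (items (D' ! i))" and ?Y = "slice_pairs 0 (items (D ! j)) (items (D' ! j))"
      have "?X \<subseteq> ?Y \<or> ?Y \<subseteq> ?X"
      proof -
        have "only_strands (items (D ! i)) \<or> only_strands (items (D ! j))" using jo(1) joins_iff by blast
        then show ?thesis
        proof
          assume "only_strands (items (D ! i))"
          then have "?X = set (zip (concat (map item_bots (items (D ! i)))) (concat (map item_bots (items (D' ! i)))))"
            using slice_pairs_only_strands(2)[OF tyi gi(2) gi'(2)] by blast
          also have "\<dots> \<subseteq> ?Y" using marks_slice_pairs(1)[OF tyj gj(2) gj'(2)] jo unfolding joins_iff by simp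
          finally show ?thesis by blast
        next
          assume "only_strands (items (D ! j))"
          then have "?Y = set (zip (concat (map item_tops (items (D ! j)))) (concat (map item_tops (items (D' ! j)))))"
            using slice_pairs_only_strands(1)[OF tyj gj(2) gj'(2)] by blast
          also have "\<dots> \<subseteq> ?X" using marks_slice_pairs(2)[OF tyi gi(2) gi'(2)] jo unfolding joins_iff by simp
          finally show ?thesis by blast
        qed
      qed
      then obtain X where X: "order_preserving X" "(x, x') \<in> X" "(z, z') \<in> X"
        using moni[of 1] monj[of 0] i(4) j(4) True by auto
      then show ?thesis using e unfolding order_preserving_def by blast
    qed
  qed
qed

lemma matched_lex:
  assumes D: "good b t D" and D': "good b t D'" and shape: "shape D = shape D'"
    and "(z, z') \<in> matched D D'" "(w, w') \<in> matched D D'"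
  shows "Im z < Im w \<Longrightarrow> Im z' < Im w'" "Im z = Im w \<Longrightarrow> Im z' = Im w'"
    "Im z = Im w \<Longrightarrow> Re z < Re w \<Longrightarrow> Re z' < Re w'" "Im z = Im w \<Longrightarrow> Re z = Re w \<Longrightarrow> Re z' = Re w'"
proof -
  obtain x x' \<theta> i where z: "z = Complex x (level \<theta> (D ! i))" "z' = Complex x' (level \<theta> (D' ! i))"
    and i: "i < length D" "0 \<le> \<theta>" "\<theta> \<le> 1" "(x, x') \<in> slice_pairs \<theta> (items (D ! i)) (items (D' ! i))"
    using assms(4) unfolding matched_def by blast
  obtain y y' \<eta> j where w: "w = Complex y (level \<eta> (D ! j))" "w' = Complex y' (level \<eta> (D' ! j))"
    and j: "j < length D" "0 \<le> \<eta>" "\<eta> \<le> 1" "(y, y') \<in> slice_pairs \<eta> (items (D ! j)) (items (D' ! j))"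
    using assms(5) unfolding matched_def by blast
  note A = matched_ordered[OF D D' shape i j] and B = matched_ordered[OF D D' shape j i]
  have "i < j \<or> i = j \<and> \<theta> \<le> \<eta> \<or> j < i \<or> j = i \<and> \<eta> \<le> \<theta>" by linarith
  then show "Im z < Im w \<Longrightarrow> Im z' < Im w'" "Im z = Im w \<Longrightarrow> Im z' = Im w'"
    "Im z = Im w \<Longrightarrow> Re z < Re w \<Longrightarrow> Re z' < Re w'" "Im z = Im w \<Longrightarrow> Re z = Re w \<Longrightarrow> Re z' = Re w'"
    using A B unfolding z w complex.sel by (metis less_irrefl less_asym)+
qed

text \<open>Convex combinations preserve the order of heights, and at equal heights the order from left to right.\<close>

lemma lex_no_collision:
  fixes z z' w w' :: complex
  assumes "Im z < Im w \<Longrightarrow> Im z' < Im w'" "Im w < Im z \<Longrightarrow> Im w' < Im z'" "Im z = Im w \<Longrightarrow> Im z' = Im w'"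
    "Im z = Im w \<Longrightarrow> Re z < Re w \<Longrightarrow> Re z' < Re w'" "Im z = Im w \<Longrightarrow> Re w < Re z \<Longrightarrow> Re w' < Re z'"
    "Im z = Im w \<Longrightarrow> Re z = Re w \<Longrightarrow> Re z' = Re w'"
    and s: "0 \<le> s" "s \<le> 1" and eq: "(1 - of_real s) * z + of_real s * z' = (1 - of_real s) * w + of_real s * w'"
  shows "z = w \<and> z' = w'"
proof -
  have I: "(1 - s) * Im z + s * Im z' = (1 - s) * Im w + s * Im w'"
    and R: "(1 - s) * Re z + s * Re z' = (1 - s) * Re w + s * Re w'"
    using arg_cong[OF eq, of Im] arg_cong[OF eq, of Re] by simp_all
  have Im: "Im z = Im w"
    using I convex_less[OF _ assms(1) s] convex_less[OF _ assms(2) s] by (metis less_irrefl linorder_less_linear)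
  then have "Re z = Re w"
    using R convex_less[OF _ assms(4) s] convex_less[OF _ assms(5) s] by (metis less_irrefl linorder_less_linear)
  then show ?thesis using Im assms(3,6) by (simp add: complex_eq_iff)
qed

lemma matched_bd:
  assumes D: "good b t D" and D': "good b t D'" and shape: "shape D = shape D'" and "(z, z') \<in> matched D D'"
  shows "z = z' \<or> (z \<in> interior sq \<and> z' \<in> interior sq)"
proof -
  obtain x x' \<theta> i where z: "z = Complex x (level \<theta> (D ! i))" "z' = Complex x' (level \<theta> (D' ! i))"
    and i: "i < length D" "0 \<le> \<theta>" "\<theta> \<le> 1" "(x, x') \<in> slice_pairs \<theta> (items (D ! i)) (items (D' ! i))"
    using assms(4) unfolding matched_def by blast
  have len: "length D' = length D" using shape_nth[OF shape i(1)] by simp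
  note tyi = shape_nth[OF shape i(1), THEN conjunct2]
  have i': "i < length D'" using i len by simp
  note gi = good_nth[OF D i(1)] and gi' = good_nth[OF D' i']
  have hd: "starts_at t (D ! 0)" "starts_at t (D' ! 0)" "ends_at b (D ! (length D - 1))" "ends_at b (D' ! (length D - 1))"
    using D D' len unfolding good_def by (metis hd_conv_nth last_conv_nth)+
  have hd1: "fst (D ! 0) = 1" "fst (D' ! 0) = 1" "fst (snd (D ! (length D - 1))) = -1" "fst (snd (D' ! (length D - 1))) = -1"
    using hd by (cases "D ! 0"; cases "D' ! 0"; cases "D ! (length D - 1)"; cases "D' ! (length D - 1)"; simp)+
  have le1: "level \<theta> (E ! i) \<le> 1 \<and> - 1 \<le> level \<theta> (E ! i) \<and> (\<not> (i = 0 \<and> \<theta> = 0) \<longrightarrow> level \<theta> (E ! i) < 1) \<and>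
      (\<not> (i = length D - 1 \<and> \<theta> = 1) \<longrightarrow> - 1 < level \<theta> (E ! i))"
    if E: "good b t E" "length E = length D" "fst (E ! 0) = 1" "fst (snd (E ! (length D - 1))) = -1" for E :: "'a layer list"
  proof -
    have iE: "i < length E" using i E by simp
    note b = level_bounds[OF good_nth(1)[OF E(1) iE] i(2,3)]
    have u: "fst (E ! i) \<le> 1 \<and> (i \<noteq> 0 \<longrightarrow> fst (E ! i) < 1)"
    proof (cases "i = 0")
      case False
      then have "fst (E ! i) \<le> fst (snd (E ! 0))" using good_heights(1)[OF E(1) _ iE] by blast
      also have "\<dots> < 1" using good_nth(4)[OF E(1), of 0] iE E(3) by fastforce
      finally show ?thesis by simp
    qed (use E in simp)
    have d: "- 1 \<le> fst (snd (E ! i)) \<and> (i \<noteq> length D - 1 \<longrightarrow> -1 < fst (snd (E ! i)))"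
    proof (cases "i = length D - 1")
      case False
      then have lt: "i < length D - 1" using i by simp
      have "-1 < fst (E ! (length D - 1))" using good_nth(4)[OF E(1), of "length D - 1"] E i by auto
      also have "\<dots> \<le> fst (snd (E ! i))" using good_heights(1)[OF E(1) lt] E i by auto
      finally show ?thesis by simp
    qed (use E in simp)
    show ?thesis using b u d by fastforce
  qed
  note l = le1[OF D refl hd1(1,3)] and l' = le1[OF D' len hd1(2,4)]
  have xx: "\<bar>x\<bar> < 1" "\<bar>x'\<bar> < 1"
  proof -
    obtain it it' \<sigma> where it: "(it, it') \<in> set (zip (items (D ! i)) (items (D' ! i)))" "-1 \<le> \<sigma>" "\<sigma> \<le> 1"
      "x = item_x \<theta> it \<sigma>" "x' = item_x \<theta> it' \<sigma>" using i(4) unfolding slice_pairs_def by blast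
    have "good_item it" "good_item it'" using it(1) gi(2) gi'(2) by (metis set_zip_leftD set_zip_rightD)+
    then show "\<bar>x\<bar> < 1" "\<bar>x'\<bar> < 1" using it item_x_bounds i by blast+
  qed
  consider "i = 0 \<and> \<theta> = 0" | "i = length D - 1 \<and> \<theta> = 1" | "\<not> (i = 0 \<and> \<theta> = 0)" "\<not> (i = length D - 1 \<and> \<theta> = 1)" by blast
  then show ?thesis
  proof cases
    case 1
    have "only_strands (items (D ! 0))" "concat (map item_tops (items (D ! 0))) = mark_xs t" "concat (map item_tops (items (D' ! 0))) = mark_xs t"
      using hd by (cases "D ! 0"; cases "D' ! 0"; simp)+
    then have "(x, x') \<in> set (zip (mark_xs t) (mark_xs t))"
      using i(4) 1 slice_pairs_only_strands(1)[OF tyi gi(2) gi'(2)] by simp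
    then have "x = x'" by (auto simp: zip_same_conv_map)
    then show ?thesis using z 1 hd1 by (simp add: level_def)
  next
    case 2
    have "only_strands (items (D ! i))" "concat (map item_bots (items (D ! i))) = mark_xs b" "concat (map item_bots (items (D' ! i))) = mark_xs b"
      using hd 2 by (cases "D ! i"; cases "D' ! i"; simp)+
    then have "(x, x') \<in> set (zip (mark_xs b) (mark_xs b))"
      using i(4) 2 slice_pairs_only_strands(2)[OF tyi gi(2) gi'(2)] by simp
    then have "x = x'" by (auto simp: zip_same_conv_map)
    then show ?thesis using z 2 hd1 by (simp add: level_def)
  next
    case 3
    then show ?thesis using l l' xx unfolding z interior_sq by (auto simp: abs_less_iff)
  qed
qed

lemma is_placeI: "0 < w \<Longrightarrow> 0 < h \<Longrightarrow> is_place (place c w h)"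
  unfolding is_place_def by blast

lemma image_filter: "f ` {p \<in> Z. P (f p)} = {x \<in> f ` Z. P x}"
  by auto

lemma list_all2_concat: "list_all2 (list_all2 Q) xss yss \<Longrightarrow> list_all2 Q (concat xss) (concat yss)"
  by (induction rule: list_all2_induct) (auto intro: list_all2_appendI)

text \<open>
  The matching increases lexicographically (heights first), so moving matched points along straight
  segments never makes two points collide.
\<close>

lemma layered_isotopy:
  assumes D: "good b t D" and D': "good b t D'" and shape: "shape D = shape D'" and T: "planar_tangle (layered b t D)"
  shows "planar_tangle (layered b t D')" "isotopic (layered b t D) (layered b t D')"
proof -
  have len: "length D' = length D" using arg_cong[OF shape, of length] unfolding shape_def by simp
  define Q where "Q = (\<lambda>B B'. in_bot B' = in_bot B \<and> in_top B' = in_top B \<and> is_place (in_map B) \<and> is_place (in_map B') \<and>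
      (\<forall>z\<in>sq. (in_map B z, in_map B' z) \<in> matched D D'))"
  have box: "list_all2 Q (item_box (fst (D ! i)) (fst (snd (D ! i))) it) (item_box (fst (D' ! i)) (fst (snd (D' ! i))) it')"
    if i: "i < length D" and m: "(it, it') \<in> set (zip (items (D ! i)) (items (D' ! i)))" for i it it'
  proof -
    have i': "i < length D'" using i len by simp
    obtain u d I where L: "D ! i = (u, d, I)" by (cases "D ! i") auto
    obtain u' d' I' where L': "D' ! i = (u', d', I')" by (cases "D' ! i") auto
    have ud: "d < u" "d' < u'" using good_nth(4)[OF D i] good_nth(4)[OF D' i'] L L' by auto
    obtain lab a b w where it: "it = (lab, a, b, w)" by (cases it) auto
    have "fst it = fst it'" using zip_fst_eq[OF m] shape_nth[OF shape i] by blast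
    then obtain a' b' w' where it': "it' = (lab, a', b', w')" using it by (cases it') auto
    have gg: "good_item it" "good_item it'"
      using m good_nth(2)[OF D i] good_nth(2)[OF D' i'] by (metis set_zip_leftD set_zip_rightD)+
    show ?thesis
    proof (cases lab)
      case None then show ?thesis unfolding it it' by simp
    next
      case (Some y)
      obtain k l v where y: "y = (k, l, v)" by (cases y) auto
      have g: "0 < w" "b = a" "0 < w'" "b' = a'" using gg unfolding it it' Some by auto
      have "(place (Complex a ((u + d) / 2)) w ((u - d) / 2) z, place (Complex a' ((u' + d') / 2)) w' ((u' - d') / 2) z) \<in> matched D D'"
        if z: "z \<in> sq" for z
      proof -
        \<comment> \<open>the relative depth of \<open>z\<close> in the box\<close>
        let ?t = "(1 - Im z) / 2"
        have "0 \<le> ?t" "?t \<le> 1" "-1 \<le> Re z" "Re z \<le> 1" using z unfolding mem_sq abs_le_iff by auto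
        moreover have "place (Complex a ((u + d) / 2)) w ((u - d) / 2) z = Complex (item_x ?t it (Re z)) (level ?t (D ! i))"
          "place (Complex a' ((u' + d') / 2)) w' ((u' - d') / 2) z = Complex (item_x ?t it' (Re z)) (level ?t (D' ! i))"
          unfolding place_def it it' L L' level_def g by (auto simp: complex_eq_iff field_simps)
        moreover have "(item_x ?t it (Re z), item_x ?t it' (Re z)) \<in> slice_pairs ?t (items (D ! i)) (items (D' ! i))"
          using m calculation unfolding slice_pairs_def by blast
        ultimately show ?thesis using i unfolding matched_def by blast
      qed
      moreover have "is_place (place (Complex a ((u + d) / 2)) w ((u - d) / 2))" "is_place (place (Complex a' ((u' + d') / 2)) w' ((u' - d') / 2))"
        by (rule is_placeI; use g ud in simp)+
      ultimately show ?thesis unfolding it it' Some y L L' Q_def by (simp add: in_bot_def in_top_def in_map_def)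
    qed
  qed
  have lb: "list_all2 Q (layer_boxes (D ! i)) (layer_boxes (D' ! i))" if i: "i < length D" for i
  proof -
    obtain u d I where L: "D ! i = (u, d, I)" by (cases "D ! i") auto
    obtain u' d' I' where L': "D' ! i = (u', d', I')" by (cases "D' ! i") auto
    have "length I = length I'" using shape_nth[OF shape i] L L' by (metis length_map snd_conv)
    show ?thesis unfolding L L' layer_boxes.simps
    proof (rule list_all2_concat, rule list_all2_all_nthI)
      show "length (map (item_box u d) I) = length (map (item_box u' d') I')" using \<open>length I = length I'\<close> by simp
      fix n assume n: "n < length (map (item_box u d) I)"
      have "(I ! n, I' ! n) \<in> set (zip I I')" using n \<open>length I = length I'\<close> by (auto simp: in_set_zip)
      then show "list_all2 Q (map (item_box u d) I ! n) (map (item_box u' d') I' ! n)"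
        using box[OF i, of "I ! n" "I' ! n"] n \<open>length I = length I'\<close> unfolding L L' by simp
    qed
  qed
  have "list_all2 Q (boxes (layered b t D)) (boxes (layered b t D'))"
    unfolding layered_def tangle.simps
    by (rule list_all2_concat, rule list_all2_all_nthI) (use lb len in auto)
  then have lenb: "length (boxes (layered b t D')) = length (boxes (layered b t D))"
    and nthQ: "\<And>i. i < length (boxes (layered b t D)) \<Longrightarrow> Q (boxes (layered b t D) ! i) (boxes (layered b t D') ! i)"
    unfolding list_all2_conv_all_nth by auto
  define seg where "seg i it it' = (\<lambda>\<theta>. (Complex (item_x \<theta> it 0) (level \<theta> (D ! i)), Complex (item_x \<theta> it' 0) (level \<theta> (D' ! i)))) ` {0..1::real}" for i and it it' :: "'a item"
  define P where "P = (\<lambda>i. {p \<in> set (zip (items (D ! i)) (items (D' ! i))). fst (fst p) = None})"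
  define RS where "RS = (\<Union>i<length D. \<Union>p\<in>P i. seg i (fst p) (snd p))"
  have segc: "compact (seg i it it')" for i it it'
  proof -
    obtain lab a b w where it: "it = (lab, a, b, w)" by (cases it) auto
    obtain lab' a' b' w' where it': "it' = (lab', a', b', w')" by (cases it') auto
    show ?thesis unfolding seg_def it it' level_def item_x.simps
      by (intro compact_continuous_image continuous_intros compact_Icc)
  qed
  have RSc: "compact RS" unfolding RS_def P_def by (intro compact_UN segc finite_lessThan) auto
  have RSR: "RS \<subseteq> matched D D'"
  proof
    fix q assume "q \<in> RS"
    then obtain i it it' \<theta> where q: "i < length D" "(it, it') \<in> set (zip (items (D ! i)) (items (D' ! i)))" "0 \<le> \<theta>" "\<theta> \<le> 1"
      "q = (Complex (item_x \<theta> it 0) (level \<theta> (D ! i)), Complex (item_x \<theta> it' 0) (level \<theta> (D' ! i)))"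
      unfolding RS_def P_def seg_def by auto
    have "(item_x \<theta> it 0, item_x \<theta> it' 0) \<in> slice_pairs \<theta> (items (D ! i)) (items (D' ! i))"
      using q(2) unfolding slice_pairs_def by fastforce
    then show "q \<in> matched D D'" using q unfolding matched_def by blast
  qed
  have seg_str: "item_strand u d it = (\<lambda>\<theta>. Complex (item_x \<theta> it 0) (level \<theta> (u, d, I))) ` {0..1}" if N: "fst it = None" for u d I and it :: "'a item"
  proof -
    obtain a b w where it: "it = (None, a, b, w)" using N by (cases it) auto
    have "closed_segment (Complex a u) (Complex b d) = (\<lambda>\<theta>. Complex ((1 - \<theta>) * a + \<theta> * b) ((1 - \<theta>) * u + \<theta> * d)) ` {0..1}"
      unfolding closed_segment_image_interval
      by (intro image_cong refl) (auto simp: complex_eq_iff)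
    then show ?thesis unfolding it level_def by simp
  qed
  have str: "strands (layered b t E) = (\<Union>i<length D. \<Union>it\<in>{it\<in>set (items (E ! i)). fst it = None}. (\<lambda>\<theta>. Complex (item_x \<theta> it 0) (level \<theta> (E ! i))) ` {0..1})"
    if "length E = length D" for E :: "'a layer list"
  proof -
    have "layer_strands L = (\<Union>it\<in>{it\<in>set (items L). fst it = None}. (\<lambda>\<theta>. Complex (item_x \<theta> it 0) (level \<theta> L)) ` {0..1})" for L :: "'a layer"
    proof -
      obtain u d I where L: "L = (u, d, I)" by (cases L) auto
      have e: "item_strand u d it = {}" if "fst it \<noteq> None" for it :: "'a item" using that by (cases it) auto
      have "layer_strands L = (\<Union>it\<in>{it\<in>set I. fst it = None}. item_strand u d it)" unfolding L layer_strands.simps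
      proof (intro equalityI subsetI)
        fix x assume "x \<in> (\<Union>it\<in>set I. item_strand u d it)"
        then obtain it where it: "it \<in> set I" "x \<in> item_strand u d it" by blast
        then have "fst it = None" using e[of it] by (metis empty_iff)
        then show "x \<in> (\<Union>it\<in>{it\<in>set I. fst it = None}. item_strand u d it)" using it by blast
      qed blast
      then show ?thesis unfolding L using seg_str[of _ u d I] by simp
    qed
    moreover have "(\<Union>L\<in>set E. layer_strands L) = (\<Union>i<length D. layer_strands (E ! i))"
      using that by (auto simp: set_conv_nth)
    ultimately show ?thesis unfolding layered_def by simp
  qed
  have S1: "strands (layered b t D) = fst ` RS"
  proof -
    have "fst ` P i = {it\<in>set (items (D ! i)). fst it = None}" if "i < length D" for i
    proof -
      have "length (items (D ! i)) = length (items (D' ! i))" using shape_nth[OF shape that] by (metis length_map)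
      then have "set (items (D ! i)) = fst ` set (zip (items (D ! i)) (items (D' ! i)))"
        by (metis map_fst_zip set_map)
      then show ?thesis unfolding P_def by auto
    qed
    then have "(\<Union>i<length D. \<Union>it\<in>{it\<in>set (items (D ! i)). fst it = None}. f i it) = (\<Union>i<length D. \<Union>p\<in>P i. f i (fst p))"
      for f :: "nat \<Rightarrow> 'a item \<Rightarrow> complex set" by (intro SUP_cong refl) (simp flip: UN_simps)
    then show ?thesis unfolding str[OF refl] RS_def image_UN seg_def image_image fst_conv .
  qed
  have S2: "strands (layered b t D') = snd ` RS"
  proof -
    have "snd ` P i = {it\<in>set (items (D' ! i)). fst it = None}" if "i < length D" for i
    proof -
      have l: "length (items (D ! i)) = length (items (D' ! i))" using shape_nth[OF shape that] by (metis length_map)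
      then have "set (items (D' ! i)) = snd ` set (zip (items (D ! i)) (items (D' ! i)))"
        by (metis map_snd_zip set_map)
      moreover have "fst (fst p) = fst (snd p)" if "p \<in> set (zip (items (D ! i)) (items (D' ! i)))" for p
        using zip_fst_eq[of "fst p" "snd p"] that shape_nth[OF shape \<open>i < length D\<close>] by (simp)
      moreover have "snd ` {p \<in> Z. fst (fst p) = None} = {it \<in> snd ` Z. fst it = None}"
        if Z: "\<And>p. p \<in> Z \<Longrightarrow> fst (fst p) = fst (snd p)" for Z :: "('a item \<times> 'a item) set"
      proof -
        have A: "{p \<in> Z. fst (fst p) = None} = {p \<in> Z. fst (snd p) = None}" using Z by (intro Collect_cong) metis
        show ?thesis unfolding A by (rule image_filter)
      qed
      ultimately show ?thesis unfolding P_def by presburger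
    qed
    then have "(\<Union>i<length D. \<Union>it\<in>{it\<in>set (items (D' ! i)). fst it = None}. f i it) = (\<Union>i<length D. \<Union>p\<in>P i. f i (snd p))"
      for f :: "nat \<Rightarrow> 'a item \<Rightarrow> complex set" by (intro SUP_cong refl) (simp flip: UN_simps)
    then show ?thesis unfolding str[OF len] RS_def image_UN seg_def image_image snd_conv .
  qed
  have nocol: "z = w \<and> z' = w'"
    if "(z, z') \<in> matched D D'" "(w, w') \<in> matched D D'" "0 \<le> s" "s \<le> 1"
      "(1 - of_real s) * z + of_real s * z' = (1 - of_real s) * w + of_real s * w'" for z z' w w' s
  proof -
    note L1 = matched_lex[OF D D' shape that(1,2)] and L2 = matched_lex[OF D D' shape that(2,1)]
    show ?thesis
      by (rule lex_no_collision[OF L1(1) L2(1) L1(2) L1(3) L2(3)[OF sym] L1(4) that(3-5)]; assumption)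
  qed
  note iso = straight_isotopy[OF T _ _ lenb _ _ RSc RSR S1 S2 _ nocol matched_bd[OF D D' shape]]
  show "planar_tangle (layered b t D')"
    by (rule iso(1)) (use nthQ in \<open>auto simp: Q_def layered_def\<close>)
  show "isotopic (layered b t D) (layered b t D')"
    by (rule iso(2)) (use nthQ in \<open>auto simp: Q_def layered_def\<close>)
qed

section \<open>Planarity of the elementary tangles\<close>

lemma planar_from_arcs:
  assumes boxes: "\<And>B. B \<in> set (boxes T) \<Longrightarrow> orient_affine (in_map B) \<and> in_region B \<subseteq> interior sq"
    and disjoint: "sorted_wrt (\<lambda>B B'. in_region B \<inter> in_region B' = {}) (boxes T)"
    and J: "finite J" "strands T = (\<Union>j\<in>J. path_image (g j))" "\<And>j. j \<in> J \<Longrightarrow> arc (g j)"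
    and disj: "\<And>i j z. i \<in> J \<Longrightarrow> j \<in> J \<Longrightarrow> z \<in> path_image (g i) \<Longrightarrow> z \<in> path_image (g j) \<Longrightarrow> i = j"
    and ends: "(\<Union>j\<in>J. {pathstart (g j), pathfinish (g j)}) = all_marks T"
    and sub: "\<And>j. j \<in> J \<Longrightarrow> path_image (g j) \<subseteq> sq"
    and fr: "\<And>j z. j \<in> J \<Longrightarrow> z \<in> path_image (g j) \<Longrightarrow> z \<in> frontier sq \<Longrightarrow> z \<in> {pathstart (g j), pathfinish (g j)}"
    and bx: "\<And>j z B. j \<in> J \<Longrightarrow> z \<in> path_image (g j) \<Longrightarrow> B \<in> set (boxes T) \<Longrightarrow> z \<in> in_region B \<Longrightarrow> z \<in> {pathstart (g j), pathfinish (g j)}"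
  shows "planar_tangle T"
proof -
  have am: "all_marks T \<subseteq> strands T"
    unfolding ends[symmetric] J(2) using pathstart_in_path_image pathfinish_in_path_image by blast
  have mi: "in_marks B \<inter> frontier sq = {}" if "B \<in> set (boxes T)" for B
    using boxes[OF that] in_marks_region[of B] unfolding frontier_sq' by blast
  have 1: "strands T \<inter> frontier sq = marks (bots T) (tops T)"
  proof
    show "marks (bots T) (tops T) \<subseteq> strands T \<inter> frontier sq"
      using am marks_frontier unfolding all_marks_def by blast
    show "strands T \<inter> frontier sq \<subseteq> marks (bots T) (tops T)"
    proof
      fix z assume z: "z \<in> strands T \<inter> frontier sq"
      then obtain j where "j \<in> J" "z \<in> path_image (g j)" unfolding J(2) by blast
      then have "z \<in> all_marks T" using fr[of j z] z unfolding ends[symmetric] by blast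
      then show "z \<in> marks (bots T) (tops T)" using mi z unfolding all_marks_def by blast
    qed
  qed
  have dr: "B = B' \<or> in_region B \<inter> in_region B' = {}" if "B \<in> set (boxes T)" "B' \<in> set (boxes T)" for B B'
    using disjoint that unfolding sorted_wrt_disj_iff[symmetric] in_set_conv_nth by metis
  have 2: "strands T \<inter> in_region B = in_marks B" if B: "B \<in> set (boxes T)" for B
  proof
    show "in_marks B \<subseteq> strands T \<inter> in_region B"
      using am in_marks_region[of B] B unfolding all_marks_def by blast
    show "strands T \<inter> in_region B \<subseteq> in_marks B"
    proof
      fix z assume z: "z \<in> strands T \<inter> in_region B"
      then obtain j where "j \<in> J" "z \<in> path_image (g j)" unfolding J(2) by blast
      then have "z \<in> all_marks T" using bx[of j z B] B z unfolding ends[symmetric] by blast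
      moreover have "z \<notin> marks (bots T) (tops T)"
        using boxes[OF B] z marks_frontier[of "bots T" "tops T"] unfolding frontier_sq' by blast
      ultimately obtain B' where B': "B' \<in> set (boxes T)" "z \<in> in_marks B'" unfolding all_marks_def by blast
      then have "z \<in> in_region B'" using in_marks_region by blast
      then have "B = B'" using dr[OF B B'(1)] z by blast
      then show "z \<in> in_marks B" using B' by simp
    qed
  qed
  have 3: "\<exists>S. finite S \<and> disjoint S \<and> strands T = \<Union>S \<and> (\<forall>C\<in>S. is_strand (all_marks T) C)"
  proof (intro exI conjI ballI)
    show "finite ((\<lambda>j. path_image (g j)) ` J)" using J by simp
    show "strands T = \<Union>((\<lambda>j. path_image (g j)) ` J)" by (rule J)
    show "disjoint ((\<lambda>j. path_image (g j)) ` J)"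
      using disj unfolding disjoint_def by blast
    fix C assume "C \<in> (\<lambda>j. path_image (g j)) ` J"
    then obtain j where j: "j \<in> J" "C = path_image (g j)" by blast
    have "path_image (g j) \<inter> all_marks T = {pathstart (g j), pathfinish (g j)}"
    proof
      show "{pathstart (g j), pathfinish (g j)} \<subseteq> path_image (g j) \<inter> all_marks T"
        unfolding ends[symmetric] using j by auto
      show "path_image (g j) \<inter> all_marks T \<subseteq> {pathstart (g j), pathfinish (g j)}"
      proof
        fix z assume z: "z \<in> path_image (g j) \<inter> all_marks T"
        then obtain i where i: "i \<in> J" "z \<in> {pathstart (g i), pathfinish (g i)}" unfolding ends[symmetric] by blast
        then have "z \<in> path_image (g i)" by auto
        then have "i = j" using disj i(1) j(1) z by blast
        then show "z \<in> {pathstart (g j), pathfinish (g j)}" using i by simp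
      qed
    qed
    then show "is_strand (all_marks T) C" unfolding is_strand_def j(2) using J(3)[OF j(1)] by blast
  qed
  have 4: "strands T \<subseteq> sq" unfolding J(2) using sub by (rule UN_least)
  show ?thesis unfolding planar_tangle_sorted
    by (intro conjI ballI 1 2 3 4 disjoint boxes[THEN conjunct1] boxes[THEN conjunct2])
qed

lemma sorted_wrt_concat_iff:
  "sorted_wrt R (concat xss) \<longleftrightarrow> (\<forall>zs\<in>set xss. sorted_wrt R zs) \<and> sorted_wrt (\<lambda>zs ys. \<forall>x\<in>set zs. \<forall>y\<in>set ys. R x y) xss"
  by (induction xss) (auto simp: sorted_wrt_append)

lemma concat_map_nthE:
  assumes "x \<in> set (concat (map f I))"
  obtains p where "p < length I" "x \<in> set (f (I ! p))"
proof -
  obtain y where "y \<in> set I" "x \<in> set (f y)" using assms by auto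
  then show ?thesis using that by (metis in_set_conv_nth)
qed

lemma UN_set_nth: "(\<Union>x\<in>set ys. f x) = (\<Union>i\<in>{..<length ys}. f (ys ! i))"
proof -
  have "set ys = (!) ys ` {..<length ys}" by (auto simp: in_set_conv_nth)
  then show ?thesis by simp
qed

definition on_item :: "'a layer list \<Rightarrow> nat \<Rightarrow> nat \<Rightarrow> real \<Rightarrow> real \<Rightarrow> complex \<Rightarrow> bool" where
  "on_item D i p \<theta> \<sigma> z \<longleftrightarrow> i < length D \<and> p < length (items (D ! i)) \<and> 0 \<le> \<theta> \<and> \<theta> \<le> 1 \<and> -1 \<le> \<sigma> \<and> \<sigma> \<le> 1 \<and>
     z = Complex (item_x \<theta> (items (D ! i) ! p) \<sigma>) (level \<theta> (D ! i))"

lemma on_item_unique: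
  assumes D: "good b t D" and A: "on_item D i p \<theta> \<sigma> z" and B: "on_item D j q \<eta> \<tau> z"
  shows "i = j \<and> p = q \<and> \<theta> = \<eta> \<or> j = Suc i \<and> \<theta> = 1 \<and> \<eta> = 0 \<or> i = Suc j \<and> \<theta> = 0 \<and> \<eta> = 1"
proof -
  have *: "i = j \<and> p = q \<and> \<theta> = \<eta> \<or> j = Suc i \<and> \<theta> = 1 \<and> \<eta> = 0"
    if ij: "i \<le> j" and A: "on_item D i p \<theta> \<sigma> z" and B: "on_item D j q \<eta> \<tau> z" for i j p q \<theta> \<eta> \<sigma> \<tau>
  proof -
    have i: "i < length D" and j: "j < length D" using A B unfolding on_item_def by blast+
    have e: "level \<theta> (D ! i) = level \<eta> (D ! j)" "item_x \<theta> (items (D ! i) ! p) \<sigma> = item_x \<eta> (items (D ! j) ! q) \<tau>"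
      using A B unfolding on_item_def by simp_all
    note gi = good_nth[OF D i] and gj = good_nth[OF D j]
    have t: "0 \<le> \<theta>" "\<theta> \<le> 1" "0 \<le> \<eta>" "\<eta> \<le> 1" using A B unfolding on_item_def by blast+
    show ?thesis
    proof (cases "i = j")
      case True
      have "\<theta> = \<eta>" using level_less[OF gi(1), of \<theta> \<eta>] level_less[OF gi(1), of \<eta> \<theta>] e(1) True by fastforce
      moreover have "p = q"
      proof (rule ccontr)
        assume "p \<noteq> q"
        have lo: "left_of (items (D ! i) ! r) (items (D ! i) ! s)" if "r < s" "s < length (items (D ! i))" for r s
          using gi(3) that unfolding sorted_wrt_iff_nth_less by blast
        have block: "good_item (items (D ! i) ! r)" if "r < length (items (D ! i))" for r using gi(2) that by simp
        from \<open>p \<noteq> q\<close> show False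
          using item_x_less[OF lo[of p q], of \<theta> \<sigma> \<tau>] item_x_less[OF lo[of q p], of \<theta> \<tau> \<sigma>] block[of p] block[of q] A B e(2) True \<open>\<theta> = \<eta>\<close>
          unfolding on_item_def by (metis less_irrefl linorder_neqE_nat)
      qed
      ultimately show ?thesis using True by simp
    next
      case False
      then have lt: "i < j" using ij by simp
      note h = good_heights[OF D lt j]
      note b = level_bounds[OF gi(1) t(1,2)] and c = level_bounds[OF gj(1) t(3,4)]
      show ?thesis using h b c e(1) by fastforce
    qed
  qed
  show ?thesis using *[OF _ A B] *[OF _ B A] by (metis nle_le)
qed

lemma on_item_bounds:
  assumes D: "good b t D" and A: "on_item D i p \<theta> \<sigma> z"
  shows "\<bar>Re z\<bar> < 1" "\<bar>Im z\<bar> \<le> 1" "Im z = 1 \<Longrightarrow> i = 0 \<and> \<theta> = 0" "Im z = -1 \<Longrightarrow> i = length D - 1 \<and> \<theta> = 1"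
proof -
  have i: "i < length D" and t: "0 \<le> \<theta>" "\<theta> \<le> 1" "-1 \<le> \<sigma>" "\<sigma> \<le> 1" using A unfolding on_item_def by blast+
  have z: "z = Complex (item_x \<theta> (items (D ! i) ! p) \<sigma>) (level \<theta> (D ! i))" and p: "p < length (items (D ! i))"
    using A unfolding on_item_def by blast+
  have hd: "starts_at t (D ! 0)" "ends_at b (D ! (length D - 1))"
    using D unfolding good_def by (metis hd_conv_nth last_conv_nth)+
  have hd1: "fst (D ! 0) = 1" "fst (snd (D ! (length D - 1))) = -1"
    using hd by (cases "D ! 0"; cases "D ! (length D - 1)"; simp)+
  note b = level_bounds[OF good_nth(1)[OF D i] t(1,2)]
  have u: "fst (D ! i) \<le> 1 \<and> (i \<noteq> 0 \<longrightarrow> fst (D ! i) < 1)"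
  proof (cases "i = 0")
    case False
    then have "fst (D ! i) \<le> fst (snd (D ! 0))" using good_heights(1)[OF D _ i] by blast
    also have "\<dots> < 1" using good_nth(4)[OF D, of 0] i hd1 by fastforce
    finally show ?thesis by simp
  qed (use hd1 in simp)
  have d: "- 1 \<le> fst (snd (D ! i)) \<and> (i \<noteq> length D - 1 \<longrightarrow> -1 < fst (snd (D ! i)))"
  proof (cases "i = length D - 1")
    case False
    then have lt: "i < length D - 1" using i by simp
    have "-1 < fst (D ! (length D - 1))" using good_nth(4)[OF D, of "length D - 1"] hd1 i by auto
    also have "\<dots> \<le> fst (snd (D ! i))" using good_heights(1)[OF D lt] i by auto
    finally show ?thesis by simp
  qed (use hd1 in simp)
  have "good_item (items (D ! i) ! p)" using good_nth(2)[OF D i] p by simp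
  then show "\<bar>Re z\<bar> < 1" unfolding z complex.sel by (rule item_x_bounds[OF _ t])
  show "\<bar>Im z\<bar> \<le> 1" unfolding z complex.sel using b u d by linarith
  show "Im z = 1 \<Longrightarrow> i = 0 \<and> \<theta> = 0" unfolding z complex.sel using b(2,4) u by fastforce
  show "Im z = -1 \<Longrightarrow> i = length D - 1 \<and> \<theta> = 1" unfolding z complex.sel using b(1,3) d by fastforce
qed

lemma item_box_region:
  assumes "B \<in> set (item_box (fst (D ! i)) (fst (snd (D ! i))) (items (D ! i) ! p))" "i < length D" "p < length (items (D ! i))"
    "good_item (items (D ! i) ! p)" "fst (snd (D ! i)) < fst (D ! i)"
  shows "fst (items (D ! i) ! p) \<noteq> None" "is_place (in_map B)"
    "\<And>z. z \<in> in_region B \<Longrightarrow> \<exists>\<theta> \<sigma>. on_item D i p \<theta> \<sigma> z"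
    "in_marks B = (\<lambda>x. Complex x (fst (D ! i))) ` set (item_tops (items (D ! i) ! p)) \<union> (\<lambda>x. Complex x (fst (snd (D ! i)))) ` set (item_bots (items (D ! i) ! p))"
proof -
  obtain u d I where L: "D ! i = (u, d, I)" by (cases "D ! i") auto
  obtain lab a b w where it: "items (D ! i) ! p = (lab, a, b, w)" by (cases "items (D ! i) ! p") auto
  obtain k l v where lab: "lab = Some (k, l, v)"
    using assms(1) unfolding it by (cases lab) auto
  have B: "B = (k, l, place (Complex a ((u + d) / 2)) w ((u - d) / 2))"
    using assms(1) unfolding it unfolding L lab by simp
  have g: "0 < w" "b = a" "d < u" using assms(4,5) unfolding it unfolding L lab by auto
  show "fst (items (D ! i) ! p) \<noteq> None" unfolding it lab by simp
  show "is_place (in_map B)" unfolding B in_map_def using g by (auto intro: is_placeI)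
  show "\<exists>\<theta> \<sigma>. on_item D i p \<theta> \<sigma> z" if zB: "z \<in> in_region B" for z
  proof -
    obtain y where y: "y \<in> sq" "z = place (Complex a ((u + d) / 2)) w ((u - d) / 2) y"
      using zB unfolding B in_region_def in_map_def by auto
    let ?t = "(1 - Im y) / 2"
    have "0 \<le> ?t" "?t \<le> 1" "-1 \<le> Re y" "Re y \<le> 1" using y(1) unfolding mem_sq abs_le_iff by auto
    moreover have "z = Complex (item_x ?t (items (D ! i) ! p) (Re y)) (level ?t (D ! i))"
      unfolding y(2) place_def it unfolding L level_def g by (auto simp: complex_eq_iff field_simps)
    ultimately show ?thesis using assms(2,3) unfolding on_item_def by blast
  qed
  have t: "place (Complex a ((u + d) / 2)) w ((u - d) / 2) (top_mark l j) = Complex (a + w * xpos l j) u" for j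
    unfolding place_def top_mark_def by (auto simp: complex_eq_iff field_simps)
  have b: "place (Complex a ((u + d) / 2)) w ((u - d) / 2) (bot_mark k j) = Complex (a + w * xpos k j) d" for j
    unfolding place_def bot_mark_def by (auto simp: complex_eq_iff field_simps)
  show "in_marks B = (\<lambda>x. Complex x (fst (D ! i))) ` set (item_tops (items (D ! i) ! p)) \<union> (\<lambda>x. Complex x (fst (snd (D ! i)))) ` set (item_bots (items (D ! i) ! p))"
    unfolding B in_marks_def marks_def it unfolding lab L g by (auto simp: in_bot_def in_top_def in_map_def image_Un image_image t b)
qed

lemma boxes_layered_E:
  assumes "B \<in> set (boxes (layered b t D))"
  obtains i p where "i < length D" "p < length (items (D ! i))" "B \<in> set (item_box (fst (D ! i)) (fst (snd (D ! i))) (items (D ! i) ! p))"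
proof -
  obtain L where L: "L \<in> set D" "B \<in> set (layer_boxes L)" using assms unfolding layered_def by auto
  obtain u d I where u: "L = (u, d, I)" by (cases L) auto
  obtain it where it: "it \<in> set I" "B \<in> set (item_box u d it)" using L(2) unfolding u by auto
  obtain i where i: "i < length D" "D ! i = L" using L(1) unfolding in_set_conv_nth by blast
  obtain p where "p < length I" "I ! p = it" using it(1) unfolding in_set_conv_nth by blast
  then show ?thesis using that[of i p] i it u by simp
qed

lemma boxes_layered_I:
  assumes "i < length D" "p < length (items (D ! i))" "B \<in> set (item_box (fst (D ! i)) (fst (snd (D ! i))) (items (D ! i) ! p))"
  shows "B \<in> set (boxes (layered b t D))"
proof -
  obtain u d I where u: "D ! i = (u, d, I)" by (cases "D ! i") auto
  have "B \<in> set (layer_boxes (D ! i))" using assms(2,3) unfolding u by auto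
  then show ?thesis using assms(1) unfolding layered_def by auto
qed

lemma only_strands_marks:
  assumes "only_strands I"
  shows "set (concat (map item_tops I)) = {a. \<exists>b w. (None, a, b, w) \<in> set I}" "set (concat (map item_bots I)) = {b. \<exists>a w. (None, a, b, w) \<in> set I}"
proof -
  have "set (concat (map item_tops I)) = {a. \<exists>b w. (None, a, b, w) \<in> set I} \<and> set (concat (map item_bots I)) = {b. \<exists>a w. (None, a, b, w) \<in> set I}"
    using assms
  proof (induction I)
    case Nil then show ?case by simp
  next
    case (Cons it I)
    obtain a b w where it: "it = (None, a, b, w)"
      using Cons.prems by (cases it) (auto simp: only_strands_def)
    show ?case using Cons unfolding it by (auto simp: only_strands_def)
  qed
  then show "set (concat (map item_tops I)) = {a. \<exists>b w. (None, a, b, w) \<in> set I}" "set (concat (map item_bots I)) = {b. \<exists>a w. (None, a, b, w) \<in> set I}"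
    by blast+
qed

text \<open>
  Without adjacent layers of strands every strand is a single segment. Planarity of the other layered
  tangles that occur is inherited by gluing and isotopy.
\<close>

lemma planar_layered_alternating:
  fixes D :: "'a layer list"
  assumes D: "good b t D"
    and alt: "\<And>i. Suc i < length D \<Longrightarrow> (\<forall>it\<in>set (items (D ! i)). fst it \<noteq> None) \<or> (\<forall>it\<in>set (items (D ! Suc i)). fst it \<noteq> None)"
  shows "planar_tangle (layered b t D)"
proof -
  let ?it = "\<lambda>i p. items (D ! i) ! p"
  define J where "J = {(i, p). i < length D \<and> p < length (items (D ! i)) \<and> fst (?it i p) = None}"
  define g where "g = (\<lambda>(i, p). linepath (Complex (item_x 0 (?it i p) 0) (level 0 (D ! i))) (Complex (item_x 1 (?it i p) 0) (level 1 (D ! i))))"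
  have gi: "path_image (g (i, p)) = {z. \<exists>\<theta>. on_item D i p \<theta> 0 z}" if ip: "i < length D" "p < length (items (D ! i))" for i p
  proof -
    obtain lab a b w where it: "?it i p = (lab, a, b, w)" by (cases "?it i p") auto
    have "path_image (g (i, p)) = (\<lambda>\<theta>. Complex (item_x \<theta> (?it i p) 0) (level \<theta> (D ! i))) ` {0..1}"
      unfolding g_def case_prod_conv path_image_linepath closed_segment_image_interval it level_def item_x.simps
      by (intro image_cong refl) (auto simp: complex_eq_iff algebra_simps)
    then show ?thesis using ip unfolding on_item_def by auto
  qed
  have ends: "pathstart (g (i, p)) = Complex (item_x 0 (?it i p) 0) (fst (D ! i))" "pathfinish (g (i, p)) = Complex (item_x 1 (?it i p) 0) (fst (snd (D ! i)))" for i p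
    unfolding g_def by (simp_all add: level_def)
  have at_end: "z \<in> {pathstart (g (i, p)), pathfinish (g (i, p))}" if "on_item D i p \<theta> 0 z" "\<theta> = 0 \<or> \<theta> = 1" for i p \<theta> z
    using that unfolding on_item_def ends level_def by auto
  have hdl: "starts_at t (D ! 0)" "ends_at b (D ! (length D - 1))" and Dne: "0 < length D"
    using D unfolding good_def by (metis hd_conv_nth last_conv_nth length_greater_0_conv)+
  have h0: "fst (D ! 0) = 1" "only_strands (items (D ! 0))" "concat (map item_tops (items (D ! 0))) = mark_xs t"
    using hdl(1) by (cases "D ! 0"; simp)+
  have hl: "fst (snd (D ! (length D - 1))) = -1" "only_strands (items (D ! (length D - 1)))" "concat (map item_bots (items (D ! (length D - 1)))) = mark_xs b"
    using hdl(2) by (cases "D ! (length D - 1)"; simp)+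
  have reg: "z \<in> in_region B \<Longrightarrow> \<exists>\<theta> \<sigma>. on_item D i p \<theta> \<sigma> z" and lab: "fst (?it i p) \<noteq> None" and plc: "is_place (in_map B)"
    and mks: "in_marks B = (\<lambda>x. Complex x (fst (D ! i))) ` set (item_tops (?it i p)) \<union> (\<lambda>x. Complex x (fst (snd (D ! i)))) ` set (item_bots (?it i p))"
    if "i < length D" "p < length (items (D ! i))" "B \<in> set (item_box (fst (D ! i)) (fst (snd (D ! i))) (?it i p))" for i p B z
    using item_box_region[OF that(3,1,2)] good_nth(2,4)[OF D that(1)] that(2) by simp_all
  have notend: "i \<noteq> 0 \<and> i \<noteq> length D - 1" if "i < length D" "p < length (items (D ! i))" "fst (?it i p) \<noteq> None" for i p
    using that h0(2) hl(2) unfolding only_strands_def by (metis nth_mem)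
  show ?thesis
  proof (rule planar_from_arcs[where J = J and g = g])
    show "finite J"
    proof -
      have "J \<subseteq> Sigma {..<length D} (\<lambda>i. {..<length (items (D ! i))})" unfolding J_def by auto
      then show ?thesis by (rule finite_subset) auto
    qed
    show "orient_affine (in_map B) \<and> in_region B \<subseteq> interior sq" if B: "B \<in> set (boxes (layered b t D))" for B
    proof -
      obtain i p where ip: "i < length D" "p < length (items (D ! i))" "B \<in> set (item_box (fst (D ! i)) (fst (snd (D ! i))) (?it i p))"
        using boxes_layered_E[OF B] .
      have "z \<in> interior sq" if zB: "z \<in> in_region B" for z
      proof -
        obtain \<theta> \<sigma> where at: "on_item D i p \<theta> \<sigma> z" using reg[OF ip zB] by blast
        show ?thesis using on_item_bounds[OF D at] notend[OF ip(1,2) lab[OF ip]] unfolding interior_sq by linarith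
      qed
      then show ?thesis using orient_affine_place[OF plc[OF ip]] by blast
    qed
    show "sorted_wrt (\<lambda>B B'. in_region B \<inter> in_region B' = {}) (boxes (layered b t D))"
    proof -
      have dis: "in_region B \<inter> in_region B' = {}" if ip: "i < length D" "p < length (items (D ! i))" "B \<in> set (item_box (fst (D ! i)) (fst (snd (D ! i))) (?it i p))"
        and jq: "j < length D" "q < length (items (D ! j))" "B' \<in> set (item_box (fst (D ! j)) (fst (snd (D ! j))) (?it j q))" and ne: "i < j \<or> i = j \<and> p < q" for i p j q B B'
      proof (rule ccontr)
        assume "in_region B \<inter> in_region B' \<noteq> {}"
        then obtain z where "z \<in> in_region B" "z \<in> in_region B'" by blast
        then obtain \<theta> \<sigma> \<eta> \<tau> where "on_item D i p \<theta> \<sigma> z" "on_item D j q \<eta> \<tau> z" using reg[OF ip] reg[OF jq] by blast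
        from on_item_unique[OF D this] ne have "j = Suc i" by auto
        then have "only_strands (items (D ! i)) \<or> only_strands (items (D ! j))"
          using good_joins[OF D] jq(1) joins_iff by blast
        then show False using lab[OF ip] lab[OF jq] ip jq unfolding only_strands_def by (metis nth_mem)
      qed
      have sing: "sorted_wrt R (item_box u d it)" for R u d and it :: "'a item"
        by (cases "(u, d, it)" rule: item_box.cases) auto
      have lb: "layer_boxes L = concat (map (item_box (fst L) (fst (snd L))) (items L))" for L :: "'a layer"
        by (cases L) auto
      show ?thesis
        unfolding layered_def tangle.simps sorted_wrt_concat_iff
      proof (intro conjI ballI)
        fix Bs assume "Bs \<in> set (map layer_boxes D)"
        then obtain i where i: "i < length D" "Bs = layer_boxes (D ! i)" by (auto simp: in_set_conv_nth)
        show "sorted_wrt (\<lambda>B B'. in_region B \<inter> in_region B' = {}) Bs"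
          unfolding i(2) lb sorted_wrt_concat_iff
        proof (intro conjI ballI)
          fix Cs assume "Cs \<in> set (map (item_box (fst (D ! i)) (fst (snd (D ! i)))) (items (D ! i)))"
          then obtain it :: "'a item" where "Cs = item_box (fst (D ! i)) (fst (snd (D ! i))) it" unfolding set_map by blast
          then show "sorted_wrt (\<lambda>B B'. in_region B \<inter> in_region B' = {}) Cs"
            using sing by blast
        next
          show "sorted_wrt (\<lambda>zs ys. \<forall>x\<in>set zs. \<forall>y\<in>set ys. in_region x \<inter> in_region y = {})
             (map (item_box (fst (D ! i)) (fst (snd (D ! i)))) (items (D ! i)))"
            unfolding sorted_wrt_iff_nth_less length_map
          proof (intro allI impI ballI)
            fix p q x y assume pq: "p < q" "q < length (items (D ! i))"
              and "x \<in> set (map (item_box (fst (D ! i)) (fst (snd (D ! i)))) (items (D ! i)) ! p)"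
                "y \<in> set (map (item_box (fst (D ! i)) (fst (snd (D ! i)))) (items (D ! i)) ! q)"
            then show "in_region x \<inter> in_region y = {}"
              by (intro dis[OF i(1) _ _ i(1)]) simp_all
          qed
        qed
      next
        show "sorted_wrt (\<lambda>zs ys. \<forall>x\<in>set zs. \<forall>y\<in>set ys. in_region x \<inter> in_region y = {}) (map layer_boxes D)"
          unfolding sorted_wrt_iff_nth_less
        proof (intro allI impI ballI)
          fix i j x y assume ij: "i < j" "j < length (map layer_boxes D)" and x: "x \<in> set (map layer_boxes D ! i)" and y: "y \<in> set (map layer_boxes D ! j)"
          have x': "x \<in> set (layer_boxes (D ! i))" and y': "y \<in> set (layer_boxes (D ! j))" using x y ij by simp_all
          obtain p where "p < length (items (D ! i))" "x \<in> set (item_box (fst (D ! i)) (fst (snd (D ! i))) (?it i p))"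
            by (rule concat_map_nthE[OF x'[unfolded lb]])
          moreover obtain q where "q < length (items (D ! j))" "y \<in> set (item_box (fst (D ! j)) (fst (snd (D ! j))) (?it j q))"
            by (rule concat_map_nthE[OF y'[unfolded lb]])
          ultimately show "in_region x \<inter> in_region y = {}" using dis[of i p x j q y] ij by simp
        qed
      qed
    qed
    show "strands (layered b t D) = (\<Union>j\<in>J. path_image (g j))"
    proof -
      have ls: "layer_strands (D ! i) = (\<Union>p\<in>{p. p < length (items (D ! i)) \<and> fst (?it i p) = None}. path_image (g (i, p)))" if "i < length D" for i
      proof -
        obtain u d I where L: "D ! i = (u, d, I)" by (cases "D ! i") auto
        have ist: "item_strand u d (I ! p) = (if fst (I ! p) = None then path_image (g (i, p)) else {})" for p
        proof -
          obtain lab a b w where it: "I ! p = (lab, a, b, w)" by (cases "I ! p") auto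
          show ?thesis by (cases lab) (simp_all add: g_def L it level_def)
        qed
        have "(\<Union>it\<in>set I. item_strand u d it) = (\<Union>p\<in>{..<length I}. item_strand u d (I ! p))"
          by (rule UN_set_nth)
        then show ?thesis unfolding L layer_strands.simps ist by (auto split: if_splits)
      qed
      have "strands (layered b t D) = (\<Union>i\<in>{..<length D}. layer_strands (D ! i))"
        unfolding layered_def tangle.simps by (rule UN_set_nth)
      also have "\<dots> = (\<Union>i\<in>{..<length D}. \<Union>p\<in>{p. p < length (items (D ! i)) \<and> fst (?it i p) = None}. path_image (g (i, p)))"
        using ls by simp
      also have "\<dots> = (\<Union>j\<in>J. path_image (g j))" unfolding J_def by blast
      finally show ?thesis .
    qed
    show "arc (g j)" if jJ: "j \<in> J" for j
    proof -
      obtain i p where j: "j = (i, p)" "i < length D" using jJ unfolding J_def by blast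
      show ?thesis unfolding j(1) g_def case_prod_conv
        by (rule arc_linepath) (use good_nth(4)[OF D j(2)] in \<open>simp add: level_def\<close>)
    qed
    show "j = j'" if jJ: "j \<in> J" "j' \<in> J" "z \<in> path_image (g j)" "z \<in> path_image (g j')" for j j' z
    proof -
      obtain i p where j: "j = (i, p)" "i < length D" "p < length (items (D ! i))" "fst (?it i p) = None" using jJ unfolding J_def by blast
      obtain i' p' where j': "j' = (i', p')" "i' < length D" "p' < length (items (D ! i'))" "fst (?it i' p') = None" using jJ unfolding J_def by blast
      obtain \<theta> \<theta>' where "on_item D i p \<theta> 0 z" "on_item D i' p' \<theta>' 0 z" using jJ j j' gi by auto
      from on_item_unique[OF D this] show ?thesis
        using alt[of i] alt[of i'] j j' by (metis nth_mem)
    qed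
    show "path_image (g j) \<subseteq> sq" if jJ: "j \<in> J" for j
    proof -
      obtain i p where j: "j = (i, p)" "i < length D" "p < length (items (D ! i))" using jJ unfolding J_def by blast
      show ?thesis unfolding j(1) gi[OF j(2,3)] using on_item_bounds(1,2)[OF D] by (fastforce simp: mem_sq)
    qed
    show "z \<in> {pathstart (g j), pathfinish (g j)}" if jJ: "j \<in> J" "z \<in> path_image (g j)" "z \<in> frontier sq" for j z
    proof -
      obtain i p where j: "j = (i, p)" "i < length D" "p < length (items (D ! i))" using jJ unfolding J_def by blast
      obtain \<theta> where at: "on_item D i p \<theta> 0 z" using jJ j gi by auto
      have "Im z = 1 \<or> Im z = -1" using that(3) on_item_bounds(1,2)[OF D at] unfolding frontier_sq interior_sq by linarith
      then show ?thesis using on_item_bounds(3,4)[OF D at] at_end[OF at] j(1) by blast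
    qed
    show "z \<in> {pathstart (g j), pathfinish (g j)}" if jJ: "j \<in> J" "z \<in> path_image (g j)" "B \<in> set (boxes (layered b t D))" "z \<in> in_region B" for j z B
    proof -
      obtain i p where j: "j = (i, p)" "i < length D" "p < length (items (D ! i))" "fst (?it i p) = None" using jJ unfolding J_def by blast
      obtain \<theta> where at: "on_item D i p \<theta> 0 z" using jJ j gi by auto
      obtain i' p' where ip: "i' < length D" "p' < length (items (D ! i'))" "B \<in> set (item_box (fst (D ! i')) (fst (snd (D ! i'))) (?it i' p'))"
        using boxes_layered_E[OF jJ(3)] .
      obtain \<eta> \<tau> where at': "on_item D i' p' \<eta> \<tau> z" using reg[OF ip jJ(4)] by blast
      show ?thesis using on_item_unique[OF D at at'] lab[OF ip] j(4) at_end[OF at] j(1) by metis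
    qed
    have item: "items (D ! i) ! p = (None, a, b', w) \<Longrightarrow> item_x 0 (?it i p) 0 = a \<and> item_x 1 (?it i p) 0 = b'" for i p a b' w by simp
    have JI: "(i, p) \<in> J" if "i < length D" "p < length (items (D ! i))" "?it i p = (None, a, b', w)" for i p a b' w
      using that unfolding J_def by simp
    show "(\<Union>j\<in>J. {pathstart (g j), pathfinish (g j)}) = all_marks (layered b t D)" (is "?L = ?R")
    proof
      have am: "?R = (\<lambda>x. Complex x 1) ` set (mark_xs t) \<union> (\<lambda>x. Complex x (-1)) ` set (mark_xs b) \<union> (\<Union>B\<in>set (boxes (layered b t D)). in_marks B)"
        unfolding all_marks_def marks_def top_mark_def bot_mark_def by (auto simp: layered_def)
      have boxm: "(\<lambda>x. Complex x (fst (D ! i))) ` set (item_tops (?it i p)) \<union> (\<lambda>x. Complex x (fst (snd (D ! i)))) ` set (item_bots (?it i p)) \<subseteq> ?R"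
        if ip: "i < length D" "p < length (items (D ! i))" "fst (?it i p) \<noteq> None" for i p
      proof -
        have "\<exists>B. B \<in> set (item_box (fst (D ! i)) (fst (snd (D ! i))) (?it i p))"
          using ip(3) by (cases "(fst (D ! i), fst (snd (D ! i)), ?it i p)" rule: item_box.cases) auto
        then obtain B where B: "B \<in> set (item_box (fst (D ! i)) (fst (snd (D ! i))) (?it i p))" ..
        show ?thesis unfolding mks[OF ip(1,2) B, symmetric] am using boxes_layered_I[OF ip(1,2) B] by blast
      qed
      show "?L \<subseteq> ?R"
      proof
        fix z assume "z \<in> ?L"
        then obtain i p where j: "i < length D" "p < length (items (D ! i))" "fst (?it i p) = None" and z: "z = pathstart (g (i, p)) \<or> z = pathfinish (g (i, p))"
          unfolding J_def by blast
        obtain a b' w where it: "?it i p = (None, a, b', w)" using j(3) by (cases "?it i p") auto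
        have mem: "a \<in> set (concat (map item_tops (items (D ! i))))" "b' \<in> set (concat (map item_bots (items (D ! i))))"
          using nth_mem[OF j(2)] unfolding it by force+
        from z show "z \<in> ?R"
        proof
          assume z: "z = pathstart (g (i, p))"
          then have z: "z = Complex a (fst (D ! i))" unfolding ends it by simp
          show ?thesis
          proof (cases i)
            case 0
            have "a \<in> set (mark_xs t)" using mem(1) unfolding 0 h0(3) .
            moreover have "z = Complex a 1" using z unfolding 0 h0(1) .
            ultimately show ?thesis unfolding am by blast
          next
            case (Suc k)
            have k: "k < length D" "Suc k < length D" using j Suc by simp_all
            have jo: "fst (snd (D ! k)) = fst (D ! i)" "concat (map item_bots (items (D ! k))) = concat (map item_tops (items (D ! i)))"
              using good_joins[OF D k(2)] Suc unfolding joins_iff by simp_all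
            have nob: "\<forall>it\<in>set (items (D ! k)). fst it \<noteq> None"
              using alt[OF k(2)] j Suc by (metis nth_mem)
            obtain q where q: "q < length (items (D ! k))" "a \<in> set (item_bots (?it k q))"
              using mem(1) unfolding jo(2)[symmetric] by (rule concat_map_nthE)
            then have "z \<in> (\<lambda>x. Complex x (fst (snd (D ! k)))) ` set (item_bots (?it k q))" unfolding z jo(1) by blast
            then show ?thesis using boxm[OF k(1) q(1)] nob q(1) nth_mem by blast
          qed
        next
          assume z: "z = pathfinish (g (i, p))"
          then have z: "z = Complex b' (fst (snd (D ! i)))" unfolding ends it by simp
          show ?thesis
          proof (cases "i = length D - 1")
            case True
            have "b' \<in> set (mark_xs b)" using mem(2) unfolding True hl(3) .
            moreover have "z = Complex b' (- 1)" using z unfolding True hl(1) .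
            ultimately show ?thesis unfolding am by blast
          next
            case False
            have k: "Suc i < length D" using j False by simp
            have jo: "fst (snd (D ! i)) = fst (D ! Suc i)" "concat (map item_bots (items (D ! i))) = concat (map item_tops (items (D ! Suc i)))"
              using good_joins[OF D k] unfolding joins_iff by simp_all
            have nob: "\<forall>it\<in>set (items (D ! Suc i)). fst it \<noteq> None"
              using alt[OF k] j by (metis nth_mem)
            obtain q where q: "q < length (items (D ! Suc i))" "b' \<in> set (item_tops (?it (Suc i) q))"
              using mem(2) unfolding jo(2) by (rule concat_map_nthE)
            then have "z \<in> (\<lambda>x. Complex x (fst (D ! Suc i))) ` set (item_tops (?it (Suc i) q))" unfolding z jo(1) by blast
            then show ?thesis using boxm[OF k q(1)] nob q(1) nth_mem by blast
          qed
        qed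
      qed
      have st: "Complex a (fst (D ! i)) \<in> ?L" if os: "i < length D" "only_strands (items (D ! i))" "a \<in> set (concat (map item_tops (items (D ! i))))" for a i
      proof -
        obtain b' w where m: "(None, a, b', w) \<in> set (items (D ! i))" using os(3) unfolding only_strands_marks(1)[OF os(2)] by blast
        then obtain p where p: "p < length (items (D ! i))" "?it i p = (None, a, b', w)" unfolding in_set_conv_nth by blast
        then have "pathstart (g (i, p)) = Complex a (fst (D ! i))" unfolding ends by simp
        then show ?thesis using JI[OF os(1) p] by (intro UN_I[of "(i, p)"]) simp_all
      qed
      have fi: "Complex b' (fst (snd (D ! i))) \<in> ?L" if os: "i < length D" "only_strands (items (D ! i))" "b' \<in> set (concat (map item_bots (items (D ! i))))" for b' i
      proof -
        obtain a w where m: "(None, a, b', w) \<in> set (items (D ! i))" using os(3) unfolding only_strands_marks(2)[OF os(2)] by blast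
        then obtain p where p: "p < length (items (D ! i))" "?it i p = (None, a, b', w)" unfolding in_set_conv_nth by blast
        then have "pathfinish (g (i, p)) = Complex b' (fst (snd (D ! i)))" unfolding ends by simp
        then show ?thesis using JI[OF os(1) p] by (intro UN_I[of "(i, p)"]) simp_all
      qed
      show "?R \<subseteq> ?L"
      proof
        fix z assume "z \<in> ?R"
        then consider "z \<in> (\<lambda>x. Complex x 1) ` set (mark_xs t)" | "z \<in> (\<lambda>x. Complex x (-1)) ` set (mark_xs b)" | B where "B \<in> set (boxes (layered b t D))" "z \<in> in_marks B"
          unfolding am by blast
        then show "z \<in> ?L"
        proof cases
          case 1
          then obtain x where x: "z = Complex x 1" "x \<in> set (mark_xs t)" by blast
          show ?thesis using st[OF Dne h0(2)] x unfolding h0(1,3) by simp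
        next
          case 2
          then obtain x where x: "z = Complex x (- 1)" "x \<in> set (mark_xs b)" by blast
          show ?thesis using fi[OF _ hl(2)] Dne x unfolding hl(1,3) by simp
        next
          case (3 B)
          obtain i p where ip: "i < length D" "p < length (items (D ! i))" "B \<in> set (item_box (fst (D ! i)) (fst (snd (D ! i))) (?it i p))"
            using boxes_layered_E[OF 3(1)] .
          have nos: "\<not> only_strands (items (D ! i))" using lab[OF ip] ip(2) unfolding only_strands_def by (metis nth_mem)
          note ne = notend[OF ip(1,2) lab[OF ip]]
          from 3(2) consider x where "x \<in> set (item_tops (?it i p))" "z = Complex x (fst (D ! i))"
            | x where "x \<in> set (item_bots (?it i p))" "z = Complex x (fst (snd (D ! i)))" unfolding mks[OF ip] by blast
          then show ?thesis
          proof cases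
            case 1
            obtain k where k: "i = Suc k" using ne by (cases i) auto
            have jo: "fst (snd (D ! k)) = fst (D ! i)" "concat (map item_bots (items (D ! k))) = concat (map item_tops (items (D ! i)))" "only_strands (items (D ! k))"
              using good_joins[OF D, of k] nos ip k unfolding joins_iff by simp_all
            have "x \<in> set (concat (map item_tops (items (D ! i))))" using 1 nth_mem[OF ip(2)] by auto
            then show ?thesis using fi[of k x] jo 1 ip(1) k by simp
          next
            case 2
            have k: "Suc i < length D" using ne ip(1) by linarith
            have jo: "fst (snd (D ! i)) = fst (D ! Suc i)" "concat (map item_bots (items (D ! i))) = concat (map item_tops (items (D ! Suc i)))" "only_strands (items (D ! Suc i))"
              using good_joins[OF D k] nos unfolding joins_iff by simp_all
            have "x \<in> set (concat (map item_bots (items (D ! i))))" using 2 nth_mem[OF ip(2)] by auto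
            then show ?thesis using st[OF k jo(3)] jo 2 by simp
          qed
        qed
      qed
    qed
  qed
qed

section \<open>Operations on layered tangles\<close>

definition fan :: "(nat \<Rightarrow> real) \<Rightarrow> (nat \<Rightarrow> real) \<Rightarrow> nat \<Rightarrow> 'a item list" where
  "fan p q n = map (\<lambda>j. (None, p j, q j, 0)) [0..<n]"

lemma fan_simps [simp]:
  "concat (map item_tops (fan p q n)) = map p [0..<n]"
  "concat (map item_bots (fan p q n)) = map q [0..<n]"
  "only_strands (fan p q n)"
  "concat (map (item_box u d) (fan p q n)) = []"
  "map fst (fan p q n) = replicate n None"
proof -
  have e: "concat (map (\<lambda>j. [f j]) ys) = map f ys" for f :: "nat \<Rightarrow> real" and ys by (induction ys) auto
  show "concat (map item_tops (fan p q n)) = map p [0..<n]" "concat (map item_bots (fan p q n)) = map q [0..<n]"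
    "only_strands (fan p q n)" "map fst (fan p q n) = replicate n None"
    by (simp_all add: fan_def only_strands_def comp_def map_replicate_const e)
  show "concat (map (item_box u d) (fan p q n)) = []" by (simp add: fan_def comp_def)
qed

lemma fan_strands: "layer_strands (u, d, fan p q n) = (\<Union>j<n. closed_segment (Complex (p j) u) (Complex (q j) d))"
  unfolding fan_def by auto

lemma good_fan:
  assumes "d < u" "\<And>j. j < n \<Longrightarrow> \<bar>p j\<bar> < 1 \<and> \<bar>q j\<bar> < 1" "\<And>i j. i < j \<Longrightarrow> j < n \<Longrightarrow> p i < p j \<and> q i < q j"
  shows "good_layer (u, d, fan p q n)"
  using assms unfolding fan_def by (auto simp: sorted_wrt_iff_nth_less abs_less_iff)

abbreviation layer_tops :: "'a layer \<Rightarrow> real list" where "layer_tops L \<equiv> concat (map item_tops (items L))"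
abbreviation layer_bots :: "'a layer \<Rightarrow> real list" where "layer_bots L \<equiv> concat (map item_bots (items L))"

text \<open>
  The invariant of a part of a layered diagram, between heights \<open>u\<close> and \<open>d\<close>; a good diagram is a block
  from \<open>1\<close> to \<open>-1\<close> with equally spaced marks.
\<close>

definition block :: "real list \<Rightarrow> real \<Rightarrow> real list \<Rightarrow> real \<Rightarrow> 'a layer list \<Rightarrow> bool" where
  "block T u B d D \<longleftrightarrow> D \<noteq> [] \<and> (\<forall>L\<in>set D. good_layer L) \<and> successively joins D \<and>
     fst (hd D) = u \<and> layer_tops (hd D) = T \<and> fst (snd (last D)) = d \<and> layer_bots (last D) = B"

lemma good_iff_block:
  "good b t D \<longleftrightarrow> block (mark_xs t) 1 (mark_xs b) (-1) D \<and> only_strands (items (hd D)) \<and> only_strands (items (last D))"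
proof -
  have "starts_at t L \<longleftrightarrow> fst L = 1 \<and> only_strands (items L) \<and> layer_tops L = mark_xs t" for L :: "'a layer" by (cases L) auto
  moreover have "ends_at b L \<longleftrightarrow> fst (snd L) = -1 \<and> only_strands (items L) \<and> layer_bots L = mark_xs b" for L :: "'a layer" by (cases L) auto
  ultimately show ?thesis unfolding good_def block_def by auto
qed

lemma block_append:
  assumes "block T u M e D1" "block M e B d D2" "only_strands (items (last D1)) \<or> only_strands (items (hd D2))"
  shows "block T u B d (D1 @ D2)"
  using assms unfolding block_def by (auto simp: successively_append_iff joins_iff)

lemma block_single: "good_layer L \<Longrightarrow> fst L = u \<Longrightarrow> fst (snd L) = d \<Longrightarrow> layer_tops L = T \<Longrightarrow> layer_bots L = B \<Longrightarrow> block T u B d [L]"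
  unfolding block_def by simp

fun rescale_item :: "real \<Rightarrow> real \<Rightarrow> 'a item \<Rightarrow> 'a item" where
  "rescale_item p w (lab, a, b, v) = (lab, p + w * a, p + w * b, w * v)"

fun rescale :: "real \<Rightarrow> real \<Rightarrow> real \<Rightarrow> real \<Rightarrow> 'a layer \<Rightarrow> 'a layer" where
  "rescale p q w h (u, d, I) = (q + h * u, q + h * d, map (rescale_item p w) I)"

lemma rescale_sel [simp]: "fst (rescale p q w h L) = q + h * fst L" "fst (snd (rescale p q w h L)) = q + h * fst (snd L)"
    "items (rescale p q w h L) = map (rescale_item p w) (items L)"
  by (cases L; simp)+

lemma fst_rescale_item [simp]: "fst (rescale_item p w it) = fst it" by (cases it) simp

lemma rescale_item_marks [simp]:
  "item_tops (rescale_item p w it) = map (\<lambda>x. p + w * x) (item_tops it)"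
  "item_bots (rescale_item p w it) = map (\<lambda>x. p + w * x) (item_bots it)"
proof -
  obtain lab a b v where it: "it = (lab, a, b, v)" by (cases it) auto
  have "(item_tops (rescale_item p w it) = map (\<lambda>x. p + w * x) (item_tops it)) \<and> item_bots (rescale_item p w it) = map (\<lambda>x. p + w * x) (item_bots it)"
  proof (cases lab)
    case (Some y)
    obtain k l x where "y = (k, l, x)" by (cases y) auto
    then show ?thesis unfolding it Some by (simp add: algebra_simps)
  qed (simp add: it)
  then show "item_tops (rescale_item p w it) = map (\<lambda>x. p + w * x) (item_tops it)" "item_bots (rescale_item p w it) = map (\<lambda>x. p + w * x) (item_bots it)" by auto
qed

lemma only_strands_rescale [simp]: "only_strands (map (rescale_item p w) I) \<longleftrightarrow> only_strands I"
  unfolding only_strands_def by auto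

lemma rescale_marks [simp]:
  "concat (map item_tops (map (rescale_item p w) I)) = map (\<lambda>x. p + w * x) (concat (map item_tops I))"
  "concat (map item_bots (map (rescale_item p w) I)) = map (\<lambda>x. p + w * x) (concat (map item_bots I))"
  "concat (map (item_tops \<circ> rescale_item p w) I) = map (\<lambda>x. p + w * x) (concat (map item_tops I))"
  "concat (map (item_bots \<circ> rescale_item p w) I) = map (\<lambda>x. p + w * x) (concat (map item_bots I))"
  by (induction I) auto

lemma good_item_rescale:
  assumes "good_item it" "0 < w" "\<bar>p\<bar> + w \<le> 1"
  shows "good_item (rescale_item p w it)"
proof -
  obtain lab a b v where it: "it = (lab, a, b, v)" by (cases it) auto
  have *: "-1 < p + w * x" "p + w * x < 1" if "-1 < x" "x < 1" for x
  proof -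
    have "w * x < w * 1" "w * (-1) < w * x" using that assms(2) by (intro mult_strict_left_mono; simp)+
    then show "-1 < p + w * x" "p + w * x < 1" using assms(3) by linarith+
  qed
  have "-1 < a - v" "a + v < 1" "-1 < b - v" "b + v < 1" and v: "0 \<le> v" using assms(1) unfolding it by (cases lab; auto)+
  then have "-1 < a + v" "b + v > -1" "a - v < 1" "b - v < 1" by linarith+
  then have "-1 < p + w * (a - v)" "p + w * (a + v) < 1" "-1 < p + w * (b - v)" "p + w * (b + v) < 1"
    using * \<open>-1 < a - v\<close> \<open>a + v < 1\<close> \<open>-1 < b - v\<close> \<open>b + v < 1\<close> by blast+
  then show ?thesis using assms(1,2) unfolding it by (cases lab) (auto simp: algebra_simps)
qed

lemma left_of_rescale: "0 < w \<Longrightarrow> left_of (rescale_item p w it) (rescale_item p w jt) \<longleftrightarrow> left_of it jt"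
proof -
  assume w: "0 < w"
  obtain lab a b v where it: "it = (lab, a, b, v)" by (cases it) auto
  obtain lab' a' b' v' where jt: "jt = (lab', a', b', v')" by (cases jt) auto
  have e: "p + w * x + w * y < p + w * x' - w * y' \<longleftrightarrow> x + y < x' - y'" for x y x' y'
  proof -
    have "p + w * x + w * y < p + w * x' - w * y' \<longleftrightarrow> w * (x + y) < w * (x' - y')" by (simp add: algebra_simps)
    then show ?thesis using w by simp
  qed
  show ?thesis unfolding it jt by (simp add: e)
qed

lemma good_layer_rescale:
  assumes "good_layer L" "0 < w" "\<bar>p\<bar> + w \<le> 1" "0 < h"
  shows "good_layer (rescale p q w h L)"
proof -
  obtain u d I where L: "L = (u, d, I)" by (cases L) auto
  have g: "d < u" "\<forall>it\<in>set I. good_item it" "sorted_wrt left_of I" using assms(1) unfolding L by simp_all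
  have "\<forall>it\<in>set (map (rescale_item p w) I). good_item it"
    unfolding set_map ball_simps using g(2) good_item_rescale[OF _ assms(2,3)] by blast
  then show ?thesis using g assms(4) unfolding L
    by (simp add: sorted_wrt_map left_of_rescale[OF assms(2)])
qed

lemma block_rescale:
  fixes D :: "'a layer list"
  assumes "block T u B d D" "0 < w" "\<bar>p\<bar> + w \<le> 1" "0 < h"
  shows "block (map (\<lambda>x. p + w * x) T) (q + h * u) (map (\<lambda>x. p + w * x) B) (q + h * d) (map (rescale p q w h) D)"
proof -
  note g = assms(1)[unfolded block_def]
  have j: "joins (rescale p q w h L) (rescale p q w h L')" if "joins L L'" for L L' :: "'a layer"
    using that unfolding joins_iff rescale_sel rescale_marks only_strands_rescale by simp
  show ?thesis unfolding block_def
  proof (intro conjI ballI)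
    fix L assume "L \<in> set (map (rescale p q w h) D)"
    then obtain M :: "'a layer" where M: "M \<in> set D" "L = rescale p q w h M" unfolding set_map by (rule imageE)
    have "good_layer M" using g M(1) by blast
    then show "good_layer L" unfolding M(2) by (rule good_layer_rescale[OF _ assms(2-4)])
  next
    show "successively joins (map (rescale p q w h) D)"
      unfolding successively_map using g j by (blast intro: successively_mono)
  qed (use g in \<open>simp_all add: hd_map last_map\<close>)
qed

lemma rescale_geometry:
  assumes "0 < w" "0 < h"
  shows "layer_boxes (rescale p q w h L) = map (\<lambda>B. (in_bot B, in_top B, place (Complex p q) w h \<circ> in_map B)) (layer_boxes L)"
    and "layer_strands (rescale p q w h L) = place (Complex p q) w h ` layer_strands L"
proof -
  obtain u d I where L: "L = (u, d, I)" by (cases L) auto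
  have pp: "place (Complex p q) w h \<circ> place (Complex a c) v k = place (Complex (p + w * a) (q + h * c)) (w * v) (h * k)" for a c v k
    unfolding place_def by (auto simp: fun_eq_iff complex_eq_iff algebra_simps)
  have e: "(q + h * u + (q + h * d)) / 2 = q + h * ((u + d) / 2)" "(q + h * u - (q + h * d)) / 2 = h * ((u - d) / 2)"
    by (simp_all add: field_simps)
  have ib: "item_box (q + h * u) (q + h * d) (rescale_item p w it) = map (\<lambda>B. (in_bot B, in_top B, place (Complex p q) w h \<circ> in_map B)) (item_box u d it)" for it :: "'a item"
  proof -
    obtain lab a b v where it: "it = (lab, a, b, v)" by (cases it) auto
    show ?thesis
    proof (cases lab)
      case (Some y)
      obtain k l x where y: "y = (k, l, x)" by (cases y) auto
      show ?thesis unfolding it Some y rescale_item.simps item_box.simps e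
        by (simp add: in_bot_def in_top_def in_map_def pp)
    qed (simp add: it)
  qed
  show "layer_boxes (rescale p q w h L) = map (\<lambda>B. (in_bot B, in_top B, place (Complex p q) w h \<circ> in_map B)) (layer_boxes L)"
    unfolding L by (simp add: map_concat comp_def ib)
  have seg: "closed_segment (place (Complex p q) w h x) (place (Complex p q) w h y) = place (Complex p q) w h ` closed_segment x y" for x y
  proof -
    have lin: "linear (\<lambda>z. Complex (w * Re z) (h * Im z))"
      by (rule linearI) (auto simp: complex_eq_iff algebra_simps)
    have "place (Complex p q) w h = (\<lambda>x. Complex p q + x) \<circ> (\<lambda>z. Complex (w * Re z) (h * Im z))"
      unfolding place_def by (simp add: fun_eq_iff)
    then show ?thesis
      using closed_segment_linear_image[OF lin, of x y] closed_segment_translation[of "Complex p q"]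
      by (simp add: image_image)
  qed
  have ist: "item_strand (q + h * u) (q + h * d) (rescale_item p w it) = place (Complex p q) w h ` item_strand u d it" for it :: "'a item"
  proof -
    obtain lab a b v where it: "it = (lab, a, b, v)" by (cases it) auto
    have "Complex (p + w * x) (q + h * y) = place (Complex p q) w h (Complex x y)" for x y
      unfolding place_def by (simp add: complex_eq_iff)
    then show ?thesis unfolding it by (cases lab) (simp_all add: seg)
  qed
  show "layer_strands (rescale p q w h L) = place (Complex p q) w h ` layer_strands L"
    unfolding L by (simp add: image_UN ist)
qed

lemma layered_rescale:
  assumes "0 < w" "0 < h"
  shows "boxes (layered b' t' (map (rescale p q w h) D)) = map (\<lambda>B. (in_bot B, in_top B, place (Complex p q) w h \<circ> in_map B)) (boxes (layered b t D))"
    and "strands (layered b' t' (map (rescale p q w h) D)) = place (Complex p q) w h ` strands (layered b t D)"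
  unfolding layered_def by (simp_all add: map_concat comp_def rescale_geometry[OF assms] image_UN)

lemma shape_rescale [simp]: "shape (map (rescale p q w h) D) = shape D"
  unfolding shape_def by (simp add: case_prod_beta comp_def)

lemma shape_append [simp]: "shape (D @ D') = shape D @ shape D'" "shape (L # D') = map fst (items L) # shape D'" "shape [] = []"
  unfolding shape_def by (simp_all add: case_prod_beta)

subsection \<open>Labels\<close>

fun item_labels :: "(nat \<times> nat \<times> 'a) option \<Rightarrow> 'a list" where
  "item_labels None = []" | "item_labels (Some (k, l, x)) = [x]"

definition labels :: "(nat \<times> nat \<times> 'a) option list list \<Rightarrow> 'a list" where
  "labels \<tau> = concat (map (\<lambda>I. concat (map item_labels I)) \<tau>)"

lemma labels_simps [simp]: "labels [] = []" "labels (I # \<tau>) = concat (map item_labels I) @ labels \<tau>" "labels (\<sigma> @ \<tau>) = labels \<sigma> @ labels \<tau>"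
  unfolding labels_def by auto

definition well_labelled :: "('a, 'b) planar_alg_scheme \<Rightarrow> (nat \<times> nat \<times> 'a) option list list \<Rightarrow> bool" where
  "well_labelled A \<tau> \<longleftrightarrow> (\<forall>I\<in>set \<tau>. \<forall>k l x. Some (k, l, x) \<in> set I \<longrightarrow> x \<in> spc A k l)"

lemma labelling_iff: "labelling A T ys \<longleftrightarrow> list_all2 (\<lambda>B x. x \<in> spc A (in_bot B) (in_top B)) (boxes T) ys"
  unfolding labelling_def list_all2_conv_all_nth by auto

lemma labelling_layered:
  assumes "well_labelled A (shape D)"
  shows "labelling A (layered b t D) (labels (shape D))"
  using assms unfolding labelling_iff
proof (induction D)
  case Nil then show ?case by (simp add: layered_def)
next
  case (Cons L D)
  obtain u d I where L: "L = (u, d, I)" by (cases L) auto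
  have "\<forall>k l x. Some (k, l, x) \<in> set (map fst I) \<longrightarrow> x \<in> spc A k l" using Cons.prems unfolding L well_labelled_def by auto
  then have "list_all2 (\<lambda>B x. x \<in> spc A (in_bot B) (in_top B)) (concat (map (item_box u d) I)) (concat (map item_labels (map fst I)))"
  proof (induction I)
    case (Cons it I)
    have "list_all2 (\<lambda>B x. x \<in> spc A (in_bot B) (in_top B)) (item_box u d it) (item_labels (fst it))"
      using Cons.prems by (cases "(u, d, it)" rule: item_box.cases) (auto simp: in_bot_def in_top_def)
    then show ?case using Cons by (auto intro: list_all2_appendI)
  qed simp
  moreover have "list_all2 (\<lambda>B x. x \<in> spc A (in_bot B) (in_top B)) (boxes (layered b t D)) (labels (shape D))"
    using Cons.IH Cons.prems unfolding well_labelled_def by simp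
  ultimately show ?case unfolding layered_def L by (auto intro: list_all2_appendI)
qed

lemma layered_lengths: "length (labels (shape D)) = length (boxes (layered b t D))"
proof -
  have "length (item_labels (fst it)) = length (item_box u d it)" for u d and it :: "'a item"
    by (cases "(u, d, it)" rule: item_box.cases) auto
  then have "length (concat (map item_labels (map fst I))) = length (concat (map (item_box u d) I))" for u d and I :: "'a item list"
    by (induction I) auto
  then have "length (concat (map item_labels (map fst (items L)))) = length (layer_boxes L)" for L :: "'a layer"
    by (cases L) simp
  then show ?thesis unfolding layered_def by (induction D) auto
qed

text \<open>By \<open>layered_isotopy\<close>, a shape has at most one value and every good diagram of the shape computes it.\<close>

definition evaluates :: "('a, 'b) planar_alg_scheme \<Rightarrow> (nat \<times> nat \<times> 'a) option list list \<Rightarrow> nat \<Rightarrow> nat \<Rightarrow> 'a \<Rightarrow> bool" where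
  "evaluates A \<tau> b t v \<longleftrightarrow> well_labelled A \<tau> \<and> (\<exists>D. good b t D \<and> shape D = \<tau> \<and> planar_tangle (layered b t D) \<and> v = act A (layered b t D) (labels \<tau>))"

lemma planar_algebra_axioms:
  assumes "unshaded_planar_algebra A"
  shows act_closed: "planar_tangle T \<Longrightarrow> labelling A T ys \<Longrightarrow> act A T ys \<in> spc A (bots T) (tops T)"
    and act_isotopic: "planar_tangle T \<Longrightarrow> planar_tangle T' \<Longrightarrow> isotopic T T' \<Longrightarrow> labelling A T ys \<Longrightarrow> act A T ys = act A T' ys"
    and act_permute: "planar_tangle T \<Longrightarrow> labelling A T ys \<Longrightarrow> bij_betw \<pi> {..<length ys} {..<length ys} \<Longrightarrow>
          act A (permute_boxes \<pi> T) (map (\<lambda>k. ys ! \<pi> k) [0..<length ys]) = act A T ys"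
    and act_glue: "planar_tangle T \<Longrightarrow> planar_tangle S \<Longrightarrow> labelling A T ys \<Longrightarrow> labelling A S zs \<Longrightarrow> i < length ys \<Longrightarrow>
       bots S = in_bot (boxes T ! i) \<Longrightarrow> tops S = in_top (boxes T ! i) \<Longrightarrow> ys ! i = act A S zs \<Longrightarrow>
          act A (glue T i S) (take i ys @ zs @ drop (Suc i) ys) = act A T ys"
    and act_unit: "x \<in> spc A b t \<Longrightarrow> act A (unit_tangle b t) [x] = x"
    and act_add: "planar_tangle T \<Longrightarrow> i < length ys \<Longrightarrow> labelling A T (ys[i := x]) \<Longrightarrow> labelling A T (ys[i := y]) \<Longrightarrow>
          act A T (ys[i := x + y]) = act A T (ys[i := x]) + act A T (ys[i := y])"
    and act_scl: "planar_tangle T \<Longrightarrow> i < length ys \<Longrightarrow> labelling A T (ys[i := x]) \<Longrightarrow>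
          act A T (ys[i := scl A c x]) = scl A c (act A T (ys[i := x]))"
    and vs: "vector_space (scl A)" and subsp: "module.subspace (scl A) (spc A b t)"
  using assms unfolding unshaded_planar_algebra_def by (elim conjE; simp; fail)+

text \<open>
  Gluing concatenates lists of boxes in an order that depends on how a diagram is assembled; only the
  multiset of labelled boxes matters.
\<close>

lemma act_perm:
  assumes A: "unshaded_planar_algebra A" and T: "planar_tangle T" "labelling A T ys"
    and T': "bots T' = bots T" "tops T' = tops T" "strands T' = strands T" "length ys' = length (boxes T')"
    and m: "mset (zip (boxes T) ys) = mset (zip (boxes T') ys')"
  shows "planar_tangle T'" "labelling A T' ys'" "act A T' ys' = act A T ys"
proof -
  have len: "length (boxes T) = length ys" using T(2) unfolding labelling_def by simp
  have len': "length ys' = length ys" using arg_cong[OF m, of size] T'(4) len by simp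
  obtain \<pi> where p: "\<pi> permutes {..<length ys}" "permute_list \<pi> (zip (boxes T) ys) = zip (boxes T') ys'"
    using mset_eq_permutation[OF m[symmetric]] len by auto
  have zz: "zip (boxes T') ys' = zip (permute_list \<pi> (boxes T)) (permute_list \<pi> ys)"
    using p(2) permute_list_zip[OF p(1) _ len] len by simp
  have b: "boxes T' = permute_list \<pi> (boxes T)" and y: "ys' = permute_list \<pi> ys"
    using arg_cong[OF zz, of "map fst"] arg_cong[OF zz, of "map snd"] len len' T'(4) by simp_all
  have T'e: "T' = permute_boxes \<pi> T"
    using T' b unfolding permute_boxes_def permute_list_def by (intro tangle.equality) simp_all
  have bij: "bij_betw \<pi> {..<length ys} {..<length ys}" using p(1) by (rule permutes_imp_bij)
  have setb: "set (boxes T') = set (boxes T)" using p(1) len unfolding b by simp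
  have "mset (boxes T') = mset (boxes T)" using p(1) len unfolding b by simp
  have sy: "symp_on (set (boxes T)) (\<lambda>B B'. in_region B \<inter> in_region B' = {})" by (auto intro: symp_onI)
  show "planar_tangle T'"
    unfolding planar_tangle_def
  proof (intro conjI)
    show "\<forall>i<length (boxes T'). \<forall>j<length (boxes T'). i \<noteq> j \<longrightarrow> in_region (boxes T' ! i) \<inter> in_region (boxes T' ! j) = {}"
    proof (intro allI impI)
      fix i j assume ij: "i < length (boxes T')" "j < length (boxes T')" "i \<noteq> j"
      then have l: "i < length ys" "j < length ys" using len' T'(4) by simp_all
      have "\<pi> i < length (boxes T)" "\<pi> j < length (boxes T)" "\<pi> i \<noteq> \<pi> j"
        using permutes_in_image[OF p(1)] permutes_inj[OF p(1)] l ij(3) len by (auto dest: injD)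
      then have "in_region (boxes T ! \<pi> i) \<inter> in_region (boxes T ! \<pi> j) = {}" using T(1) unfolding planar_tangle_def by blast
      then show "in_region (boxes T' ! i) \<inter> in_region (boxes T' ! j) = {}"
        unfolding b permute_list_def using l len by simp
    qed
    have am: "all_marks T' = all_marks T" unfolding all_marks_def T' setb ..
    show "\<exists>S. finite S \<and> disjoint S \<and> strands T' = \<Union> S \<and> (\<forall>C\<in>S. is_strand (all_marks T') C)"
      using T(1) unfolding am T' planar_tangle_def by (elim conjE)
  qed (use T(1) in \<open>simp_all add: planar_tangle_def setb T'\<close>)
  show "labelling A T' ys'"
    unfolding labelling_def
  proof (intro conjI allI impI)
    show "length ys' = length (boxes T')" by fact
    fix i assume "i < length ys'"
    then have i: "i < length ys" using len' by simp
    have "\<pi> i < length ys" using permutes_in_image[OF p(1)] i by auto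
    then have "ys ! \<pi> i \<in> spc A (in_bot (boxes T ! \<pi> i)) (in_top (boxes T ! \<pi> i))"
      using T(2) unfolding labelling_def by blast
    then show "ys' ! i \<in> spc A (in_bot (boxes T' ! i)) (in_top (boxes T' ! i))"
      unfolding b y permute_list_def using i len by simp
  qed
  show "act A T' ys' = act A T ys"
    using act_permute[OF A T bij] unfolding T'e y permute_list_def .
qed

section \<open>The value of a layered diagram\<close>

abbreviation Id :: "nat \<Rightarrow> 'a option list" where "Id k \<equiv> replicate k None"

lemma layered_sel [simp]: "bots (layered b t D) = b" "tops (layered b t D) = t"
  unfolding layered_def by simp_all

lemma evaluates_unique:
  assumes A: "unshaded_planar_algebra A" and "evaluates A \<tau> b t u" "evaluates A \<tau> b t v"
  shows "u = v"
proof -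
  obtain D where D: "good b t D" "shape D = \<tau>" "planar_tangle (layered b t D)" "u = act A (layered b t D) (labels \<tau>)" and ok: "well_labelled A \<tau>"
    using assms(2) unfolding evaluates_def by blast
  obtain E where E: "good b t E" "shape E = \<tau>" "planar_tangle (layered b t E)" "v = act A (layered b t E) (labels \<tau>)"
    using assms(3) unfolding evaluates_def by blast
  have "isotopic (layered b t D) (layered b t E)" using layered_isotopy(2)[OF D(1) E(1) _ D(3)] D(2) E(2) by simp
  then show ?thesis using act_isotopic[OF A D(3) E(3)] labelling_layered[of A D b t] ok D E by metis
qed

lemma evaluates_mem: "unshaded_planar_algebra A \<Longrightarrow> evaluates A \<tau> b t v \<Longrightarrow> v \<in> spc A b t"
  unfolding evaluates_def using act_closed labelling_layered by (metis layered_sel)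

lemma evaluates_realise:
  assumes A: "unshaded_planar_algebra A" and v: "evaluates A \<tau> b t v" and D: "good b t D" "shape D = \<tau>"
  shows "planar_tangle (layered b t D)" "v = act A (layered b t D) (labels \<tau>)"
proof -
  obtain E where E: "good b t E" "shape E = \<tau>" "planar_tangle (layered b t E)" and ok: "well_labelled A \<tau>"
    using v unfolding evaluates_def by blast
  show p: "planar_tangle (layered b t D)" using layered_isotopy(1)[OF E(1) D(1) _ E(3)] E(2) D(2) by simp
  then have "evaluates A \<tau> b t (act A (layered b t D) (labels \<tau>))" unfolding evaluates_def using D ok by blast
  then show "v = act A (layered b t D) (labels \<tau>)" by (rule evaluates_unique[OF A v])
qed

lemma xpos_strict: "i < j \<Longrightarrow> j < k \<Longrightarrow> xpos k i < xpos k j"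
  using xpos_less_iff by blast

lemma xpos_abs: "j < k \<Longrightarrow> \<bar>xpos k j\<bar> < 1"
  using xpos_bounds[of j k] by linarith

lemma xpos_abs2: "j < k \<Longrightarrow> \<bar>xpos k j\<bar> < 2"
  using xpos_abs[of j k] by simp

lemma place_marks:
  "place (Complex p q) w h (top_mark k j) = Complex (p + w * xpos k j) (q + h)"
  "place (Complex p q) w h (bot_mark k j) = Complex (p + w * xpos k j) (q - h)"
  unfolding place_def top_mark_def bot_mark_def by (simp_all add: complex_eq_iff)

subsection \<open>The elementary tangles are layered\<close>

definition unit_layers :: "nat \<Rightarrow> nat \<Rightarrow> 'a \<Rightarrow> 'a layer list" where
  "unit_layers b t x = [(1, 1/2, fan (xpos t) (\<lambda>j. xpos t j / 2) t), (1/2, -1/2, [(Some (b, t, x), 0, 0, 1/2)]),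
     (-1/2, -1, fan (\<lambda>j. xpos b j / 2) (xpos b) b)]"

lemma good_unit_layers: "good b t (unit_layers b t x)"
  unfolding good_def unit_layers_def
  by (auto intro!: good_fan simp del: good_layer.simps simp: xpos_strict xpos_abs xpos_abs2) simp

lemma unit_tangle_layered: "unit_tangle b t = layered b t (unit_layers b t x)"
proof -
  have p0: "place 0 (1/2) (1/2) = place (Complex 0 0) (1/2) (1/2)"
    unfolding place_def by (simp add: fun_eq_iff complex_eq_iff)
  have "(\<Union>m\<in>marks b t. closed_segment (place 0 (1/2) (1/2) m) m) =
     (\<Union>j<t. closed_segment (Complex (xpos t j) 1) (Complex (xpos t j / 2) (1/2))) \<union>
     (\<Union>j<b. closed_segment (Complex (xpos b j / 2) (-1/2)) (Complex (xpos b j) (-1)))"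
  proof -
    have t: "closed_segment (place 0 (1/2) (1/2) (top_mark t j)) (top_mark t j) = closed_segment (Complex (xpos t j) 1) (Complex (xpos t j / 2) (1/2))" for j
      unfolding p0 place_marks by (simp add: top_mark_def closed_segment_commute)
    have b: "closed_segment (place 0 (1/2) (1/2) (bot_mark b j)) (bot_mark b j) = closed_segment (Complex (xpos b j / 2) (-1/2)) (Complex (xpos b j) (-1))" for j
      unfolding p0 place_marks by (simp add: bot_mark_def)
    show ?thesis unfolding marks_def by (simp only: UN_Un image_UN UN_simps t b) blast
  qed
  then show ?thesis unfolding unit_tangle_def layered_def unit_layers_def p0
    by (simp add: fan_strands del: layer_strands.simps) simp
qed

definition mult_layers :: "nat \<Rightarrow> nat \<Rightarrow> nat \<Rightarrow> 'a \<Rightarrow> 'a \<Rightarrow> 'a layer list" where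
  "mult_layers b c t x y = [(1, 3/4, fan (xpos t) (\<lambda>j. xpos t j / 2) t), (3/4, 1/4, [(Some (c, t, x), 0, 0, 1/2)]),
     (1/4, -1/4, fan (\<lambda>j. xpos c j / 2) (\<lambda>j. xpos c j / 2) c), (-1/4, -3/4, [(Some (b, c, y), 0, 0, 1/2)]),
     (-3/4, -1, fan (\<lambda>j. xpos b j / 2) (xpos b) b)]"

lemma good_mult_layers: "good b t (mult_layers b c t x y)"
  unfolding good_def mult_layers_def
  by (auto intro!: good_fan simp del: good_layer.simps simp: xpos_strict xpos_abs xpos_abs2) simp_all

lemma mult_tangle_layered: "mult_tangle b c t = layered b t (mult_layers b c t x y)"
proof -
  have s1: "closed_segment (place (Complex 0 (1/2)) (1/2) (1/4) (top_mark t j)) (top_mark t j) = closed_segment (Complex (xpos t j) 1) (Complex (xpos t j / 2) (3/4))" for j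
    unfolding place_marks by (simp add: top_mark_def closed_segment_commute)
  have s2: "closed_segment (place (Complex 0 (-1/2)) (1/2) (1/4) (top_mark c j)) (place (Complex 0 (1/2)) (1/2) (1/4) (bot_mark c j)) =
      closed_segment (Complex (xpos c j / 2) (1/4)) (Complex (xpos c j / 2) (-1/4))" for j
    unfolding place_marks by (simp add: closed_segment_commute)
  have s3: "closed_segment (bot_mark b j) (place (Complex 0 (-1/2)) (1/2) (1/4) (bot_mark b j)) =
      closed_segment (Complex (xpos b j / 2) (-3/4)) (Complex (xpos b j) (-1))" for j
    unfolding place_marks by (simp add: bot_mark_def closed_segment_commute)
  show ?thesis unfolding mult_tangle_def layered_def mult_layers_def Let_def s1 s2 s3
    by (simp add: fan_strands Un_ac del: layer_strands.simps) simp
qed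

definition pair_x :: "nat \<Rightarrow> nat \<Rightarrow> nat \<Rightarrow> real" where
  "pair_x t t' j = (if j < t then - 1/2 + xpos t j / 4 else 1/2 + xpos t' (j - t) / 4)"

definition tensor_layers :: "nat \<Rightarrow> nat \<Rightarrow> nat \<Rightarrow> nat \<Rightarrow> 'a \<Rightarrow> 'a \<Rightarrow> 'a layer list" where
  "tensor_layers b t b' t' x y = [(1, 1/2, fan (xpos (t + t')) (pair_x t t') (t + t')),
     (1/2, -1/2, [(Some (b, t, x), -1/2, -1/2, 1/4), (Some (b', t', y), 1/2, 1/2, 1/4)]),
     (-1/2, -1, fan (pair_x b b') (xpos (b + b')) (b + b'))]"

lemma pair_x_bounds:
  "j < t + t' \<Longrightarrow> \<bar>pair_x t t' j\<bar> < 1" "i < j \<Longrightarrow> j < t + t' \<Longrightarrow> pair_x t t' i < pair_x t t' j"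
proof -
  have a: "-1 < xpos t j \<and> xpos t j < 1" if "j < t" for j t using xpos_bounds[OF that] by simp
  show "\<bar>pair_x t t' j\<bar> < 1" if "j < t + t'"
  proof (cases "j < t")
    case False
    then have "j - t < t'" using that by simp
    then show ?thesis using a[of "j - t" t'] False unfolding pair_x_def by simp
  next
    case True then show ?thesis using a[of j t] unfolding pair_x_def by simp
  qed
  show "pair_x t t' i < pair_x t t' j" if "i < j" "j < t + t'"
  proof -
    consider "j < t" | "i < t" "\<not> j < t" | "\<not> i < t" "\<not> j < t" using that by linarith
    then show ?thesis
    proof cases
      case 1 then show ?thesis using xpos_strict[of i j t] that unfolding pair_x_def by simp
    next
      case 2
      then have "j - t < t'" using that by simp
      then show ?thesis using 2 a[of i t] a[of "j - t" t'] unfolding pair_x_def by simp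
    next
      case 3
      then have "i - t < j - t" "j - t < t'" using that by simp_all
      then show ?thesis using 3 xpos_strict[of "i - t" "j - t" t'] unfolding pair_x_def by simp
    qed
  qed
qed

lemma map_upt_add: "map q [0..<m + n] = map q [0..<m] @ map (\<lambda>j. q (m + j)) [0..<n]"
proof -
  have "[0..<m + n] = [0..<m] @ map (\<lambda>j. m + j) [0..<n]"
    by (rule nth_equalityI) (auto simp: nth_append)
  then show ?thesis by (simp add: comp_def)
qed

lemma UN_lt_add: "(\<Union>j<m + n. f j) = (\<Union>j<m. f j) \<union> (\<Union>j<n. f (m + j))" for m n :: nat
proof -
  have "{..<m + n} = {..<m} \<union> (\<lambda>j. m + j) ` {..<n}"
  proof (intro equalityI subsetI)
    fix x assume x: "x \<in> {..<m + n}"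
    show "x \<in> {..<m} \<union> (\<lambda>j. m + j) ` {..<n}"
    proof (cases "x < m")
      case False
      then have "x = m + (x - m)" "x - m < n" using x by auto
      then show ?thesis by blast
    qed simp
  qed auto
  then show ?thesis by simp
qed

lemma pair_x_marks: "map (pair_x m n) [0..<m + n] = map (\<lambda>x. - 1/2 + 1/4 * x) (mark_xs m) @ map (\<lambda>x. 1/2 + 1/4 * x) (mark_xs n)"
  unfolding map_upt_add by (simp add: pair_x_def comp_def)

lemma good_tensor_layers: "good (b + b') (t + t') (tensor_layers b t b' t' x y)"
proof -
  have "good_layer (1, 1/2, fan (xpos (t + t')) (pair_x t t') (t + t'))" "good_layer (-1/2, -1, fan (pair_x b b') (xpos (b + b')) (b + b'))"
    by (intro good_fan; simp add: xpos_abs xpos_strict pair_x_bounds)+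
  moreover have "good_layer (1/2, -1/2, [(Some (b, t, x), -1/2, -1/2, 1/4), (Some (b', t', y), 1/2, 1/2, 1/4)])" by simp
  ultimately show ?thesis
    unfolding good_def tensor_layers_def by (simp add: pair_x_marks comp_def del: upt_Suc good_layer.simps)
qed

lemma tensor_tangle_layered: "tensor_tangle b t b' t' = layered (b + b') (t + t') (tensor_layers b t b' t' x y)"
proof -
  have s1: "(\<Union>j<t. closed_segment (place (Complex (-1/2) 0) (1/4) (1/2) (top_mark t j)) (top_mark (t + t') j)) =
     (\<Union>j<t. closed_segment (Complex (xpos (t + t') j) 1) (Complex (pair_x t t' j) (1/2)))"
    unfolding place_marks pair_x_def by (simp add: top_mark_def closed_segment_commute)
  have s2: "closed_segment (place (Complex (1/2) 0) (1/4) (1/2) (top_mark t' j)) (top_mark (t + t') (t + j)) =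
     closed_segment (Complex (xpos (t + t') (t + j)) 1) (Complex (pair_x t t' (t + j)) (1/2))" for j
    unfolding place_marks pair_x_def by (simp add: top_mark_def closed_segment_commute)
  have s3: "(\<Union>j<b. closed_segment (place (Complex (-1/2) 0) (1/4) (1/2) (bot_mark b j)) (bot_mark (b + b') j)) =
     (\<Union>j<b. closed_segment (Complex (pair_x b b' j) (-1/2)) (Complex (xpos (b + b') j) (-1)))"
    unfolding place_marks pair_x_def by (simp add: bot_mark_def)
  have s4: "closed_segment (place (Complex (1/2) 0) (1/4) (1/2) (bot_mark b' j)) (bot_mark (b + b') (b + j)) =
     closed_segment (Complex (pair_x b b' (b + j)) (-1/2)) (Complex (xpos (b + b') (b + j)) (-1))" for j
    unfolding place_marks pair_x_def by (simp add: bot_mark_def)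
  show ?thesis unfolding tensor_tangle_def layered_def tensor_layers_def Let_def s1 s2 s3 s4
    by (simp add: fan_strands UN_lt_add Un_ac del: layer_strands.simps) simp
qed

lemma planar_unit: "planar_tangle (unit_tangle b t)"
  unfolding unit_tangle_layered[of b t "undefined :: nat"]
  by (rule planar_layered_alternating[OF good_unit_layers]) (auto simp: unit_layers_def less_Suc_eq nth_Cons')

lemma planar_mult: "planar_tangle (mult_tangle b c t)"
  unfolding mult_tangle_layered[of b c t "undefined :: nat" "undefined :: nat"]
  by (rule planar_layered_alternating[OF good_mult_layers]) (auto simp: mult_layers_def less_Suc_eq nth_Cons')

lemma planar_tensor: "planar_tangle (tensor_tangle b t b' t')"
  unfolding tensor_tangle_layered[of b t b' t' "undefined :: nat" "undefined :: nat"]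
  by (rule planar_layered_alternating[OF good_tensor_layers]) (auto simp: tensor_layers_def less_Suc_eq nth_Cons')

definition id_layers :: "nat \<Rightarrow> 'a layer list" where
  "id_layers k = [(1, -1, fan (xpos k) (xpos k) k)]"

lemma good_id_layers: "good k k (id_layers k)"
  unfolding good_def id_layers_def
  by (auto intro!: good_fan simp del: good_layer.simps simp: xpos_strict xpos_abs)

definition one :: "('a, 'b) planar_alg_scheme \<Rightarrow> nat \<Rightarrow> 'a" where
  "one A k = act A (layered k k (id_layers k :: 'a layer list)) []"

lemma evaluates_one: "evaluates A [Id k] k k (one A k)"
proof -
  have "planar_tangle (layered k k (id_layers k :: 'a layer list))"
    by (rule planar_layered_alternating[OF good_id_layers]) (auto simp: id_layers_def)
  moreover have "shape (id_layers k) = [Id k]" "labels [Id k :: (nat \<times> nat \<times> 'a) option list] = []"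
    by (simp_all add: id_layers_def)
  moreover have "well_labelled A [Id k]" unfolding well_labelled_def by auto
  ultimately show ?thesis unfolding evaluates_def one_def using good_id_layers by metis
qed

lemma one_strand: "one A 1 = strand A"
proof -
  have "layered 1 1 (id_layers 1 :: 'a layer list) = strand_tangle"
    unfolding layered_def id_layers_def strand_tangle_def
    by (simp add: fan_strands bot_mark_def top_mark_def closed_segment_commute lessThan_Suc del: layer_strands.simps)
  then show ?thesis unfolding one_def strand_def by simp
qed

lemma one_empty: "one A 0 = empty_diag A"
proof -
  have "layered 0 0 (id_layers 0 :: 'a layer list) = empty_tangle"
    unfolding layered_def id_layers_def empty_tangle_def
    by (simp add: fan_strands del: layer_strands.simps)
  then show ?thesis unfolding one_def empty_diag_def by simp
qed

lemma evaluates_element: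
  assumes "unshaded_planar_algebra A" "x \<in> spc A b t"
  shows "evaluates A [Id t, [Some (b, t, x)], Id b] b t x"
proof -
  have l: "concat (map item_labels (Id k :: (nat \<times> nat \<times> 'a) option list)) = []" for k by (induction k) auto
  have "shape (unit_layers b t x) = [Id t, [Some (b, t, x)], Id b]" by (simp add: unit_layers_def)
  moreover have "labels [Id t, [Some (b, t, x)], Id b] = [x]" by (simp add: l)
  moreover have "well_labelled A [Id t, [Some (b, t, x)], Id b]" using assms(2) unfolding well_labelled_def by auto
  ultimately show ?thesis unfolding evaluates_def
    using good_unit_layers[of b t x] planar_unit[of b t] unit_tangle_layered[of b t x] act_unit[OF assms] by metis
qed

subsection \<open>Products\<close>

text \<open>The second box is filled first, which leaves the position of the first box unchanged.\<close>

definition glue2 :: "tangle \<Rightarrow> tangle \<Rightarrow> tangle \<Rightarrow> tangle" where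
  "glue2 T S S' = glue (glue T 1 S') 0 S"

lemma glue2_simps:
  assumes "boxes T = [B, B']"
  shows "glue2 T S S' = \<lparr> bots = bots T, tops = tops T,
     boxes = map (\<lambda>C. (in_bot C, in_top C, in_map B \<circ> in_map C)) (boxes S) @ map (\<lambda>C. (in_bot C, in_top C, in_map B' \<circ> in_map C)) (boxes S'),
     strands = strands T \<union> in_map B' ` strands S' \<union> in_map B ` strands S \<rparr>"
  unfolding glue2_def glue_def Let_def by (simp add: assms)

lemma planar_glue2:
  assumes "planar_tangle T" "planar_tangle S" "planar_tangle S'" "boxes T = [B, B']"
    "bots S = in_bot B" "tops S = in_top B" "bots S' = in_bot B'" "tops S' = in_top B'"
  shows "planar_tangle (glue2 T S S')"
proof -
  have "planar_tangle (glue T 1 S')" by (rule planar_glue) (use assms in auto)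
  moreover have "boxes (glue T 1 S') = B # map (\<lambda>C. (in_bot C, in_top C, in_map B' \<circ> in_map C)) (boxes S')"
    unfolding glue_def Let_def by (simp add: assms)
  ultimately show ?thesis unfolding glue2_def by (intro planar_glue) (use assms in auto)
qed

lemma act_glue2:
  assumes A: "unshaded_planar_algebra A"
    and p: "planar_tangle T" "planar_tangle S" "planar_tangle S'" "boxes T = [B, B']"
    "bots S = in_bot B" "tops S = in_top B" "bots S' = in_bot B'" "tops S' = in_top B'"
    and l: "labelling A S ys" "labelling A S' zs"
  shows "act A (glue2 T S S') (ys @ zs) = act A T [act A S ys, act A S' zs]" "labelling A (glue2 T S S') (ys @ zs)"
proof -
  have u: "act A S ys \<in> spc A (in_bot B) (in_top B)" using act_closed[OF A p(2) l(1)] p by simp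
  have v: "act A S' zs \<in> spc A (in_bot B') (in_top B')" using act_closed[OF A p(3) l(2)] p by simp
  have lT: "labelling A T [act A S ys, act A S' zs]" unfolding labelling_iff p(4) using u v by simp
  have p1: "planar_tangle (glue T 1 S')" by (rule planar_glue) (use p in auto)
  have b1: "boxes (glue T 1 S') = B # map (\<lambda>C. (in_bot C, in_top C, in_map B' \<circ> in_map C)) (boxes S')"
    unfolding glue_def Let_def by (simp add: p(4))
  have e1: "act A (glue T 1 S') (act A S ys # zs) = act A T [act A S ys, act A S' zs]"
    using act_glue[OF A p(1,3) lT l(2), of 1] p by simp
  have l1: "labelling A (glue T 1 S') (act A S ys # zs)"
    using u l(2) unfolding labelling_iff b1 by (simp add: list_all2_map1 in_bot_def in_top_def)
  show "act A (glue2 T S S') (ys @ zs) = act A T [act A S ys, act A S' zs]"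
    unfolding glue2_def using act_glue[OF A p1 p(2) l1 l(1), of 0] p b1 e1 by simp
  show "labelling A (glue2 T S S') (ys @ zs)"
    using l unfolding labelling_iff glue2_simps[OF p(4)] tangle.simps
    by (intro list_all2_appendI) (simp_all add: list_all2_map1 in_bot_def in_top_def)
qed

lemma labels_Id [simp]: "concat (map item_labels (Id k)) = []" by (induction k) auto

lemma well_labelled_simps [simp]: "well_labelled A (\<sigma> @ \<tau>) \<longleftrightarrow> well_labelled A \<sigma> \<and> well_labelled A \<tau>" "well_labelled A (Id k # \<tau>) \<longleftrightarrow> well_labelled A \<tau>" "well_labelled A []"
  unfolding well_labelled_def by auto

text \<open>
  Shrunk into the boxes of the multiplication tangle, layered diagrams form a layered diagram again; the
  strands of that tangle contribute the three layers of strands.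
\<close>

lemma evaluates_mult:
  assumes A: "unshaded_planar_algebra A" and u: "evaluates A \<sigma> c t u" and v: "evaluates A \<tau> b c v"
  shows "evaluates A (Id t # \<sigma> @ Id c # \<tau> @ [Id b]) b t (mult A b c t u v)"
proof -
  obtain D where D: "good c t D" "shape D = \<sigma>" "planar_tangle (layered c t D)" "u = act A (layered c t D) (labels \<sigma>)" and ok: "well_labelled A \<sigma>"
    using u unfolding evaluates_def by blast
  obtain E where E: "good b c E" "shape E = \<tau>" "planar_tangle (layered b c E)" "v = act A (layered b c E) (labels \<tau>)" and ok': "well_labelled A \<tau>"
    using v unfolding evaluates_def by blast
  define G where "G = [(1, 3/4, fan (xpos t) (\<lambda>j. xpos t j / 2) t)] @ map (rescale 0 (1/2) (1/2) (1/4)) D @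
     [(1/4, -1/4, fan (\<lambda>j. xpos c j / 2) (\<lambda>j. xpos c j / 2) c)] @ map (rescale 0 (-1/2) (1/2) (1/4)) E @
     [(-3/4, -1, fan (\<lambda>j. xpos b j / 2) (xpos b) b)]"
  have f1: "block (mark_xs t) 1 (map (\<lambda>j. xpos t j / 2) [0..<t]) (3/4) [(1, 3/4, fan (xpos t) (\<lambda>j. xpos t j / 2) t) :: 'a layer]"
    by (rule block_single, rule good_fan) (auto simp: xpos_abs xpos_abs2 xpos_strict)
  have f2: "block (map (\<lambda>j. xpos c j / 2) [0..<c]) (1/4) (map (\<lambda>j. xpos c j / 2) [0..<c]) (-1/4) [(1/4, -1/4, fan (\<lambda>j. xpos c j / 2) (\<lambda>j. xpos c j / 2) c) :: 'a layer]"
    by (rule block_single, rule good_fan) (auto simp: xpos_abs xpos_abs2 xpos_strict)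
  have f3: "block (map (\<lambda>j. xpos b j / 2) [0..<b]) (-3/4) (mark_xs b) (-1) [(-3/4, -1, fan (\<lambda>j. xpos b j / 2) (xpos b) b) :: 'a layer]"
    by (rule block_single, rule good_fan) (auto simp: xpos_abs xpos_abs2 xpos_strict)
  have gD: "block (map (\<lambda>j. xpos t j / 2) [0..<t]) (3/4) (map (\<lambda>j. xpos c j / 2) [0..<c]) (1/4) (map (rescale 0 (1/2) (1/2) (1/4)) D)"
    using block_rescale[of "mark_xs t" 1 "mark_xs c" "-1" D "1/2" 0 "1/4" "1/2"] D(1) unfolding good_iff_block by (simp add: comp_def)
  have gE: "block (map (\<lambda>j. xpos c j / 2) [0..<c]) (-1/4) (map (\<lambda>j. xpos b j / 2) [0..<b]) (-3/4) (map (rescale 0 (-1/2) (1/2) (1/4)) E)"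
    using block_rescale[of "mark_xs c" 1 "mark_xs b" "-1" E "1/2" 0 "1/4" "-1/2"] E(1) unfolding good_iff_block by (simp add: comp_def)
  have gG: "good b t G"
    unfolding good_iff_block G_def
    by (intro conjI block_append[OF f1 block_append[OF gD block_append[OF f2 block_append[OF gE f3]]]]) simp_all
  have tG: "shape G = Id t # \<sigma> @ Id c # \<tau> @ [Id b]" unfolding G_def using D(2) E(2) by simp
  have bm: "boxes (mult_tangle b c t) = [(c, t, place (Complex 0 (1/2)) (1/2) (1/4)), (b, c, place (Complex 0 (-1/2)) (1/2) (1/4))]"
    unfolding mult_tangle_def Let_def by simp
  have LG: "layered b t G = glue2 (mult_tangle b c t) (layered c t D) (layered b c E)"
  proof -
    have s: "strands (mult_tangle b c t) = layer_strands (1, 3/4, fan (xpos t) (\<lambda>j. xpos t j / 2) t :: 'a item list) \<union>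
       layer_strands (1/4, -1/4, fan (\<lambda>j. xpos c j / 2) (\<lambda>j. xpos c j / 2) c :: 'a item list) \<union>
       layer_strands (-3/4, -1, fan (\<lambda>j. xpos b j / 2) (xpos b) b :: 'a item list)"
      unfolding mult_tangle_layered[of b c t "undefined :: 'a" "undefined :: 'a"] layered_def mult_layers_def
      by (simp del: layer_strands.simps) (simp add: Un_ac)
    have d: "concat (map layer_boxes (map (rescale 0 (1/2) (1/2) (1/4)) D)) = map (\<lambda>C. (in_bot C, in_top C, place (Complex 0 (1/2)) (1/2) (1/4) \<circ> in_map C)) (boxes (layered c t D))"
      using layered_rescale(1)[of "1/2" "1/4" c t 0 "1/2" D] unfolding layered_def by simp
    have e: "concat (map layer_boxes (map (rescale 0 (-1/2) (1/2) (1/4)) E)) = map (\<lambda>C. (in_bot C, in_top C, place (Complex 0 (-1/2)) (1/2) (1/4) \<circ> in_map C)) (boxes (layered b c E))"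
      using layered_rescale(1)[of "1/2" "1/4" b c 0 "-1/2" E] unfolding layered_def by simp
    have d': "(\<Union>L\<in>set (map (rescale 0 (1/2) (1/2) (1/4)) D). layer_strands L) = place (Complex 0 (1/2)) (1/2) (1/4) ` strands (layered c t D)"
      using layered_rescale(2)[of "1/2" "1/4" c t 0 "1/2" D] unfolding layered_def by simp
    have e': "(\<Union>L\<in>set (map (rescale 0 (-1/2) (1/2) (1/4)) E). layer_strands L) = place (Complex 0 (-1/2)) (1/2) (1/4) ` strands (layered b c E)"
      using layered_rescale(2)[of "1/2" "1/4" b c 0 "-1/2" E] unfolding layered_def by simp
    have "boxes (layered b t G) = boxes (glue2 (mult_tangle b c t) (layered c t D) (layered b c E))"
      unfolding glue2_simps[OF bm] layered_def[of b t G] tangle.simps unfolding G_def map_append concat_append d e by (simp add: in_map_def)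
    moreover have "strands (layered b t G) = strands (glue2 (mult_tangle b c t) (layered c t D) (layered b c E))"
      unfolding glue2_simps[OF bm] layered_def[of b t G] tangle.simps unfolding G_def set_append UN_Un d' e' s
      by (simp add: in_map_def Un_ac del: layer_strands.simps)
    ultimately show ?thesis by (intro tangle.equality) (simp_all add: glue2_simps[OF bm], simp_all add: mult_tangle_def Let_def)
  qed
  have pp: "planar_tangle (layered b t G)" unfolding LG
    by (rule planar_glue2[OF planar_mult D(3) E(3) bm]) (simp_all add: in_bot_def in_top_def)
  have "act A (layered b t G) (labels \<sigma> @ labels \<tau>) = mult A b c t u v"
    unfolding LG mult_def D(4) E(4)
    by (rule act_glue2(1)[OF A planar_mult D(3) E(3) bm]) (use labelling_layered ok ok' D(2) E(2) in \<open>auto simp: in_bot_def in_top_def\<close>)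
  then show ?thesis unfolding evaluates_def using gG tG pp ok ok' by (intro conjI exI[of _ G]) simp_all
qed

subsection \<open>Juxtaposition\<close>

text \<open>Meant for layers of equal heights; the factor \<open>1/4\<close> and the shifts are those of the tensor tangle.\<close>

definition beside :: "'a layer \<Rightarrow> 'a layer \<Rightarrow> 'a layer" where
  "beside L M = (1/2 * fst L, 1/2 * fst (snd L), map (rescale_item (-1/2) (1/4)) (items L) @ map (rescale_item (1/2) (1/4)) (items M))"

lemma beside_sel [simp]: "fst (beside L M) = 1/2 * fst L" "fst (snd (beside L M)) = 1/2 * fst (snd L)"
  "items (beside L M) = map (rescale_item (-1/2) (1/4)) (items L) @ map (rescale_item (1/2) (1/4)) (items M)"
  unfolding beside_def by simp_all

lemma left_of_sides:
  assumes "good_item it" "good_item jt"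
  shows "left_of (rescale_item (-1/2) (1/4) it) (rescale_item (1/2) (1/4) jt)"
proof -
  obtain lab a b v where it: "it = (lab, a, b, v)" by (cases it) auto
  obtain lab' a' b' v' where jt: "jt = (lab', a', b', v')" by (cases jt) auto
  have "a + v < 1" "b + v < 1" "-1 < a' - v'" "-1 < b' - v'" using assms unfolding it jt by simp_all
  then show ?thesis unfolding it jt by simp
qed

lemma good_layer_iff: "good_layer L \<longleftrightarrow> fst (snd L) < fst L \<and> (\<forall>it\<in>set (items L). good_item it) \<and> sorted_wrt left_of (items L)"
  by (cases L) simp

lemma good_layer_beside:
  fixes L M :: "'a layer"
  assumes "good_layer L" "good_layer M"
  shows "good_layer (beside L M)"
proof -
  have g: "good_item (rescale_item (-1/2) (1/4) it)" "good_item (rescale_item (1/2) (1/4) it)" if "good_item it" for it :: "'a item"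
    by (rule good_item_rescale[OF that]; simp)+
  have l: "left_of (rescale_item p (1/4) it) (rescale_item p (1/4) jt) \<longleftrightarrow> left_of it jt" for p and it jt :: "'a item"
    by (rule left_of_rescale) simp
  have L: "fst (snd L) < fst L" "\<forall>it\<in>set (items L). good_item it" "sorted_wrt left_of (items L)"
    and M: "\<forall>it\<in>set (items M). good_item it" "sorted_wrt left_of (items M)"
    using assms unfolding good_layer_iff by blast+
  have "\<forall>it\<in>set (items (beside L M)). good_item it"
    unfolding beside_sel set_append set_map using L(2) M(1) g by blast
  moreover have "sorted_wrt left_of (items (beside L M))"
    unfolding beside_sel sorted_wrt_append sorted_wrt_map l set_map using L(2,3) M left_of_sides by blast
  ultimately show ?thesis using L(1) unfolding good_layer_iff by simp
qed

lemma block_beside: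
  assumes D: "block T u B d D" and E: "block T' u' B' d' E" and len: "length E = length D"
    and c: "\<And>i. Suc i < length D \<Longrightarrow> only_strands (items (beside (D ! i) (E ! i))) \<or> only_strands (items (beside (D ! Suc i) (E ! Suc i)))"
  shows "block (map (\<lambda>x. -1/2 + 1/4 * x) T @ map (\<lambda>x. 1/2 + 1/4 * x) T') (1/2 * u)
     (map (\<lambda>x. -1/2 + 1/4 * x) B @ map (\<lambda>x. 1/2 + 1/4 * x) B') (1/2 * d) (map2 beside D E)"
proof -
  let ?H = "map2 beside D E"
  have ne: "D \<noteq> []" "E \<noteq> []" "?H \<noteq> []" using D E len unfolding block_def by auto
  have lH: "length ?H = length D" using len by simp
  have nH: "?H ! i = beside (D ! i) (E ! i)" if "i < length D" for i using that len by simp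
  have l0: "0 < length D" "length D - 1 < length D" using ne by simp_all
  have hd: "hd ?H = beside (hd D) (hd E)" using nH[OF l0(1)] hd_conv_nth[OF ne(1)] hd_conv_nth[OF ne(2)] hd_conv_nth[OF ne(3)] by metis
  have last: "last ?H = beside (last D) (last E)" using nH[OF l0(2)] last_conv_nth[OF ne(1)] last_conv_nth[OF ne(2)] last_conv_nth[OF ne(3)] len lH by metis
  have mk: "layer_tops (beside L M) = map (\<lambda>x. -1/2 + 1/4 * x) (layer_tops L) @ map (\<lambda>x. 1/2 + 1/4 * x) (layer_tops M)"
    "layer_bots (beside L M) = map (\<lambda>x. -1/2 + 1/4 * x) (layer_bots L) @ map (\<lambda>x. 1/2 + 1/4 * x) (layer_bots M)" for L M :: "'a layer"
    unfolding beside_sel map_append concat_append rescale_marks by simp_all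
  show ?thesis unfolding block_def
  proof (intro conjI ballI ne(3))
    fix L assume "L \<in> set ?H"
    then obtain i where i: "i < length D" "L = ?H ! i" unfolding in_set_conv_nth lH by blast
    have "D ! i \<in> set D" "E ! i \<in> set E" using i len by simp_all
    then have "good_layer (D ! i)" "good_layer (E ! i)" using D E unfolding block_def by blast+
    then show "good_layer L" unfolding i(2) nH[OF i(1)] by (rule good_layer_beside)
  next
    show "successively joins ?H" unfolding successively_conv_nth lH
    proof (intro allI impI)
      fix i assume i: "Suc i < length D"
      have "joins (D ! i) (D ! Suc i)" "joins (E ! i) (E ! Suc i)"
        using D E i len unfolding block_def successively_conv_nth by auto
      then show "joins (?H ! i) (?H ! Suc i)"
        using c[OF i] nH[of i] nH[of "Suc i"] i unfolding joins_iff by (simp add: mk)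
    qed
  next
    show "fst (hd ?H) = 1/2 * u" unfolding hd beside_sel using D unfolding block_def by blast
    show "fst (snd (last ?H)) = 1/2 * d" unfolding last beside_sel using D unfolding block_def by blast
    show "layer_tops (hd ?H) = map (\<lambda>x. -1/2 + 1/4 * x) T @ map (\<lambda>x. 1/2 + 1/4 * x) T'"
      unfolding hd mk using D E unfolding block_def by blast
    show "layer_bots (last ?H) = map (\<lambda>x. -1/2 + 1/4 * x) B @ map (\<lambda>x. 1/2 + 1/4 * x) B'"
      unfolding last mk using D E unfolding block_def by blast
  qed
qed

lemma item_labels_length: "length (concat (map item_labels (map fst I))) = length (concat (map (item_box u d) I))"
proof -
  have "length (item_labels (fst it)) = length (item_box u d it)" for it :: "'a item"
    by (cases "(u, d, it)" rule: item_box.cases) auto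
  then show ?thesis by (induction I) auto
qed

lemma zip3: "length a = length a' \<Longrightarrow> length b = length b' \<Longrightarrow> zip ((a @ b) @ c) ((a' @ b') @ c') = zip a a' @ zip b b' @ zip c c'"
  by simp

lemma beside_geometry:
  assumes "list_all2 (\<lambda>L M. fst L = fst M \<and> fst (snd L) = fst (snd M)) D E"
  shows "(\<Union>L\<in>set (map2 beside D E). layer_strands L) =
      (\<Union>L\<in>set (map (rescale (-1/2) 0 (1/4) (1/2)) D). layer_strands L) \<union> (\<Union>L\<in>set (map (rescale (1/2) 0 (1/4) (1/2)) E). layer_strands L) \<and>
     mset (zip (concat (map layer_boxes (map2 beside D E))) (labels (shape (map2 beside D E)))) =
      mset (zip (concat (map layer_boxes (map (rescale (-1/2) 0 (1/4) (1/2)) D))) (labels (shape D))) +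
      mset (zip (concat (map layer_boxes (map (rescale (1/2) 0 (1/4) (1/2)) E))) (labels (shape E)))"
  using assms
proof (induction rule: list_all2_induct)
  case Nil then show ?case by simp
next
  case (Cons L D M E)
  obtain u d I where L: "L = (u, d, I)" by (cases L) auto
  obtain J where M: "M = (u, d, J)" using Cons.hyps(1) unfolding L by (cases M) auto
  let ?I = "map (rescale_item (-1/2) (1/4)) I" and ?J = "map (rescale_item (1/2) (1/4)) J"
  have h: "beside L M = (1/2 * u, 1/2 * d, ?I @ ?J)" unfolding beside_def L M by simp
  have t: "rescale (-1/2) 0 (1/4) (1/2) L = (1/2 * u, 1/2 * d, ?I)" "rescale (1/2) 0 (1/4) (1/2) M = (1/2 * u, 1/2 * d, ?J)"
    unfolding L M by simp_all
  let ?ib = "\<lambda>I. concat (map (item_box (1/2 * u) (1/2 * d)) I)" and ?lb = "\<lambda>I. concat (map item_labels (map fst I))"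
  have fI: "map fst ?I = map fst I" "map fst ?J = map fst J" by simp_all
  have lz: "length (?ib K) = length (?lb K)" for K :: "'a item list" using item_labels_length[of K] by metis
  have lz2: "length (concat (map layer_boxes K)) = length (labels (shape K))" for K :: "'a layer list"
    using layered_lengths[of K 0 0] unfolding layered_def by simp
  have lI: "layer_boxes (beside L M) = ?ib ?I @ ?ib ?J" unfolding h by simp
  have lT: "layer_boxes (rescale (-1/2) 0 (1/4) (1/2) L) = ?ib ?I" "layer_boxes (rescale (1/2) 0 (1/4) (1/2) M) = ?ib ?J" unfolding t by simp_all
  have tyL: "shape (L # D) = map fst ?I # shape D" and tyM: "shape (M # E) = map fst ?J # shape E" by (simp_all add: L M)
  have m2: "map2 beside (L # D) (M # E) = beside L M # map2 beside D E" by simp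
  have tyh: "shape (beside L M # K) = map fst (?I @ ?J) # shape K" for K by (simp add: h)
  have "zip (concat (map layer_boxes (map2 beside (L # D) (M # E)))) (labels (shape (map2 beside (L # D) (M # E)))) =
     zip (?ib ?I) (?lb ?I) @ zip (?ib ?J) (?lb ?J) @ zip (concat (map layer_boxes (map2 beside D E))) (labels (shape (map2 beside D E)))"
    unfolding m2 list.map(2) lI concat.simps(2) tyh labels_simps map_append concat_append by (rule zip3[OF lz lz])
  moreover have "zip (concat (map layer_boxes (map (rescale (-1/2) 0 (1/4) (1/2)) (L # D)))) (labels (shape (L # D))) =
     zip (?ib ?I) (?lb ?I) @ zip (concat (map layer_boxes (map (rescale (-1/2) 0 (1/4) (1/2)) D))) (labels (shape D))"
    unfolding list.map(2) lT concat.simps(2) tyL labels_simps by (rule zip_append[OF lz])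
  moreover have "zip (concat (map layer_boxes (map (rescale (1/2) 0 (1/4) (1/2)) (M # E)))) (labels (shape (M # E))) =
     zip (?ib ?J) (?lb ?J) @ zip (concat (map layer_boxes (map (rescale (1/2) 0 (1/4) (1/2)) E))) (labels (shape E))"
    unfolding list.map(2) lT concat.simps(2) tyM labels_simps by (rule zip_append[OF lz])
  moreover have "layer_strands (beside L M) = layer_strands (rescale (-1/2) 0 (1/4) (1/2) L) \<union> layer_strands (rescale (1/2) 0 (1/4) (1/2) M)"
    unfolding h t by (simp del: set_map add: UN_Un)
  ultimately show ?case using Cons.IH by (simp only: mset_append) (simp add: Un_ac add_ac)
qed

lemma shape_beside: "length D = length E \<Longrightarrow> shape (map2 beside D E) = map2 (@) (shape D) (shape E)"
  by (induction D E rule: list_induct2) simp_all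

lemma only_strands_iff: "only_strands I \<longleftrightarrow> set (map fst I) \<subseteq> {None}"
  unfolding only_strands_def by auto

definition compatible :: "'a option list list \<Rightarrow> bool" where
  "compatible \<tau> \<longleftrightarrow> successively (\<lambda>I J. set I \<subseteq> {None} \<or> set J \<subseteq> {None}) \<tau>"

text \<open>
  The layers of the second diagram are first given the heights of the first, which does not change its value.
  Then layers are put side by side one by one.
\<close>

lemma evaluates_tensor:
  assumes A: "unshaded_planar_algebra A" and u: "evaluates A \<sigma> b t u" and v: "evaluates A \<tau> b' t' v"
    and len: "length \<tau> = length \<sigma>" and c: "compatible (map2 (@) \<sigma> \<tau>)"
  shows "evaluates A (Id (t + t') # map2 (@) \<sigma> \<tau> @ [Id (b + b')]) (b + b') (t + t') (tensor A b t b' t' u v)"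
proof -
  obtain D where D: "good b t D" "shape D = \<sigma>" "planar_tangle (layered b t D)" "u = act A (layered b t D) (labels \<sigma>)" and ok: "well_labelled A \<sigma>"
    using u unfolding evaluates_def by blast
  obtain E0 where E0: "good b' t' E0" "shape E0 = \<tau>" and ok': "well_labelled A \<tau>"
    using v unfolding evaluates_def by blast
  have lenD: "length D = length \<sigma>" "length E0 = length \<sigma>" using D(2) E0(2) len unfolding shape_def by auto
  \<comment> \<open>the second diagram with the heights of the first\<close>
  define E where "E = map2 (\<lambda>L M. (fst L, fst (snd L), items M)) D E0"
  have lE: "length E = length D" unfolding E_def using lenD by simp
  have nE: "E ! i = (fst (D ! i), fst (snd (D ! i)), items (E0 ! i))" if "i < length D" for i
    unfolding E_def using that lenD by simp
  have ne: "D \<noteq> []" "E \<noteq> []" "E0 \<noteq> []" using D(1) E0(1) lE unfolding good_def by auto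
  have tE: "shape E = \<tau>"
  proof -
    have "shape E = shape E0" unfolding shape_def
      by (rule nth_equalityI) (use nE lE lenD in \<open>auto simp: case_prod_beta\<close>)
    then show ?thesis using E0(2) by simp
  qed
  have hE: "hd E = (fst (hd D), fst (snd (hd D)), items (hd E0))" "last E = (fst (last D), fst (snd (last D)), items (last E0))"
  proof -
    have l0: "0 < length D" "length D - 1 < length D" using ne by simp_all
    show "hd E = (fst (hd D), fst (snd (hd D)), items (hd E0))"
      using nE[OF l0(1)] hd_conv_nth[OF ne(1)] hd_conv_nth[OF ne(2)] hd_conv_nth[OF ne(3)] by metis
    show "last E = (fst (last D), fst (snd (last D)), items (last E0))"
      using nE[OF l0(2)] last_conv_nth[OF ne(1)] last_conv_nth[OF ne(2)] last_conv_nth[OF ne(3)] lE lenD by metis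
  qed
  have gE: "good b' t' E"
    unfolding good_iff_block block_def
  proof (intro conjI ballI ne)
    fix L assume "L \<in> set E"
    then obtain i where i: "i < length D" "L = E ! i" unfolding in_set_conv_nth lE by blast
    then show "good_layer L"
      using good_nth[OF D(1), of i] good_nth[OF E0(1), of i] lenD unfolding i(2) nE[OF i(1)] good_layer_iff by simp
  next
    show "successively joins E" unfolding successively_conv_nth lE
    proof (intro allI impI)
      fix i assume i: "Suc i < length D"
      show "joins (E ! i) (E ! Suc i)"
        using good_joins[OF D(1) i] good_joins[OF E0(1), of i] lenD i nE[of i] nE[of "Suc i"] unfolding joins_iff by simp
    qed
  qed (use D(1) E0(1) in \<open>simp_all add: hE good_iff_block block_def\<close>)
  have pE: "planar_tangle (layered b' t' E)" "v = act A (layered b' t' E) (labels \<tau>)"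
    using evaluates_realise[OF A v gE tE] by blast+
  have la: "list_all2 (\<lambda>L M. fst L = fst M \<and> fst (snd L) = fst (snd M)) D E"
    by (rule list_all2_all_nthI) (use lE nE in auto)
  define G where "G = [(1, 1/2, fan (xpos (t + t')) (pair_x t t') (t + t'))] @ map2 beside D E @ [(-1/2, -1, fan (pair_x b b') (xpos (b + b')) (b + b'))]"
  have tH: "shape (map2 beside D E) = map2 (@) \<sigma> \<tau>" using shape_beside[of D E] lE D(2) tE by simp
  have f1: "block (mark_xs (t + t')) 1 (map (\<lambda>x. - 1/2 + 1/4 * x) (mark_xs t) @ map (\<lambda>x. 1/2 + 1/4 * x) (mark_xs t')) (1/2) [(1, 1/2, fan (xpos (t + t')) (pair_x t t') (t + t')) :: 'a layer]"
    unfolding pair_x_marks[symmetric] by (rule block_single, rule good_fan) (auto simp: xpos_abs pair_x_bounds xpos_strict)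
  have f2: "block (map (\<lambda>x. - 1/2 + 1/4 * x) (mark_xs b) @ map (\<lambda>x. 1/2 + 1/4 * x) (mark_xs b')) (-1/2) (mark_xs (b + b')) (-1) [(-1/2, -1, fan (pair_x b b') (xpos (b + b')) (b + b')) :: 'a layer]"
    unfolding pair_x_marks[symmetric] by (rule block_single, rule good_fan) (auto simp: xpos_abs pair_x_bounds xpos_strict)
  have f3: "block (map (\<lambda>x. - 1/2 + 1/4 * x) (mark_xs t) @ map (\<lambda>x. 1/2 + 1/4 * x) (mark_xs t')) (1/2)
    (map (\<lambda>x. - 1/2 + 1/4 * x) (mark_xs b) @ map (\<lambda>x. 1/2 + 1/4 * x) (mark_xs b')) (-1/2) (map2 beside D E)"
  proof -
    have "only_strands (items (beside (D ! i) (E ! i))) \<or> only_strands (items (beside (D ! Suc i) (E ! Suc i)))" if i: "Suc i < length D" for i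
    proof -
      have n: "map2 (@) \<sigma> \<tau> ! j = map fst (items (beside (D ! j) (E ! j)))" if "j < length D" for j
        unfolding tH[symmetric] shape_def using that lE by (simp add: case_prod_beta)
      have "length (map2 (@) \<sigma> \<tau>) = length D" using lenD len by simp
      then have "set (map2 (@) \<sigma> \<tau> ! i) \<subseteq> {None} \<or> set (map2 (@) \<sigma> \<tau> ! Suc i) \<subseteq> {None}"
        using c i unfolding compatible_def successively_conv_nth by metis
      then show ?thesis using n[of i] n[of "Suc i"] i unfolding only_strands_iff by (metis Suc_lessD)
    qed
    then show ?thesis
      using block_beside[of "mark_xs t" 1 "mark_xs b" "-1" D "mark_xs t'" 1 "mark_xs b'" "-1" E] D(1) gE lE unfolding good_iff_block by simp
  qed
  have gG: "good (b + b') (t + t') G"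
    unfolding good_iff_block G_def
    by (intro conjI block_append[OF f1 block_append[OF f3 f2]]) simp_all
  have tG: "shape G = Id (t + t') # map2 (@) \<sigma> \<tau> @ [Id (b + b')]" unfolding G_def using tH by simp
  have bm: "boxes (tensor_tangle b t b' t') = [(b, t, place (Complex (-1/2) 0) (1/4) (1/2)), (b', t', place (Complex (1/2) 0) (1/4) (1/2))]"
    unfolding tensor_tangle_def Let_def by simp
  let ?g = "glue2 (tensor_tangle b t b' t') (layered b t D) (layered b' t' E)"
  have pg: "planar_tangle ?g"
    by (rule planar_glue2[OF planar_tensor D(3) pE(1) bm]) (simp_all add: in_bot_def in_top_def)
  have lD: "labelling A (layered b t D) (labels \<sigma>)" and lE': "labelling A (layered b' t' E) (labels \<tau>)"
    using labelling_layered ok ok' D(2) tE by auto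
  have ag: "act A ?g (labels \<sigma> @ labels \<tau>) = tensor A b t b' t' u v" "labelling A ?g (labels \<sigma> @ labels \<tau>)"
    unfolding tensor_def D(4) pE(2)
    by (rule act_glue2[OF A planar_tensor D(3) pE(1) bm]; use lD lE' in \<open>simp add: in_bot_def in_top_def\<close>)+
  have lg: "concat (map layer_boxes (map (rescale (-1/2) 0 (1/4) (1/2)) D)) = map (\<lambda>C. (in_bot C, in_top C, place (Complex (-1/2) 0) (1/4) (1/2) \<circ> in_map C)) (boxes (layered b t D))"
    using layered_rescale(1)[of "1/4" "1/2" b t "-1/2" 0 D] unfolding layered_def by simp
  have rg: "concat (map layer_boxes (map (rescale (1/2) 0 (1/4) (1/2)) E)) = map (\<lambda>C. (in_bot C, in_top C, place (Complex (1/2) 0) (1/4) (1/2) \<circ> in_map C)) (boxes (layered b' t' E))"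
    using layered_rescale(1)[of "1/4" "1/2" b' t' "1/2" 0 E] unfolding layered_def by simp
  have ls: "(\<Union>L\<in>set (map (rescale (-1/2) 0 (1/4) (1/2)) D). layer_strands L) = place (Complex (-1/2) 0) (1/4) (1/2) ` strands (layered b t D)"
    using layered_rescale(2)[of "1/4" "1/2" b t "-1/2" 0 D] unfolding layered_def by simp
  have rs: "(\<Union>L\<in>set (map (rescale (1/2) 0 (1/4) (1/2)) E). layer_strands L) = place (Complex (1/2) 0) (1/4) (1/2) ` strands (layered b' t' E)"
    using layered_rescale(2)[of "1/4" "1/2" b' t' "1/2" 0 E] unfolding layered_def by simp
  have s0: "strands (tensor_tangle b t b' t') = layer_strands (1, 1/2, fan (xpos (t + t')) (pair_x t t') (t + t') :: 'a item list) \<union>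
       layer_strands (-1/2, -1, fan (pair_x b b') (xpos (b + b')) (b + b') :: 'a item list)"
    unfolding tensor_tangle_layered[of b t b' t' "undefined :: 'a" "undefined :: 'a"] layered_def tensor_layers_def
    by (simp del: layer_strands.simps) (simp add: Un_ac)
  have sG: "strands (layered (b + b') (t + t') G) = strands ?g"
    unfolding glue2_simps[OF bm] layered_def[of "b + b'" "t + t'" G] tangle.simps
    unfolding G_def set_append UN_Un beside_geometry[OF la, THEN conjunct1] ls rs s0
    by (simp add: in_map_def Un_ac del: layer_strands.simps)
  have mG: "mset (zip (boxes ?g) (labels \<sigma> @ labels \<tau>)) = mset (zip (boxes (layered (b + b') (t + t') G)) (labels (shape G)))"
  proof -
    have "boxes (layered (b + b') (t + t') G) = concat (map layer_boxes (map2 beside D E))"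
      unfolding layered_def G_def by simp
    moreover have "labels (shape G) = labels (shape (map2 beside D E))" unfolding tG tH by simp
    ultimately have "mset (zip (boxes (layered (b + b') (t + t') G)) (labels (shape G))) =
      mset (zip (map (\<lambda>C. (in_bot C, in_top C, place (Complex (-1/2) 0) (1/4) (1/2) \<circ> in_map C)) (boxes (layered b t D))) (labels \<sigma>)) +
      mset (zip (map (\<lambda>C. (in_bot C, in_top C, place (Complex (1/2) 0) (1/4) (1/2) \<circ> in_map C)) (boxes (layered b' t' E))) (labels \<tau>))"
      using beside_geometry[OF la, THEN conjunct2] unfolding lg rg D(2) tE by simp
    moreover have "length (boxes (layered b t D)) = length (labels \<sigma>)" using lD unfolding labelling_def by simp
    ultimately show ?thesis unfolding glue2_simps[OF bm] by (simp add: zip_append in_map_def)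
  qed
  have t: "bots ?g = b + b'" "tops ?g = t + t'" unfolding glue2_simps[OF bm] by (simp_all add: tensor_tangle_def Let_def)
  note pr = act_perm[OF A pg ag(2) _ _ sG layered_lengths mG]
  have "planar_tangle (layered (b + b') (t + t') G)" "act A (layered (b + b') (t + t') G) (labels (shape G)) = tensor A b t b' t' u v"
    using pr(1,3) t ag(1) by simp_all
  moreover have "well_labelled A (shape G)"
  proof -
    have "well_labelled A (map2 (@) \<sigma> \<tau>)"
      using ok ok' unfolding well_labelled_def by (auto simp: set_zip) (metis nth_mem)+
    then show ?thesis unfolding tG by simp
  qed
  ultimately show ?thesis unfolding evaluates_def using gG tG by (intro conjI exI[of _ G]) simp_all
qed

subsection \<open>Splitting and merging layers of strands\<close>

lemma fan_form:
  assumes "only_strands I" "\<forall>it\<in>set I. good_item it"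
  shows "I = fan (\<lambda>j. fst (snd (I ! j))) (\<lambda>j. fst (snd (snd (I ! j)))) (length I)"
proof (rule nth_equalityI)
  fix i assume i: "i < length I"
  obtain lab a b w where it: "I ! i = (lab, a, b, w)" by (cases "I ! i") auto
  have "good_item (I ! i)" "fst (I ! i) = None" using assms i unfolding only_strands_def by auto
  then show "I ! i = fan (\<lambda>j. fst (snd (I ! j))) (\<lambda>j. fst (snd (snd (I ! j)))) (length I) ! i"
    using i unfolding fan_def it by (simp add: it)
qed (simp add: fan_def)

lemma good_fan_iff:
  "good_layer (u, d, fan p q n) \<longleftrightarrow> d < u \<and> (\<forall>j<n. \<bar>p j\<bar> < 1 \<and> \<bar>q j\<bar> < 1) \<and> (\<forall>i j. i < j \<longrightarrow> j < n \<longrightarrow> p i < p j \<and> q i < q j)"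
  unfolding fan_def by (auto simp: sorted_wrt_iff_nth_less abs_less_iff)

lemma good_replace:
  assumes g: "good b t (D1 @ X @ D2)" and X: "block T u B d X" "only_strands (items (hd X))" "only_strands (items (last X))"
    and Y: "block T u B d Y" "only_strands (items (hd Y))" "only_strands (items (last Y))"
  shows "good b t (D1 @ Y @ D2)"
proof -
  have ne: "X \<noteq> []" "Y \<noteq> []" using X(1) Y(1) unfolding block_def by auto
  show ?thesis
    using g X Y ne unfolding good_iff_block block_def
    by (cases "D1 = []"; cases "D2 = []") (auto simp: successively_append_iff joins_iff)
qed

lemma layered_replace:
  assumes "concat (map layer_boxes X) = concat (map layer_boxes Y)" "(\<Union>L\<in>set X. layer_strands L) = (\<Union>L\<in>set Y. layer_strands L)"
  shows "layered b t (D1 @ X @ D2) = layered b t (D1 @ Y @ D2)"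
  unfolding layered_def using assms by (simp add: UN_Un)

text \<open>Cutting segments at their midpoints does not change the tangle.\<close>

lemma layer_split:
  fixes D1 D2 :: "'a layer list"
  assumes g: "good b t (D1 @ [(u, d, fan p q n)] @ D2)"
  shows "\<exists>m e. good b t (D1 @ [(u, e, fan p m n), (e, d, fan m q n)] @ D2) \<and>
     layered b t (D1 @ [(u, e, fan p m n), (e, d, fan m q n)] @ D2) = layered b t (D1 @ [(u, d, fan p q n)] @ D2)"
proof (intro exI conjI)
  define m where "m j = (p j + q j) / 2" for j
  define e where "e = (u + d) / 2"
  have gl: "good_layer (u, d, fan p q n :: 'a item list)" using g unfolding good_def by (simp del: good_layer.simps)
  note gf = gl[unfolded good_fan_iff]
  have g1: "good_layer (u, e, fan p m n :: 'a item list)" unfolding good_fan_iff e_def m_def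
  proof (intro conjI allI impI)
    fix i j assume "i < j" "j < n"
    then have "p i < p j" "q i < q j" using gf by blast+
    then show "p i < p j" "(p i + q i) / 2 < (p j + q j) / 2" by simp_all
  next
    fix j assume "j < n"
    then have "\<bar>p j\<bar> < 1" "\<bar>q j\<bar> < 1" using gf by blast+
    then show "\<bar>p j\<bar> < 1" "\<bar>(p j + q j) / 2\<bar> < 1" by (auto simp: abs_less_iff)
  qed (use gf in simp)
  have g2: "good_layer (e, d, fan m q n :: 'a item list)" unfolding good_fan_iff e_def m_def
  proof (intro conjI allI impI)
    fix i j assume "i < j" "j < n"
    then have "p i < p j" "q i < q j" using gf by blast+
    then show "q i < q j" "(p i + q i) / 2 < (p j + q j) / 2" by simp_all
  next
    fix j assume "j < n"
    then have "\<bar>p j\<bar> < 1" "\<bar>q j\<bar> < 1" using gf by blast+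
    then show "\<bar>q j\<bar> < 1" "\<bar>(p j + q j) / 2\<bar> < 1" by (auto simp: abs_less_iff)
  qed (use gf in simp)
  have X: "block (map p [0..<n]) u (map q [0..<n]) d [(u, d, fan p q n) :: 'a layer]"
    by (rule block_single[OF gl]) simp_all
  have Y: "block (map p [0..<n]) u (map q [0..<n]) d [(u, e, fan p m n), (e, d, fan m q n) :: 'a layer]"
  proof -
    have "block (map p [0..<n]) u (map m [0..<n]) e [(u, e, fan p m n) :: 'a layer]" by (rule block_single[OF g1]) simp_all
    moreover have "block (map m [0..<n]) e (map q [0..<n]) d [(e, d, fan m q n) :: 'a layer]" by (rule block_single[OF g2]) simp_all
    ultimately show ?thesis using block_append by fastforce
  qed
  show "good b t (D1 @ [(u, e, fan p m n), (e, d, fan m q n)] @ D2)"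
    by (rule good_replace[OF g X _ _ Y]) simp_all
  show "layered b t (D1 @ [(u, e, fan p m n), (e, d, fan m q n)] @ D2) = layered b t (D1 @ [(u, d, fan p q n)] @ D2)"
  proof (rule layered_replace)
    have "closed_segment (Complex (p j) u) (Complex (q j) d) = closed_segment (Complex (p j) u) (Complex (m j) e) \<union> closed_segment (Complex (m j) e) (Complex (q j) d)" for j
    proof (rule Un_closed_segment[symmetric])
      have "Complex (m j) e = midpoint (Complex (p j) u) (Complex (q j) d)"
        unfolding m_def e_def midpoint_def by (simp add: complex_eq_iff)
      then show "Complex (m j) e \<in> closed_segment (Complex (p j) u) (Complex (q j) d)" by simp
    qed
    then show "(\<Union>L\<in>set [(u, e, fan p m n), (e, d, fan m q n) :: 'a layer]. layer_strands L) = (\<Union>L\<in>set [(u, d, fan p q n) :: 'a layer]. layer_strands L)"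
      by (simp add: fan_strands UN_Un_distrib del: layer_strands.simps)
  qed simp
qed

lemma layer_merge:
  fixes D1 D2 :: "'a layer list"
  assumes g: "good b t (D1 @ [(u, e, fan p m n), (e', d, fan m' q n)] @ D2)"
  shows "good b t (D1 @ [(u, d, fan p q n)] @ D2)"
proof -
  have g1: "good_layer (u, e, fan p m n :: 'a item list)" and g2: "good_layer (e', d, fan m' q n :: 'a item list)" and j: "joins (u, e, fan p m n :: 'a item list) (e', d, fan m' q n)"
    using g unfolding good_def by (simp_all add: successively_append_iff successively_Cons del: good_layer.simps joins.simps)
  have mm: "map m [0..<n] = map m' [0..<n]" "e = e'" using j by simp_all
  have g3: "good_layer (u, d, fan p q n :: 'a item list)" using g1 g2 mm unfolding good_fan_iff by auto
  have X: "block (map p [0..<n]) u (map q [0..<n]) d [(u, d, fan p q n) :: 'a layer]"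
    by (rule block_single[OF g3]) simp_all
  have Y: "block (map p [0..<n]) u (map q [0..<n]) d [(u, e, fan p m n), (e', d, fan m' q n) :: 'a layer]"
  proof -
    have "block (map p [0..<n]) u (map m [0..<n]) e [(u, e, fan p m n) :: 'a layer]" by (rule block_single[OF g1]) simp_all
    moreover have "block (map m [0..<n]) e (map q [0..<n]) d [(e', d, fan m' q n) :: 'a layer]"
      unfolding mm by (rule block_single[OF g2]) simp_all
    ultimately show ?thesis using block_append by fastforce
  qed
  show ?thesis by (rule good_replace[OF g Y _ _ X]) simp_all
qed

lemma evaluates_split:
  fixes A :: "('a, 'b) planar_alg_scheme"
  assumes "evaluates A (\<sigma> @ [Id k] @ \<tau>) b t v"
  shows "evaluates A (\<sigma> @ [Id k, Id k] @ \<tau>) b t v"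
proof -
  obtain D where D: "good b t D" "shape D = \<sigma> @ [Id k] @ \<tau>" "planar_tangle (layered b t D)" "v = act A (layered b t D) (labels (\<sigma> @ [Id k] @ \<tau>))"
    and ok: "well_labelled A (\<sigma> @ [Id k] @ \<tau>)"
    using assms unfolding evaluates_def by blast
  obtain D1 L D2 where DD: "D = D1 @ [L] @ D2" "shape D1 = \<sigma>" "shape [L] = [Id k]" "shape D2 = \<tau>"
    using D(2) unfolding shape_def by (auto simp: map_eq_append_conv map_eq_Cons_conv)
  obtain u d I where L: "L = (u, d, I)" by (cases L) auto
  have I: "map fst I = Id k" using DD(3) unfolding L shape_def by simp
  have os: "only_strands I" unfolding only_strands_iff I by auto
  have lI: "length I = k" using arg_cong[OF I, of length] by simp
  have gi: "\<forall>it\<in>set I. good_item it" using D(1) unfolding good_def DD(1) L by simp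
  obtain p q where If: "I = fan p q k" using fan_form[OF os gi] lI by metis
  obtain m e where S: "good b t (D1 @ [(u, e, fan p m k), (e, d, fan m q k)] @ D2)"
     "layered b t (D1 @ [(u, e, fan p m k), (e, d, fan m q k)] @ D2) = layered b t D"
    using layer_split[of b t D1 u d p q k D2] D(1) unfolding DD(1) L If by blast
  have "shape (D1 @ [(u, e, fan p m k), (e, d, fan m q k)] @ D2) = \<sigma> @ [Id k, Id k] @ \<tau>"
    using DD by simp
  moreover have "labels (\<sigma> @ [Id k, Id k] @ \<tau>) = labels (\<sigma> @ [Id k] @ \<tau>)" by simp
  moreover have "well_labelled A (\<sigma> @ [Id k, Id k] @ \<tau>)" using ok by simp
  ultimately show ?thesis unfolding evaluates_def using S D(3,4) by metis
qed

text \<open>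
  Merging two layers of strands straightens the strands and so changes the tangle. But the straightened
  tangle, cut again at midpoints, has the shape before merging, hence the same value.
\<close>

lemma evaluates_merge:
  fixes A :: "('a :: ab_group_add, 'b) planar_alg_scheme"
  assumes A: "unshaded_planar_algebra A" and v: "evaluates A (\<sigma> @ [Id k, Id k] @ \<tau>) b t v"
  shows "evaluates A (\<sigma> @ [Id k] @ \<tau>) b t v"
proof -
  obtain D where D: "good b t D" "shape D = \<sigma> @ [Id k, Id k] @ \<tau>"
    and ok: "well_labelled A (\<sigma> @ [Id k, Id k] @ \<tau>)"
    using v unfolding evaluates_def by blast
  obtain D1 L M D2 where DD: "D = D1 @ [L, M] @ D2" "shape D1 = \<sigma>" "shape [L] = [Id k]" "shape [M] = [Id k]" "shape D2 = \<tau>"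
    using D(2) unfolding shape_def by (auto simp: map_eq_append_conv map_eq_Cons_conv)
  obtain u d I where L: "L = (u, d, I)" by (cases L) auto
  obtain u' d' I' where M: "M = (u', d', I')" by (cases M) auto
  have I: "map fst I = Id k" "map fst I' = Id k" using DD(3,4) unfolding L M shape_def by simp_all
  have os: "only_strands I" "only_strands I'" unfolding only_strands_iff I by auto
  have lI: "length I = k" "length I' = k" using arg_cong[OF I(1), of length] arg_cong[OF I(2), of length] by simp_all
  have gi: "\<forall>it\<in>set I. good_item it" "\<forall>it\<in>set I'. good_item it" using D(1) unfolding good_def DD(1) L M by simp_all
  obtain p q where If: "I = fan p q k" using fan_form[OF os(1) gi(1)] lI by metis
  obtain p' q' where If': "I' = fan p' q' k" using fan_form[OF os(2) gi(2)] lI by metis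
  have G: "good b t (D1 @ [(u, d', fan p q' k)] @ D2)"
    using layer_merge[of b t D1 u d p q k u' d' p' q' D2] D(1) unfolding DD(1) L M If If' by simp
  obtain m e where S: "good b t (D1 @ [(u, e, fan p m k), (e, d', fan m q' k)] @ D2)"
     "layered b t (D1 @ [(u, e, fan p m k), (e, d', fan m q' k)] @ D2) = layered b t (D1 @ [(u, d', fan p q' k)] @ D2)"
    using layer_split[OF G] by blast
  have t: "shape (D1 @ [(u, e, fan p m k), (e, d', fan m q' k)] @ D2) = \<sigma> @ [Id k, Id k] @ \<tau>"
    using DD by simp
  have "planar_tangle (layered b t (D1 @ [(u, d', fan p q' k)] @ D2))" "v = act A (layered b t (D1 @ [(u, d', fan p q' k)] @ D2)) (labels (\<sigma> @ [Id k, Id k] @ \<tau>))"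
    using evaluates_realise[OF A v S(1) t] unfolding S(2) by blast+
  moreover have "shape (D1 @ [(u, d', fan p q' k)] @ D2) = \<sigma> @ [Id k] @ \<tau>" using DD by simp
  moreover have "labels (\<sigma> @ [Id k, Id k] @ \<tau>) = labels (\<sigma> @ [Id k] @ \<tau>)" by simp
  moreover have "well_labelled A (\<sigma> @ [Id k] @ \<tau>)" using ok by simp
  ultimately show ?thesis unfolding evaluates_def using G by metis
qed

subsection \<open>The strict monoidal category\<close>

text \<open>
  Layers of strands at the top and at the bottom make both sides of a product fit; by splitting and
  merging they can be added and dropped at will.
\<close>

definition represents :: "('a, 'b) planar_alg_scheme \<Rightarrow> (nat \<times> nat \<times> 'a) option list list \<Rightarrow> nat \<Rightarrow> nat \<Rightarrow> 'a \<Rightarrow> bool" where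
  "represents A \<sigma> b t x \<longleftrightarrow> evaluates A (Id t # \<sigma> @ [Id b]) b t x"

lemma represents_unique: "unshaded_planar_algebra A \<Longrightarrow> represents A \<sigma> b t x \<Longrightarrow> represents A \<sigma> b t y \<Longrightarrow> x = y"
  unfolding represents_def by (rule evaluates_unique)

lemma represents_mem: "unshaded_planar_algebra A \<Longrightarrow> represents A \<sigma> b t x \<Longrightarrow> x \<in> spc A b t"
  unfolding represents_def by (rule evaluates_mem)

lemma represents_element: "unshaded_planar_algebra A \<Longrightarrow> x \<in> spc A b t \<Longrightarrow> represents A [[Some (b, t, x)]] b t x"
  unfolding represents_def using evaluates_element[of A x b t] by simp

lemma represents_one: "represents A [] k k (one A k)"
  unfolding represents_def using evaluates_split[of A "[]" k "[]" k k] evaluates_one[of A k] by simp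

lemma represents_top: "unshaded_planar_algebra A \<Longrightarrow> represents A (Id t # \<sigma>) b t x \<longleftrightarrow> represents A \<sigma> b t x"
  unfolding represents_def using evaluates_split[of A "[]" t "\<sigma> @ [Id b]" b t x] evaluates_merge[of A "[]" t "\<sigma> @ [Id b]" b t x] by auto

lemma represents_bot: "unshaded_planar_algebra A \<Longrightarrow> represents A (\<sigma> @ [Id b]) b t x \<longleftrightarrow> represents A \<sigma> b t x"
  unfolding represents_def using evaluates_split[of A "Id t # \<sigma>" b "[]" b t x] evaluates_merge[of A "Id t # \<sigma>" b "[]" b t x] by auto

lemma represents_ones: "unshaded_planar_algebra A \<Longrightarrow> represents A (replicate N (Id k)) k k (one A k)"
  by (induction N) (auto simp: represents_one represents_top)

lemma represents_mult:
  assumes A: "unshaded_planar_algebra A" and "represents A \<sigma> c t u" "represents A \<tau> b c v"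
  shows "represents A (\<sigma> @ Id c # \<tau>) b t (mult A b c t u v)"
proof -
  let ?v = "mult A b c t u v"
  have "evaluates A ((Id t # Id t # \<sigma>) @ [Id c, Id c] @ (Id c # \<tau> @ [Id b, Id b])) b t ?v"
    using evaluates_mult[OF A assms(2,3)[unfolded represents_def]] by simp
  from evaluates_merge[OF A this] have "evaluates A ((Id t # Id t # \<sigma>) @ [Id c, Id c] @ (\<tau> @ [Id b, Id b])) b t ?v" by simp
  from evaluates_merge[OF A this] have "represents A (Id t # (\<sigma> @ Id c # \<tau>) @ [Id b]) b t ?v" unfolding represents_def by simp
  then show ?thesis using represents_top[OF A] represents_bot[OF A] by blast
qed

lemma represents_tensor:
  assumes A: "unshaded_planar_algebra A" and "represents A \<sigma> b t u" "represents A \<tau> b' t' v" and len: "length \<sigma> = length \<tau>"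
    and c: "compatible (map2 (@) \<sigma> \<tau>)"
  shows "represents A (map2 (@) \<sigma> \<tau>) (b + b') (t + t') (tensor A b t b' t' u v)"
proof -
  have m: "map2 (@) (Id t # \<sigma> @ [Id b]) (Id t' # \<tau> @ [Id b']) = Id (t + t') # map2 (@) \<sigma> \<tau> @ [Id (b + b')]"
    using len by (simp add: replicate_add)
  have "compatible (Id (t + t') # map2 (@) \<sigma> \<tau> @ [Id (b + b')])"
    using c unfolding compatible_def by (auto simp: successively_append_iff successively_Cons)
  then have "represents A (Id (t + t') # map2 (@) \<sigma> \<tau> @ [Id (b + b')]) (b + b') (t + t') (tensor A b t b' t' u v)"
    using evaluates_tensor[OF A assms(2,3)[unfolded represents_def]] len unfolding m represents_def by simp
  then have "represents A (map2 (@) \<sigma> \<tau> @ [Id (b + b')]) (b + b') (t + t') (tensor A b t b' t' u v)"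
    by (simp add: represents_top[OF A])
  then show ?thesis unfolding represents_bot[OF A] .
qed

lemma compatible_simps [simp]: "compatible []" "compatible [I]" "compatible (I # Id k # \<tau>) \<longleftrightarrow> compatible \<tau> \<or> compatible (Id k # \<tau>)"
proof -
  show "compatible []" "compatible [I]" unfolding compatible_def by simp_all
  have "set (Id k :: 'a option list) \<subseteq> {None}" by auto
  then show "compatible (I # Id k # \<tau>) \<longleftrightarrow> compatible \<tau> \<or> compatible (Id k # \<tau>)"
    unfolding compatible_def by (cases \<tau>) auto
qed

context
  fixes A :: "('a :: ab_group_add, 'b) planar_alg_scheme"
  assumes A: "unshaded_planar_algebra A"
begin

lemma mult_mem: "x \<in> spc A c t \<Longrightarrow> y \<in> spc A b c \<Longrightarrow> mult A b c t x y \<in> spc A b t"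
  using represents_mem[OF A represents_mult[OF A represents_element[OF A] represents_element[OF A]]] .

lemma tensor_mem: "x \<in> spc A b t \<Longrightarrow> y \<in> spc A b' t' \<Longrightarrow> tensor A b t b' t' x y \<in> spc A (b + b') (t + t')"
  using represents_mem[OF A represents_tensor[OF A represents_element[OF A] represents_element[OF A]]] by simp

lemma one_mem: "one A k \<in> spc A k k"
  by (rule represents_mem[OF A represents_one])

text \<open>This and the following laws hold because both sides are represented by the same shape.\<close>

lemma mult_assoc:
  assumes "x \<in> spc A d e" "y \<in> spc A c d" "z \<in> spc A b c"
  shows "mult A b c e (mult A c d e x y) z = mult A b d e x (mult A b c d y z)"
  using represents_mult[OF A represents_mult[OF A represents_element[OF A assms(1)] represents_element[OF A assms(2)]] represents_element[OF A assms(3)]]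
    represents_mult[OF A represents_element[OF A assms(1)] represents_mult[OF A represents_element[OF A assms(2)] represents_element[OF A assms(3)]]]
  by (simp add: represents_unique[OF A])

lemma mult_one:
  assumes "x \<in> spc A b t"
  shows "mult A b t t (one A t) x = x" "mult A b b t x (one A b) = x"
proof -
  note r = represents_element[OF A assms]
  have "represents A [[Some (b, t, x)]] b t (mult A b t t (one A t) x)"
    using represents_mult[OF A represents_one r] represents_top[OF A] by simp
  then show "mult A b t t (one A t) x = x" using represents_unique[OF A _ r] by blast
  have "represents A [[Some (b, t, x)]] b t (mult A b b t x (one A b))"
    using represents_mult[OF A r represents_one] represents_bot[OF A, of "[[Some (b, t, x)]]"] by simp
  then show "mult A b b t x (one A b) = x" using represents_unique[OF A _ r] by blast
qed

lemma tensor_assoc: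
  assumes "x \<in> spc A b t" "y \<in> spc A b' t'" "z \<in> spc A b'' t''"
  shows "tensor A (b + b') (t + t') b'' t'' (tensor A b t b' t' x y) z = tensor A b t (b' + b'') (t' + t'') x (tensor A b' t' b'' t'' y z)"
proof -
  note r = represents_element[OF A assms(1)] represents_element[OF A assms(2)] represents_element[OF A assms(3)]
  have "represents A [[Some (b, t, x), Some (b', t', y), Some (b'', t'', z)]] (b + b' + b'') (t + t' + t'') (tensor A (b + b') (t + t') b'' t'' (tensor A b t b' t' x y) z)"
    using represents_tensor[OF A represents_tensor[OF A r(1,2)] r(3)] by simp
  moreover have "represents A [[Some (b, t, x), Some (b', t', y), Some (b'', t'', z)]] (b + b' + b'') (t + t' + t'') (tensor A b t (b' + b'') (t' + t'') x (tensor A b' t' b'' t'' y z))"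
    using represents_tensor[OF A r(1) represents_tensor[OF A r(2,3)]] by (simp add: add.assoc)
  ultimately show ?thesis by (rule represents_unique[OF A])
qed

lemma tensor_empty:
  assumes "x \<in> spc A b t"
  shows "tensor A b t 0 0 x (one A 0) = x" "tensor A 0 0 b t (one A 0) x = x"
proof -
  note r = represents_element[OF A assms] and e = represents_ones[OF A, of 1 0]
  have "represents A [[Some (b, t, x)]] b t (tensor A b t 0 0 x (one A 0))"
    using represents_tensor[OF A r e] by simp
  then show "tensor A b t 0 0 x (one A 0) = x" using represents_unique[OF A _ r] by blast
  have "represents A [[Some (b, t, x)]] b t (tensor A 0 0 b t (one A 0) x)"
    using represents_tensor[OF A e r] by simp
  then show "tensor A 0 0 b t (one A 0) x = x" using represents_unique[OF A _ r] by blast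
qed

lemma tensor_one: "tensor A j j k k (one A j) (one A k) = one A (j + k)"
  using represents_tensor[OF A represents_one[of A j] represents_one[of A k]] represents_unique[OF A _ represents_one] by simp

lemma interchange:
  assumes "x \<in> spc A c t" "x' \<in> spc A b c" "y \<in> spc A c' t'" "y' \<in> spc A b' c'"
  shows "mult A (b + b') (c + c') (t + t') (tensor A c t c' t' x y) (tensor A b c b' c' x' y') =
     tensor A b t b' t' (mult A b c t x x') (mult A b' c' t' y y')"
proof -
  note r = represents_element[OF A assms(1)] represents_element[OF A assms(2)] represents_element[OF A assms(3)] represents_element[OF A assms(4)]
  let ?\<tau> = "[[Some (c, t, x), Some (c', t', y)], Id (c + c'), [Some (b, c, x'), Some (b', c', y')]]"
  have "represents A ?\<tau> (b + b') (t + t') (mult A (b + b') (c + c') (t + t') (tensor A c t c' t' x y) (tensor A b c b' c' x' y'))"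
    using represents_mult[OF A represents_tensor[OF A r(1,3)] represents_tensor[OF A r(2,4)]] by simp
  moreover have "represents A ?\<tau> (b + b') (t + t') (tensor A b t b' t' (mult A b c t x x') (mult A b' c' t' y y'))"
    using represents_tensor[OF A represents_mult[OF A r(1,2)] represents_mult[OF A r(3,4)]] by (simp add: replicate_add[symmetric])
  ultimately show ?thesis by (rule represents_unique[OF A])
qed

end

section \<open>Closing strands\<close>

subsection \<open>Half circles\<close>

text \<open>For \<open>e = 1\<close> the upper and for \<open>e = - 1\<close> the lower half, from \<open>c - e r\<close> to \<open>c + e r\<close>.\<close>

definition half_circle :: "real \<Rightarrow> complex \<Rightarrow> real \<Rightarrow> real \<Rightarrow> complex" where
  "half_circle e c r s = c + Complex (- e * r * cos (pi * s)) (e * r * sin (pi * s))"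

lemma half_circle_ends: "pathstart (half_circle e c r) = c - of_real (e * r)" "pathfinish (half_circle e c r) = c + of_real (e * r)"
  unfolding half_circle_def pathstart_def pathfinish_def by (simp_all add: complex_eq_iff)

lemma arc_half_circle:
  assumes "e \<noteq> 0" "0 < r" shows "arc (half_circle e c r)"
  unfolding arc_def path_def
proof
  show "continuous_on {0..1} (half_circle e c r)"
    unfolding half_circle_def by (intro continuous_intros)
  show "inj_on (half_circle e c r) {0..1}"
  proof (rule inj_onI)
    fix x y :: real assume x: "x \<in> {0..1}" "y \<in> {0..1}" and "half_circle e c r x = half_circle e c r y"
    then have "cos (pi * x) = cos (pi * y)" using assms unfolding half_circle_def by simp
    then have "pi * x = pi * y"
      by (rule cos_inj_pi[rotated 4]) (use x in auto)
    then show "x = y" by simp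
  qed
qed

lemma half_circle_image:
  assumes "e = 1 \<or> e = -1" "0 < r"
  shows "path_image (half_circle e c r) = {z. dist z c = r \<and> 0 \<le> e * (Im z - Im c)}"
proof
  have ee: "e * e = 1" using assms(1) by auto
  show "path_image (half_circle e c r) \<subseteq> {z. dist z c = r \<and> 0 \<le> e * (Im z - Im c)}"
  proof
    fix z assume "z \<in> path_image (half_circle e c r)"
    then obtain s where s: "0 \<le> s" "s \<le> 1" "z = half_circle e c r s" unfolding path_image_def by auto
    have e2: "e\<^sup>2 = 1" using ee by (simp add: power2_eq_square)
    have "(dist z c)\<^sup>2 = r\<^sup>2 * (cos (pi * s))\<^sup>2 + r\<^sup>2 * (sin (pi * s))\<^sup>2"
      unfolding s(3) half_circle_def dist_norm cmod_power2 by (simp add: power_mult_distrib e2)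
    then have "(dist z c)\<^sup>2 = r\<^sup>2" by (simp add: distrib_left[symmetric])
    then have "dist z c = r" using assms(2) by (simp add: power2_eq_iff_nonneg)
    moreover have "e * (Im z - Im c) = (e * e) * r * sin (pi * s)" unfolding s(3) half_circle_def by simp
    moreover have "0 \<le> sin (pi * s)" using s by (intro sin_ge_zero) auto
    ultimately show "z \<in> {z. dist z c = r \<and> 0 \<le> e * (Im z - Im c)}" using ee assms(2) by simp
  qed
  show "{z. dist z c = r \<and> 0 \<le> e * (Im z - Im c)} \<subseteq> path_image (half_circle e c r)"
  proof
    fix z assume z: "z \<in> {z. dist z c = r \<and> 0 \<le> e * (Im z - Im c)}"
    define x where "x = (Re z - Re c) / r"
    define y where "y = (Im z - Im c) / r"
    have "(Re z - Re c)\<^sup>2 + (Im z - Im c)\<^sup>2 = r\<^sup>2"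
      using z unfolding dist_norm by (metis (mono_tags, lifting) cmod_power2 mem_Collect_eq minus_complex.sel)
    then have xy: "x\<^sup>2 + y\<^sup>2 = 1" unfolding x_def y_def using assms(2) by (simp add: power_divide add_divide_distrib[symmetric])
    then have "(e * x)\<^sup>2 \<le> 1" using ee by (simp add: power_mult_distrib power2_eq_square[of e]) (smt (verit) zero_le_power2)
    then have ex: "-1 \<le> - e * x" "- e * x \<le> 1" by (auto simp: abs_square_le_1 abs_le_iff)
    define s where "s = arccos (- e * x) / pi"
    have s: "0 \<le> s" "s \<le> 1" unfolding s_def using arccos_bounded[OF ex] by (simp_all add: divide_le_eq)
    have c: "cos (pi * s) = - e * x" unfolding s_def using ex by (simp add: cos_arccos)
    have "(sin (pi * s))\<^sup>2 = (e * y)\<^sup>2"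
    proof -
      have "(sin (pi * s))\<^sup>2 = 1 - (e * e) * x\<^sup>2" using sin_squared_eq[of "pi * s"] c by (simp add: power2_eq_square)
      also have "\<dots> = (e * e) * y\<^sup>2" using xy ee by simp
      finally show ?thesis by (simp add: power2_eq_square)
    qed
    moreover have "0 \<le> sin (pi * s)" using s by (intro sin_ge_zero) auto
    moreover have "0 \<le> e * y" using z assms(2) unfolding y_def by simp
    ultimately have sn: "sin (pi * s) = e * y" by (simp add: power2_eq_iff_nonneg)
    have "half_circle e c r s = c + Complex ((e * e) * (r * x)) ((e * e) * (r * y))"
      unfolding half_circle_def c sn by (simp add: algebra_simps)
    also have "\<dots> = z" unfolding ee x_def y_def using assms(2) by (simp add: complex_eq_iff)
    finally show "z \<in> path_image (half_circle e c r)" unfolding path_image_def using s by force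
  qed
qed

lemma planar_cap: "planar_tangle cap_tangle" and planar_cup: "planar_tangle cup_tangle"
proof -
  have hs: "xpos 2 0 = -1/2" "xpos 2 (Suc 0) = 1/2" unfolding xpos_def by simp_all
  have two: "{..<2::nat} = {0, 1}" by auto
  have sub: "\<bar>Re z\<bar> \<le> r \<and> \<bar>Im z - Im c\<bar> \<le> r \<and> (\<bar>Im z - Im c\<bar> = 0 \<longrightarrow> \<bar>Re z\<bar> = r)" if "dist z c = r" "Re c = 0" for z c r
  proof -
    have "\<bar>Re (z - c)\<bar> \<le> r" "\<bar>Im (z - c)\<bar> \<le> r" using that(1) unfolding dist_norm by (metis abs_Re_le_cmod abs_Im_le_cmod)+
    moreover have "\<bar>Re (z - c)\<bar> = r" if "Im (z - c) = 0"
      using \<open>dist z c = r\<close> that unfolding dist_norm by (metis cmod_eq_Re)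
    ultimately show ?thesis using that(2) by simp
  qed
  let ?a = "half_circle 1 (- \<i>) (1/2)" and ?u = "half_circle (-1) \<i> (1/2)"
  have ia: "path_image ?a = {z. dist z (- \<i>) = 1/2 \<and> Im z \<ge> - 1}" by (subst half_circle_image) auto
  have iu: "path_image ?u = {z. dist z \<i> = 1/2 \<and> Im z \<le> 1}" by (subst half_circle_image) auto
  have ea: "pathstart ?a = Complex (-1/2) (-1)" "pathfinish ?a = Complex (1/2) (-1)"
    unfolding half_circle_ends by (simp_all add: complex_eq_iff)
  have eu: "pathstart ?u = Complex (1/2) 1" "pathfinish ?u = Complex (-1/2) 1"
    unfolding half_circle_ends by (simp_all add: complex_eq_iff)
  show "planar_tangle cap_tangle"
  proof (rule planar_from_arcs[where J = "{0::nat}" and g = "\<lambda>_. ?a"])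
    show "strands cap_tangle = (\<Union>j\<in>{0::nat}. path_image ?a)" unfolding ia cap_tangle_def by simp
    show "arc ?a" by (rule arc_half_circle) auto
    show "(\<Union>j\<in>{0::nat}. {pathstart ?a, pathfinish ?a}) = all_marks cap_tangle"
      unfolding all_marks_def marks_def ea cap_tangle_def bot_mark_def by (auto simp: two hs)
    show "path_image ?a \<subseteq> sq" unfolding ia using sub[of _ "- \<i>"] by (fastforce simp: mem_sq)
    fix z assume z: "z \<in> path_image ?a" "z \<in> frontier sq"
    then have "Im z = -1 \<and> \<bar>Re z\<bar> = 1/2" using sub[of z "- \<i>" "1/2"] unfolding ia frontier_sq mem_sq interior_sq by auto
    then show "z \<in> {pathstart ?a, pathfinish ?a}" unfolding ea by (auto simp: complex_eq_iff abs_if split: if_splits)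
  qed (auto simp: cap_tangle_def)
  show "planar_tangle cup_tangle"
  proof (rule planar_from_arcs[where J = "{0::nat}" and g = "\<lambda>_. ?u"])
    show "strands cup_tangle = (\<Union>j\<in>{0::nat}. path_image ?u)" unfolding iu cup_tangle_def by simp
    show "arc ?u" by (rule arc_half_circle) auto
    show "(\<Union>j\<in>{0::nat}. {pathstart ?u, pathfinish ?u}) = all_marks cup_tangle"
      unfolding all_marks_def marks_def eu cup_tangle_def top_mark_def by (auto simp: two hs)
    show "path_image ?u \<subseteq> sq" unfolding iu using sub[of _ "\<i>"] by (fastforce simp: mem_sq)
    fix z assume z: "z \<in> path_image ?u" "z \<in> frontier sq"
    then have "Im z = 1 \<and> \<bar>Re z\<bar> = 1/2" using sub[of z "\<i>" "1/2"] unfolding iu frontier_sq mem_sq interior_sq by auto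
    then show "z \<in> {pathstart ?u, pathfinish ?u}" unfolding eu by (auto simp: complex_eq_iff abs_if split: if_splits)
  qed (auto simp: cup_tangle_def)
qed

definition closing_path :: "real \<Rightarrow> real \<Rightarrow> complex" where
  "closing_path r = half_circle 1 (Complex 0 (1/4)) r +++ (linepath (Complex r (1/4)) (Complex r (-1/4)) +++ half_circle (-1) (Complex 0 (-1/4)) r)"

lemma vertical_segment: "closed_segment (Complex x y) (Complex x y') = {z. Re z = x \<and> min y y' \<le> Im z \<and> Im z \<le> max y y'}"
  by (auto simp: closed_segment_same_Re closed_segment_eq_real_ivl min_def max_def)

text \<open>
  A point determines the radius of the closing strand through it, so that the closing strands of
  different radii are disjoint.
\<close>

lemma closing_strand_mem:
  assumes "0 < r" "z \<in> closing_strand r"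
  shows "(max 0 (\<bar>Im z\<bar> - 1/4))\<^sup>2 + (Re z)\<^sup>2 = r\<^sup>2" "\<bar>Im z\<bar> < 1/4 \<Longrightarrow> Re z = r"
proof -
  from assms(2) consider "dist z (Complex 0 (1/4)) = r" "Im z \<ge> 1/4" | "Re z = r" "-1/4 \<le> Im z" "Im z \<le> 1/4"
    | "dist z (Complex 0 (-1/4)) = r" "Im z \<le> -1/4"
    unfolding closing_strand_def using assms(1) by (auto simp: vertical_segment)
  then have "(max 0 (\<bar>Im z\<bar> - 1/4))\<^sup>2 + (Re z)\<^sup>2 = r\<^sup>2 \<and> (\<bar>Im z\<bar> < 1/4 \<longrightarrow> Re z = r)"
  proof cases
    case 1
    have "r\<^sup>2 = (Re z)\<^sup>2 + (Im z - 1/4)\<^sup>2" unfolding 1(1)[symmetric] dist_norm cmod_power2 by simp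
    then show ?thesis using 1(2) by auto
  next
    case 2
    then have "max 0 (\<bar>Im z\<bar> - 1/4) = 0" by auto
    then show ?thesis using 2(1) by simp
  next
    case 3
    have "r\<^sup>2 = (Re z)\<^sup>2 + (- Im z - 1/4)\<^sup>2" unfolding 3(1)[symmetric] dist_norm cmod_power2 by (simp add: power2_eq_square algebra_simps)
    moreover have "max 0 (\<bar>Im z\<bar> - 1/4) = - Im z - 1/4" using 3(2) by simp
    ultimately show ?thesis using 3(2) by simp
  qed
  then show "(max 0 (\<bar>Im z\<bar> - 1/4))\<^sup>2 + (Re z)\<^sup>2 = r\<^sup>2" "\<bar>Im z\<bar> < 1/4 \<Longrightarrow> Re z = r" by auto
qed

lemma closing_path:
  assumes r: "0 < r"
  shows "arc (closing_path r)" "path_image (closing_path r) = closing_strand r"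
    "pathstart (closing_path r) = Complex (- r) (1/4)" "pathfinish (closing_path r) = Complex (- r) (-1/4)"
proof -
  let ?a = "half_circle 1 (Complex 0 (1/4)) r" and ?b = "half_circle (-1) (Complex 0 (-1/4)) r"
    and ?l = "linepath (Complex r (1/4)) (Complex r (-1/4))"
  have e: "pathstart ?a = Complex (-r) (1/4)" "pathfinish ?a = Complex r (1/4)" "pathstart ?b = Complex r (-1/4)" "pathfinish ?b = Complex (-r) (-1/4)"
    unfolding half_circle_ends by (simp_all add: complex_eq_iff)
  have ia: "path_image ?a = {z. dist z (Complex 0 (1/4)) = r \<and> Im z \<ge> 1/4}" using r by (subst half_circle_image) auto
  have ib: "path_image ?b = {z. dist z (Complex 0 (-1/4)) = r \<and> Im z \<le> -1/4}" using r by (subst half_circle_image) auto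
  have il: "path_image ?l = {z. Re z = r \<and> -1/4 \<le> Im z \<and> Im z \<le> 1/4}" unfolding path_image_linepath vertical_segment by auto
  have "arc (?l +++ ?b)"
  proof (rule arc_join)
    show "path_image ?l \<inter> path_image ?b \<subseteq> {pathstart ?b}"
      unfolding il ib e by (auto simp: complex_eq_iff)
  qed (use r e in \<open>auto intro!: arc_half_circle simp: arc_linepath\<close>)
  then show "arc (closing_path r)" unfolding closing_path_def
  proof (rule arc_join[rotated])
    have pj: "path_image (?l +++ ?b) = path_image ?l \<union> path_image ?b" using e by (intro path_image_join) simp
    have ps: "pathstart (?l +++ ?b) = Complex r (1/4)" by simp
    show "path_image ?a \<inter> path_image (?l +++ ?b) \<subseteq> {pathstart (?l +++ ?b)}"
      unfolding pj ps unfolding ia ib il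
    proof
      fix z assume "z \<in> {z. dist z (Complex 0 (1/4)) = r \<and> 1/4 \<le> Im z} \<inter> ({z. Re z = r \<and> -1/4 \<le> Im z \<and> Im z \<le> 1/4} \<union> {z. dist z (Complex 0 (-1/4)) = r \<and> Im z \<le> -1/4})"
      then have "Im z = 1/4 \<and> Re z = r" by auto
      then show "z \<in> {Complex r (1/4)}" by (simp add: complex_eq_iff)
    qed
  qed (use r e in \<open>auto intro!: arc_half_circle\<close>)
  show "path_image (closing_path r) = closing_strand r"
  proof -
    have "path_image (?a +++ (?l +++ ?b)) = path_image ?a \<union> (path_image ?l \<union> path_image ?b)"
      using e by (simp add: path_image_join)
    then show ?thesis unfolding closing_path_def closing_strand_def ia ib path_image_linepath using r by (simp add: Un_assoc)
  qed
  show "pathstart (closing_path r) = Complex (- r) (1/4)" "pathfinish (closing_path r) = Complex (- r) (-1/4)"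
    unfolding closing_path_def using e by simp_all
qed

lemma planar_trR: "planar_tangle (trR_tangle k)"
proof -
  define r where "r j = 1/2 - xpos k j / 4" for j
  have rb: "1/4 < r j" "r j < 3/4" if "j < k" for j using xpos_bounds[OF that] unfolding r_def by simp_all
  have rp: "0 < r j" if "j < k" for j using rb(1)[OF that] by simp
  have rinj: "i = j" if "i < k" "j < k" "r i = r j" for i j using that xpos_inj[of k i j] unfolding r_def by simp
  have bx: "boxes (trR_tangle k) = [(k, k, place (Complex (-1/2) 0) (1/4) (1/4))]" unfolding trR_tangle_def by simp
  have reg: "z \<in> in_region (k, k, place (Complex (-1/2) 0) (1/4) (1/4)) \<longleftrightarrow> -3/4 \<le> Re z \<and> Re z \<le> -1/4 \<and> \<bar>Im z\<bar> \<le> 1/4" for z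
  proof
    assume "z \<in> in_region (k, k, place (Complex (-1/2) 0) (1/4) (1/4))"
    then show "-3/4 \<le> Re z \<and> Re z \<le> -1/4 \<and> \<bar>Im z\<bar> \<le> 1/4"
      unfolding in_region_def in_map_def place_def by (auto simp: mem_sq abs_le_iff)
  next
    assume z: "-3/4 \<le> Re z \<and> Re z \<le> -1/4 \<and> \<bar>Im z\<bar> \<le> 1/4"
    have "z = place (Complex (-1/2) 0) (1/4) (1/4) (Complex (4 * Re z + 2) (4 * Im z))" unfolding place_def by (simp add: complex_eq_iff field_simps)
    moreover have "Complex (4 * Re z + 2) (4 * Im z) \<in> sq" using z by (auto simp: mem_sq abs_le_iff)
    ultimately show "z \<in> in_region (k, k, place (Complex (-1/2) 0) (1/4) (1/4))" unfolding in_region_def in_map_def by auto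
  qed
  have bnd: "\<bar>Re z\<bar> \<le> r j \<and> \<bar>Im z\<bar> \<le> 1/4 + r j" if "j < k" "z \<in> closing_strand (r j)" for j z
  proof -
    have e: "(max 0 (\<bar>Im z\<bar> - 1/4))\<^sup>2 + (Re z)\<^sup>2 = (r j)\<^sup>2" and p: "0 < r j" using closing_strand_mem[OF _ that(2)] rb[OF that(1)] by auto
    have "(Re z)\<^sup>2 \<le> (r j)\<^sup>2" "(max 0 (\<bar>Im z\<bar> - 1/4))\<^sup>2 \<le> (r j)\<^sup>2" using e zero_le_power2[of "Re z"] zero_le_power2[of "max 0 (\<bar>Im z\<bar> - 1/4)"] by linarith+
    then have "\<bar>Re z\<bar> \<le> r j" "max 0 (\<bar>Im z\<bar> - 1/4) \<le> r j" using p by (auto simp: abs_le_square_iff[symmetric] power2_le_iff_abs_le)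
    then show ?thesis by simp
  qed
  show ?thesis
  proof (rule planar_from_arcs[where J = "{..<k}" and g = "\<lambda>j. closing_path (r j)"])
    show "strands (trR_tangle k) = (\<Union>j\<in>{..<k}. path_image (closing_path (r j)))"
      unfolding trR_tangle_def r_def[symmetric] by (simp add: closing_path(2)[OF rp])
    show "arc (closing_path (r j))" if "j \<in> {..<k}" for j using closing_path(1)[of "r j"] rb[of j] that by simp
    show "orient_affine (in_map B) \<and> in_region B \<subseteq> interior sq" if "B \<in> set (boxes (trR_tangle k))" for B
    proof -
      have B: "B = (k, k, place (Complex (-1/2) 0) (1/4) (1/4))" using that bx by simp
      have "in_region B \<subseteq> interior sq"
      proof
        fix z assume "z \<in> in_region B"
        then have "-3/4 \<le> Re z \<and> Re z \<le> -1/4 \<and> \<bar>Im z\<bar> \<le> 1/4" unfolding B reg .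
        then show "z \<in> interior sq" unfolding interior_sq by linarith
      qed
      moreover have "orient_affine (in_map B)" unfolding B in_map_def by (auto intro!: orient_affine_place is_placeI)
      ultimately show ?thesis by blast
    qed
    show "i = j" if ij: "i \<in> {..<k}" "j \<in> {..<k}" "z \<in> path_image (closing_path (r i))" "z \<in> path_image (closing_path (r j))" for i j z
    proof -
      have p: "0 < r i" "0 < r j" using rb ij by fastforce+
      have "z \<in> closing_strand (r i)" "z \<in> closing_strand (r j)" using ij closing_path(2) p by simp_all
      then have "(r i)\<^sup>2 = (r j)\<^sup>2" using closing_strand_mem(1) p by metis
      then have "r i = r j" using p by (simp add: power2_eq_iff_nonneg)
      then show ?thesis using rinj ij by simp
    qed
    show "(\<Union>j\<in>{..<k}. {pathstart (closing_path (r j)), pathfinish (closing_path (r j))}) = all_marks (trR_tangle k)"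
    proof -
      have m: "in_marks (k, k, place (Complex (-1/2) 0) (1/4) (1/4)) = (\<Union>j\<in>{..<k}. {Complex (- r j) (1/4), Complex (- r j) (-1/4)})"
        unfolding in_marks_def marks_def by (auto simp: in_map_def in_bot_def in_top_def image_Un image_image place_marks r_def)
      have "all_marks (trR_tangle k) = (\<Union>j\<in>{..<k}. {Complex (- r j) (1/4), Complex (- r j) (-1/4)})"
        unfolding all_marks_def bx m[symmetric] by (simp add: trR_tangle_def marks_def)
      then show ?thesis by (simp add: closing_path(3,4)[OF rp])
    qed
    show "path_image (closing_path (r j)) \<subseteq> sq" if "j \<in> {..<k}" for j
    proof -
      have j: "j < k" "0 < r j" using that rb[of j] by auto
      show ?thesis unfolding closing_path(2)[OF j(2)] using bnd[OF j(1)] rb[OF j(1)] by (fastforce simp: mem_sq)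
    qed
    show "z \<in> {pathstart (closing_path (r j)), pathfinish (closing_path (r j))}" if "j \<in> {..<k}" "z \<in> path_image (closing_path (r j))" "z \<in> frontier sq" for j z
    proof -
      have j: "j < k" "0 < r j" using that rb[of j] by auto
      have "\<bar>Re z\<bar> < 1" "\<bar>Im z\<bar> < 1" using bnd[OF j(1), of z] rb[OF j(1)] that(2) unfolding closing_path(2)[OF j(2)] by auto
      then show ?thesis using that(3) by (simp add: frontier_sq interior_sq)
    qed
    show "z \<in> {pathstart (closing_path (r j)), pathfinish (closing_path (r j))}" if "j \<in> {..<k}" "z \<in> path_image (closing_path (r j))" "B \<in> set (boxes (trR_tangle k))" "z \<in> in_region B" for j z B
    proof -
      have j: "j < k" "0 < r j" using that rb[of j] by auto
      have zc: "z \<in> closing_strand (r j)" using that(2) closing_path(2)[OF j(2)] by simp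
      have zr: "-3/4 \<le> Re z" "Re z \<le> -1/4" "\<bar>Im z\<bar> \<le> 1/4" 
      proof -
        have "B = (k, k, place (Complex (-1/2) 0) (1/4) (1/4))" using that(3) unfolding bx by simp
        then have "-3/4 \<le> Re z \<and> Re z \<le> -1/4 \<and> \<bar>Im z\<bar> \<le> 1/4" using that(4) reg[of z] by blast
        then show "-3/4 \<le> Re z" "Re z \<le> -1/4" "\<bar>Im z\<bar> \<le> 1/4" by blast+
      qed
      have "\<bar>Im z\<bar> = 1/4" using closing_strand_mem(2)[OF j(2) zc] zr j by linarith
      moreover have "(Re z)\<^sup>2 = (r j)\<^sup>2" using closing_strand_mem(1)[OF j(2) zc] zr(3) by simp
      then have "Re z = - r j" using zr(2) j(2) by (auto simp: power2_eq_iff)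
      ultimately show ?thesis unfolding closing_path(3,4)[OF j(2)] by (auto simp: complex_eq_iff abs_if split: if_splits)
    qed
  qed (auto simp: bx)
qed

subsection \<open>The trace of an element of the one-strand space\<close>

text \<open>A strand that crosses each height twice, symmetrically, is described by its half-width.\<close>

definition sym_curve :: "(real \<Rightarrow> real) \<Rightarrow> real \<Rightarrow> real \<Rightarrow> complex set" where
  "sym_curve X a b = {z. a \<le> Im z \<and> Im z \<le> b \<and> (Re z = X (Im z) \<or> Re z = - X (Im z))}"

definition right_curve :: "(real \<Rightarrow> real) \<Rightarrow> real \<Rightarrow> real \<Rightarrow> complex set" where
  "right_curve X a b = {z. a \<le> Im z \<and> Im z \<le> b \<and> Re z = X (Im z)}"

lemma place_image: "w \<noteq> 0 \<Longrightarrow> h \<noteq> 0 \<Longrightarrow> place (Complex p q) w h ` S = {z. Complex ((Re z - p) / w) ((Im z - q) / h) \<in> S}"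
  unfolding place_def by (force simp: complex_eq_iff image_iff intro: bexI[of _ "Complex ((Re _ - p) / w) ((Im _ - q) / h)"])

lemma place_sym_curve: "0 < w \<Longrightarrow> 0 < h \<Longrightarrow> place (Complex 0 q) w h ` sym_curve X a b = sym_curve (\<lambda>y. w * X ((y - q) / h)) (q + h * a) (q + h * b)"
  by (subst place_image) (auto simp: sym_curve_def field_simps)

lemma place_right_curve: "0 < w \<Longrightarrow> 0 < h \<Longrightarrow> place (Complex 0 q) w h ` right_curve X a b = right_curve (\<lambda>y. w * X ((y - q) / h)) (q + h * a) (q + h * b)"
  by (subst place_image) (auto simp: right_curve_def field_simps)

lemma sym_curve_cong: "(\<And>y. a \<le> y \<Longrightarrow> y \<le> b \<Longrightarrow> X y = X' y) \<Longrightarrow> sym_curve X a b = sym_curve X' a b"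
  unfolding sym_curve_def by auto

lemma right_curve_cong: "(\<And>y. a \<le> y \<Longrightarrow> y \<le> b \<Longrightarrow> X y = X' y) \<Longrightarrow> right_curve X a b = right_curve X' a b"
  unfolding right_curve_def by auto

lemma sym_curve_join: "a \<le> b \<Longrightarrow> b \<le> c \<Longrightarrow> sym_curve X a b \<union> sym_curve X b c = sym_curve X a c"
  unfolding sym_curve_def by auto

lemma sloped_segment:
  assumes "y0 < y1"
  shows "closed_segment (Complex x0 y0) (Complex x1 y1) = {z. y0 \<le> Im z \<and> Im z \<le> y1 \<and> Re z = x0 + (x1 - x0) * ((Im z - y0) / (y1 - y0))}"
proof
  show "closed_segment (Complex x0 y0) (Complex x1 y1) \<subseteq> {z. y0 \<le> Im z \<and> Im z \<le> y1 \<and> Re z = x0 + (x1 - x0) * ((Im z - y0) / (y1 - y0))}"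
  proof
    fix z assume "z \<in> closed_segment (Complex x0 y0) (Complex x1 y1)"
    then obtain s where s: "0 \<le> s" "s \<le> 1" "z = (1 - s) *\<^sub>R Complex x0 y0 + s *\<^sub>R Complex x1 y1" unfolding in_segment by blast
    have I: "Im z = y0 + s * (y1 - y0)" and R: "Re z = x0 + (x1 - x0) * s" unfolding s(3) by (simp_all add: algebra_simps)
    have "0 \<le> s * (y1 - y0)" "s * (y1 - y0) \<le> 1 * (y1 - y0)" using s assms by (auto intro!: mult_right_mono)
    moreover have q: "(Im z - y0) / (y1 - y0) = s" unfolding I using assms by simp
    ultimately have "y0 \<le> Im z" "Im z \<le> y1" unfolding I by simp_all
    then show "z \<in> {z. y0 \<le> Im z \<and> Im z \<le> y1 \<and> Re z = x0 + (x1 - x0) * ((Im z - y0) / (y1 - y0))}"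
      unfolding mem_Collect_eq q R by blast
  qed
  show "{z. y0 \<le> Im z \<and> Im z \<le> y1 \<and> Re z = x0 + (x1 - x0) * ((Im z - y0) / (y1 - y0))} \<subseteq> closed_segment (Complex x0 y0) (Complex x1 y1)"
  proof
    fix z assume z: "z \<in> {z. y0 \<le> Im z \<and> Im z \<le> y1 \<and> Re z = x0 + (x1 - x0) * ((Im z - y0) / (y1 - y0))}"
    define s where "s = (Im z - y0) / (y1 - y0)"
    have "0 \<le> s" "s \<le> 1" using z assms unfolding s_def by auto
    moreover have "s * (y1 - y0) = Im z - y0" using assms unfolding s_def by simp
    then have I: "Im z = y0 + s * (y1 - y0)" by simp
    have R: "Re z = x0 + (x1 - x0) * s" using z unfolding s_def by simp
    have "z = (1 - s) *\<^sub>R Complex x0 y0 + s *\<^sub>R Complex x1 y1" using I R by (simp add: complex_eq_iff algebra_simps)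
    ultimately show "z \<in> closed_segment (Complex x0 y0) (Complex x1 y1)" unfolding in_segment by blast
  qed
qed

text \<open>
  The half-width of the closed strand of \<open>trR_tangle 1\<close> at height \<open>y\<close>: half circles of radius \<open>1/2\<close>, joined by a
  straight part between the heights \<open>\<plusminus>1/4\<close> of the box.
\<close>

definition trace_x :: "real \<Rightarrow> real" where
  "trace_x y = sqrt (1/4 - (max 0 (\<bar>y\<bar> - 1/4))\<^sup>2)"

text \<open>
  The half-width of the strand of \<open>loop_tangle\<close>. From bottom to top: the cup squeezed by the
  multiplication tangle, vertical segments, sloping segments, vertical segments beside the box, and
  the cap, which passes through two multiplication tangles.
\<close>

definition loop_x :: "real \<Rightarrow> real" where
  "loop_x y = min (1/4) (max (1/8) (1/4 - 2 * (y - 1/4))) *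
     (sqrt (1 - (max 0 (32 * (y - 9/16)))\<^sup>2) * sqrt (1 - (max 0 (8 * (- 1/4 - y)))\<^sup>2))"

text \<open>
  A piecewise linear correspondence from the heights of \<open>trR_tangle 1\<close> to those of \<open>loop_tangle\<close>. It maps
  \<open>-3/4, -1/4, 1/4, 3/4\<close> to \<open>-3/8, 11/32, 13/32, 19/32\<close>, so box goes to box and turning points go to turning points.
\<close>

definition loop_y :: "real \<Rightarrow> real" where
  "loop_y y = 3/8 + (max (-1/4) (min (1/4) y)) / 8 + 23/16 * min 0 (y + 1/4) + 3/8 * max 0 (y - 1/4)"

lemma loop_y_values: "y \<le> -1/4 \<Longrightarrow> loop_y y = 11/32 + 23/16 * (y + 1/4)" "-1/4 \<le> y \<Longrightarrow> y \<le> 1/4 \<Longrightarrow> loop_y y = 3/8 + y / 8" "1/4 \<le> y \<Longrightarrow> loop_y y = 13/32 + 3/8 * (y - 1/4)"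
proof -
  assume "y \<le> -1/4"
  then have "max (-1/4) (min (1/4) y) = -1/4" "min 0 (y + 1/4) = y + 1/4" "max 0 (y - 1/4) = 0" by simp_all
  then show "loop_y y = 11/32 + 23/16 * (y + 1/4)" unfolding loop_y_def by simp
next
  assume "-1/4 \<le> y" "y \<le> 1/4"
  then have "max (-1/4) (min (1/4) y) = y" "min 0 (y + 1/4) = 0" "max 0 (y - 1/4) = 0" by simp_all
  then show "loop_y y = 3/8 + y / 8" unfolding loop_y_def by simp
next
  assume "1/4 \<le> y"
  then have "max (-1/4) (min (1/4) y) = 1/4" "min 0 (y + 1/4) = 0" "max 0 (y - 1/4) = y - 1/4" by simp_all
  then show "loop_y y = 13/32 + 3/8 * (y - 1/4)" unfolding loop_y_def by simp
qed

lemma loop_y_mono: "y < y' \<Longrightarrow> loop_y y < loop_y y'"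
  using loop_y_values[of y] loop_y_values[of y']
  by (cases "y \<le> -1/4"; cases "y' \<le> -1/4"; cases "y \<le> 1/4"; cases "y' \<le> 1/4") (auto simp: field_simps)

lemma loop_x_values:
  "y \<le> -1/4 \<Longrightarrow> loop_x y = 1/4 * sqrt (1 - (8 * (- 1/4 - y))\<^sup>2)"
  "-1/4 \<le> y \<Longrightarrow> y \<le> 1/4 \<Longrightarrow> loop_x y = 1/4"
  "1/4 \<le> y \<Longrightarrow> y \<le> 5/16 \<Longrightarrow> loop_x y = 1/4 - 2 * (y - 1/4)"
  "5/16 \<le> y \<Longrightarrow> y \<le> 9/16 \<Longrightarrow> loop_x y = 1/8"
  "9/16 \<le> y \<Longrightarrow> loop_x y = 1/8 * sqrt (1 - (32 * (y - 9/16))\<^sup>2)"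
  unfolding loop_x_def by (simp_all add: max_def min_def)

lemma sqrt_scale: "0 \<le> c \<Longrightarrow> c * sqrt x = sqrt (c\<^sup>2 * x)"
  by (simp add: real_sqrt_mult)

lemma cap_sym_curve: "strands cap_tangle = sym_curve (\<lambda>y. sqrt (1/4 - (y + 1)\<^sup>2)) (-1) (-1/2)"
  and cup_sym_curve: "strands cup_tangle = sym_curve (\<lambda>y. sqrt (1/4 - (1 - y)\<^sup>2)) (1/2) 1"
proof -
  have d: "dist z c = 1/2 \<longleftrightarrow> (Re z)\<^sup>2 + (Im z - Im c)\<^sup>2 = 1/4" if "Re c = 0" for z c
  proof -
    have "dist z c = 1/2 \<longleftrightarrow> (dist z c)\<^sup>2 = (1/2)\<^sup>2" by (rule power2_eq_iff_nonneg[symmetric]) auto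
    then show ?thesis unfolding dist_norm cmod_power2 using that by (simp add: power2_eq_square)
  qed
  have r: "x\<^sup>2 + y\<^sup>2 = 1/4 \<longleftrightarrow> y\<^sup>2 \<le> 1/4 \<and> (x = sqrt (1/4 - y\<^sup>2) \<or> x = - sqrt (1/4 - y\<^sup>2))" for x y :: real
  proof
    assume a: "x\<^sup>2 + y\<^sup>2 = 1/4"
    then have e: "1/4 - y\<^sup>2 = x\<^sup>2" by linarith
    have "y\<^sup>2 \<le> 1/4" using a zero_le_power2[of x] by linarith
    then show "y\<^sup>2 \<le> 1/4 \<and> (x = sqrt (1/4 - y\<^sup>2) \<or> x = - sqrt (1/4 - y\<^sup>2))" unfolding e by auto
  next
    assume a: "y\<^sup>2 \<le> 1/4 \<and> (x = sqrt (1/4 - y\<^sup>2) \<or> x = - sqrt (1/4 - y\<^sup>2))"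
    then have "x\<^sup>2 = 1/4 - y\<^sup>2" by auto
    then show "x\<^sup>2 + y\<^sup>2 = 1/4" by simp
  qed
  have s: "(y::real)\<^sup>2 \<le> 1/4 \<longleftrightarrow> \<bar>y\<bar> \<le> 1/2" for y
    using abs_le_square_iff[of y "1/2"] by (simp add: power2_eq_square)
  show "strands cap_tangle = sym_curve (\<lambda>y. sqrt (1/4 - (y + 1)\<^sup>2)) (-1) (-1/2)"
  proof -
    have "dist z (- \<i>) = 1/2 \<and> Im z \<ge> -1 \<longleftrightarrow> -1 \<le> Im z \<and> Im z \<le> -1/2 \<and> (Re z = sqrt (1/4 - (Im z + 1)\<^sup>2) \<or> Re z = - sqrt (1/4 - (Im z + 1)\<^sup>2))" for z
    proof -
      have dd: "dist z (- \<i>) = 1/2 \<longleftrightarrow> (Re z)\<^sup>2 + (Im z + 1)\<^sup>2 = 1/4" using d[of "- \<i>" z] by simp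
      show ?thesis unfolding dd r[of "Re z" "Im z + 1"] s by auto
    qed
    then show ?thesis unfolding cap_tangle_def sym_curve_def by simp
  qed
  show "strands cup_tangle = sym_curve (\<lambda>y. sqrt (1/4 - (1 - y)\<^sup>2)) (1/2) 1"
  proof -
    have "dist z \<i> = 1/2 \<and> Im z \<le> 1 \<longleftrightarrow> 1/2 \<le> Im z \<and> Im z \<le> 1 \<and> (Re z = sqrt (1/4 - (1 - Im z)\<^sup>2) \<or> Re z = - sqrt (1/4 - (1 - Im z)\<^sup>2))" for z
    proof -
      have dd: "dist z \<i> = 1/2 \<longleftrightarrow> (Re z)\<^sup>2 + (1 - Im z)\<^sup>2 = 1/4" using d[of "\<i>" z] by (simp add: power2_commute)
      show ?thesis unfolding dd r[of "Re z" "1 - Im z"] s by auto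
    qed
    then show ?thesis unfolding cup_tangle_def sym_curve_def by simp
  qed
qed

text \<open>Three stages of gluing: a box beside a strand, then with a cap on top, then with a cup below.\<close>

definition loop_mid :: tangle where "loop_mid = glue (tensor_tangle 1 1 1 1) 1 strand_tangle"
definition loop_top :: tangle where "loop_top = glue2 (mult_tangle 2 2 0) cap_tangle loop_mid"
definition loop_tangle :: tangle where "loop_tangle = glue2 (mult_tangle 0 2 0) loop_top cup_tangle"

lemma planar_strand: "planar_tangle strand_tangle"
proof -
  have "layered 1 1 (id_layers 1 :: nat layer list) = strand_tangle"
    unfolding layered_def id_layers_def strand_tangle_def
    by (simp add: fan_strands bot_mark_def top_mark_def closed_segment_commute lessThan_Suc del: layer_strands.simps)
  moreover have "planar_tangle (layered 1 1 (id_layers 1 :: nat layer list))"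
    by (rule planar_layered_alternating[OF good_id_layers]) (auto simp: id_layers_def)
  ultimately show ?thesis by simp
qed

lemma loop_bots [simp]:
  "bots strand_tangle = 1" "tops strand_tangle = 1" "bots cap_tangle = 2" "tops cap_tangle = 0" "bots cup_tangle = 0" "tops cup_tangle = 2"
  "boxes strand_tangle = []" "boxes cap_tangle = []" "boxes cup_tangle = []"
  by (simp_all add: strand_tangle_def cap_tangle_def cup_tangle_def)

lemma mult_boxes: "boxes (mult_tangle b c t) = [(c, t, place (Complex 0 (1/2)) (1/2) (1/4)), (b, c, place (Complex 0 (-1/2)) (1/2) (1/4))]"
  and mult_bots [simp]: "bots (mult_tangle b c t) = b" "tops (mult_tangle b c t) = t"
  unfolding mult_tangle_def Let_def by simp_all

lemma tensor_boxes: "boxes (tensor_tangle b t b' t') = [(b, t, place (Complex (-1/2) 0) (1/4) (1/2)), (b', t', place (Complex (1/2) 0) (1/4) (1/2))]"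
  and tensor_bots [simp]: "bots (tensor_tangle b t b' t') = b + b'" "tops (tensor_tangle b t b' t') = t + t'"
  unfolding tensor_tangle_def Let_def by simp_all

lemma in_sel [simp]: "in_bot (b, t, f) = b" "in_top (b, t, f) = t" "in_map (b, t, f) = f"
  by (simp_all add: in_bot_def in_top_def in_map_def)

lemma loop_mid_boxes: "boxes loop_mid = [(1, 1, place (Complex (-1/2) 0) (1/4) (1/2))]" "bots loop_mid = 2" "tops loop_mid = 2"
  unfolding loop_mid_def glue_def Let_def by (simp_all add: tensor_boxes)

lemma planar_loop_mid: "planar_tangle loop_mid"
  unfolding loop_mid_def by (rule planar_glue[OF planar_tensor planar_strand]) (simp_all add: tensor_boxes)

lemma loop_top_boxes: "boxes loop_top = [(1, 1, place (Complex 0 (-1/2)) (1/2) (1/4) \<circ> place (Complex (-1/2) 0) (1/4) (1/2))]" "bots loop_top = 2" "tops loop_top = 0"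
  unfolding loop_top_def glue2_simps[OF mult_boxes] by (simp_all add: loop_mid_boxes)

lemma planar_loop_top: "planar_tangle loop_top"
  unfolding loop_top_def by (rule planar_glue2[OF planar_mult planar_cap planar_loop_mid mult_boxes]) (simp_all add: loop_mid_boxes)

lemma loop_boxes: "boxes loop_tangle = [(1, 1, place (Complex (-1/8) (3/8)) (1/16) (1/32))]" "bots loop_tangle = 0" "tops loop_tangle = 0"
proof -
  have "place (Complex 0 (1/2)) (1/2) (1/4) \<circ> (place (Complex 0 (-1/2)) (1/2) (1/4) \<circ> place (Complex (-1/2) 0) (1/4) (1/2)) = place (Complex (-1/8) (3/8)) (1/16) (1/32)"
    unfolding place_def by (simp add: fun_eq_iff complex_eq_iff field_simps)
  then show "boxes loop_tangle = [(1, 1, place (Complex (-1/8) (3/8)) (1/16) (1/32))]" "bots loop_tangle = 0" "tops loop_tangle = 0"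
    unfolding loop_tangle_def glue2_simps[OF mult_boxes] by (simp_all add: loop_top_boxes)
qed

lemma planar_loop: "planar_tangle loop_tangle"
  unfolding loop_tangle_def by (rule planar_glue2[OF planar_mult planar_loop_top planar_cup mult_boxes]) (simp_all add: loop_top_boxes)

lemma act_loop:
  assumes A: "unshaded_planar_algebra A" and x: "x \<in> spc A 1 1"
  shows "act A loop_tangle [x] = mult A 0 2 0 (mult A 2 2 0 (cap A) (tensor A 1 1 1 1 x (strand A))) (cup A)"
proof -
  have ln: "labelling A cap_tangle []" "labelling A cup_tangle []" "labelling A strand_tangle []" unfolding labelling_def by simp_all
  have "strand A \<in> spc A 1 1" using act_closed[OF A planar_strand ln(3)] unfolding strand_def by simp
  then have lt: "labelling A (tensor_tangle 1 1 1 1) [x, strand A]" unfolding labelling_iff tensor_boxes using x by simp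
  have 1: "act A loop_mid [x] = tensor A 1 1 1 1 x (strand A)"
    using act_glue[OF A planar_tensor planar_strand lt ln(3), of 1] unfolding loop_mid_def tensor_def strand_def by (simp add: tensor_boxes)
  have lm: "labelling A loop_mid [x]" unfolding labelling_iff loop_mid_boxes using x by simp
  have 2: "act A loop_top [x] = mult A 2 2 0 (cap A) (tensor A 1 1 1 1 x (strand A))"
    using act_glue2(1)[OF A planar_mult[of 2 2 0] planar_cap planar_loop_mid mult_boxes _ _ _ _ ln(1) lm] 1
    unfolding loop_top_def[symmetric] mult_def cap_def by (simp add: loop_mid_boxes)
  have lt2: "labelling A loop_top [x]" unfolding labelling_iff loop_top_boxes using x by simp
  show ?thesis
    using act_glue2(1)[OF A planar_mult[of 0 2 0] planar_loop_top planar_cup mult_boxes _ _ _ _ lt2 ln(2)] 2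
    unfolding loop_tangle_def[symmetric] mult_def cup_def by (simp add: loop_top_boxes)
qed

lemma sym_segments:
  assumes "y0 < y1"
  shows "closed_segment (Complex (- x0) y0) (Complex (- x1) y1) \<union> closed_segment (Complex x0 y0) (Complex x1 y1) =
    sym_curve (\<lambda>y. x0 + (x1 - x0) * ((y - y0) / (y1 - y0))) y0 y1"
proof -
  have "- x0 + (- x1 + x0) * t = - (x0 + (x1 - x0) * t)" for t by (simp add: algebra_simps)
  then show ?thesis unfolding sloped_segment[OF assms] sym_curve_def by auto
qed

lemma loop_strands: "strands loop_tangle = sym_curve loop_x (-3/8) (11/32) \<union> right_curve loop_x (11/32) (13/32) \<union> sym_curve loop_x (13/32) (19/32)"
proof -
  have two: "{..<2::nat} = {0, 1}" and xp: "xpos 2 0 = -1/2" "xpos 2 (Suc 0) = 1/2" "xpos 1 0 = 0" "xpos (Suc 0) 0 = 0"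
    unfolding xpos_def by auto
  have m0: "strands (mult_tangle 0 2 0) = sym_curve (\<lambda>y. 1/4) (-1/4) (1/4)"
    unfolding mult_tangle_def Let_def place_marks using sym_segments[of "-1/4" "1/4" "1/4" "1/4"] by (simp add: two xp)
  have m2: "strands (mult_tangle 2 2 0) = sym_curve (\<lambda>y. 1/4) (-1/4) (1/4) \<union> sym_curve (\<lambda>y. 1/4 - (y + 3/4)) (-1) (-3/4)"
  proof -
    have "sym_curve (\<lambda>y. 1/2 + (1/4 - 1/2) * ((y - - 1) / (-3/4 - - 1))) (-1) (-3/4) = sym_curve (\<lambda>y. 1/4 - (y + 3/4)) (-1) (-3/4)"
      by (rule sym_curve_cong) (simp add: field_simps)
    then show ?thesis
      unfolding mult_tangle_def Let_def place_marks using sym_segments[of "-1/4" "1/4" "1/4" "1/4"] sym_segments[of "-1" "-3/4" "1/2" "1/4"]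
      by (simp add: two xp bot_mark_def)
  qed
  have lm: "strands loop_mid = sym_curve (\<lambda>y. 1/2) (1/2) 1 \<union> sym_curve (\<lambda>y. 1/2) (-1) (-1/2) \<union> right_curve (\<lambda>y. 1/2) (-1/2) (1/2)"
  proof -
    have "place (Complex (1/2) 0) (1/4) (1/2) ` closed_segment (Complex 0 (-1)) (Complex 0 1) = right_curve (\<lambda>y. 1/2) (-1/2) (1/2)"
      unfolding sloped_segment[of "-1" 1, simplified] by (subst place_image) (auto simp: right_curve_def)
    moreover have "strands (tensor_tangle 1 1 1 1) = sym_curve (\<lambda>y. 1/2) (1/2) 1 \<union> sym_curve (\<lambda>y. 1/2) (-1) (-1/2)"
    proof -
      have f1: "sym_curve (\<lambda>y. 1/2) (1/2) 1 = closed_segment (Complex (-1/2) (1/2)) (Complex (-1/2) 1) \<union> closed_segment (Complex (1/2) (1/2)) (Complex (1/2) 1)"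
        using sym_segments[of "1/2" 1 "1/2" "1/2"] by simp
      have f2: "sym_curve (\<lambda>y. 1/2) (-1) (-1/2) = closed_segment (Complex (-1/2) (-1)) (Complex (-1/2) (-1/2)) \<union> closed_segment (Complex (1/2) (-1)) (Complex (1/2) (-1/2))"
        using sym_segments[of "-1" "-1/2" "1/2" "1/2"] by simp
      have xp': "xpos (Suc (Suc 0)) 0 = -1/2" "xpos (Suc (Suc 0)) (Suc 0) = 1/2" unfolding xpos_def by simp_all
      show ?thesis unfolding f1 f2 tensor_tangle_def Let_def place_marks
        by (simp add: xp xp' top_mark_def bot_mark_def lessThan_Suc closed_segment_commute Un_ac)
    qed
    ultimately show ?thesis
      unfolding loop_mid_def glue_def Let_def by (simp add: tensor_boxes strand_tangle_def bot_mark_def top_mark_def xp)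
  qed
  let ?u = "place (Complex 0 (1/2)) (1/2) (1/4)" and ?d = "place (Complex 0 (-1/2)) (1/2) (1/4)"
  have lt: "strands loop_top = strands (mult_tangle 2 2 0) \<union> ?d ` strands loop_mid \<union> ?u ` strands cap_tangle"
    unfolding loop_top_def glue2_simps[OF mult_boxes] by simp
  have ll: "strands loop_tangle = strands (mult_tangle 0 2 0) \<union> ?d ` strands cup_tangle \<union> ?u ` strands loop_top"
    unfolding loop_tangle_def glue2_simps[OF mult_boxes] by simp
  have p1: "sym_curve (\<lambda>y. 1/4) (-1/4) (1/4) = sym_curve loop_x (-1/4) (1/4)"
    by (rule sym_curve_cong) (simp add: loop_x_values)
  have p2: "?d ` strands cup_tangle = sym_curve loop_x (-3/8) (-1/4)"
  proof -
    have "1/2 * sqrt (1/4 - (1 - (y - -1/2) / (1/4))\<^sup>2) = loop_x y" if "y \<le> -1/4" for y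
      unfolding loop_x_values(1)[OF that] by (subst sqrt_scale, simp, subst sqrt_scale, simp) (simp add: power2_eq_square field_simps)
    then have "sym_curve (\<lambda>y. 1/2 * sqrt (1/4 - (1 - (y - -1/2) / (1/4))\<^sup>2)) (-3/8) (-1/4) = sym_curve loop_x (-3/8) (-1/4)"
      by (intro sym_curve_cong) blast
    then show ?thesis unfolding cup_sym_curve by (subst place_sym_curve) simp_all
  qed
  have p3: "?u ` ?u ` strands cap_tangle = sym_curve loop_x (9/16) (19/32)"
  proof -
    have "1/2 * (1/2 * sqrt (1/4 - (((y - 1/2) / (1/4) - 1/2) / (1/4) + 1)\<^sup>2)) = loop_x y" if "9/16 \<le> y" for y
      unfolding loop_x_values(5)[OF that] by (subst sqrt_scale, simp, subst sqrt_scale, simp, subst sqrt_scale, simp) (simp add: power2_eq_square field_simps)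
    then have "sym_curve (\<lambda>y. 1/2 * (1/2 * sqrt (1/4 - (((y - 1/2) / (1/4) - 1/2) / (1/4) + 1)\<^sup>2))) (9/16) (19/32) = sym_curve loop_x (9/16) (19/32)"
      by (intro sym_curve_cong) blast
    then show ?thesis unfolding cap_sym_curve by (simp add: place_sym_curve)
  qed
  have p4: "?u ` strands (mult_tangle 2 2 0) = sym_curve loop_x (7/16) (9/16) \<union> sym_curve loop_x (1/4) (5/16)"
  proof -
    have "sym_curve (\<lambda>y. 1/2 * (1/4)) (7/16) (9/16) = sym_curve loop_x (7/16) (9/16)"
      by (rule sym_curve_cong) (simp add: loop_x_values)
    moreover have "sym_curve (\<lambda>y. 1/2 * (1/4 - ((y - 1/2) / (1/4) + 3/4))) (1/4) (5/16) = sym_curve loop_x (1/4) (5/16)"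
      by (rule sym_curve_cong) (simp add: loop_x_values)
    ultimately show ?thesis unfolding m2 image_Un by (simp add: place_sym_curve)
  qed
  have p5: "?u ` ?d ` strands loop_mid = sym_curve loop_x (13/32) (7/16) \<union> sym_curve loop_x (5/16) (11/32) \<union> right_curve loop_x (11/32) (13/32)"
  proof -
    have "sym_curve (\<lambda>y. 1/2 * (1/2 * (1/2))) (13/32) (7/16) = sym_curve loop_x (13/32) (7/16)"
      "sym_curve (\<lambda>y. 1/2 * (1/2 * (1/2))) (5/16) (11/32) = sym_curve loop_x (5/16) (11/32)"
      by (rule sym_curve_cong, simp add: loop_x_values)+
    moreover have "right_curve (\<lambda>y. 1/2 * (1/2 * (1/2))) (11/32) (13/32) = right_curve loop_x (11/32) (13/32)"
      by (rule right_curve_cong) (simp add: loop_x_values)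
    ultimately show ?thesis unfolding lm image_Un by (simp add: place_sym_curve place_right_curve)
  qed
  have j1: "sym_curve loop_x (-3/8) (-1/4) \<union> sym_curve loop_x (-1/4) (1/4) \<union> sym_curve loop_x (1/4) (5/16) \<union> sym_curve loop_x (5/16) (11/32) = sym_curve loop_x (-3/8) (11/32)"
    by (simp add: sym_curve_join)
  have j2: "sym_curve loop_x (13/32) (7/16) \<union> sym_curve loop_x (7/16) (9/16) \<union> sym_curve loop_x (9/16) (19/32) = sym_curve loop_x (13/32) (19/32)"
    by (simp add: sym_curve_join)
  show ?thesis
    unfolding ll lt m0 p1 p2 image_Un p3 p4 p5 j1[symmetric] j2[symmetric] by (simp only: Un_ac)
qed

lemma circle_slice:
  assumes "Re c = 0"
  shows "dist z c = 1/2 \<longleftrightarrow> \<bar>Im z - Im c\<bar> \<le> 1/2 \<and> (Re z = sqrt (1/4 - (Im z - Im c)\<^sup>2) \<or> Re z = - sqrt (1/4 - (Im z - Im c)\<^sup>2))"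
proof -
  have "dist z c = 1/2 \<longleftrightarrow> (dist z c)\<^sup>2 = (1/2)\<^sup>2" by (rule power2_eq_iff_nonneg[symmetric]) auto
  then have d: "dist z c = 1/2 \<longleftrightarrow> (Re z)\<^sup>2 + (Im z - Im c)\<^sup>2 = 1/4"
    unfolding dist_norm cmod_power2 using assms by (simp add: power2_eq_square)
  have r: "x\<^sup>2 + y\<^sup>2 = 1/4 \<longleftrightarrow> y\<^sup>2 \<le> 1/4 \<and> (x = sqrt (1/4 - y\<^sup>2) \<or> x = - sqrt (1/4 - y\<^sup>2))" for x y :: real
  proof
    assume a: "x\<^sup>2 + y\<^sup>2 = 1/4"
    then have e: "1/4 - y\<^sup>2 = x\<^sup>2" by linarith
    have "y\<^sup>2 \<le> 1/4" using a zero_le_power2[of x] by linarith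
    then show "y\<^sup>2 \<le> 1/4 \<and> (x = sqrt (1/4 - y\<^sup>2) \<or> x = - sqrt (1/4 - y\<^sup>2))" unfolding e by auto
  next
    assume a: "y\<^sup>2 \<le> 1/4 \<and> (x = sqrt (1/4 - y\<^sup>2) \<or> x = - sqrt (1/4 - y\<^sup>2))"
    then have "x\<^sup>2 = 1/4 - y\<^sup>2" by auto
    then show "x\<^sup>2 + y\<^sup>2 = 1/4" by simp
  qed
  have s: "(y::real)\<^sup>2 \<le> 1/4 \<longleftrightarrow> \<bar>y\<bar> \<le> 1/2" for y
    using abs_le_square_iff[of y "1/2"] by (simp add: power2_eq_square)
  show ?thesis unfolding d r s ..
qed

lemma trace_strands: "strands (trR_tangle 1) = sym_curve trace_x (-3/4) (-1/4) \<union> right_curve trace_x (-1/4) (1/4) \<union> sym_curve trace_x (1/4) (3/4)"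
proof -
  have x: "xpos 1 0 = 0" "xpos (Suc 0) 0 = 0" unfolding xpos_def by simp_all
  have "strands (trR_tangle 1) = closing_strand (1/2)" unfolding trR_tangle_def by (simp add: lessThan_Suc x)
  moreover have "{z. dist z (Complex 0 (1/4)) = 1/2 \<and> Im z \<ge> 1/4} = sym_curve trace_x (1/4) (3/4)"
  proof (rule set_eqI)
    fix z
    have "trace_x (Im z) = sqrt (1/4 - (Im z - 1/4)\<^sup>2)" if "1/4 \<le> Im z" using that unfolding trace_x_def by (simp add: max_def)
    then show "z \<in> {z. dist z (Complex 0 (1/4)) = 1/2 \<and> Im z \<ge> 1/4} \<longleftrightarrow> z \<in> sym_curve trace_x (1/4) (3/4)"
      unfolding mem_Collect_eq circle_slice[of "Complex 0 (1/4)", simplified] sym_curve_def using circle_slice[of "Complex 0 (1/4)" z] by (auto simp: abs_le_iff)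
  qed
  moreover have "{z. dist z (Complex 0 (-1/4)) = 1/2 \<and> Im z \<le> -1/4} = sym_curve trace_x (-3/4) (-1/4)"
  proof (rule set_eqI)
    fix z
    have "trace_x (Im z) = sqrt (1/4 - (Im z - -1/4)\<^sup>2)" if "Im z \<le> -1/4" 
    proof -
      have "max 0 (\<bar>Im z\<bar> - 1/4) = - (Im z - -1/4)" using that by simp
      then show ?thesis unfolding trace_x_def by (simp only: power2_minus)
    qed
    then show "z \<in> {z. dist z (Complex 0 (-1/4)) = 1/2 \<and> Im z \<le> -1/4} \<longleftrightarrow> z \<in> sym_curve trace_x (-3/4) (-1/4)"
      unfolding mem_Collect_eq sym_curve_def using circle_slice[of "Complex 0 (-1/4)" z] by (auto simp: abs_le_iff)
  qed
  moreover have "closed_segment (Complex (1/2) (1/4)) (Complex (1/2) (-1/4)) = right_curve trace_x (-1/4) (1/4)"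
  proof -
    have "sqrt (1/4) = (1/2::real)" using real_sqrt_abs[of "1/2"] by (simp add: power2_eq_square)
    moreover have "max 0 (\<bar>y\<bar> - 1/4) = 0" if "-1/4 \<le> y" "y \<le> 1/4" for y :: real using that by simp
    ultimately have "trace_x y = 1/2" if "-1/4 \<le> y" "y \<le> 1/4" for y using that unfolding trace_x_def by simp
    then have "right_curve trace_x (-1/4) (1/4) = right_curve (\<lambda>_. 1/2) (-1/4) (1/4)" by (intro right_curve_cong) blast
    then show ?thesis unfolding vertical_segment right_curve_def by auto
  qed
  ultimately show ?thesis unfolding closing_strand_def by auto
qed

lemma signed_slices:
  fixes x y k :: real
  shows "(\<exists>e. (e, y) \<in> ({1, -1} \<times> I) \<union> ({1} \<times> J) \<union> ({1, -1} \<times> K) \<and> x = e * k) \<longleftrightarrow>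
     y \<in> I \<and> (x = k \<or> x = - k) \<or> y \<in> J \<and> x = k \<or> y \<in> K \<and> (x = k \<or> x = - k)" (is "?L \<longleftrightarrow> ?R")
proof
  assume ?L
  then obtain e where "(e, y) \<in> ({1, -1} \<times> I) \<union> ({1} \<times> J) \<union> ({1, -1} \<times> K)" "x = e * k" by blast
  then show ?R by auto
next
  assume ?R
  then consider "y \<in> I \<union> K" "x = - k" | "y \<in> I \<union> J \<union> K" "x = k" by blast
  then show ?L
  proof cases
    case 1 then show ?thesis by (intro exI[of _ "-1"]) auto
  next
    case 2 then show ?thesis by (intro exI[of _ 1]) auto
  qed
qed

lemma loop_x_pos: "-3/8 < v \<Longrightarrow> v < 19/32 \<Longrightarrow> 0 < loop_x v"
proof -
  assume v: "-3/8 < v" "v < 19/32"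
  have m: "(max 0 (32 * (v - 9/16)))\<^sup>2 < 1" "(max 0 (8 * (- 1/4 - v)))\<^sup>2 < 1"
    using v by (auto simp: abs_square_less_1 max_def)
  show ?thesis unfolding loop_x_def by (intro mult_pos_pos) (use m in auto)
qed

lemma loop_x_ends: "loop_x (-3/8) = 0" "loop_x (19/32) = 0"
  by (simp_all add: loop_x_values power2_eq_square)

lemma loop_x_bound: "-3/8 \<le> v \<Longrightarrow> v \<le> 19/32 \<Longrightarrow> 0 \<le> loop_x v \<and> loop_x v \<le> 1/4"
proof -
  assume v: "-3/8 \<le> v" "v \<le> 19/32"
  have le1: "sqrt (1 - x\<^sup>2) \<le> 1" for x :: real by (simp)
  have "loop_x v \<le> (1/4) * (1 * 1)" unfolding loop_x_def
  proof (intro mult_mono le1 min.cobounded1)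
    show "0 \<le> sqrt (1 - (max 0 (8 * (- 1 / 4 - v)))\<^sup>2)" "0 \<le> sqrt (1 - (max 0 (32 * (v - 9 / 16)))\<^sup>2) * sqrt (1 - (max 0 (8 * (- 1 / 4 - v)))\<^sup>2)"
      using v by (auto simp: abs_square_le_1 max_def intro!: mult_nonneg_nonneg)
  qed auto
  moreover have "0 \<le> loop_x v"
  proof -
    consider "v = -3/8" | "v = 19/32" | "-3/8 < v" "v < 19/32" using v by linarith
    then show ?thesis
    proof cases
      case 1 show ?thesis unfolding 1 loop_x_ends by simp
    next
      case 2 show ?thesis unfolding 2 loop_x_ends by simp
    next
      case 3 then show ?thesis using loop_x_pos by (simp add: less_imp_le)
    qed
  qed
  ultimately show ?thesis by simp
qed

lemma trace_x_props: "\<bar>y\<bar> \<le> 3/4 \<Longrightarrow> 0 \<le> trace_x y \<and> trace_x y \<le> 1/2 \<and> (trace_x y = 0 \<longleftrightarrow> \<bar>y\<bar> = 3/4)"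
proof -
  assume y: "\<bar>y\<bar> \<le> 3/4"
  let ?m = "max 0 (\<bar>y\<bar> - 1/4)"
  have m: "0 \<le> ?m" "?m \<le> 1/2"
  proof -
    show "0 \<le> ?m" by simp
    show "?m \<le> 1/2" by (rule max.boundedI) (use y in simp_all)
  qed
  then have "?m\<^sup>2 \<le> (1/2)\<^sup>2" by (intro power_mono) auto
  then have 1: "?m\<^sup>2 \<le> 1/4" by (simp add: power2_eq_square)
  have s: "sqrt (1/4) = (1/2::real)" using real_sqrt_abs[of "1/2"] by (simp add: power2_eq_square)
  have "trace_x y \<le> sqrt (1/4)" unfolding trace_x_def by (rule real_sqrt_le_mono) simp
  then have 2: "trace_x y \<le> 1/2" unfolding s .
  have "trace_x y = 0 \<longleftrightarrow> ?m\<^sup>2 = (1/2)\<^sup>2" unfolding trace_x_def by (auto simp: power2_eq_square)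
  also have "\<dots> \<longleftrightarrow> ?m = 1/2" using m by (intro power2_eq_iff_nonneg) auto
  also have "\<dots> \<longleftrightarrow> \<bar>y\<bar> = 3/4" by (auto simp: max_def)
  finally show ?thesis using 1 2 unfolding trace_x_def by simp
qed

lemma loop_y_range: "\<bar>y\<bar> \<le> 3/4 \<Longrightarrow> -3/8 \<le> loop_y y \<and> loop_y y \<le> 19/32 \<and> (loop_y y = -3/8 \<longleftrightarrow> y = -3/4) \<and> (loop_y y = 19/32 \<longleftrightarrow> y = 3/4)"
proof -
  assume y: "\<bar>y\<bar> \<le> 3/4"
  have e: "loop_y (-3/4) = -3/8" "loop_y (3/4) = 19/32" by (simp_all add: loop_y_values)
  have "-3/4 \<le> y" "y \<le> 3/4" using y by auto
  then consider "y = -3/4" | "y = 3/4" | "-3/4 < y" "y < 3/4" by linarith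
  then show ?thesis
  proof cases
    case 1 show ?thesis unfolding 1 e by simp
  next
    case 2 show ?thesis unfolding 2 e by simp
  next
    case 3 then show ?thesis using loop_y_mono[of "-3/4" y] loop_y_mono[of y "3/4"] unfolding e by simp
  qed
qed

text \<open>
  Moving each height \<open>y\<close> to \<open>loop_y y\<close> and rescaling each horizontal line by the ratio \<open>\<kappa>\<close> of the half-widths
  matches the strands. At the heights of the box the ratio is constant, so that the boxes match as well.
\<close>

lemma trace_isotopy: "isotopic (trR_tangle 1) loop_tangle"
proof -
  \<comment> \<open>signs and heights: both sides above and below the box, and the right side at its heights\<close>
  define S :: "(real \<times> real) set" where "S = ({1, -1} \<times> {-3/4..-1/4}) \<union> ({1} \<times> {-1/4..1/4}) \<union> ({1, -1} \<times> {1/4..3/4})"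
  define f where "f = (\<lambda>p::real \<times> real. (Complex (fst p * trace_x (snd p)) (snd p), Complex (fst p * loop_x (loop_y (snd p))) (loop_y (snd p))))"
  define RS where "RS = f ` S"
  let ?p = "place (Complex (-1/2) 0) (1/4) (1/4)" and ?q = "place (Complex (-1/8) (3/8)) (1/16) (1/32)"
  define R where "R = RS \<union> (\<lambda>z. (?p z, ?q z)) ` sq"
  \<comment> \<open>both half-widths vanish at the turning points, where any positive ratio will do\<close>
  define \<kappa> where "\<kappa> y = (if trace_x y = 0 then 1 else loop_x (loop_y y) / trace_x y)" for y
  have bt: "boxes (trR_tangle 1) = [(1, 1, ?p)]" "bots (trR_tangle 1) = 0" "tops (trR_tangle 1) = 0" unfolding trR_tangle_def by simp_all
  have cS: "compact S" unfolding S_def by (intro compact_Un compact_Times) auto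
  have fc: "continuous_on S f"
  proof -
    have C: "continuous_on S (\<lambda>p. Complex (a p) (b p))" if "continuous_on S a" "continuous_on S b" for a b
      unfolding Complex_eq using that by (intro continuous_intros) 
    have "continuous_on S (\<lambda>p. trace_x (snd p))" unfolding trace_x_def by (intro continuous_intros)
    moreover have g: "continuous_on S (\<lambda>p. loop_y (snd p))" unfolding loop_y_def by (intro continuous_intros) auto
    moreover have "continuous_on S (\<lambda>p. loop_x (loop_y (snd p)))" unfolding loop_x_def by (intro continuous_intros g)
    ultimately show ?thesis unfolding f_def by (intro continuous_on_Pair C continuous_intros)
  qed
  have cRS: "compact RS" unfolding RS_def by (rule compact_continuous_image[OF fc cS])
  have Sb: "\<bar>snd p\<bar> \<le> 3/4" "fst p = 1 \<or> fst p = -1" "\<bar>snd p\<bar> < 1/4 \<Longrightarrow> fst p = 1" if "p \<in> S" for p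
    using that unfolding S_def by (auto simp: abs_le_iff abs_less_iff)
  have s1: "strands (trR_tangle 1) = fst ` RS"
  proof -
    have "fst ` RS = (\<lambda>p. Complex (fst p * trace_x (snd p)) (snd p)) ` S" unfolding RS_def f_def image_image by simp
    also have "\<dots> = sym_curve trace_x (-3/4) (-1/4) \<union> right_curve trace_x (-1/4) (1/4) \<union> sym_curve trace_x (1/4) (3/4)"
    proof (rule set_eqI)
      fix z
      have "z \<in> (\<lambda>p. Complex (fst p * trace_x (snd p)) (snd p)) ` S \<longleftrightarrow> (\<exists>e. (e, Im z) \<in> S \<and> Re z = e * trace_x (Im z))"
      proof
        assume "\<exists>e. (e, Im z) \<in> S \<and> Re z = e * trace_x (Im z)"
        then obtain e where e: "(e, Im z) \<in> S" "Re z = e * trace_x (Im z)" by blast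
        have "z = Complex (fst (e, Im z) * trace_x (snd (e, Im z))) (snd (e, Im z))" using e(2) by (simp add: complex_eq_iff)
        then show "z \<in> (\<lambda>p. Complex (fst p * trace_x (snd p)) (snd p)) ` S" using e(1) by (rule image_eqI)
      next
        assume "z \<in> (\<lambda>p. Complex (fst p * trace_x (snd p)) (snd p)) ` S"
        then obtain p where p: "p \<in> S" "z = Complex (fst p * trace_x (snd p)) (snd p)" by (rule imageE)
        have "(fst p, Im z) \<in> S \<and> Re z = fst p * trace_x (Im z)" using p(1) unfolding p(2) by simp
        then show "\<exists>e. (e, Im z) \<in> S \<and> Re z = e * trace_x (Im z)" by (rule exI)
      qed
      then show "z \<in> (\<lambda>p. Complex (fst p * trace_x (snd p)) (snd p)) ` S \<longleftrightarrow> z \<in> sym_curve trace_x (-3/4) (-1/4) \<union> right_curve trace_x (-1/4) (1/4) \<union> sym_curve trace_x (1/4) (3/4)"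
        unfolding S_def signed_slices sym_curve_def right_curve_def by auto
    qed
    finally show ?thesis using trace_strands by simp
  qed
  have s2: "strands loop_tangle = snd ` RS"
  proof -
    have "snd ` RS = (\<lambda>p. Complex (fst p * loop_x (snd p)) (snd p)) ` ((\<lambda>p. (fst p, loop_y (snd p))) ` S)" unfolding RS_def f_def image_image by simp
    also have "(\<lambda>p. (fst p, loop_y (snd p))) ` S = ({1, -1} \<times> {-3/8..11/32}) \<union> ({1} \<times> {11/32..13/32}) \<union> ({1, -1} \<times> {13/32..19/32})"
    proof -
      have i1: "loop_y ` {-3/4..-1/4} = {-3/8..11/32}"
      proof
        show "loop_y ` {-3/4..-1/4} \<subseteq> {-3/8..11/32}" by (auto simp: loop_y_values field_simps)
        show "{-3/8..11/32} \<subseteq> loop_y ` {-3/4..-1/4}"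
        proof
          fix v :: real assume "v \<in> {-3/8..11/32}"
          then have "16/23 * (v - 11/32) - 1/4 \<in> {-3/4..-1/4}" "loop_y (16/23 * (v - 11/32) - 1/4) = v" by (auto simp: loop_y_values field_simps)
          then show "v \<in> loop_y ` {-3/4..-1/4}" by (metis imageI)
        qed
      qed
      have i2: "loop_y ` {-1/4..1/4} = {11/32..13/32}"
      proof
        show "loop_y ` {-1/4..1/4} \<subseteq> {11/32..13/32}" by (auto simp: loop_y_values field_simps)
        show "{11/32..13/32} \<subseteq> loop_y ` {-1/4..1/4}"
        proof
          fix v :: real assume "v \<in> {11/32..13/32}"
          then have "8 * (v - 3/8) \<in> {-1/4..1/4}" "loop_y (8 * (v - 3/8)) = v" by (auto simp: loop_y_values field_simps)
          then show "v \<in> loop_y ` {-1/4..1/4}" by (metis imageI)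
        qed
      qed
      have i3: "loop_y ` {1/4..3/4} = {13/32..19/32}"
      proof
        show "loop_y ` {1/4..3/4} \<subseteq> {13/32..19/32}" by (auto simp: loop_y_values field_simps)
        show "{13/32..19/32} \<subseteq> loop_y ` {1/4..3/4}"
        proof
          fix v :: real assume "v \<in> {13/32..19/32}"
          then have "8/3 * (v - 13/32) + 1/4 \<in> {1/4..3/4}" "loop_y (8/3 * (v - 13/32) + 1/4) = v" by (auto simp: loop_y_values field_simps)
          then show "v \<in> loop_y ` {1/4..3/4}" by (metis imageI)
        qed
      qed
      have "(\<lambda>p. (fst p, loop_y (snd p))) ` (E \<times> I) = E \<times> loop_y ` I" for E :: "real set" and I by force
      then show ?thesis unfolding S_def image_Un by (simp only: i1 i2 i3)
    qed
    also have "(\<lambda>p. Complex (fst p * loop_x (snd p)) (snd p)) ` (({1, -1} \<times> {-3/8..11/32}) \<union> ({1} \<times> {11/32..13/32}) \<union> ({1, -1} \<times> {13/32..19/32})) =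
      sym_curve loop_x (-3/8) (11/32) \<union> right_curve loop_x (11/32) (13/32) \<union> sym_curve loop_x (13/32) (19/32)" (is "_ ` ?S = _")
    proof (rule set_eqI)
      fix z
      have "z \<in> (\<lambda>p. Complex (fst p * loop_x (snd p)) (snd p)) ` ?S \<longleftrightarrow> (\<exists>e. (e, Im z) \<in> ?S \<and> Re z = e * loop_x (Im z))"
      proof
        assume "\<exists>e. (e, Im z) \<in> ?S \<and> Re z = e * loop_x (Im z)"
        then obtain e where e: "(e, Im z) \<in> ?S" "Re z = e * loop_x (Im z)" by blast
        have "z = Complex (fst (e, Im z) * loop_x (snd (e, Im z))) (snd (e, Im z))" using e(2) by (simp add: complex_eq_iff)
        then show "z \<in> (\<lambda>p. Complex (fst p * loop_x (snd p)) (snd p)) ` ?S" using e(1) by (rule image_eqI)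
      next
        assume "z \<in> (\<lambda>p. Complex (fst p * loop_x (snd p)) (snd p)) ` ?S"
        then obtain p where p: "p \<in> ?S" "z = Complex (fst p * loop_x (snd p)) (snd p)" by (rule imageE)
        have "(fst p, Im z) \<in> ?S \<and> Re z = fst p * loop_x (Im z)" using p(1) unfolding p(2) by simp
        then show "\<exists>e. (e, Im z) \<in> ?S \<and> Re z = e * loop_x (Im z)" by (rule exI)
      qed
      then show "z \<in> (\<lambda>p. Complex (fst p * loop_x (snd p)) (snd p)) ` ?S \<longleftrightarrow> z \<in> sym_curve loop_x (-3/8) (11/32) \<union> right_curve loop_x (11/32) (13/32) \<union> sym_curve loop_x (13/32) (19/32)"
        unfolding signed_slices sym_curve_def right_curve_def by auto
    qed
    finally show ?thesis using loop_strands by simp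
  qed
  have half: "trace_x y = 1/2" "loop_x (loop_y y) = 1/8" "\<kappa> y = 1/4" if "\<bar>y\<bar> \<le> 1/4" for y
  proof -
    have "sqrt (1/4) = (1/2::real)" using real_sqrt_abs[of "1/2"] by (simp add: power2_eq_square)
    moreover have "max 0 (\<bar>y\<bar> - 1/4) = 0" using that by simp
    ultimately show t: "trace_x y = 1/2" unfolding trace_x_def by simp
    have "loop_y y = 3/8 + y / 8" using that by (intro loop_y_values(2)) auto
    then show c: "loop_x (loop_y y) = 1/8" using that by (simp add: loop_x_values(4) abs_le_iff)
    show "\<kappa> y = 1/4" unfolding \<kappa>_def t c by simp
  qed
  have key: "\<bar>Im z\<bar> \<le> 3/4 \<and> Im z' = loop_y (Im z) \<and> Re z' = \<kappa> (Im z) * Re z" if "(z, z') \<in> R" for z z'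
  proof -
    from that consider p where "p \<in> S" "z = Complex (fst p * trace_x (snd p)) (snd p)" "z' = Complex (fst p * loop_x (loop_y (snd p))) (loop_y (snd p))"
      | x where "x \<in> sq" "z = ?p x" "z' = ?q x" unfolding R_def RS_def f_def by auto
    then show ?thesis
    proof cases
      case 1
      have "loop_x (loop_y (snd p)) = \<kappa> (snd p) * trace_x (snd p)"
      proof (cases "trace_x (snd p) = 0")
        case True
        then have "\<bar>snd p\<bar> = 3/4" using trace_x_props[OF Sb(1)[OF 1(1)]] by blast
        then have "snd p = 3/4 \<or> snd p = -3/4" by linarith
        then have "loop_y (snd p) = 19/32 \<or> loop_y (snd p) = -3/8" using loop_y_range[OF Sb(1)[OF 1(1)]] by blast
        then have "loop_x (loop_y (snd p)) = 0" using loop_x_ends by metis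
        then show ?thesis using True by simp
      qed (simp add: \<kappa>_def)
      then show ?thesis using Sb(1)[OF 1(1)] unfolding 1(2,3) by simp
    next
      case 2
      have y: "\<bar>Im z\<bar> \<le> 1/4" using 2(1) unfolding 2(2) place_def mem_sq by simp
      have "Im z' = 3/8 + Im z / 8" and r: "Re z' = 1/4 * Re z" unfolding 2(2,3) place_def by simp_all
      moreover have "loop_y (Im z) = 3/8 + Im z / 8" using y by (intro loop_y_values(2)) auto
      moreover have "Re z' = \<kappa> (Im z) * Re z" unfolding half(3)[OF y] by (rule r)
      ultimately show ?thesis using y by simp
    qed
  qed
  have kpos: "0 < \<kappa> y" if "\<bar>y\<bar> \<le> 3/4" for y
  proof (cases "\<bar>y\<bar> = 3/4")
    case True then show ?thesis using trace_x_props[OF that] unfolding \<kappa>_def by simp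
  next
    case False
    then have "0 < trace_x y" using trace_x_props[OF that] by auto
    moreover have "0 < loop_x (loop_y y)" by (rule loop_x_pos) (use loop_y_range[OF that] False in \<open>auto simp: abs_if split: if_splits\<close>)
    ultimately show ?thesis unfolding \<kappa>_def by simp
  qed
  have nocol: "z = w \<and> z' = w'"
    if zz: "(z, z') \<in> R" "(w, w') \<in> R" and s: "0 \<le> s" "s \<le> 1" and eq: "(1 - of_real s) * z + of_real s * z' = (1 - of_real s) * w + of_real s * w'" for z z' w w' s
  proof (rule lex_no_collision[OF _ _ _ _ _ _ s eq])
    note kz = key[OF zz(1)] and kw = key[OF zz(2)]
    show "Im z < Im w \<Longrightarrow> Im z' < Im w'" "Im w < Im z \<Longrightarrow> Im w' < Im z'" using kz kw loop_y_mono by auto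
    show "Im z = Im w \<Longrightarrow> Im z' = Im w'" using kz kw by simp
    show "Im z = Im w \<Longrightarrow> Re z < Re w \<Longrightarrow> Re z' < Re w'" "Im z = Im w \<Longrightarrow> Re w < Re z \<Longrightarrow> Re w' < Re z'"
      "Im z = Im w \<Longrightarrow> Re z = Re w \<Longrightarrow> Re z' = Re w'" using kz kw kpos[of "Im w"] by simp_all
  qed
  have bd: "z = z' \<or> (z \<in> interior sq \<and> z' \<in> interior sq)" if "(z, z') \<in> R" for z z'
  proof -
    have x: "\<bar>Re z\<bar> < 1 \<and> \<bar>Re z'\<bar> < 1"
    proof -
      from that consider p where "p \<in> S" "z = Complex (fst p * trace_x (snd p)) (snd p)" "z' = Complex (fst p * loop_x (loop_y (snd p))) (loop_y (snd p))"
        | x where "x \<in> sq" "z = ?p x" "z' = ?q x" unfolding R_def RS_def f_def by auto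
      then show ?thesis
      proof cases
        case 1
        have "0 \<le> trace_x (snd p)" "trace_x (snd p) \<le> 1/2" using trace_x_props[OF Sb(1)[OF 1(1)]] by blast+
        moreover have "0 \<le> loop_x (loop_y (snd p))" "loop_x (loop_y (snd p)) \<le> 1/4" using loop_x_bound loop_y_range[OF Sb(1)[OF 1(1)]] by blast+
        ultimately show ?thesis using Sb(2)[OF 1(1)] unfolding 1(2,3) by auto
      next
        case 2 then show ?thesis unfolding 2(2,3) place_def mem_sq by auto
      qed
    qed
    have "\<bar>Im z\<bar> < 1" using key[OF that] by simp
    moreover have "\<bar>Im z'\<bar> < 1" using key[OF that] loop_y_range[of "Im z"] by auto
    ultimately show ?thesis using x unfolding interior_sq by blast
  qed
  show ?thesis
  proof (rule straight_isotopy(2)[OF planar_trR _ _ _ _ _ cRS _ s1 s2 _ nocol bd])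
    show "bots loop_tangle = bots (trR_tangle 1)" "tops loop_tangle = tops (trR_tangle 1)" "length (boxes loop_tangle) = length (boxes (trR_tangle 1))"
      using bt loop_boxes by simp_all
    show "RS \<subseteq> R" unfolding R_def by blast
    fix i assume "i < length (boxes (trR_tangle 1))"
    then have i: "i = 0" using bt by simp
    show "in_bot (boxes loop_tangle ! i) = in_bot (boxes (trR_tangle 1) ! i) \<and> in_top (boxes loop_tangle ! i) = in_top (boxes (trR_tangle 1) ! i)"
      unfolding i bt loop_boxes by simp
    show "is_place (in_map (boxes (trR_tangle 1) ! i)) \<and> is_place (in_map (boxes loop_tangle ! i))"
      unfolding i bt loop_boxes by (auto intro: is_placeI)
    show "(in_map (boxes (trR_tangle 1) ! i) z, in_map (boxes loop_tangle ! i) z) \<in> R" if "z \<in> sq" for z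
      unfolding i bt loop_boxes R_def using that by simp
  qed
qed

text \<open>
  The bubble relation is a statement about the trace tangle, whereas the saddle relation is about
  caps and cups; this equation relates them.
\<close>

lemma trace_loop:
  assumes A: "unshaded_planar_algebra A" and x: "x \<in> spc A 1 1"
  shows "trR A 1 x = mult A 0 2 0 (mult A 2 2 0 (cap A) (tensor A 1 1 1 1 x (strand A))) (cup A)"
proof -
  have "labelling A (trR_tangle 1) [x]" unfolding labelling_iff trR_tangle_def using x by simp
  then show ?thesis unfolding act_loop[OF A x, symmetric] trR_def
    by (rule act_isotopic[OF A planar_trR planar_loop trace_isotopy])
qed

subsection \<open>The adjoint of a product\<close>

lemma cnj_segment: "cnj ` closed_segment x y = closed_segment (cnj x) (cnj y)"
  by (rule closed_segment_linear_image[symmetric]) (rule bounded_linear.linear[OF bounded_linear_cnj])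

text \<open>Reflection exchanges the two boxes of the multiplication tangle.\<close>

lemma star_mult:
  assumes A: "unshaded_planar_algebra A" and adj: "planar_adjoint A"
    and f: "f \<in> spc A c t" and g: "g \<in> spc A b c"
  shows "star A b t (mult A b c t f g) = mult A t c b (star A b c g) (star A c t f)"
proof -
  have fs: "star A c t f \<in> spc A t c" and gs: "star A b c g \<in> spc A c b"
    using adj f g unfolding planar_adjoint_def by blast+
  let ?u = "place (Complex 0 (1/2)) (1/2) (1/4)" and ?d = "place (Complex 0 (-1/2)) (1/2) (1/4)"
  have cp: "cnj \<circ> ?u \<circ> cnj = ?d" "cnj \<circ> ?d \<circ> cnj = ?u"
    unfolding place_def by (auto simp: fun_eq_iff complex_eq_iff)
  have cm: "cnj (top_mark k j) = bot_mark k j" "cnj (bot_mark k j) = top_mark k j" for k j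
    unfolding top_mark_def bot_mark_def by (simp_all add: complex_eq_iff)
  have cpm: "cnj (?u x) = ?d (cnj x)" "cnj (?d x) = ?u (cnj x)" for x
    unfolding place_def by (simp_all add: complex_eq_iff)
  have st: "cnj ` strands (mult_tangle b c t) = strands (mult_tangle t c b)"
    unfolding mult_tangle_def Let_def tangle.select_convs image_Un image_UN cnj_segment cm cpm
    by (simp only: closed_segment_commute Un_ac)
  have bx: "boxes (reflect (mult_tangle b c t)) = [(t, c, ?d), (c, b, ?u)]"
    unfolding reflect_def mult_boxes by (simp add: cp cp[simplified])
  have lT: "labelling A (mult_tangle b c t) [f, g]" unfolding labelling_iff mult_boxes using f g by simp
  have l2: "labelling A (mult_tangle t c b) [star A b c g, star A c t f]" unfolding labelling_iff mult_boxes using fs gs by simp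
  have "star A b t (mult A b c t f g) = act A (reflect (mult_tangle b c t)) [star A c t f, star A b c g]"
  proof -
    have "star A (bots M) (tops M) (act A M ys) = act A (reflect M) (map2 (\<lambda>B x. star A (in_bot B) (in_top B) x) (boxes M) ys)"
      if "planar_tangle M" "labelling A M ys" for M ys
      using adj that unfolding planar_adjoint_def by blast
    from this[OF planar_mult lT] show ?thesis unfolding mult_def by (simp add: mult_boxes)
  qed
  also have "\<dots> = mult A t c b (star A b c g) (star A c t f)"
    unfolding mult_def
    by (rule act_perm(3)[OF A planar_mult l2]) (simp_all add: bx mult_boxes, simp_all add: reflect_def st)
  finally show ?thesis .
qed

section \<open>Words in two invertible objects\<close>

text \<open>
  A strict monoidal category with complex vector spaces of morphisms and with scalars as the only
  endomorphisms of the unit object. The operations are total functions on one type of morphisms, and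
  the laws are required for morphisms of matching types. Objects are numbers of strands.
\<close>

locale diagram_category =
  fixes hom :: "nat \<Rightarrow> nat \<Rightarrow> 'm set"
    and cmp :: "'m \<Rightarrow> 'm \<Rightarrow> 'm" (infixl "\<odot>" 70)
    and ten :: "'m \<Rightarrow> 'm \<Rightarrow> 'm" (infixl "\<otimes>" 72)
    and idm :: "nat \<Rightarrow> 'm"
    and add :: "'m \<Rightarrow> 'm \<Rightarrow> 'm" (infixl "\<oplus>" 65)
    and smul :: "complex \<Rightarrow> 'm \<Rightarrow> 'm" (infixr "\<cdot>" 75)
    and zero :: "nat \<Rightarrow> nat \<Rightarrow> 'm"
  assumes cmp_in: "f \<in> hom c t \<Longrightarrow> g \<in> hom b c \<Longrightarrow> f \<odot> g \<in> hom b t"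
    and ten_in: "f \<in> hom b t \<Longrightarrow> g \<in> hom b' t' \<Longrightarrow> f \<otimes> g \<in> hom (b + b') (t + t')"
    and idm_in: "idm k \<in> hom k k"
    and cmp_assoc: "f \<in> hom c d \<Longrightarrow> g \<in> hom b c \<Longrightarrow> h \<in> hom a b \<Longrightarrow> (f \<odot> g) \<odot> h = f \<odot> (g \<odot> h)"
    and cmp_idl: "f \<in> hom b t \<Longrightarrow> idm t \<odot> f = f"
    and cmp_idr: "f \<in> hom b t \<Longrightarrow> f \<odot> idm b = f"
    and ten_assoc: "f \<in> hom b t \<Longrightarrow> g \<in> hom b' t' \<Longrightarrow> h \<in> hom b'' t'' \<Longrightarrow> (f \<otimes> g) \<otimes> h = f \<otimes> (g \<otimes> h)"
    and ten_idl: "f \<in> hom b t \<Longrightarrow> idm 0 \<otimes> f = f"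
    and ten_idr: "f \<in> hom b t \<Longrightarrow> f \<otimes> idm 0 = f"
    and ten_idm: "idm j \<otimes> idm k = idm (j + k)"
    and interchange: "f \<in> hom c t \<Longrightarrow> f' \<in> hom b c \<Longrightarrow> g \<in> hom c' t' \<Longrightarrow> g' \<in> hom b' c' \<Longrightarrow>
      (f \<otimes> g) \<odot> (f' \<otimes> g') = (f \<odot> f') \<otimes> (g \<odot> g')"
    and add_in: "f \<in> hom b t \<Longrightarrow> g \<in> hom b t \<Longrightarrow> f \<oplus> g \<in> hom b t"
    and smul_in: "f \<in> hom b t \<Longrightarrow> z \<cdot> f \<in> hom b t"
    and zero_in: "zero b t \<in> hom b t"
    and cmp_addl: "f \<in> hom c t \<Longrightarrow> f' \<in> hom c t \<Longrightarrow> g \<in> hom b c \<Longrightarrow> (f \<oplus> f') \<odot> g = (f \<odot> g) \<oplus> (f' \<odot> g)"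
    and cmp_addr: "f \<in> hom c t \<Longrightarrow> g \<in> hom b c \<Longrightarrow> g' \<in> hom b c \<Longrightarrow> f \<odot> (g \<oplus> g') = (f \<odot> g) \<oplus> (f \<odot> g')"
    and cmp_smull: "f \<in> hom c t \<Longrightarrow> g \<in> hom b c \<Longrightarrow> (z \<cdot> f) \<odot> g = z \<cdot> (f \<odot> g)"
    and cmp_smulr: "f \<in> hom c t \<Longrightarrow> g \<in> hom b c \<Longrightarrow> f \<odot> (z \<cdot> g) = z \<cdot> (f \<odot> g)"
    and ten_addl: "f \<in> hom b t \<Longrightarrow> f' \<in> hom b t \<Longrightarrow> g \<in> hom b' t' \<Longrightarrow> (f \<oplus> f') \<otimes> g = (f \<otimes> g) \<oplus> (f' \<otimes> g)"
    and ten_addr: "f \<in> hom b t \<Longrightarrow> g \<in> hom b' t' \<Longrightarrow> g' \<in> hom b' t' \<Longrightarrow> f \<otimes> (g \<oplus> g') = (f \<otimes> g) \<oplus> (f \<otimes> g')"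
    and ten_smull: "f \<in> hom b t \<Longrightarrow> g \<in> hom b' t' \<Longrightarrow> (z \<cdot> f) \<otimes> g = z \<cdot> (f \<otimes> g)"
    and smul_zero: "f \<in> hom b t \<Longrightarrow> 0 \<cdot> f = zero b t"
    and smul_one: "f \<in> hom b t \<Longrightarrow> 1 \<cdot> f = f"
    and smul_smul: "f \<in> hom b t \<Longrightarrow> z \<cdot> (z' \<cdot> f) = (z * z') \<cdot> f"
    and smul_zero_right: "z \<cdot> zero b t = zero b t"
    and smul_add: "f \<in> hom b t \<Longrightarrow> (z \<cdot> f) \<oplus> (z' \<cdot> f) = (z + z') \<cdot> f"
    and add_diff: "f \<in> hom b t \<Longrightarrow> g \<in> hom b t \<Longrightarrow> f \<oplus> (-1) \<cdot> g = zero b t \<Longrightarrow> f = g"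
    and scalars: "f \<in> hom 0 0 \<Longrightarrow> \<exists>z. f = z \<cdot> idm 0"
begin

lemma zero_cmp: "f \<in> hom c t \<Longrightarrow> f \<odot> zero b c = zero b t" "g \<in> hom b c \<Longrightarrow> zero c t \<odot> g = zero b t"
proof -
  assume f: "f \<in> hom c t"
  have "f \<odot> (0 \<cdot> zero b c) = 0 \<cdot> (f \<odot> zero b c)" by (rule cmp_smulr[OF f zero_in])
  then show "f \<odot> zero b c = zero b t" using smul_zero[OF zero_in] smul_zero[OF cmp_in[OF f zero_in]] by simp
next
  assume g: "g \<in> hom b c"
  have "(0 \<cdot> zero c t) \<odot> g = 0 \<cdot> (zero c t \<odot> g)" by (rule cmp_smull[OF zero_in g])
  then show "zero c t \<odot> g = zero b t" using smul_zero[OF zero_in] smul_zero[OF cmp_in[OF zero_in g]] by simp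
qed

lemma zero_ten: "g \<in> hom b' t' \<Longrightarrow> zero b t \<otimes> g = zero (b + b') (t + t')"
proof -
  assume g: "g \<in> hom b' t'"
  have "(0 \<cdot> zero b t) \<otimes> g = 0 \<cdot> (zero b t \<otimes> g)" by (rule ten_smull[OF zero_in g])
  then show ?thesis using smul_zero[OF zero_in] smul_zero[OF ten_in[OF zero_in g]] by simp
qed

lemma smul_cancel: "z \<noteq> 0 \<Longrightarrow> f \<in> hom b t \<Longrightarrow> z \<cdot> f = zero b t \<Longrightarrow> f = zero b t"
  using smul_smul[of f b t "1 / z" z] smul_one[of f b t] smul_zero_right[of "1 / z" b t] by simp

lemma smul_inj: "f \<in> hom b t \<Longrightarrow> f \<noteq> zero b t \<Longrightarrow> z \<cdot> f = z' \<cdot> f \<Longrightarrow> z = z'"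
proof (rule ccontr)
  assume f: "f \<in> hom b t" "f \<noteq> zero b t" "z \<cdot> f = z' \<cdot> f" "z \<noteq> z'"
  have "(z - z') \<cdot> f = z \<cdot> f \<oplus> (- z') \<cdot> f" using smul_add[OF f(1), of z "- z'"] by simp
  also have "\<dots> = z' \<cdot> f \<oplus> (- z') \<cdot> f" using f(3) by simp
  also have "\<dots> = zero b t" using smul_add[OF f(1), of z' "- z'"] smul_zero[OF f(1)] by simp
  finally show False using smul_cancel[of "z - z'" f b t] f by simp
qed

end

locale two_colours = diagram_category +
  fixes P Q :: 'a
  assumes PQ_in: "P \<in> hom 1 1" "Q \<in> hom 1 1"
    and idem: "P \<odot> P = P" "Q \<odot> Q = Q"
    and sum: "idm 1 = P \<oplus> Q"
begin

definition letter :: "bool \<Rightarrow> 'a" where "letter x = (if x then P else Q)"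

primrec word :: "bool list \<Rightarrow> 'a" where
  "word [] = idm 0"
| "word (x # w) = letter x \<otimes> word w"

lemma letter_in: "letter x \<in> hom 1 1" unfolding letter_def using PQ_in by simp

lemma letter_idem: "letter x \<odot> letter x = letter x" unfolding letter_def using idem by simp

lemma word_in: "word w \<in> hom (length w) (length w)"
proof (induction w)
  case (Cons x w)
  then show ?case using ten_in[OF letter_in[of x] Cons.IH] by simp
qed (simp add: idm_in)

lemma word_append: "word (u @ v) = word u \<otimes> word v"
  by (induction u) (simp_all add: ten_idl[OF word_in] ten_assoc[OF letter_in word_in word_in])

lemma word_idem: "word w \<odot> word w = word w"
proof (induction w)
  case (Cons x w)
  then show ?case using interchange[OF letter_in[of x] letter_in[of x] word_in[of w] word_in[of w]] letter_idem by simp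
qed (simp add: cmp_idl[OF idm_in])

text \<open>Each strand of an identity is expanded as \<open>P \<oplus> Q\<close>.\<close>

lemma resolution:
  assumes add: "\<And>x y. x \<in> hom k k \<Longrightarrow> y \<in> hom k k \<Longrightarrow> \<phi> (x \<oplus> y) = \<phi> x \<oplus> \<phi> y"
    and N: "\<And>x y. x \<in> N \<Longrightarrow> y \<in> N \<Longrightarrow> x \<oplus> y \<in> N"
    and W: "\<And>w. length w = k \<Longrightarrow> \<phi> (word w) \<in> N"
  shows "\<phi> (idm k) \<in> N"
  using add W
proof (induction k arbitrary: \<phi>)
  case 0
  then show ?case using "0.prems"(2)[of "[]"] by simp
next
  case (Suc k)
  have *: "\<phi> (letter x \<otimes> idm k) \<in> N" for x
  proof (rule Suc.IH[of "\<lambda>y. \<phi> (letter x \<otimes> y)"])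
    fix y z assume "y \<in> hom k k" "z \<in> hom k k"
    then show "\<phi> (letter x \<otimes> (y \<oplus> z)) = \<phi> (letter x \<otimes> y) \<oplus> \<phi> (letter x \<otimes> z)"
      using Suc.prems(1)[of "letter x \<otimes> y" "letter x \<otimes> z"] ten_addr[OF letter_in] ten_in[OF letter_in[of x], of _ k k] by simp
  next
    fix w :: "bool list" assume "length w = k"
    then show "\<phi> (letter x \<otimes> word w) \<in> N" using Suc.prems(2)[of "x # w"] by simp
  qed
  have "idm (Suc k) = idm 1 \<otimes> idm k" using ten_idm[of 1 k] by simp
  also have "\<dots> = letter True \<otimes> idm k \<oplus> letter False \<otimes> idm k"
    unfolding sum letter_def using ten_addl[OF PQ_in idm_in] by simp
  finally have "\<phi> (idm (Suc k)) = \<phi> (letter True \<otimes> idm k) \<oplus> \<phi> (letter False \<otimes> idm k)"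
    using Suc.prems(1)[of "letter True \<otimes> idm k" "letter False \<otimes> idm k"] ten_in[OF letter_in idm_in[of k]] by simp
  then show ?case using N * by simp
qed

end

text \<open>
  The set \<open>G\<close> stands for the generated morphisms. The inverse pairs of morphisms that the arrow
  relations provide are required to lie in \<open>G\<close>.
\<close>

locale word_relations = two_colours +
  fixes G :: "'a set" and a n :: nat
  assumes G_cmp: "f \<in> hom c t \<Longrightarrow> g \<in> hom b c \<Longrightarrow> f \<in> G \<Longrightarrow> g \<in> G \<Longrightarrow> f \<odot> g \<in> G"
    and G_ten: "f \<in> hom b t \<Longrightarrow> g \<in> hom b' t' \<Longrightarrow> f \<in> G \<Longrightarrow> g \<in> G \<Longrightarrow> f \<otimes> g \<in> G"
    and G_add: "f \<in> hom b t \<Longrightarrow> g \<in> hom b t \<Longrightarrow> f \<in> G \<Longrightarrow> g \<in> G \<Longrightarrow> f \<oplus> g \<in> G"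
    and G_smul: "f \<in> hom b t \<Longrightarrow> f \<in> G \<Longrightarrow> z \<cdot> f \<in> G"
    and G_zero: "zero b t \<in> G"
    and G_idm: "idm k \<in> G" and G_letters: "P \<in> G" "Q \<in> G"
    and cancel_QP: "\<exists>\<alpha>\<in>hom 2 0 \<inter> G. \<exists>\<beta>\<in>hom 0 2 \<inter> G. \<beta> \<odot> \<alpha> = Q \<otimes> P \<and> \<alpha> \<odot> \<beta> = idm 0"
    and unitary: "\<exists>\<alpha>\<in>hom a n \<inter> G. \<exists>\<beta>\<in>hom n a \<inter> G. \<beta> \<odot> \<alpha> = word (replicate a True) \<and> \<alpha> \<odot> \<beta> = word (replicate n False)"
    and a_pos: "1 \<le> a"
begin

lemma word_G: "word w \<in> G"
proof (induction w)
  case (Cons x w)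
  have "letter x \<in> G" unfolding letter_def using G_letters by simp
  then show ?case using G_ten[OF letter_in word_in _ Cons.IH] by simp
qed (simp add: G_idm)

text \<open>Isomorphism of words through generated morphisms.\<close>

definition equiv (infix "\<simeq>" 50) where
  "u \<simeq> v \<longleftrightarrow> (\<exists>\<alpha>\<in>hom (length u) (length v) \<inter> G. \<exists>\<beta>\<in>hom (length v) (length u) \<inter> G. \<beta> \<odot> \<alpha> = word u \<and> \<alpha> \<odot> \<beta> = word v)"

lemma equiv_refl: "u \<simeq> u"
  unfolding equiv_def using word_in word_G word_idem by blast

lemma equiv_sym: "u \<simeq> v \<Longrightarrow> v \<simeq> u"
  unfolding equiv_def by blast

lemma equiv_trans:
  assumes "u \<simeq> v" "v \<simeq> w" shows "u \<simeq> w"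
proof -
  obtain \<alpha> \<beta> where 1: "\<alpha> \<in> hom (length u) (length v)" "\<alpha> \<in> G" "\<beta> \<in> hom (length v) (length u)" "\<beta> \<in> G" "\<beta> \<odot> \<alpha> = word u" "\<alpha> \<odot> \<beta> = word v"
    using assms(1) unfolding equiv_def by blast
  obtain \<gamma> \<delta> where 2: "\<gamma> \<in> hom (length v) (length w)" "\<gamma> \<in> G" "\<delta> \<in> hom (length w) (length v)" "\<delta> \<in> G" "\<delta> \<odot> \<gamma> = word v" "\<gamma> \<odot> \<delta> = word w"
    using assms(2) unfolding equiv_def by blast
  have "(\<beta> \<odot> \<delta>) \<odot> (\<gamma> \<odot> \<alpha>) = \<beta> \<odot> ((\<delta> \<odot> \<gamma>) \<odot> \<alpha>)"
    using cmp_assoc[OF 1(3) 2(3) cmp_in[OF 2(1) 1(1)]] cmp_assoc[OF 2(3,1) 1(1)] by simp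
  also have "\<dots> = (\<beta> \<odot> \<alpha>) \<odot> (\<beta> \<odot> \<alpha>)"
    unfolding 2(5) 1(6)[symmetric] using cmp_assoc[OF 1(1,3,1)] cmp_assoc[OF 1(3,1) cmp_in[OF 1(3,1)]] by simp
  finally have e1: "(\<beta> \<odot> \<delta>) \<odot> (\<gamma> \<odot> \<alpha>) = word u" unfolding 1(5) word_idem .
  have "(\<gamma> \<odot> \<alpha>) \<odot> (\<beta> \<odot> \<delta>) = \<gamma> \<odot> ((\<alpha> \<odot> \<beta>) \<odot> \<delta>)"
    using cmp_assoc[OF 2(1) 1(1) cmp_in[OF 1(3) 2(3)]] cmp_assoc[OF 1(1,3) 2(3)] by simp
  also have "\<dots> = (\<gamma> \<odot> \<delta>) \<odot> (\<gamma> \<odot> \<delta>)"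
    unfolding 1(6) 2(5)[symmetric] using cmp_assoc[OF 2(3,1,3)] cmp_assoc[OF 2(1,3) cmp_in[OF 2(1,3)]] by simp
  finally have e2: "(\<gamma> \<odot> \<alpha>) \<odot> (\<beta> \<odot> \<delta>) = word w" unfolding 2(6) word_idem .
  have "\<gamma> \<odot> \<alpha> \<in> hom (length u) (length w) \<inter> G" "\<beta> \<odot> \<delta> \<in> hom (length w) (length u) \<inter> G"
    using cmp_in[OF 2(1) 1(1)] cmp_in[OF 1(3) 2(3)] G_cmp[OF 2(1) 1(1)] G_cmp[OF 1(3) 2(3)] 1 2 by simp_all
  then show ?thesis unfolding equiv_def using e1 e2 by blast
qed

lemma equiv_append:
  assumes "u \<simeq> u'" "v \<simeq> v'" shows "u @ v \<simeq> u' @ v'"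
proof -
  obtain \<alpha> \<beta> where 1: "\<alpha> \<in> hom (length u) (length u')" "\<alpha> \<in> G" "\<beta> \<in> hom (length u') (length u)" "\<beta> \<in> G" "\<beta> \<odot> \<alpha> = word u" "\<alpha> \<odot> \<beta> = word u'"
    using assms(1) unfolding equiv_def by blast
  obtain \<gamma> \<delta> where 2: "\<gamma> \<in> hom (length v) (length v')" "\<gamma> \<in> G" "\<delta> \<in> hom (length v') (length v)" "\<delta> \<in> G" "\<delta> \<odot> \<gamma> = word v" "\<gamma> \<odot> \<delta> = word v'"
    using assms(2) unfolding equiv_def by blast
  have "(\<beta> \<otimes> \<delta>) \<odot> (\<alpha> \<otimes> \<gamma>) = word (u @ v)" "(\<alpha> \<otimes> \<gamma>) \<odot> (\<beta> \<otimes> \<delta>) = word (u' @ v')"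
    using interchange[OF 1(3,1) 2(3,1)] interchange[OF 1(1,3) 2(1,3)] 1(5,6) 2(5,6) by (simp_all add: word_append)
  moreover have "\<alpha> \<otimes> \<gamma> \<in> hom (length (u @ v)) (length (u' @ v')) \<inter> G" "\<beta> \<otimes> \<delta> \<in> hom (length (u' @ v')) (length (u @ v)) \<inter> G"
    using ten_in[OF 1(1) 2(1)] ten_in[OF 1(3) 2(3)] G_ten[OF 1(1) 2(1)] G_ten[OF 1(3) 2(3)] 1 2 by simp_all
  ultimately show ?thesis unfolding equiv_def by blast
qed

lemma equiv_QP: "[False, True] \<simeq> []"
  using cancel_QP unfolding equiv_def by (simp add: letter_def ten_idr[OF PQ_in(1)] numeral_2_eq_2)

lemma equiv_unitary: "replicate a True \<simeq> replicate n False"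
  using unitary unfolding equiv_def by simp

abbreviation pw :: "nat \<Rightarrow> bool list" where "pw j \<equiv> replicate j True"

lemma equiv_powers: "replicate k False @ replicate k True \<simeq> []"
proof (induction k)
  case 0 then show ?case by (simp add: equiv_refl)
next
  case (Suc k)
  have e: "replicate (Suc k) False @ replicate (Suc k) True = replicate k False @ ([False, True] @ replicate k True)"
    by (simp add: replicate_append_same[symmetric])
  have "replicate k False @ ([False, True] @ replicate k True) \<simeq> replicate k False @ ([] @ replicate k True)"
    by (intro equiv_append equiv_refl equiv_QP)
  then show ?case unfolding e using equiv_trans Suc.IH by simp
qed

lemma equiv_period: "pw (a + n) \<simeq> []"
proof -
  have "pw (a + n) = pw a @ pw n" by (simp add: replicate_add)
  moreover have "pw a @ pw n \<simeq> replicate n False @ pw n" by (intro equiv_append equiv_refl equiv_unitary)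
  ultimately show ?thesis using equiv_trans equiv_powers by simp
qed

text \<open>
  A letter \<open>P\<close> in front of a power raises the exponent, modulo the period \<open>a + n\<close>. A letter \<open>Q\<close> cancels the
  first \<open>P\<close>, and \<open>Q\<close> alone is equivalent to the power with exponent \<open>a + n - 1\<close>.
\<close>

lemma equiv_normal_form: "\<exists>j<a + n. w \<simeq> pw j"
proof (induction w)
  case Nil
  show ?case by (rule exI[of _ 0]) (use a_pos equiv_refl in auto)
next
  case (Cons x w)
  then obtain j where j: "j < a + n" "w \<simeq> pw j" by blast
  have xw: "x # w \<simeq> x # pw j" using equiv_append[OF equiv_refl[of "[x]"] j(2)] by simp
  have Q: "False # pw (Suc i) \<simeq> pw i" for i
    using equiv_append[OF equiv_QP equiv_refl[of "pw i"]] by simp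
  show ?case
  proof (cases x)
    case True
    then have xj: "x # pw j = pw (Suc j)" by simp
    show ?thesis
    proof (cases "Suc j < a + n")
      case True then show ?thesis using xw xj by metis
    next
      case False
      then have "Suc j = a + n" using j by simp
      then have "x # w \<simeq> []" using equiv_trans[OF xw] equiv_period unfolding xj by simp
      then show ?thesis using a_pos by (intro exI[of _ 0]) auto
    qed
  next
    case False
    show ?thesis
    proof (cases j)
      case 0
      \<comment> \<open>a full period is inserted, and its first letter cancelled\<close>
      have "False # pw (a + n) \<simeq> False # []" using equiv_append[OF equiv_refl[of "[False]"] equiv_period] by simp
      moreover have "False # pw (a + n) \<simeq> pw (a + n - 1)" using Q[of "a + n - 1"] a_pos by simp
      ultimately have "[False] \<simeq> pw (a + n - 1)" by (metis equiv_trans equiv_sym)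
      moreover have "x # w \<simeq> [False]" using xw 0 False by simp
      ultimately have "x # w \<simeq> pw (a + n - 1)" by (rule equiv_trans[rotated])
      then show ?thesis using a_pos by (intro exI[of _ "a + n - 1"]) auto
    next
      case (Suc i)
      then have "x # w \<simeq> pw i" using equiv_trans[OF xw] Q[of i] False by simp
      then show ?thesis using j Suc by (intro exI[of _ i]) auto
    qed
  qed
qed

text \<open>Tensoring with an invertible word is faithful: the inverse word undoes it.\<close>

lemma ten_cancel:
  assumes z: "z \<in> hom b t" and v: "v @ w \<simeq> []" and zero: "z \<otimes> word v = zero (b + length v) (t + length v)"
  shows "z = zero b t"
proof -
  obtain \<alpha> \<beta> where 1: "\<alpha> \<in> hom (length (v @ w)) 0" "\<beta> \<in> hom 0 (length (v @ w))" "\<beta> \<odot> \<alpha> = word (v @ w)" "\<alpha> \<odot> \<beta> = idm 0"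
    using v unfolding equiv_def by auto
  have "\<alpha> \<odot> (word (v @ w) \<odot> \<beta>) = idm 0"
    unfolding 1(3)[symmetric] cmp_assoc[OF 1(2,1,2)] 1(4) cmp_idr[OF 1(2)] ..
  then have "z = z \<otimes> (\<alpha> \<odot> (word (v @ w) \<odot> \<beta>))" using ten_idr[OF z] by simp
  also have "\<dots> = (idm t \<otimes> \<alpha>) \<odot> ((z \<otimes> word (v @ w)) \<odot> (idm b \<otimes> \<beta>))"
    using interchange[OF z idm_in word_in 1(2)] interchange[OF idm_in z 1(1) cmp_in[OF word_in 1(2)]] cmp_idl[OF z] cmp_idr[OF z] by simp
  also have "z \<otimes> word (v @ w) = zero (b + length (v @ w)) (t + length (v @ w))"
    unfolding word_append ten_assoc[OF z word_in word_in, symmetric] zero using zero_ten[OF word_in] by (simp add: add.assoc)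
  also have "\<dots> \<odot> (idm b \<otimes> \<beta>) = zero b (t + length (v @ w))"
    using zero_cmp(2)[OF ten_in[OF idm_in 1(2)], of b "t + length (v @ w)"] by simp
  also have "(idm t \<otimes> \<alpha>) \<odot> zero b (t + length (v @ w)) = zero b t"
    using zero_cmp(1)[OF ten_in[OF idm_in 1(1)], of t b] by simp
  finally show ?thesis .
qed

lemma inverse_power: "j \<le> a + n \<Longrightarrow> pw j @ pw (a + n - j) \<simeq> []"
  using equiv_period by (simp add: replicate_add[symmetric])

text \<open>
  Tensoring with the inverse power turns \<open>x\<close> into an endomorphism of a word equivalent to the empty
  word, which is a scalar.
\<close>

lemma endomorphism_power:
  assumes j: "j \<le> a + n" and x: "x \<in> hom j j" "word (pw j) \<odot> x = x" "x \<odot> word (pw j) = x"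
  shows "\<exists>z. x = z \<cdot> word (pw j)"
proof -
  let ?v = "pw (a + n - j)" and ?w = "pw j"
  have w: "word ?w \<in> hom j j" using word_in[of ?w] by simp
  have v: "word ?v \<in> hom (a + n - j) (a + n - j)" using word_in[of ?v] by simp
  let ?m = "j + (a + n - j)"
  obtain \<alpha> \<beta> where 1: "\<alpha> \<in> hom ?m 0" "\<beta> \<in> hom 0 ?m" "\<beta> \<odot> \<alpha> = word (?w @ ?v)" "\<alpha> \<odot> \<beta> = idm 0"
    using inverse_power[OF j] unfolding equiv_def by auto
  have xv: "x \<otimes> word ?v \<in> hom ?m ?m" by (rule ten_in[OF x(1) v])
  have wv: "word (?w @ ?v) \<in> hom ?m ?m" using word_in[of "?w @ ?v"] by simp
  obtain z where z: "\<alpha> \<odot> ((x \<otimes> word ?v) \<odot> \<beta>) = z \<cdot> idm 0"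
    using scalars[OF cmp_in[OF 1(1) cmp_in[OF xv 1(2)]]] by blast
  have "\<beta> \<odot> ((\<alpha> \<odot> ((x \<otimes> word ?v) \<odot> \<beta>)) \<odot> \<alpha>) = word (?w @ ?v) \<odot> ((x \<otimes> word ?v) \<odot> word (?w @ ?v))"
    unfolding 1(3)[symmetric]
    by (simp add: cmp_assoc[OF 1(1) cmp_in[OF xv 1(2)] 1(1)] cmp_assoc[OF xv 1(2,1)]
        cmp_assoc[OF 1(2,1) cmp_in[OF xv cmp_in[OF 1(2,1)]]])
  also have "\<dots> = x \<otimes> word ?v"
    unfolding word_append using interchange[OF x(1) w v v] interchange[OF w x(1) v v] x(2,3) word_idem by simp
  finally have e1: "\<beta> \<odot> ((\<alpha> \<odot> ((x \<otimes> word ?v) \<odot> \<beta>)) \<odot> \<alpha>) = x \<otimes> word ?v" .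
  have e2: "\<beta> \<odot> ((z \<cdot> idm 0) \<odot> \<alpha>) = (z \<cdot> word ?w) \<otimes> word ?v"
    using cmp_smull[OF idm_in 1(1)] cmp_idl[OF 1(1)] cmp_smulr[OF 1(2,1)] 1(3) ten_smull[OF w v] by (simp add: word_append)
  have xz: "x \<otimes> word ?v = (z \<cdot> word ?w) \<otimes> word ?v" using e1 e2 z by simp
  have "(x \<oplus> (-1) \<cdot> (z \<cdot> word ?w)) \<otimes> word ?v = x \<otimes> word ?v \<oplus> (-1) \<cdot> ((z \<cdot> word ?w) \<otimes> word ?v)"
    using ten_addl[OF x(1) smul_in[OF smul_in[OF w]] v] ten_smull[OF smul_in[OF w] v] by simp
  also have "\<dots> = 1 \<cdot> (x \<otimes> word ?v) \<oplus> (-1) \<cdot> (x \<otimes> word ?v)" unfolding xz[symmetric] using smul_one[OF xv] by simp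
  also have "\<dots> = zero (j + length ?v) (j + length ?v)" using smul_add[OF xv, of 1 "-1"] smul_zero[OF xv] by simp
  finally have "x \<oplus> (-1) \<cdot> (z \<cdot> word ?w) = zero j j"
    using ten_cancel[OF add_in[OF x(1) smul_in[OF smul_in[OF w]]], of ?v ?w] equiv_period j by (simp add: replicate_add[symmetric])
  then have "x = z \<cdot> word ?w" by (rule add_diff[OF x(1) smul_in[OF w]])
  then show ?thesis ..
qed

lemma conjugate_word:
  assumes "\<alpha> \<in> hom (length u) (length v)" "\<beta> \<in> hom (length v) (length u)" "\<beta> \<odot> \<alpha> = word u" "\<alpha> \<odot> \<beta> = word v"
  shows "\<beta> \<odot> (word v \<odot> \<alpha>) = word u"
proof -
  have "\<beta> \<odot> (word v \<odot> \<alpha>) = (\<beta> \<odot> \<alpha>) \<odot> (\<beta> \<odot> \<alpha>)"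
    unfolding assms(4)[symmetric] using cmp_assoc[OF assms(1,2,1)] cmp_assoc[OF assms(2,1) cmp_in[OF assms(2,1)]] by simp
  then show ?thesis unfolding assms(3) word_idem .
qed

text \<open>
  A morphism is a sum of morphisms between words. These factor through normal forms, by generated
  isomorphisms; between normal forms, only multiples of the identities are left.
\<close>

lemma generation:
  assumes H: "\<And>i j f. i < a + n \<Longrightarrow> j < a + n \<Longrightarrow> i \<noteq> j \<Longrightarrow> f \<in> hom i j \<Longrightarrow> word (pw j) \<odot> f = f \<Longrightarrow> f \<odot> word (pw i) = f \<Longrightarrow> f = zero i j"
    and f: "f \<in> hom b t"
  shows "f \<in> G"
proof -
  have sandwich: "word w \<odot> (f \<odot> word w') \<in> G" if len: "length w = t" "length w' = b" for w w'
  proof -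
    obtain j where j: "j < a + n" "w \<simeq> pw j" using equiv_normal_form by blast
    obtain i where i: "i < a + n" "w' \<simeq> pw i" using equiv_normal_form by blast
    obtain \<alpha> \<beta> where 1: "\<alpha> \<in> hom (length w) (length (pw j))" "\<alpha> \<in> G" "\<beta> \<in> hom (length (pw j)) (length w)" "\<beta> \<in> G" "\<beta> \<odot> \<alpha> = word w" "\<alpha> \<odot> \<beta> = word (pw j)"
      using j(2) unfolding equiv_def by blast
    obtain \<gamma> \<delta> where 2: "\<gamma> \<in> hom (length w') (length (pw i))" "\<gamma> \<in> G" "\<delta> \<in> hom (length (pw i)) (length w')" "\<delta> \<in> G" "\<delta> \<odot> \<gamma> = word w'" "\<gamma> \<odot> \<delta> = word (pw i)"
      using i(2) unfolding equiv_def by blast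
    have t1: "\<alpha> \<in> hom t j" "\<beta> \<in> hom j t" "\<gamma> \<in> hom b i" "\<delta> \<in> hom i b" "word (pw j) \<in> hom j j" "word (pw i) \<in> hom i i"
      using 1 2 len word_in[of "pw j"] word_in[of "pw i"] by simp_all
    \<comment> \<open>the morphism between words, transported to normal forms\<close>
    define g where "g = word (pw j) \<odot> (\<alpha> \<odot> (f \<odot> (\<delta> \<odot> word (pw i))))"
    have c1: "\<delta> \<odot> word (pw i) \<in> hom i b" using cmp_in[OF t1(4,6)] .
    have c2: "f \<odot> (\<delta> \<odot> word (pw i)) \<in> hom i t" using cmp_in[OF f c1] .
    have c3: "\<alpha> \<odot> (f \<odot> (\<delta> \<odot> word (pw i))) \<in> hom i j" using cmp_in[OF t1(1) c2] .
    have g: "g \<in> hom i j" unfolding g_def using cmp_in[OF t1(5) c3] .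
    have gl: "word (pw j) \<odot> g = g" unfolding g_def using cmp_assoc[OF t1(5,5) c3] word_idem by simp
    have gr: "g \<odot> word (pw i) = g" unfolding g_def
      by (simp add: cmp_assoc[OF t1(5) c3 t1(6)] cmp_assoc[OF t1(1) c2 t1(6)] cmp_assoc[OF f c1 t1(6)] cmp_assoc[OF t1(4,6,6)] word_idem)
    have gG: "g \<in> G"
    proof (cases "i = j")
      case True
      then obtain z where "g = z \<cdot> word (pw j)" using endomorphism_power[of j g] j g gl gr by auto
      then show ?thesis using G_smul[OF t1(5) word_G] by simp
    next
      case False
      then have "g = zero i j" using H[OF i(1) j(1) False g gl gr] by simp
      then show ?thesis using G_zero by simp
    qed
    have "\<beta> \<odot> (g \<odot> \<gamma>) = (\<beta> \<odot> (word (pw j) \<odot> \<alpha>)) \<odot> (f \<odot> (\<delta> \<odot> (word (pw i) \<odot> \<gamma>)))"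
      unfolding g_def
      by (simp add: cmp_assoc[OF t1(5) c3 t1(3)] cmp_assoc[OF t1(1) c2 t1(3)] cmp_assoc[OF f c1 t1(3)] cmp_assoc[OF t1(4,6,3)]
          cmp_assoc[OF t1(2) cmp_in[OF t1(5,1)] cmp_in[OF f cmp_in[OF t1(4) cmp_in[OF t1(6,3)]]]]
          cmp_assoc[OF t1(5,1) cmp_in[OF f cmp_in[OF t1(4) cmp_in[OF t1(6,3)]]]])
    also have "\<dots> = word w \<odot> (f \<odot> word w')"
      using conjugate_word[OF 1(1,3,5,6)] conjugate_word[OF 2(1,3,5,6)] by simp
    finally show ?thesis using G_cmp[OF t1(2) cmp_in[OF g t1(3)] 1(4) G_cmp[OF g t1(3) gG 2(2)]] by simp
  qed
  have "word w \<odot> f \<in> G \<inter> hom b t" if len: "length w = t" for w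
  proof -
    have w: "word w \<in> hom t t" using word_in[of w] len by simp
    have "word w \<odot> (f \<odot> idm b) \<in> G \<inter> hom b t"
    proof (rule resolution[where \<phi> = "\<lambda>x. word w \<odot> (f \<odot> x)"])
      fix x y assume "x \<in> hom b b" "y \<in> hom b b"
      then show "word w \<odot> (f \<odot> (x \<oplus> y)) = word w \<odot> (f \<odot> x) \<oplus> word w \<odot> (f \<odot> y)"
        using cmp_addr[OF f] cmp_addr[OF w cmp_in[OF f] cmp_in[OF f]] by simp
    next
      fix w' :: "bool list" assume "length w' = b"
      then show "word w \<odot> (f \<odot> word w') \<in> G \<inter> hom b t"
        using sandwich[OF len] cmp_in[OF w cmp_in[OF f]] word_in[of w'] by simp
    qed (auto intro: G_add add_in)
    then show ?thesis using cmp_idr[OF f] by simp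
  qed
  then have "idm t \<odot> f \<in> G \<inter> hom b t"
    by (intro resolution[where \<phi> = "\<lambda>x. x \<odot> f"]) (auto intro: G_add add_in cmp_addl[OF _ _ f])
  then show ?thesis using cmp_idl[OF f] by simp
qed

end

section \<open>Counting minimal projections\<close>

locale positive_category = word_relations +
  fixes st :: "'a \<Rightarrow> 'a" and tr :: "'a \<Rightarrow> complex"
  assumes st_in: "f \<in> hom b t \<Longrightarrow> st f \<in> hom t b"
    and st_st: "f \<in> hom b t \<Longrightarrow> st (st f) = f"
    and st_cmp: "f \<in> hom c t \<Longrightarrow> g \<in> hom b c \<Longrightarrow> st (f \<odot> g) = st g \<odot> st f"
    and st_smul: "f \<in> hom b t \<Longrightarrow> st (z \<cdot> f) = cnj z \<cdot> st f"
    and tr_smul: "x \<in> hom b b \<Longrightarrow> tr (z \<cdot> x) = z * tr x"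
    and tr_pos: "f \<in> hom b t \<Longrightarrow> f \<noteq> zero b t \<Longrightarrow> \<exists>r>0. tr (st f \<odot> f) = complex_of_real r"
begin

definition minimal :: "nat \<Rightarrow> 'a \<Rightarrow> bool" where
  "minimal k p \<longleftrightarrow> p \<in> hom k k \<and> p \<odot> p = p \<and> st p = p \<and> p \<noteq> zero k k \<and>
     (\<forall>x\<in>hom k k. p \<odot> (x \<odot> p) = x \<longrightarrow> (\<exists>c. x = c \<cdot> p))"

text \<open>
  A nonzero morphism from \<open>p\<close> to the power \<open>j\<close>. Minimal projections linked to a common power turn out to be
  isomorphic.
\<close>

definition linked :: "nat \<Rightarrow> 'a \<Rightarrow> nat \<Rightarrow> bool" where
  "linked k p j \<longleftrightarrow> (\<exists>f\<in>hom k j. word (pw j) \<odot> f = f \<and> f \<odot> p = f \<and> f \<noteq> zero k j)"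

lemma st_zero: "st (zero b t) = zero t b"
proof -
  have "st (0 \<cdot> zero b t) = 0 \<cdot> st (zero b t)" using st_smul[OF zero_in, of 0] by simp
  then show ?thesis using smul_zero[OF zero_in] smul_zero[OF st_in[OF zero_in]] by simp
qed

lemma st_nonzero: "f \<in> hom b t \<Longrightarrow> f \<noteq> zero b t \<Longrightarrow> st f \<noteq> zero t b"
  using st_st st_zero by metis

lemma minimalD:
  assumes "minimal k p"
  shows "p \<in> hom k k" "p \<odot> p = p" "st p = p" "p \<noteq> zero k k"
    "x \<in> hom k k \<Longrightarrow> p \<odot> (x \<odot> p) = x \<Longrightarrow> \<exists>c. x = c \<cdot> p"
  using assms unfolding minimal_def by blast+

lemma adjoint_absorbs:
  assumes p: "minimal k p" and f: "f \<in> hom k l" "f \<odot> p = f"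
  shows "p \<odot> st f = st f"
proof -
  have "st (f \<odot> p) = st p \<odot> st f" by (rule st_cmp[OF f(1) minimalD(1)[OF p]])
  then show ?thesis using f(2) minimalD(3)[OF p] by simp
qed

text \<open>Minimality makes \<open>st f \<odot> f\<close> a multiple of \<open>p\<close>; comparing traces shows that the factor is positive.\<close>

lemma adjoint_square:
  assumes p: "minimal k p" and f: "f \<in> hom k l" "f \<odot> p = f" "f \<noteq> zero k l"
  shows "\<exists>r>0. st f \<odot> f = complex_of_real r \<cdot> p"
proof -
  note p' = minimalD[OF p]
  have x: "st f \<odot> f \<in> hom k k" by (rule cmp_in[OF st_in[OF f(1)] f(1)])
  have "p \<odot> ((st f \<odot> f) \<odot> p) = st f \<odot> f"
    using cmp_assoc[OF st_in[OF f(1)] f(1) p'(1)] cmp_assoc[OF p'(1) st_in[OF f(1)] f(1)] adjoint_absorbs[OF p f(1,2)] f(2) by simp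
  then obtain c where c: "st f \<odot> f = c \<cdot> p" using p'(5)[OF x] by blast
  obtain r1 where r1: "r1 > 0" "tr (st f \<odot> f) = complex_of_real r1" using tr_pos[OF f(1,3)] by blast
  obtain r2 where r2: "r2 > 0" "tr p = complex_of_real r2" using tr_pos[OF p'(1,4)] p'(2,3) by auto
  have "complex_of_real r1 = c * complex_of_real r2" using r1(2) r2(2) c tr_smul[OF p'(1)] by simp
  then have "c = complex_of_real (r1 / r2)" using r2(1) by (simp add: field_simps)
  then show ?thesis using c r1(1) r2(1) by (intro exI[of _ "r1 / r2"]) simp
qed

text \<open>
  The idempotent \<open>word (pw j)\<close> need not be self-adjoint, so \<open>f \<odot> st f\<close> is multiplied by it to become an
  endomorphism of the power. Its factor agrees with that of \<open>st f \<odot> f\<close>, as one sees by composing with \<open>f\<close>.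
\<close>

lemma square_adjoint:
  assumes p: "minimal k p" and j: "j \<le> a + n"
    and f: "f \<in> hom k j" "word (pw j) \<odot> f = f" "f \<odot> p = f" "f \<noteq> zero k j"
  shows "\<exists>r>0. f \<odot> (st f \<odot> word (pw j)) = complex_of_real r \<cdot> word (pw j)"
proof -
  let ?e = "word (pw j)" and ?x = "f \<odot> (st f \<odot> word (pw j))"
  note p' = minimalD[OF p]
  have e: "?e \<in> hom j j" using word_in[of "pw j"] by simp
  have s: "st f \<in> hom j k" by (rule st_in[OF f(1)])
  have x: "?x \<in> hom j j" by (rule cmp_in[OF f(1) cmp_in[OF s e]])
  have "?e \<odot> ?x = ?x" using cmp_assoc[OF e f(1) cmp_in[OF s e]] f(2) by simp
  moreover have "?x \<odot> ?e = ?x" using cmp_assoc[OF f(1) cmp_in[OF s e] e] cmp_assoc[OF s e e] word_idem by simp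
  ultimately obtain z where z: "?x = z \<cdot> ?e" using endomorphism_power[OF j x] by blast
  obtain r where r: "r > 0" "st f \<odot> f = complex_of_real r \<cdot> p" using adjoint_square[OF p f(1,3,4)] by blast
  have "z \<cdot> f = ?x \<odot> f" unfolding z using cmp_smull[OF e f(1)] f(2) by simp
  also have "\<dots> = f \<odot> (st f \<odot> f)" using cmp_assoc[OF f(1) cmp_in[OF s e] f(1)] cmp_assoc[OF s e f(1)] f(2) by simp
  also have "\<dots> = complex_of_real r \<cdot> f" unfolding r(2) using cmp_smulr[OF f(1) p'(1)] f(3) by simp
  finally have "z = complex_of_real r" by (rule smul_inj[OF f(1,4)])
  then show ?thesis using z r(1) by blast
qed

text \<open>
  The composite cannot vanish, since \<open>f \<odot> st f\<close> is a nonzero multiple of the power \<open>i\<close> by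
  \<open>square_adjoint\<close>.
\<close>

lemma linked_comp:
  assumes p: "minimal k p" and i: "i \<le> a + n" and l: "linked k p i"
    and g: "g \<in> hom i j" "word (pw j) \<odot> g = g" "g \<odot> word (pw i) = g" "g \<noteq> zero i j"
  shows "linked k p j"
proof -
  obtain f where f: "f \<in> hom k i" "word (pw i) \<odot> f = f" "f \<odot> p = f" "f \<noteq> zero k i"
    using l unfolding linked_def by blast
  have e: "word (pw i) \<in> hom i i" "word (pw j) \<in> hom j j" using word_in[of "pw i"] word_in[of "pw j"] by simp_all
  obtain r where r: "r > 0" "f \<odot> (st f \<odot> word (pw i)) = complex_of_real r \<cdot> word (pw i)"
    using square_adjoint[OF p i f] by blast
  have "(g \<odot> f) \<odot> (st f \<odot> word (pw i)) = complex_of_real r \<cdot> g"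
    using cmp_assoc[OF g(1) f(1) cmp_in[OF st_in[OF f(1)] e(1)]] r(2) cmp_smulr[OF g(1) e(1)] g(3) by simp
  then have "g \<odot> f \<noteq> zero k j"
    using zero_cmp(2)[OF cmp_in[OF st_in[OF f(1)] e(1)], of j] smul_cancel[OF _ g(1), of "complex_of_real r"] r(1) g(4) by auto
  moreover have "word (pw j) \<odot> (g \<odot> f) = g \<odot> f" "(g \<odot> f) \<odot> p = g \<odot> f"
    using cmp_assoc[OF e(2) g(1) f(1)] cmp_assoc[OF g(1) f(1) minimalD(1)[OF p]] g(2) f(3) by simp_all
  ultimately show ?thesis unfolding linked_def using cmp_in[OF g(1) f(1)] by blast
qed

lemma linked_iso:
  assumes p: "minimal k p" and q: "q \<in> hom l l" and u: "u \<in> hom k l" "q \<odot> (u \<odot> p) = u" "st u \<odot> u = p" "u \<odot> st u = q"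
    and l: "linked k p j"
  shows "linked l q j"
proof -
  obtain f where f: "f \<in> hom k j" "word (pw j) \<odot> f = f" "f \<odot> p = f" "f \<noteq> zero k j"
    using l unfolding linked_def by blast
  note p' = minimalD[OF p]
  have e: "word (pw j) \<in> hom j j" using word_in[of "pw j"] by simp
  have s: "st u \<in> hom l k" by (rule st_in[OF u(1)])
  have "(f \<odot> st u) \<odot> u = f" using cmp_assoc[OF f(1) s u(1)] u(3) f(3) by simp
  then have "f \<odot> st u \<noteq> zero l j" using zero_cmp(2)[OF u(1), of j] f(4) by auto
  moreover have "word (pw j) \<odot> (f \<odot> st u) = f \<odot> st u" using cmp_assoc[OF e f(1) s] f(2) by simp
  moreover have "(f \<odot> st u) \<odot> q = f \<odot> st u"
    unfolding u(4)[symmetric] using cmp_assoc[OF cmp_in[OF f(1) s] u(1) s] \<open>(f \<odot> st u) \<odot> u = f\<close> by simp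
  ultimately show ?thesis unfolding linked_def using cmp_in[OF f(1) s] by blast
qed

text \<open>
  For morphisms \<open>f\<close> and \<open>g\<close> to the common power, \<open>st g \<odot> f\<close> is nonzero. By \<open>adjoint_square\<close> its two
  composites with its adjoint are positive multiples of \<open>p\<close> and \<open>q\<close>, with the same factor, which can be scaled to \<open>1\<close>.
\<close>

lemma linked_isomorphic:
  assumes p: "minimal k p" and q: "minimal l q" and j: "j \<le> a + n" and lp: "linked k p j" and lq: "linked l q j"
  shows "\<exists>u\<in>hom k l. q \<odot> (u \<odot> p) = u \<and> st u \<odot> u = p \<and> u \<odot> st u = q"
proof -
  obtain f where f: "f \<in> hom k j" "word (pw j) \<odot> f = f" "f \<odot> p = f" "f \<noteq> zero k j"
    using lp unfolding linked_def by blast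
  obtain g where g: "g \<in> hom l j" "word (pw j) \<odot> g = g" "g \<odot> q = g" "g \<noteq> zero l j"
    using lq unfolding linked_def by blast
  note p' = minimalD[OF p] and q' = minimalD[OF q]
  have e: "word (pw j) \<in> hom j j" using word_in[of "pw j"] by simp
  have s: "st g \<in> hom j l" by (rule st_in[OF g(1)])
  define h where "h = st g \<odot> f"
  have h: "h \<in> hom k l" unfolding h_def by (rule cmp_in[OF s f(1)])
  have hp: "h \<odot> p = h" unfolding h_def using cmp_assoc[OF s f(1) p'(1)] f(3) by simp
  have hq: "q \<odot> h = h" unfolding h_def using cmp_assoc[OF q'(1) s f(1)] adjoint_absorbs[OF q g(1,3)] by simp
  obtain r' where r': "r' > 0" "g \<odot> (st g \<odot> word (pw j)) = complex_of_real r' \<cdot> word (pw j)"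
    using square_adjoint[OF q j g] by blast
  have "g \<odot> h = (g \<odot> (st g \<odot> word (pw j))) \<odot> f"
    unfolding h_def using cmp_assoc[OF g(1) cmp_in[OF s e] f(1)] cmp_assoc[OF s e f(1)] f(2) by simp
  also have "\<dots> = complex_of_real r' \<cdot> f" unfolding r'(2) using cmp_smull[OF e f(1)] f(2) by simp
  finally have hnz: "h \<noteq> zero k l" using zero_cmp(1)[OF g(1), of k] smul_cancel[OF _ f(1), of "complex_of_real r'"] r'(1) f(4) by auto
  obtain r where r: "r > 0" "st h \<odot> h = complex_of_real r \<cdot> p" using adjoint_square[OF p h hp hnz] by blast
  have sh: "st h \<in> hom l k" by (rule st_in[OF h])
  have "st (q \<odot> h) = st h \<odot> q" using st_cmp[OF q'(1) h] q'(3) by simp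
  then have "st h \<odot> q = st h" using hq by simp
  from adjoint_square[OF q sh this st_nonzero[OF h hnz]] obtain r2 where r2: "r2 > 0" "h \<odot> st h = complex_of_real r2 \<cdot> q"
    using st_st[OF h] by auto
  have "complex_of_real r2 \<cdot> h = (h \<odot> st h) \<odot> h" unfolding r2(2) using cmp_smull[OF q'(1) h] hq by simp
  also have "\<dots> = h \<odot> (st h \<odot> h)" by (rule cmp_assoc[OF h sh h])
  also have "\<dots> = complex_of_real r \<cdot> h" unfolding r(2) using cmp_smulr[OF h p'(1)] hp by simp
  finally have rr: "complex_of_real r2 = complex_of_real r" by (rule smul_inj[OF h hnz])
  define z where "z = complex_of_real (1 / sqrt r)"
  have "z * (z * complex_of_real r) = complex_of_real (1 / sqrt r * (1 / sqrt r * r))" unfolding z_def by (simp only: of_real_mult)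
  also have "1 / sqrt r * (1 / sqrt r * r) = 1" using r(1) by (simp add: field_simps)
  finally have zz: "z * (z * complex_of_real r) = 1" by simp
  have su: "st (z \<cdot> h) = z \<cdot> st h" using st_smul[OF h, of z] unfolding z_def by simp
  have "st (z \<cdot> h) \<odot> (z \<cdot> h) = p" "(z \<cdot> h) \<odot> st (z \<cdot> h) = q"
    unfolding su cmp_smull[OF sh smul_in[OF h]] cmp_smulr[OF sh h] cmp_smull[OF h smul_in[OF sh]] cmp_smulr[OF h sh] r(2) r2(2) rr
      smul_smul[OF p'(1)] smul_smul[OF q'(1)] zz by (rule smul_one[OF p'(1)], rule smul_one[OF q'(1)])
  moreover have "q \<odot> ((z \<cdot> h) \<odot> p) = z \<cdot> h" using cmp_smull[OF h p'(1)] cmp_smulr[OF q'(1) h] hp hq by simp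
  ultimately show ?thesis using smul_in[OF h] by blast
qed

text \<open>Otherwise every word, being equivalent to a power, annihilates \<open>p\<close>, and so does the identity.\<close>

lemma linked_exists:
  assumes p: "minimal k p"
  shows "\<exists>j<a + n. linked k p j"
proof (rule ccontr)
  assume no: "\<not> ?thesis"
  note p' = minimalD[OF p]
  have "idm k \<odot> p \<in> {zero k k}"
  proof (rule resolution[where \<phi> = "\<lambda>x. x \<odot> p"])
    fix w :: "bool list" assume len: "length w = k"
    obtain j where j: "j < a + n" "w \<simeq> pw j" using equiv_normal_form by blast
    obtain \<alpha> \<beta> where 1: "\<alpha> \<in> hom (length w) (length (pw j))" "\<beta> \<in> hom (length (pw j)) (length w)" "\<beta> \<odot> \<alpha> = word w" "\<alpha> \<odot> \<beta> = word (pw j)"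
      using j(2) unfolding equiv_def by blast
    have t: "\<alpha> \<in> hom k j" "\<beta> \<in> hom j k" "word (pw j) \<in> hom j j" using 1 len word_in[of "pw j"] by simp_all
    let ?f = "word (pw j) \<odot> (\<alpha> \<odot> p)"
    have "?f \<in> hom k j" "word (pw j) \<odot> ?f = ?f" "?f \<odot> p = ?f"
      using cmp_in[OF t(3) cmp_in[OF t(1) p'(1)]] cmp_assoc[OF t(3,3) cmp_in[OF t(1) p'(1)]] word_idem
        cmp_assoc[OF t(3) cmp_in[OF t(1) p'(1)] p'(1)] cmp_assoc[OF t(1) p'(1,1)] p'(2) by simp_all
    then have f0: "?f = zero k j" using no j(1) unfolding linked_def by blast
    have "word w \<odot> p = (\<beta> \<odot> (word (pw j) \<odot> \<alpha>)) \<odot> p" using conjugate_word[OF 1] by simp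
    also have "\<dots> = \<beta> \<odot> ?f"
      using cmp_assoc[OF t(2) cmp_in[OF t(3,1)] p'(1)] cmp_assoc[OF t(3,1) p'(1)] by simp
    also have "\<dots> = zero k k" unfolding f0 by (rule zero_cmp(1)[OF t(2)])
    finally show "word w \<odot> p \<in> {zero k k}" by simp
  next
    fix x y assume "x \<in> {zero k k}" "y \<in> {zero k k}"
    then show "x \<oplus> y \<in> {zero k k}" using smul_add[OF zero_in, of 0 k k 0] smul_zero[OF zero_in] by simp
  qed (rule cmp_addl[OF _ _ p'(1)])
  then show False using cmp_idl[OF p'(1)] p'(4) by simp
qed

end

lemma card_quotient_le:
  fixes R :: "('a \<times> 'a) set" and J :: "'b set"
  assumes J: "finite J" "\<And>x. x \<in> M \<Longrightarrow> \<exists>j\<in>J. N x j"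
    and N: "\<And>x y j. x \<in> M \<Longrightarrow> y \<in> M \<Longrightarrow> j \<in> J \<Longrightarrow> N x j \<Longrightarrow> N y j \<Longrightarrow> (x, y) \<in> R"
    and R: "\<And>x y j. (x, y) \<in> R \<Longrightarrow> N x j \<Longrightarrow> y \<in> M \<and> N y j"
  shows "card (M // R) \<le> card J"
proof -
  have "M // R \<subseteq> (\<lambda>j. {y \<in> M. N y j}) ` J"
  proof
    fix X assume "X \<in> M // R"
    then obtain x where x: "x \<in> M" "X = R `` {x}" by (rule quotientE)
    obtain j where j: "j \<in> J" "N x j" using J(2)[OF x(1)] by blast
    have "X = {y \<in> M. N y j}" unfolding x(2) using R[OF _ j(2)] N[OF x(1) _ j] by blast
    then show "X \<in> (\<lambda>j. {y \<in> M. N y j}) ` J" using j(1) by blast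
  qed
  then show ?thesis using J(1) by (meson card_image_le card_mono finite_imageI le_trans)
qed

section \<open>Planar algebras as diagram categories\<close>

lemma dim_one_multiple:
  assumes s: "vector_space (s :: complex \<Rightarrow> 'a :: ab_group_add \<Rightarrow> 'a)" and d: "vector_space.dim s V = 1"
    and e: "e \<in> V" "e \<noteq> 0" and x: "x \<in> V"
  shows "\<exists>c. x = s c e"
proof -
  interpret vector_space s by (rule s)
  obtain B where B: "B \<subseteq> V" "independent B" "V \<subseteq> span B" "card B = dim V" by (rule basis_exists)
  obtain b where b: "B = {b}" using B(4) d by (auto simp: card_1_singleton_iff)
  obtain c d where cd: "x = s c b" "e = s d b" using B(3) x e(1) unfolding b span_singleton by blast
  have "d \<noteq> 0" using cd(2) e(2) by auto
  then have "x = s (c / d) e" unfolding cd by simp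
  then show ?thesis ..
qed

lemma linear_span_subset:
  assumes s: "vector_space (s :: complex \<Rightarrow> 'a :: ab_group_add \<Rightarrow> 'a)"
    and V: "module.subspace s V" "B \<subseteq> V" and W: "module.subspace s W" "\<And>x. x \<in> B \<Longrightarrow> \<phi> x \<in> W"
    and lin: "\<And>x y. x \<in> V \<Longrightarrow> y \<in> V \<Longrightarrow> \<phi> (x + y) = \<phi> x + \<phi> y" "\<And>x c. x \<in> V \<Longrightarrow> \<phi> (s c x) = s c (\<phi> x)"
    and x: "x \<in> module.span s B"
  shows "\<phi> x \<in> W"
proof -
  interpret vector_space s by (rule s)
  have "x \<in> V \<and> \<phi> x \<in> W"
    using x
  proof (induction rule: span_induct_alt)
    case base
    have "\<phi> (s 0 0) = s 0 (\<phi> 0)" using lin(2) subspace_0[OF V(1)] by blast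
    then show ?case using subspace_0[OF V(1)] subspace_0[OF W(1)] by simp
  next
    case (step c x y)
    then have "x \<in> V" using V(2) by blast
    then show ?case
      using step V(1) W lin(1)[OF subspace_scale[OF V(1)], of x y c] lin(2) by (simp add: subspace_add subspace_scale)
  qed
  then show ?thesis ..
qed

context
  fixes A :: "('a :: ab_group_add, 'b) planar_alg_scheme"
  assumes A: "unshaded_planar_algebra A"
begin

interpretation V: vector_space "scl A" by (rule vs[OF A])

lemma space_closed:
  "0 \<in> spc A b t" "x \<in> spc A b t \<Longrightarrow> y \<in> spc A b t \<Longrightarrow> x + y \<in> spc A b t"
  "x \<in> spc A b t \<Longrightarrow> y \<in> spc A b t \<Longrightarrow> x - y \<in> spc A b t" "x \<in> spc A b t \<Longrightarrow> scl A z x \<in> spc A b t"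
  using subsp[OF A] V.subspace_0 V.subspace_add V.subspace_diff V.subspace_scale by blast+

lemma mult_bilinear:
  "x \<in> spc A c t \<Longrightarrow> x' \<in> spc A c t \<Longrightarrow> y \<in> spc A b c \<Longrightarrow> mult A b c t (x + x') y = mult A b c t x y + mult A b c t x' y"
  "x \<in> spc A c t \<Longrightarrow> y \<in> spc A b c \<Longrightarrow> y' \<in> spc A b c \<Longrightarrow> mult A b c t x (y + y') = mult A b c t x y + mult A b c t x y'"
  "x \<in> spc A c t \<Longrightarrow> y \<in> spc A b c \<Longrightarrow> mult A b c t (scl A z x) y = scl A z (mult A b c t x y)"
  "x \<in> spc A c t \<Longrightarrow> y \<in> spc A b c \<Longrightarrow> mult A b c t x (scl A z y) = scl A z (mult A b c t x y)"
  unfolding mult_def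
  using act_add[OF A planar_mult, of 0 "[x, y]" b c t x x'] act_add[OF A planar_mult, of 1 "[x, y]" b c t y y']
    act_scl[OF A planar_mult, of 0 "[x, y]" b c t x z] act_scl[OF A planar_mult, of 1 "[x, y]" b c t y z]
  by (simp_all add: labelling_iff mult_boxes)

lemma tensor_bilinear:
  "x \<in> spc A b t \<Longrightarrow> x' \<in> spc A b t \<Longrightarrow> y \<in> spc A b' t' \<Longrightarrow> tensor A b t b' t' (x + x') y = tensor A b t b' t' x y + tensor A b t b' t' x' y"
  "x \<in> spc A b t \<Longrightarrow> y \<in> spc A b' t' \<Longrightarrow> y' \<in> spc A b' t' \<Longrightarrow> tensor A b t b' t' x (y + y') = tensor A b t b' t' x y + tensor A b t b' t' x y'"
  "x \<in> spc A b t \<Longrightarrow> y \<in> spc A b' t' \<Longrightarrow> tensor A b t b' t' (scl A z x) y = scl A z (tensor A b t b' t' x y)"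
  "x \<in> spc A b t \<Longrightarrow> y \<in> spc A b' t' \<Longrightarrow> tensor A b t b' t' x (scl A z y) = scl A z (tensor A b t b' t' x y)"
  unfolding tensor_def
  using act_add[OF A planar_tensor, of 0 "[x, y]" b t b' t' x x'] act_add[OF A planar_tensor, of 1 "[x, y]" b t b' t' y y']
    act_scl[OF A planar_tensor, of 0 "[x, y]" b t b' t' x z] act_scl[OF A planar_tensor, of 1 "[x, y]" b t b' t' y z]
  by (simp_all add: labelling_iff tensor_boxes)

lemma elementary_mem: "strand A \<in> spc A 1 1" "cap A \<in> spc A 2 0" "cup A \<in> spc A 0 2" "empty_diag A \<in> spc A 0 0"
proof -
  have "labelling A strand_tangle []" "labelling A cap_tangle []" "labelling A cup_tangle []"
    unfolding labelling_iff strand_tangle_def cap_tangle_def cup_tangle_def by simp_all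
  then show "strand A \<in> spc A 1 1" "cap A \<in> spc A 2 0" "cup A \<in> spc A 0 2"
    unfolding strand_def cap_def cup_def using act_closed[OF A planar_strand] act_closed[OF A planar_cap] act_closed[OF A planar_cup]
    by (simp_all add: strand_tangle_def cap_tangle_def cup_tangle_def)
  show "empty_diag A \<in> spc A 0 0" unfolding one_empty[symmetric] by (rule one_mem[OF A])
qed

lemma trace_linear: "x \<in> spc A k k \<Longrightarrow> trR A k (scl A z x) = scl A z (trR A k x)" "x \<in> spc A k k \<Longrightarrow> trR A k x \<in> spc A 0 0"
proof -
  have bx: "boxes (trR_tangle k) = [(k, k, place (Complex (- 1/2) 0) (1/4) (1/4))]" "bots (trR_tangle k) = 0" "tops (trR_tangle k) = 0"
    unfolding trR_tangle_def by simp_all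
  assume x: "x \<in> spc A k k"
  then have l: "labelling A (trR_tangle k) [x]" unfolding labelling_iff bx by simp
  then show "trR A k (scl A z x) = scl A z (trR A k x)"
    unfolding trR_def using act_scl[OF A planar_trR, of 0 "[x]" k x z] by simp
  show "trR A k x \<in> spc A 0 0" unfolding trR_def using act_closed[OF A planar_trR l] bx by simp
qed

text \<open>The empty diagram is the unit of juxtaposition, so it vanishes only if all closed diagrams do.\<close>

lemma empty_nonzero:
  assumes "V.dim (spc A 0 0) = 1" shows "empty_diag A \<noteq> 0"
proof
  assume e: "empty_diag A = 0"
  have "x = 0" if x: "x \<in> spc A 0 0" for x
  proof -
    have "x = tensor A 0 0 0 0 x (scl A 0 0)" using tensor_empty(1)[OF A x] e unfolding one_empty by simp
    also have "\<dots> = 0" using tensor_bilinear(4)[OF x space_closed(1), of 0 0 0] by simp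
    finally show ?thesis .
  qed
  then have "spc A 0 0 = {0}" using space_closed(1) by blast
  then have "spc A 0 0 \<subseteq> V.span {}" by simp
  then have "V.dim (spc A 0 0) \<le> card ({} :: 'a set)" by (rule V.dim_le_card) simp
  then show False using assms by simp
qed

end

text \<open>
  The spaces of different types may overlap, so the morphisms of the category are elements
  together with their types. Values of the operations on mismatched types are arbitrary.
\<close>

type_synonym 'a typed = "nat \<times> nat \<times> 'a"

definition thom :: "('a, 'b) planar_alg_scheme \<Rightarrow> nat \<Rightarrow> nat \<Rightarrow> 'a typed set" where
  "thom A b t = {b} \<times> {t} \<times> spc A b t"

fun tcmp :: "('a, 'b) planar_alg_scheme \<Rightarrow> 'a typed \<Rightarrow> 'a typed \<Rightarrow> 'a typed" where
  "tcmp A (c, t, x) (b, _, y) = (b, t, mult A b c t x y)"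

fun tten :: "('a, 'b) planar_alg_scheme \<Rightarrow> 'a typed \<Rightarrow> 'a typed \<Rightarrow> 'a typed" where
  "tten A (b, t, x) (b', t', y) = (b + b', t + t', tensor A b t b' t' x y)"

definition tid :: "('a, 'b) planar_alg_scheme \<Rightarrow> nat \<Rightarrow> 'a typed" where
  "tid A k = (k, k, one A k)"

fun tadd :: "'a :: ab_group_add typed \<Rightarrow> 'a typed \<Rightarrow> 'a typed" where
  "tadd (b, t, x) (_, _, y) = (b, t, x + y)"

fun tsmul :: "('a, 'b) planar_alg_scheme \<Rightarrow> complex \<Rightarrow> 'a typed \<Rightarrow> 'a typed" where
  "tsmul A z (b, t, x) = (b, t, scl A z x)"

definition tzero :: "nat \<Rightarrow> nat \<Rightarrow> 'a :: ab_group_add typed" where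
  "tzero b t = (b, t, 0)"

lemma thom_iff: "(b', t', x) \<in> thom A b t \<longleftrightarrow> b' = b \<and> t' = t \<and> x \<in> spc A b t"
  unfolding thom_def by auto

lemma thomE:
  assumes "f \<in> thom A b t"
  obtains x where "f = (b, t, x)" "x \<in> spc A b t"
  using assms unfolding thom_def by auto

lemma planar_diagram_category:
  assumes A: "unshaded_planar_algebra A" and d: "vector_space.dim (scl A) (spc A 0 0) = 1"
  shows "diagram_category (thom A) (tcmp A) (tten A) (tid A) tadd (tsmul A) tzero"
proof -
  interpret V: vector_space "scl A" by (rule vs[OF A])
  note laws = mult_mem[OF A] tensor_mem[OF A] one_mem[OF A] mult_assoc[OF A] mult_one[OF A] tensor_assoc[OF A]
    tensor_empty[OF A] tensor_one[OF A] interchange[OF A] space_closed[OF A] mult_bilinear[OF A] tensor_bilinear[OF A]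
  note [elim!] = thomE
  have scalar: "\<exists>z. f = tsmul A z (tid A 0)" if f: "f \<in> thom A 0 0" for f
  proof -
    obtain x where x: "f = (0, 0, x)" "x \<in> spc A 0 0" by (rule thomE[OF f])
    obtain c where "x = scl A c (empty_diag A)"
      using dim_one_multiple[OF vs[OF A] d elementary_mem(4)[OF A] empty_nonzero[OF A d] x(2)] by blast
    then show ?thesis using x(1) unfolding tid_def one_empty by auto
  qed
  show ?thesis
    by unfold_locales ((rule scalar; assumption) | (auto simp: thom_iff tid_def tzero_def laws V.scale_left_distrib; fail))+
qed

section \<open>Generated elements\<close>

definition diagrams :: "('a :: ab_group_add, 'b) planar_alg_scheme \<Rightarrow> 'a typed set \<Rightarrow> nat \<Rightarrow> nat \<Rightarrow> 'a set" where
  "diagrams A G b t = {act A T xs | T xs. planar_tangle T \<and> bots T = b \<and> tops T = t \<and>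
           length xs = length (boxes T) \<and>
           (\<forall>i<length xs. (in_bot (boxes T ! i), in_top (boxes T ! i), xs ! i) \<in> G)}"

definition generated :: "('a :: ab_group_add, 'b) planar_alg_scheme \<Rightarrow> 'a typed set \<Rightarrow> 'a typed set" where
  "generated A G = {(b, t, x). x \<in> module.span (scl A) (diagrams A G b t)}"

lemma diagrams_alt:
  "x \<in> diagrams A G b t \<longleftrightarrow> (\<exists>T ys. x = act A T ys \<and> planar_tangle T \<and> bots T = b \<and> tops T = t \<and>
     list_all2 (\<lambda>B y. (in_bot B, in_top B, y) \<in> G) (boxes T) ys)"
  unfolding diagrams_def list_all2_conv_all_nth mem_Collect_eq by metis

context
  fixes A :: "('a :: ab_group_add, 'b) planar_alg_scheme" and G :: "'a typed set"
  assumes A: "unshaded_planar_algebra A" and G: "\<forall>b t x. (b, t, x) \<in> G \<longrightarrow> x \<in> spc A b t"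
begin

interpretation V: vector_space "scl A" by (rule vs[OF A])

lemma labelling_generators:
  "list_all2 (\<lambda>B y. (in_bot B, in_top B, y) \<in> G) (boxes T) ys \<Longrightarrow> labelling A T ys"
  unfolding labelling_iff using G by (auto elim!: list_all2_mono)

lemma diagrams_subset: "diagrams A G b t \<subseteq> spc A b t"
proof
  fix x assume "x \<in> diagrams A G b t"
  then obtain T ys where T: "x = act A T ys" "planar_tangle T" "bots T = b" "tops T = t"
    "list_all2 (\<lambda>B y. (in_bot B, in_top B, y) \<in> G) (boxes T) ys"
    unfolding diagrams_alt by blast
  then show "x \<in> spc A b t" using act_closed[OF A T(2) labelling_generators[OF T(5)]] by simp
qed

lemma generated_iff: "(b, t, x) \<in> generated A G \<longleftrightarrow> x \<in> V.span (diagrams A G b t)"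
  unfolding generated_def by simp

lemma generated_mem: "(b, t, x) \<in> generated A G \<Longrightarrow> x \<in> spc A b t"
  unfolding generated_iff using V.span_minimal[OF diagrams_subset subsp[OF A]] by blast

lemma generated_linear:
  "(b, t, 0) \<in> generated A G" "(b, t, x) \<in> generated A G \<Longrightarrow> (b, t, y) \<in> generated A G \<Longrightarrow> (b, t, x + y) \<in> generated A G"
  "(b, t, x) \<in> generated A G \<Longrightarrow> (b, t, y) \<in> generated A G \<Longrightarrow> (b, t, x - y) \<in> generated A G"
  "(b, t, x) \<in> generated A G \<Longrightarrow> (b, t, scl A z x) \<in> generated A G"
  unfolding generated_iff by (rule V.span_zero, erule (1) V.span_add, erule (1) V.span_diff, erule V.span_scale)

lemma generated_act:
  "planar_tangle T \<Longrightarrow> list_all2 (\<lambda>B y. (in_bot B, in_top B, y) \<in> G) (boxes T) ys \<Longrightarrow> (bots T, tops T, act A T ys) \<in> generated A G"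
  unfolding generated_iff by (rule V.span_base) (auto simp: diagrams_alt)

text \<open>Gluing diagrams into \<open>T\<close> gives a diagram; by bilinearity the same holds for linear combinations.\<close>

lemma generated_two_boxes:
  assumes T: "planar_tangle T" "boxes T = [B, B']"
    and lin: "\<And>x x' y. x \<in> spc A (in_bot B) (in_top B) \<Longrightarrow> x' \<in> spc A (in_bot B) (in_top B) \<Longrightarrow> y \<in> spc A (in_bot B') (in_top B') \<Longrightarrow> \<phi> (x + x') y = \<phi> x y + \<phi> x' y"
      "\<And>x y y'. x \<in> spc A (in_bot B) (in_top B) \<Longrightarrow> y \<in> spc A (in_bot B') (in_top B') \<Longrightarrow> y' \<in> spc A (in_bot B') (in_top B') \<Longrightarrow> \<phi> x (y + y') = \<phi> x y + \<phi> x y'"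
      "\<And>x y z. x \<in> spc A (in_bot B) (in_top B) \<Longrightarrow> y \<in> spc A (in_bot B') (in_top B') \<Longrightarrow> \<phi> (scl A z x) y = scl A z (\<phi> x y)"
      "\<And>x y z. x \<in> spc A (in_bot B) (in_top B) \<Longrightarrow> y \<in> spc A (in_bot B') (in_top B') \<Longrightarrow> \<phi> x (scl A z y) = scl A z (\<phi> x y)"
    and \<phi>: "\<And>x y. \<phi> x y = act A T [x, y]"
    and x: "(in_bot B, in_top B, x) \<in> generated A G" and y: "(in_bot B', in_top B', y) \<in> generated A G"
  shows "(bots T, tops T, \<phi> x y) \<in> generated A G"
proof -
  let ?W = "V.span (diagrams A G (bots T) (tops T))"
  have W: "V.subspace ?W" by (rule V.subspace_span)
  have "\<phi> x v \<in> ?W" if v: "v \<in> diagrams A G (in_bot B') (in_top B')" for v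
  proof (rule linear_span_subset[OF vs[OF A] subsp[OF A] diagrams_subset W, where \<phi> = "\<lambda>u. \<phi> u v"])
    have vm: "v \<in> spc A (in_bot B') (in_top B')" using v diagrams_subset by blast
    fix u assume "u \<in> diagrams A G (in_bot B) (in_top B)"
    then obtain S us where S: "u = act A S us" "planar_tangle S" "bots S = in_bot B" "tops S = in_top B"
      "list_all2 (\<lambda>B y. (in_bot B, in_top B, y) \<in> G) (boxes S) us"
      unfolding diagrams_alt by blast
    obtain R zs where R: "v = act A R zs" "planar_tangle R" "bots R = in_bot B'" "tops R = in_top B'"
      "list_all2 (\<lambda>B y. (in_bot B, in_top B, y) \<in> G) (boxes R) zs"
      using v unfolding diagrams_alt by blast
    have "list_all2 (\<lambda>B y. (in_bot B, in_top B, y) \<in> G) (boxes (glue2 T S R)) (us @ zs)"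
      unfolding glue2_simps[OF T(2)] using S(5) R(5) by (simp add: list_all2_append list_all2_map1 list_all2_lengthD)
    from generated_act[OF planar_glue2[OF T(1) S(2) R(2) T(2) S(3,4) R(3,4)] this]
    show "\<phi> u v \<in> ?W"
      unfolding act_glue2(1)[OF A T(1) S(2) R(2) T(2) S(3,4) R(3,4) labelling_generators[OF S(5)] labelling_generators[OF R(5)]]
      unfolding glue2_simps[OF T(2)] generated_iff S(1) R(1) \<phi> by simp
  next
    have vm: "v \<in> spc A (in_bot B') (in_top B')" using v diagrams_subset by blast
    show "\<phi> (u + u') v = \<phi> u v + \<phi> u' v" if "u \<in> spc A (in_bot B) (in_top B)" "u' \<in> spc A (in_bot B) (in_top B)" for u u'
      using lin(1) that vm by blast
    show "\<phi> (scl A z u) v = scl A z (\<phi> u v)" if "u \<in> spc A (in_bot B) (in_top B)" for u z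
      using lin(3) that vm by blast
    show "x \<in> V.span (diagrams A G (in_bot B) (in_top B))" using x unfolding generated_iff .
  qed
  then have "\<phi> x y \<in> ?W"
    by (rule linear_span_subset[OF vs[OF A] subsp[OF A] diagrams_subset W, where \<phi> = "\<phi> x"])
      (use lin(2,4) generated_mem[OF x] y in \<open>auto simp: generated_iff\<close>)
  then show ?thesis unfolding generated_iff .
qed

lemma generated_mult:
  assumes "(c, t, x) \<in> generated A G" "(b, c, y) \<in> generated A G"
  shows "(b, t, mult A b c t x y) \<in> generated A G"
  using generated_two_boxes[OF planar_mult mult_boxes, where \<phi> = "mult A b c t" and x = x and y = y] assms mult_bilinear[OF A]
  unfolding mult_def[symmetric] by simp

lemma generated_tensor:
  assumes "(b, t, x) \<in> generated A G" "(b', t', y) \<in> generated A G"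
  shows "(b + b', t + t', tensor A b t b' t' x y) \<in> generated A G"
  using generated_two_boxes[OF planar_tensor tensor_boxes, where \<phi> = "tensor A b t b' t'" and x = x and y = y] assms tensor_bilinear[OF A]
  unfolding tensor_def[symmetric] by simp

lemma generated_one: "(k, k, one A k) \<in> generated A G"
proof -
  obtain D :: "'a layer list" where D: "good k k D" "shape D = [Id k]" "planar_tangle (layered k k D)" "one A k = act A (layered k k D) (labels [Id k])"
    using evaluates_one[of A k] unfolding evaluates_def by blast
  have "length (boxes (layered k k D)) = 0" using layered_lengths[of D k k] unfolding D(2) by simp
  then show ?thesis using generated_act[OF D(3), of "[]"] D(4) by simp
qed

lemma generated_elementary: "(2, 0, cap A) \<in> generated A G" "(0, 2, cup A) \<in> generated A G" "(1, 1, strand A) \<in> generated A G"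
  using generated_act[OF planar_cap, of "[]"] generated_act[OF planar_cup, of "[]"] generated_act[OF planar_strand, of "[]"]
  unfolding cap_def cup_def strand_def by (simp_all add: cap_tangle_def cup_tangle_def strand_tangle_def)

lemma generated_generator:
  assumes "(b, t, x) \<in> G" shows "(b, t, x) \<in> generated A G"
  using generated_act[OF planar_unit, of b t "[x]"] act_unit[OF A, of x b t] G assms by (simp add: unit_tangle_def)

lemma generates_iff: "generates A G \<longleftrightarrow> (\<forall>b t. spc A b t \<subseteq> {x. (b, t, x) \<in> generated A G})"
proof -
  have "generates A G \<longleftrightarrow> (\<forall>b t. spc A b t = V.span (diagrams A G b t))" unfolding generates_def diagrams_def ..
  also have "\<dots> \<longleftrightarrow> (\<forall>b t. spc A b t = {x. (b, t, x) \<in> generated A G})" unfolding generated_iff by simp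
  finally show ?thesis using generated_mem by blast
qed

end

section \<open>The theorem\<close>

fun tst :: "('a, 'b) star_planar_alg_scheme \<Rightarrow> 'a typed \<Rightarrow> 'a typed" where
  "tst A (b, t, x) = (t, b, star A b t x)"

text \<open>Well defined on endomorphisms, since every closed diagram is a unique multiple of the empty one.\<close>

fun ttr :: "('a, 'b) planar_alg_scheme \<Rightarrow> 'a typed \<Rightarrow> complex" where
  "ttr A (b, t, x) = (SOME z. trR A b x = scl A z (empty_diag A))"

text \<open>
  The labelled cap and cup of \<open>Q\<close> are the isomorphism from \<open>Q \<otimes> P\<close> to the empty word: one composite is the
  saddle relation, the other is the trace of \<open>Q\<close>, by \<open>trace_loop\<close>.
\<close>

lemma arrow_category:
  assumes sub: "subfactor_planar_algebra A" and a: "1 \<le> a" and rel: "arrow_relations A a n \<omega> P U"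
    and G: "G = {(1, 1, P), (a, n, U), (n, a, star A a n U)}"
  shows "positive_category (thom A) (tcmp A) (tten A) (tid A) tadd (tsmul A) tzero (1, 1, P) (1, 1, half_turn A 1 1 P)
    (generated A G) a n (tst A) (ttr A)" "\<forall>b t x. (b, t, x) \<in> G \<longrightarrow> x \<in> spc A b t"
proof -
  define Q where "Q = half_turn A 1 1 P"
  have A: "unshaded_planar_algebra A" and d: "vector_space.dim (scl A) (spc A 0 0) = 1" and adj: "planar_adjoint A"
    using sub unfolding subfactor_planar_algebra_def by blast+
  interpret V: vector_space "scl A" by (rule vs[OF A])
  have star: "star A b t x \<in> spc A t b" "star A t b (star A b t x) = x" "star A b t (scl A z x) = scl A (cnj z) (star A b t x)"
    if "x \<in> spc A b t" for b t x z
    using adj that unfolding planar_adjoint_def by blast+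
  have P: "P \<in> spc A 1 1" and U: "U \<in> spc A a n" and bubble: "trR A 1 Q = empty_diag A"
    and sum: "strand A = P + Q" and orth: "mult A 1 1 1 P Q = 0" "mult A 1 1 1 Q P = 0"
    and saddle: "mult A 2 0 2 (labelled_cup A Q) (labelled_cap A Q) = tensor A 1 1 1 1 Q P"
    and unitary: "mult A n a n U (star A a n U) = tensor_power A n Q" "mult A a n a (star A a n U) U = tensor_power A a P"
    using rel unfolding arrow_relations_def Let_def Q_def[symmetric] by blast+
  have Qe: "Q = strand A - P" using sum by simp
  have Q: "Q \<in> spc A 1 1" unfolding Qe by (rule space_closed(3)[OF A elementary_mem(1)[OF A] P])
  have idem: "mult A 1 1 1 P P = P" "mult A 1 1 1 Q Q = Q"
    using mult_bilinear(1)[OF A P Q P] mult_bilinear(1)[OF A P Q Q] mult_one(1)[OF A P] mult_one(1)[OF A Q] orth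
    unfolding one_strand sum by simp_all
  show Gs: "\<forall>b t x. (b, t, x) \<in> G \<longrightarrow> x \<in> spc A b t"
    using P U star(1)[OF U] unfolding G by auto
  note gen = generated_linear[OF A Gs] generated_mult[OF A Gs] generated_tensor[OF A Gs] generated_one[OF A Gs]
    generated_elementary[OF A Gs]
  have PG: "(1, 1, P) \<in> generated A G" and UG: "(a, n, U) \<in> generated A G" "(n, a, star A a n U) \<in> generated A G"
    by (rule generated_generator[OF A Gs]; simp add: G)+
  have QG: "(1, 1, Q) \<in> generated A G" unfolding Qe by (rule gen(3)[OF gen(10) PG])
  interpret D: diagram_category "thom A" "tcmp A" "tten A" "tid A" tadd "tsmul A" tzero
    by (rule planar_diagram_category[OF A d])
  interpret C: two_colours "thom A" "tcmp A" "tten A" "tid A" tadd "tsmul A" tzero "(1, 1, P)" "(1, 1, Q)"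
  proof unfold_locales
    show "tid A 1 = tadd (1, 1, P) (1, 1, Q)" unfolding tid_def one_strand sum by simp
  qed (use P Q idem in \<open>simp_all add: thom_iff\<close>)
  have power: "C.word (replicate k x) = (k, k, tensor_power A k (if x then P else Q))" for k x
  proof (induction k)
    case 0
    have "C.word [] = (0, 0, empty_diag A)" unfolding C.word.simps unfolding tid_def one_empty ..
    then show ?case by simp
  next
    case (Suc k)
    have "C.word (replicate (Suc k) x) = tten A (C.word (replicate k x)) (C.word [x])"
      unfolding replicate_Suc replicate_append_same[symmetric] by (rule C.word_append)
    also have "C.word [x] = C.letter x" unfolding C.word.simps by (rule D.ten_idr[OF C.letter_in])
    finally show ?case unfolding Suc.IH C.letter_def by simp
  qed
  have cancel: "\<exists>\<alpha>\<in>thom A 2 0 \<inter> generated A G. \<exists>\<beta>\<in>thom A 0 2 \<inter> generated A G.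
      tcmp A \<beta> \<alpha> = (2, 2, tensor A 1 1 1 1 Q P) \<and> tcmp A \<alpha> \<beta> = tid A 0"
  proof -
    define e where "e = tensor A 1 1 1 1 Q (strand A)"
    have two: "(2::nat) = 1 + 1" by simp
    have e: "e \<in> spc A 2 2" unfolding e_def two by (rule tensor_mem[OF A Q elementary_mem(1)[OF A]])
    have eG: "(2, 2, e) \<in> generated A G" unfolding e_def two by (rule gen(6)[OF QG gen(10)])
    have s: "mult A 1 1 1 (strand A) (strand A) = strand A"
      using mult_one(1)[OF A elementary_mem(1)[OF A]] unfolding one_strand .
    have ee: "mult A 2 2 2 e e = e"
      using interchange[OF A Q Q elementary_mem(1,1)[OF A]] unfolding idem(2) s e_def[symmetric] two .
    have cp: "labelled_cap A Q = mult A 2 2 0 (cap A) e" "labelled_cup A Q = mult A 0 2 2 e (cup A)"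
      unfolding labelled_cap_def labelled_cup_def e_def by simp_all
    note m = elementary_mem(2,3)[OF A]
    have "mult A 0 2 0 (labelled_cap A Q) (labelled_cup A Q) = mult A 0 2 0 (cap A) (mult A 0 2 2 (mult A 2 2 2 e e) (cup A))"
      unfolding cp using mult_assoc[OF A m(1) e mult_mem[OF A e m(2)]] mult_assoc[OF A e e m(2)] by simp
    also have "\<dots> = mult A 0 2 0 (mult A 2 2 0 (cap A) e) (cup A)" unfolding ee using mult_assoc[OF A m(1) e m(2)] by simp
    also have "\<dots> = empty_diag A" unfolding e_def using trace_loop[OF A Q] bubble by simp
    finally have "mult A 0 2 0 (labelled_cap A Q) (labelled_cup A Q) = empty_diag A" .
    then show ?thesis
      using mult_mem[OF A m(1) e] mult_mem[OF A e m(2)] gen(5)[OF gen(8) eG] gen(5)[OF eG gen(9)] saddle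
      by (intro bexI[of _ "(2, 0, labelled_cap A Q)"] bexI[of _ "(0, 2, labelled_cup A Q)"])
        (simp_all add: thom_iff cp tid_def one_empty)
  qed
  interpret W: word_relations "thom A" "tcmp A" "tten A" "tid A" tadd "tsmul A" tzero "(1, 1, P)" "(1, 1, Q)" "generated A G" a n
  proof (unfold_locales, goal_cases)
    case 7 show ?case using PG .
  next
    case 8 show ?case using QG .
  next
    case 9 show ?case using cancel by (simp add: numeral_2_eq_2)
  next
    case 10 show ?case
      unfolding power
      by (rule bexI[of _ "(a, n, U)"], rule bexI[of _ "(n, a, star A a n U)"])
        (use UG U star(1)[OF U] unitary in \<open>simp_all add: thom_iff\<close>)
  qed (use a gen in \<open>auto simp: thom_iff tzero_def tid_def elim!: thomE\<close>)
  show "positive_category (thom A) (tcmp A) (tten A) (tid A) tadd (tsmul A) tzero (1, 1, P) (1, 1, half_turn A 1 1 P)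
    (generated A G) a n (tst A) (ttr A)"
    unfolding Q_def[symmetric]
  proof unfold_locales
    have e0: "empty_diag A \<noteq> 0" by (rule empty_nonzero[OF A d])
    have ttr: "ttr A (b, b, x) = z" if "trR A b x = scl A z (empty_diag A)" for b x z
      using that e0 by simp
    fix f and b t :: nat assume "f \<in> thom A b t"
    then obtain x where x: "f = (b, t, x)" "x \<in> spc A b t" by (rule thomE)
    show "tst A f \<in> thom A t b" "tst A (tst A f) = f" using x star by (simp_all add: thom_iff)
    show "tst A (tsmul A z f) = tsmul A (cnj z) (tst A f)" for z using x star by simp
    show "\<exists>r>0. ttr A (tcmp A (tst A f) f) = complex_of_real r" if "f \<noteq> tzero b t"
    proof -
      have "x \<noteq> 0" using that x unfolding tzero_def by simp
      then obtain r where "r > 0" "trR A b (mult A b t b (star A b t x) x) = scl A (complex_of_real r) (empty_diag A)"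
        using sub x(2) unfolding subfactor_planar_algebra_def by blast
      then show ?thesis using ttr unfolding x(1) by auto
    qed
  next
    fix f g and b c t :: nat assume "f \<in> thom A c t" "g \<in> thom A b c"
    then show "tst A (tcmp A f g) = tcmp A (tst A g) (tst A f)" using star_mult[OF A adj] by (auto elim!: thomE)
  next
    have e0: "empty_diag A \<noteq> 0" by (rule empty_nonzero[OF A d])
    have ttr: "ttr A (b, b, x) = z" if "trR A b x = scl A z (empty_diag A)" for b x z
      using that e0 by simp
    fix f z and b :: nat assume "f \<in> thom A b b"
    then obtain x where x: "f = (b, b, x)" "x \<in> spc A b b" by (rule thomE)
    obtain c where "trR A b x = scl A c (empty_diag A)"
      using dim_one_multiple[OF vs[OF A] d elementary_mem(4)[OF A] e0 trace_linear(2)[OF A x(2)]] by blast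
    then show "ttr A (tsmul A z f) = z * ttr A f"
      unfolding x(1) using ttr[of b x c] ttr[of b "scl A z x" "z * c"] trace_linear(1)[OF A x(2)] by simp
  qed
qed

text \<open>
  A nonzero morphism from the power \<open>i\<close> to another power \<open>j\<close> links every minimal projection to a power
  other than \<open>i\<close>. Then there are fewer isomorphism classes of minimal projections than vertices of
  the cycle.
\<close>

lemma arrow_relations_generate:
  assumes sub: "subfactor_planar_algebra A" and a: "1 \<le> a" and rel: "arrow_relations A a n \<omega> P U"
    and iso: "multigraph_iso (principal_graph A) (affine_A (a + n - 1))"
  shows "generates A {(1, 1, P), (a, n, U), (n, a, star A a n U)}"
proof -
  define G where "G = {(1, 1, P), (a, n, U), (n, a, star A a n U)}"
  note cat = arrow_category[OF sub a rel G_def]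
  interpret C: positive_category "thom A" "tcmp A" "tten A" "tid A" tadd "tsmul A" tzero "(1, 1, P)" "(1, 1, half_turn A 1 1 P)"
    "generated A G" a n "tst A" "ttr A"
    by (rule cat(1))
  have A: "unshaded_planar_algebra A" using sub unfolding subfactor_planar_algebra_def by blast
  interpret V: vector_space "scl A" by (rule vs[OF A])
  define M where "M = minimal_projections A"
  define R where "R = {((k, p), (l, q)). minimal_projection A k p \<and> minimal_projection A l q \<and> proj_iso A k p l q}"
  define N where "N = (\<lambda>(k, p). C.linked k (k, k, p))"
  have minimal: "C.minimal k (k, k, p)" if "minimal_projection A k p" for k p
  proof -
    have p: "p \<in> spc A k k" "mult A k k k p p = p" "star A k k p = p" and dim: "V.dim (Hom A k p k p) = 1"
      using that unfolding minimal_projection_def projection_def by blast+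
    have "p \<noteq> 0"
    proof
      assume "p = 0"
      then have "Hom A k p k p \<subseteq> V.span {}"
        unfolding Hom_def using mult_bilinear(3)[OF A space_closed(1)[OF A] mult_mem[OF A _ space_closed(1)[OF A]], of _ k k k k 0] by auto
      then have "V.dim (Hom A k p k p) \<le> card ({} :: 'a set)" by (rule V.dim_le_card) simp
      then show False using dim by simp
    qed
    have "\<exists>c. x = scl A c p" if "x \<in> spc A k k" "mult A k k k p (mult A k k k x p) = x" for x
      by (rule dim_one_multiple[OF vs[OF A] dim _ \<open>p \<noteq> 0\<close>]) (use that p in \<open>simp_all add: Hom_def\<close>)
    then show ?thesis
      unfolding C.minimal_def using p \<open>p \<noteq> 0\<close> by (auto simp: thom_iff tzero_def elim!: thomE)
  qed
  have "f = tzero i j"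
    if ij: "i < a + n" "j < a + n" "i \<noteq> j" and f: "f \<in> thom A i j" "tcmp A (C.word (replicate j True)) f = f" "tcmp A f (C.word (replicate i True)) = f"
    for i j f
  proof (rule ccontr)
    assume nz: "f \<noteq> tzero i j"
    have "card (M // R) \<le> card ({..<a + n} - {i})"
    proof (rule card_quotient_le[where N = N])
      fix x assume "x \<in> M"
      then obtain k p where x: "x = (k, p)" "minimal_projection A k p" unfolding M_def minimal_projections_def by auto
      obtain j' where j': "j' < a + n" "C.linked k (k, k, p) j'" using C.linked_exists[OF minimal[OF x(2)]] by blast
      have "C.linked k (k, k, p) j" if "j' = i"
        using C.linked_comp[OF minimal[OF x(2)] _ _ f nz] j' ij(1) unfolding that by simp
      then show "\<exists>j\<in>{..<a + n} - {i}. N x j" using j' ij unfolding N_def x(1) by auto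
    next
      fix x y j assume xy: "x \<in> M" "y \<in> M" and j: "j \<in> {..<a + n} - {i}" "N x j" "N y j"
      obtain k p where x: "x = (k, p)" "minimal_projection A k p" using xy(1) unfolding M_def minimal_projections_def by auto
      obtain l q where y: "y = (l, q)" "minimal_projection A l q" using xy(2) unfolding M_def minimal_projections_def by auto
      obtain u where u: "u \<in> thom A k l" "tcmp A (l, l, q) (tcmp A u (k, k, p)) = u" "tcmp A (tst A u) u = (k, k, p)" "tcmp A u (tst A u) = (l, l, q)"
        using C.linked_isomorphic[OF minimal[OF x(2)] minimal[OF y(2)], of j] j unfolding N_def x(1) y(1) by auto
      obtain v where v: "u = (k, l, v)" "v \<in> spc A k l" using u(1) by (rule thomE)
      have "proj_iso A k p l q" unfolding proj_iso_def Hom_def using u v by auto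
      then show "(x, y) \<in> R" unfolding R_def x(1) y(1) using x(2) y(2) by simp
    next
      fix x y j assume xy: "(x, y) \<in> R" and j: "N x j"
      obtain k p where x: "x = (k, p)" by (cases x)
      obtain l q where y: "y = (l, q)" by (cases y)
      have m: "minimal_projection A k p" "minimal_projection A l q" and "proj_iso A k p l q"
        using xy unfolding R_def x y by simp_all
      then obtain v where v: "v \<in> spc A k l" "mult A k l l q (mult A k k l v p) = v"
        "mult A k l k (star A k l v) v = p" "mult A l k l v (star A k l v) = q"
        unfolding proj_iso_def Hom_def by blast
      have "C.linked l (l, l, q) j"
        by (rule C.linked_iso[OF minimal[OF m(1)] C.minimalD(1)[OF minimal[OF m(2)]], of "(k, l, v)"])
          (use v j in \<open>simp_all add: thom_iff N_def x\<close>)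
      then show "y \<in> M \<and> N y j" unfolding y M_def minimal_projections_def N_def using m(2) by simp
    qed simp
    moreover have "card (M // R) = a + n"
    proof -
      obtain \<phi> where "bij_betw \<phi> (fst (principal_graph A)) (fst (affine_A (a + n - 1)))"
        using iso unfolding multigraph_iso_def by blast
      then have "card (M // R) = card {..a + n - 1}"
        unfolding principal_graph_def affine_A_def M_def R_def fst_conv by (rule bij_betw_same_card)
      then show ?thesis using a by simp
    qed
    ultimately show False using ij(1) by simp
  qed
  then have "f \<in> generated A G" if "f \<in> thom A b t" for f b t
    using that by (rule C.generation)
  then have "generates A G" unfolding generates_iff[OF A cat(2)] by (auto simp: thom_iff)
  then show ?thesis unfolding G_def .
qed

theorem mainTheorem8:
  fixes n :: nat
    and A :: "'a :: ab_group_add star_planar_alg" and P U :: 'a and \<omega> :: complex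
    and A' :: "'b :: ab_group_add star_planar_alg" and P' U' :: 'b and \<omega>' :: complex
  assumes "n \<ge> 1"
  shows
    "(subfactor_planar_algebra A \<and> multigraph_iso (principal_graph A) (affine_A (2 * n - 1)) \<and>
      arrow_case A \<and> \<omega> ^ (2 * n) = 1 \<and> arrow_relations A n n \<omega> P U
        \<longrightarrow> generates A {(1, 1, P), (n, n, U), (n, n, star A n n U)}) \<and>
     (subfactor_planar_algebra A' \<and> multigraph_iso (principal_graph A') (affine_A (2 * n)) \<and>
      \<omega>' ^ (2 * n + 1) = 1 \<and> arrow_relations A' (n + 1) n \<omega>' P' U'
        \<longrightarrow> generates A' {(1, 1, P'), (n + 1, n, U'), (n, n + 1, star A' (n + 1) n U')})"
proof (intro conjI impI)
  assume *: "subfactor_planar_algebra A \<and> multigraph_iso (principal_graph A) (affine_A (2 * n - 1)) \<and>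
      arrow_case A \<and> \<omega> ^ (2 * n) = 1 \<and> arrow_relations A n n \<omega> P U"
  show "generates A {(1, 1, P), (n, n, U), (n, n, star A n n U)}"
    by (rule arrow_relations_generate[where \<omega> = \<omega>]) (use * assms in \<open>simp_all add: mult_2\<close>)
next
  assume *: "subfactor_planar_algebra A' \<and> multigraph_iso (principal_graph A') (affine_A (2 * n)) \<and>
      \<omega>' ^ (2 * n + 1) = 1 \<and> arrow_relations A' (n + 1) n \<omega>' P' U'"
  show "generates A' {(1, 1, P'), (n + 1, n, U'), (n, n + 1, star A' (n + 1) n U')}"
    by (rule arrow_relations_generate[where \<omega> = \<omega>']) (use * in \<open>simp_all add: mult_2\<close>)
qed

end
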